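(* Let $\Omega\subset\mathbb{R}^N$ ($N\ge 1$) be a bounded domain, let $0<\alpha\le\beta<\infty$, let $A\in M(\alpha,\beta,\Omega)$ and let $0<\lambda\le 1$. Let $\sigma,\nu\in\mathcal{E}_\lambda(\Omega)\setminus\{0\}$. Let $u\in H_0^1(\Omega)$ be the weak solution to $$-\operatorname{div}(A(x)\nabla u)=\frac{\sigma}{u^{\lambda}},\quad u>0\quad\text{in }\Omega,\qquad u\in H_0^1(\Omega),$$ and let $v\in H_0^1(\Omega)$ be the weak solution to $$-\operatorname{div}(A(x)\nabla v)=\frac{\nu}{v^{\lambda}},\quad v>0\quad\text{in }\Omega,\qquad v\in H_0^1(\Omega).$$ Then $$\|\nabla(u-v)\|_{L^2(\Omega)}\le\frac{1}{\alpha^{\frac{1}{1+\lambda}}}\,\mathbf{d}_\lambda(\sigma,\nu)^{\frac{1}{1+\lambda}}.$$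
   Context: $M(\alpha,\beta,\Omega)$ is the set of all $A\in L^\infty(\Omega)^{N\times N}$ such that $A(x)\xi\cdot\xi\ge\alpha|\xi|^2$ and $A^{-1}(x)\xi\cdot\xi\ge\beta^{-1}|\xi|^2$ for all $\xi\in\mathbb{R}^N$ and a.e. $x\in\Omega$ ($A$ need not be symmetric). $H_0^1(\Omega)$ is the closure of $C_c^\infty(\Omega)$ in $H^1(\Omega)$, normed by $\|\nabla\cdot\|_{L^2(\Omega)}$. Capacity: for $O$ open and $K\subset O$ compact, $\mathrm{cap}(K,O)=\inf\{\|\nabla w\|_{L^2(O)}^2: w\in C_c^\infty(O),\ w\ge 1\text{ on }K\}$; for $E\subset O$, $\mathrm{cap}(E,O)=\inf_{E\subset U\subset O,\,U\text{ open}}\ \sup_{K\subset U,\,K\text{ compact}}\mathrm{cap}(K,O)$. $\mathcal{M}_0^+(\Omega)$ is the set of nonnegative (locally finite) Radon measures $\sigma$ on $\Omega$ such that, for any Borel set $E\subset\Omega$, $\mathrm{cap}(E,\Omega)=0$ implies $\sigma(E)=0$. Functions in $H_0^1(\Omega)$ are always represented by a quasicontinuous representative (unique up to sets of capacity zero), so that their integrals against measures in $\mathcal{M}_0^+(\Omega)$ make sense. For $\sigma\in\mathcal{M}_0^+(\Omega)$ put, for $0\le\lambda<1$, $$|||\sigma|||_\lambda:=\sup\Big\{\int_\Omega|\varphi|^{1-\lambda}\,d\sigma:\varphi\in H_0^1(\Omega),\ \|\nabla\varphi\|_{L^2(\Omega)}\le 1\Big\},$$ and $|||\sigma|||_1:=\sigma(\Omega)$.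 Set $\mathcal{E}_\lambda(\Omega):=\{\sigma\in\mathcal{M}_0^+(\Omega):|||\sigma|||_\lambda<\infty\}$, and for $\sigma,\nu\in\mathcal{E}_\lambda(\Omega)$ set $\mathbf{d}_\lambda(\sigma,\nu):=|||\,|\sigma-\nu|\,|||_\lambda$, where $|\sigma-\nu|$ is the total variation measure of $\sigma-\nu$. Weak solution: for $\sigma\in\mathcal{M}_0^+(\Omega)\setminus\{0\}$, a function $u\in H_0^1(\Omega)$ is a (finite energy) weak solution to $-\operatorname{div}(A\nabla u)=\sigma u^{-\lambda}$, $u>0$ in $\Omega$, if $u>0$ in $\Omega$ and $$\int_\Omega A\nabla u\cdot\nabla\varphi\,dx=\int_\Omega\frac{\varphi}{u^\lambda}\,d\sigma\quad\forall\varphi\in C_c^\infty(\Omega).$$ Here $u$ is represented by its lsc-regularization $u^*(x)=\lim_{r\to0}\operatorname{ess\,inf}_{B(x,r)}u$, which is quasicontinuous. It is known that such a weak solution exists and is unique if and only if $\sigma\in\mathcal{E}_\lambda(\Omega)\setminus\{0\}$. *)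

theory Defs
  imports "HOL-Analysis.Analysis" "HOL-Probability.Essential_Supremum" "HOL-Library.Disjoint_Sets"
begin

section \<open>Smooth functions with compact support\<close>

definition grad :: "(real^'n \<Rightarrow> real) \<Rightarrow> real^'n \<Rightarrow> real^'n"
  where "grad f x = (\<chi> i. frechet_derivative f (at x) (axis i 1))"

primrec Ck :: "nat \<Rightarrow> (real^'n \<Rightarrow> real) \<Rightarrow> bool"
  where
    "Ck 0 f \<longleftrightarrow> continuous_on UNIV f"
  | "Ck (Suc k) f \<longleftrightarrow> f differentiable_on UNIV \<and> (\<forall>i. Ck k (\<lambda>x. grad f x $ i))"

text \<open>Elements of \<open>C\<^sub>c\<^sup>\<infinity>(\<Omega>)\<close> are extended by zero to the whole space.\<close>

definition test_functions :: "(real^'n) set \<Rightarrow> (real^'n \<Rightarrow> real) set"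
  where "test_functions \<Omega> =
    {\<phi>. (\<forall>k. Ck k \<phi>) \<and> compact (closure {x. \<phi> x \<noteq> 0}) \<and> closure {x. \<phi> x \<noteq> 0} \<subseteq> \<Omega>}"


section \<open>Sobolev spaces\<close>

text \<open>Elements of \<open>L\<^sup>2\<close>, \<open>H\<^sup>1\<close> and \<open>H\<^sub>0\<^sup>1\<close> are represented by functions on the whole space, of which
  only the almost everywhere class on \<open>\<Omega>\<close> matters.\<close>

definition L2 :: "(real^'n) set \<Rightarrow> (real^'n \<Rightarrow> 'b::euclidean_space) set"
  where "L2 \<Omega> = {f. f \<in> borel_measurable (lebesgue_on \<Omega>) \<and>
                     integrable (lebesgue_on \<Omega>) (\<lambda>x. (norm (f x))\<^sup>2)}"

definition L2_norm :: "(real^'n) set \<Rightarrow> (real^'n \<Rightarrow> 'b::euclidean_space) \<Rightarrow> real"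
  where "L2_norm \<Omega> f = sqrt (\<integral>x. (norm (f x))\<^sup>2 \<partial>(lebesgue_on \<Omega>))"

definition L1_loc :: "(real^'n) set \<Rightarrow> (real^'n \<Rightarrow> 'b::euclidean_space) set"
  where "L1_loc \<Omega> = {f. \<forall>K. compact K \<and> K \<subseteq> \<Omega> \<longrightarrow> integrable (lebesgue_on K) f}"

definition is_weak_gradient ::
    "(real^'n) set \<Rightarrow> (real^'n \<Rightarrow> real) \<Rightarrow> (real^'n \<Rightarrow> real^'n) \<Rightarrow> bool"
  where "is_weak_gradient \<Omega> u g \<longleftrightarrow> u \<in> L1_loc \<Omega> \<and> g \<in> L1_loc \<Omega> \<and>
    (\<forall>\<phi>\<in>test_functions \<Omega>. \<forall>i.
       (\<integral>x. u x * grad \<phi> x $ i \<partial>(lebesgue_on \<Omega>)) = - (\<integral>x. g x $ i * \<phi> x \<partial>(lebesgue_on \<Omega>)))"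

text \<open>The weak gradient is unique almost everywhere, so the choice below is harmless.\<close>

definition weak_gradient :: "(real^'n) set \<Rightarrow> (real^'n \<Rightarrow> real) \<Rightarrow> real^'n \<Rightarrow> real^'n"
  where "weak_gradient \<Omega> u = (SOME g. is_weak_gradient \<Omega> u g)"

definition H1 :: "(real^'n) set \<Rightarrow> (real^'n \<Rightarrow> real) set"
  where "H1 \<Omega> = {u \<in> L2 \<Omega>. \<exists>g\<in>L2 \<Omega>. is_weak_gradient \<Omega> u g}"

definition H1_norm :: "(real^'n) set \<Rightarrow> (real^'n \<Rightarrow> real) \<Rightarrow> real"
  where "H1_norm \<Omega> u = sqrt ((L2_norm \<Omega> u)\<^sup>2 + (L2_norm \<Omega> (weak_gradient \<Omega> u))\<^sup>2)"

definition H01 :: "(real^'n) set \<Rightarrow> (real^'n \<Rightarrow> real) set"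
  where "H01 \<Omega> =
    {u \<in> H1 \<Omega>. \<forall>\<epsilon>>0. \<exists>\<phi>\<in>test_functions \<Omega>. H1_norm \<Omega> (\<lambda>x. u x - \<phi> x) < \<epsilon>}"


section \<open>Capacity\<close>

definition cap_compact :: "(real^'n) set \<Rightarrow> (real^'n) set \<Rightarrow> ennreal"
  where "cap_compact K O' =
    (INF w \<in> {w \<in> test_functions O'. \<forall>x\<in>K. 1 \<le> w x}. ennreal ((L2_norm O' (grad w))\<^sup>2))"

definition capacity :: "(real^'n) set \<Rightarrow> (real^'n) set \<Rightarrow> ennreal"
  where "capacity E O' =
    (INF U \<in> {U. open U \<and> E \<subseteq> U \<and> U \<subseteq> O'}. SUP K \<in> {K. compact K \<and> K \<subseteq> U}. cap_compact K O')"

definition quasicontinuous :: "(real^'n) set \<Rightarrow> (real^'n \<Rightarrow> real) \<Rightarrow> bool"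
  where "quasicontinuous \<Omega> f \<longleftrightarrow>
    (\<forall>\<epsilon>>0. \<exists>G. open G \<and> G \<subseteq> \<Omega> \<and> capacity G \<Omega> < \<epsilon> \<and> continuous_on (\<Omega> - G) f)"


section \<open>Measures\<close>

text \<open>Borel measures on the open set \<open>\<Omega>\<close> that are finite on compact sets are automatically
  regular, hence Radon.\<close>

definition M0_plus :: "(real^'n) set \<Rightarrow> (real^'n) measure set"
  where "M0_plus \<Omega> = {\<sigma>. sets \<sigma> = sets (restrict_space borel \<Omega>) \<and>
    (\<forall>K. compact K \<and> K \<subseteq> \<Omega> \<longrightarrow> emeasure \<sigma> K < \<infinity>) \<and>
    (\<forall>E\<in>sets \<sigma>. capacity E \<Omega> = 0 \<longrightarrow> emeasure \<sigma> E = 0)}"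

text \<open>A quasicontinuous function agrees with a Borel function outside a Borel set of capacity zero,
  so the integral below does not depend on the quasicontinuous representative.\<close>

definition tri_norm :: "real \<Rightarrow> (real^'n) set \<Rightarrow> (real^'n) measure \<Rightarrow> ennreal"
  where "tri_norm lam \<Omega> \<sigma> =
    (if lam = 1 then emeasure \<sigma> \<Omega>
     else (SUP \<phi> \<in> {\<phi> \<in> H01 \<Omega>. quasicontinuous \<Omega> \<phi> \<and> L2_norm \<Omega> (weak_gradient \<Omega> \<phi>) \<le> 1}.
             \<integral>\<^sup>+x. ennreal (\<bar>\<phi> x\<bar> powr (1 - lam)) \<partial>\<sigma>))"

definition E_space :: "real \<Rightarrow> (real^'n) set \<Rightarrow> (real^'n) measure set"
  where "E_space lam \<Omega> = {\<sigma> \<in> M0_plus \<Omega>. tri_norm lam \<Omega> \<sigma> < \<infinity>}"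

text \<open>The total variation measure \<open>|\<sigma> - \<nu>|\<close>. Both measures may be infinite, so that
  \<open>\<sigma> - \<nu>\<close> is a priori only defined on relatively compact Borel subsets of \<open>\<Omega>\<close>; the supremum
  is over finite families of pairwise disjoint such sets.\<close>

definition abs_diff_measure ::
    "(real^'n) set \<Rightarrow> (real^'n) measure \<Rightarrow> (real^'n) measure \<Rightarrow> (real^'n) measure"
  where "abs_diff_measure \<Omega> \<sigma> \<nu> = measure_of \<Omega> (sets (restrict_space borel \<Omega>))
    (\<lambda>E. SUP P \<in> {P. finite P \<and> disjoint P \<and>
                    (\<forall>F\<in>P. F \<in> sets (restrict_space borel \<Omega>) \<and> F \<subseteq> E \<and>
                            (\<exists>K. compact K \<and> F \<subseteq> K \<and> K \<subseteq> \<Omega>))}.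
           \<Sum>F\<in>P. ennreal \<bar>measure \<sigma> F - measure \<nu> F\<bar>)"

definition d_dist ::
    "real \<Rightarrow> (real^'n) set \<Rightarrow> (real^'n) measure \<Rightarrow> (real^'n) measure \<Rightarrow> ennreal"
  where "d_dist lam \<Omega> \<sigma> \<nu> = tri_norm lam \<Omega> (abs_diff_measure \<Omega> \<sigma> \<nu>)"


section \<open>The boundary value problem\<close>

definition M_coeff :: "real \<Rightarrow> real \<Rightarrow> (real^'n) set \<Rightarrow> (real^'n \<Rightarrow> real^'n^'n) set"
  where "M_coeff \<alpha> \<beta> \<Omega> = {A.
    A \<in> borel_measurable (lebesgue_on \<Omega>) \<and>
    (\<exists>C. AE x in lebesgue_on \<Omega>. \<forall>i j. \<bar>A x $ i $ j\<bar> \<le> C) \<and>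
    (AE x in lebesgue_on \<Omega>. \<forall>\<xi>.
       (A x *v \<xi>) \<bullet> \<xi> \<ge> \<alpha> * (norm \<xi>)\<^sup>2 \<and>
       (matrix_inv (A x) *v \<xi>) \<bullet> \<xi> \<ge> inverse \<beta> * (norm \<xi>)\<^sup>2)}"

definition essinf_on :: "(real^'n) set \<Rightarrow> (real^'n \<Rightarrow> real) \<Rightarrow> ereal"
  where "essinf_on S u = - esssup (lebesgue_on S) (\<lambda>y. - ereal (u y))"

text \<open>The lsc-regularization \<open>u\<^sup>*\<close>; it may take the value \<open>\<infinity>\<close> at some points even if \<open>u\<close> is in
  \<open>H\<^sup>1\<close>. For \<open>x \<in> \<Omega>\<close> and small \<open>r\<close> the ball is contained in \<open>\<Omega>\<close>.\<close>

definition lsc_reg :: "(real^'n) set \<Rightarrow> (real^'n \<Rightarrow> real) \<Rightarrow> real^'n \<Rightarrow> ereal"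
  where "lsc_reg \<Omega> u x = Lim (at_right 0) (\<lambda>r. essinf_on (\<Omega> \<inter> ball x r) u)"

text \<open>Where \<open>u\<^sup>* = \<infinity>\<close>, the quotient \<open>\<phi> / (u\<^sup>*)\<^sup>\<lambda>\<close> evaluates to \<open>0\<close> below (via
  \<open>real_of_ereal \<infinity> = 0\<close> and division by zero), as it should. Integrability is required explicitly
  because the integral of a non-integrable function is \<open>0\<close> by convention.\<close>

definition weak_solution ::
    "(real^'n) set \<Rightarrow> (real^'n \<Rightarrow> real^'n^'n) \<Rightarrow> real \<Rightarrow> (real^'n) measure \<Rightarrow> (real^'n \<Rightarrow> real) \<Rightarrow> bool"
  where "weak_solution \<Omega> A lam \<sigma> u \<longleftrightarrow>
    u \<in> H01 \<Omega> \<and>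
    (\<forall>x\<in>\<Omega>. lsc_reg \<Omega> u x > 0) \<and>
    (\<forall>\<phi>\<in>test_functions \<Omega>.
       integrable \<sigma> (\<lambda>x. \<phi> x / real_of_ereal (lsc_reg \<Omega> u x) powr lam) \<and>
       (\<integral>x. (A x *v weak_gradient \<Omega> u x) \<bullet> grad \<phi> x \<partial>(lebesgue_on \<Omega>)) =
       (\<integral>x. \<phi> x / real_of_ereal (lsc_reg \<Omega> u x) powr lam \<partial>\<sigma>))"

end

theory Submission
  imports Defs "HOL-Computational_Algebra.Polynomial"
begin

text \<open>
  Testing the difference of the two equations with \<open>w = u - v\<close> bounds the energy of \<open>w\<close>, times
  \<open>\<alpha>\<close>, by the integral of \<open>w (a u\<^sup>-\<^sup>\<lambda> - b v\<^sup>-\<^sup>\<lambda>)\<close> against \<open>\<rho>\<close>, where \<open>\<sigma> = a \<rho>\<close> and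
  \<open>\<nu> = b \<rho>\<close>. Since \<open>t\<^sup>-\<^sup>\<lambda>\<close> is decreasing, the integrand is at most \<open>\<bar>a - b\<bar> \<bar>w\<bar>\<^sup>1\<^sup>-\<^sup>\<lambda>\<close>, whose
  integral is at most the distance of \<open>\<sigma>\<close> and \<open>\<nu>\<close> times the norm of the gradient of \<open>w\<close> to the
  power \<open>1 - \<lambda>\<close>.

  The values of \<open>u\<close> and \<open>v\<close> that enter here are limits of rapidly converging test functions. The
  measures \<open>u\<^sup>-\<^sup>\<lambda> \<sigma>\<close> and \<open>v\<^sup>-\<^sup>\<lambda> \<nu>\<close> have finite energy, that is, the integral of \<open>\<bar>\<phi>\<bar>\<close> is bounded by
  a multiple of the norm of the gradient of \<open>\<phi>\<close>; so these limits exist almost everywhere, and no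
  potential theory is needed. They have to be compared with the lower semicontinuous regularizations.
  Applying the energy bound to \<open>\<phi>(x + h) - \<phi>(x)\<close> shows that at almost every point the limit is
  approximated by means over small balls, and for the supersolution \<open>u\<close> De Giorgi's estimate turns a
  small mean of the positive part of \<open>\<kappa> - u\<close> into a lower bound of \<open>u\<close> on the ball of half the
  radius.
\<close>

section \<open>Calculus of smooth functions\<close>

text \<open>The weak equation and the energy bound speak of test functions only, and the positive
  part of a test function is not one. So truncations use the smooth function \<open>soft\<close>,
  and facts about solutions are obtained from approximating test functions by passage to the limit,
  without a chain rule in Sobolev spaces. The limit is taken pointwise by \<open>lim\<close>, with
  no measure involved; hence one and the same function represents \<open>u\<close> for Lebesgue
  measure and for both singular measures. The two halves of the comparison with the regularization
  differ in strength: that it is at most the limit follows from finite energy and is used for each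
  solution under both measures; the reverse needs a supersolution and is used for each solution
  under its own measure. The limit of the differences is not itself inserted into the supremum that
  defines the distance when \<lambda> < 1: the test functions are, and Fatou's lemma finishes. If X
  denotes the norm of the gradient of \<open>u - v\<close> and d the distance, this gives \<alpha>
  X^2 \<le> d X^(1 - \<lambda>), whence the exponent 1 / (1 + \<lambda>).\<close>

lemma grad_eqI:
  assumes "(f has_derivative (\<lambda>h. g \<bullet> h)) (at x)"
  shows "grad f x = g"
proof -
  have "frechet_derivative f (at x) = (\<lambda>h. g \<bullet> h)"
    using frechet_derivative_at[OF assms] by simp
  then show ?thesis
    by (simp add: grad_def vec_eq_iff inner_axis)
qed

lemma has_derivative_grad:
  fixes f :: "real^'n \<Rightarrow> real"
  assumes "f differentiable (at x)"
  shows "(f has_derivative (\<lambda>h. grad f x \<bullet> h)) (at x)"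
proof -
  let ?D = "frechet_derivative f (at x)"
  have D: "(f has_derivative ?D) (at x)"
    using assms frechet_derivative_works by blast
  have lin: "linear ?D" using D has_derivative_linear by blast
  have "?D h = grad f x \<bullet> h" for h
  proof -
    have "h = (\<Sum>i\<in>UNIV. h $ i *\<^sub>R axis i 1)"
      using basis_expansion[of h] by (simp add: scalar_mult_eq_scaleR)
    then have "?D h = ?D (\<Sum>i\<in>UNIV. h $ i *\<^sub>R axis i 1)" by simp
    also have "\<dots> = (\<Sum>i\<in>UNIV. h $ i * ?D (axis i 1))"
      using lin by (simp add: linear_sum linear_cmul)
    finally show ?thesis
      by (simp add: grad_def inner_vec_def mult.commute)
  qed
  then have "?D = (\<lambda>h. grad f x \<bullet> h)" by auto
  with D show ?thesis by simp
qed

lemma Ck_Suc_differentiable: "Ck (Suc k) f \<Longrightarrow> f differentiable (at x)"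
  by (auto simp: differentiable_on_def)

lemma Ck_mono: "Ck (Suc k) f \<Longrightarrow> Ck k f"
proof (induction k arbitrary: f)
  case 0
  then show ?case by (auto intro: differentiable_imp_continuous_on)
next
  case (Suc k)
  then show ?case by auto
qed

lemma Ck_const: "Ck k (\<lambda>x::real^'n. c)"
proof (induction k arbitrary: c)
  case (Suc k)
  have "grad (\<lambda>x::real^'n. c) = (\<lambda>x. 0)"
    by (intro ext grad_eqI) auto
  with Suc show ?case by simp
qed simp

lemma Ck_component: "Ck k (\<lambda>x::real^'n. x $ j)"
proof (cases k)
  case (Suc k)
  have "((\<lambda>x::real^'n. x $ j) has_derivative (\<lambda>h. axis j 1 \<bullet> h)) (at x)" for x
    by (auto intro!: derivative_eq_intros bounded_linear_imp_has_derivative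
        simp: inner_axis' bounded_linear_vec_nth)
  then have "grad (\<lambda>x::real^'n. x $ j) = (\<lambda>x. axis j 1)"
    and "(\<lambda>x::real^'n. x $ j) differentiable_on UNIV"
    by (auto intro!: grad_eqI simp: differentiable_on_def differentiable_def fun_eq_iff)
  with Suc show ?thesis by (simp add: Ck_const)
qed (auto intro: continuous_intros)

lemma grad_add:
  assumes "f differentiable (at x)" "g differentiable (at x)"
  shows "grad (\<lambda>x. f x + g x) x = grad f x + grad g x"
  using assms
  by (auto intro!: grad_eqI derivative_eq_intros has_derivative_grad simp: inner_add_left)

lemma grad_diff:
  assumes "f differentiable (at x)" "g differentiable (at x)"
  shows "grad (\<lambda>x. f x - g x) x = grad f x - grad g x"
  using assms
  by (auto intro!: grad_eqI derivative_eq_intros has_derivative_grad simp: inner_diff_left)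

lemma grad_mult:
  fixes f g :: "real^'n \<Rightarrow> real"
  assumes "f differentiable (at x)" "g differentiable (at x)"
  shows "grad (\<lambda>x. f x * g x) x = f x *\<^sub>R grad g x + g x *\<^sub>R grad f x"
proof -
  note [derivative_intros] = has_derivative_grad[OF assms(1)] has_derivative_grad[OF assms(2)]
  show ?thesis
    by (auto intro!: grad_eqI derivative_eq_intros simp: inner_add_left algebra_simps)
qed

lemma grad_compose:
  fixes f :: "real^'n \<Rightarrow> real"
  assumes "(F has_real_derivative D) (at (f x))" "f differentiable (at x)"
  shows "grad (\<lambda>x. F (f x)) x = D *\<^sub>R grad f x"
    and "(\<lambda>x. F (f x)) differentiable (at x)"
proof -
  have "((\<lambda>x. F (f x)) has_derivative (\<lambda>h. (D *\<^sub>R grad f x) \<bullet> h)) (at x)"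
    using has_derivative_compose[OF has_derivative_grad[OF assms(2)], of F "(*) D"] assms(1)
    by (simp add: has_field_derivative_def)
  then show "grad (\<lambda>x. F (f x)) x = D *\<^sub>R grad f x"
    and "(\<lambda>x. F (f x)) differentiable (at x)"
    by (auto intro: grad_eqI simp: differentiable_def)
qed

lemma grad_translate:
  fixes f :: "real^'n \<Rightarrow> real"
  assumes "f differentiable (at (x + h))"
  shows "grad (\<lambda>x. f (x + h)) x = grad f (x + h)"
    and "(\<lambda>x. f (x + h)) differentiable (at x)"
proof -
  have "((\<lambda>x. f (x + h)) has_derivative (\<lambda>k. grad f (x + h) \<bullet> k)) (at x)"
    by (rule has_derivative_compose[of "\<lambda>x. x + h" "\<lambda>x. x" x UNIV f])
      (auto intro!: derivative_eq_intros has_derivative_grad assms)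
  then show "grad (\<lambda>x. f (x + h)) x = grad f (x + h)"
    and "(\<lambda>x. f (x + h)) differentiable (at x)"
    by (auto intro: grad_eqI simp: differentiable_def)
qed

lemma Ck_add: "Ck k f \<Longrightarrow> Ck k g \<Longrightarrow> Ck k (\<lambda>x. f x + g x)"
proof (induction k arbitrary: f g)
  case (Suc k)
  have "grad (\<lambda>x. f x + g x) x = grad f x + grad g x" for x
    using Suc.prems by (intro grad_add Ck_Suc_differentiable)
  with Suc show ?case by (auto intro: differentiable_on_add)
qed (auto intro: continuous_intros)

lemma Ck_mult: "Ck k f \<Longrightarrow> Ck k g \<Longrightarrow> Ck k (\<lambda>x. f x * g x)"
proof (induction k arbitrary: f g)
  case (Suc k)
  have "grad (\<lambda>x. f x * g x) x = f x *\<^sub>R grad g x + g x *\<^sub>R grad f x" for x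
    using Suc.prems by (intro grad_mult Ck_Suc_differentiable)
  moreover have "Ck k f" "Ck k g" using Suc.prems Ck_mono by blast+
  ultimately show ?case using Suc by (auto intro!: Ck_add differentiable_on_mult)
qed (auto intro: continuous_intros)

lemma Ck_translate: "Ck k f \<Longrightarrow> Ck k (\<lambda>x. f (x + h))"
proof (induction k arbitrary: f)
  case 0
  then show ?case by (auto intro!: continuous_intros continuous_on_compose2[of UNIV f])
next
  case (Suc k)
  have "f differentiable (at x)" for x
    using Suc.prems by (rule Ck_Suc_differentiable)
  then have "grad (\<lambda>x. f (x + h)) x = grad f (x + h)" "(\<lambda>x. f (x + h)) differentiable (at x)" for x
    using grad_translate by blast+
  with Suc show ?case by (auto simp: differentiable_on_def intro: Suc.IH)
qed

text \<open>The witness lists all derivatives at once. The chain rule turns \<open>H m\<close> into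
  \<open>H (Suc m)\<close>, so smoothness of a composition needs a single induction that treats all
  indices \<open>m\<close> together.\<close>

definition real_smooth :: "(real \<Rightarrow> real) \<Rightarrow> bool"
  where "real_smooth F \<longleftrightarrow> (\<exists>H. H 0 = F \<and> (\<forall>k t. (H k has_real_derivative H (Suc k) t) (at t)))"

lemma Ck_compose_aux:
  assumes "\<And>k t. (H k has_real_derivative H (Suc k) t) (at t)"
  shows "Ck k f \<Longrightarrow> Ck k (\<lambda>x. H m (f x))"
proof (induction k arbitrary: m)
  case 0
  have "continuous_on UNIV (H m)"
    using assms by (meson DERIV_continuous_on has_field_derivative_at_within)
  with 0 show ?case by (auto intro: continuous_on_compose2)
next
  case (Suc k)
  have "grad (\<lambda>x. H m (f x)) x = H (Suc m) (f x) *\<^sub>R grad f x"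
    and "(\<lambda>x. H m (f x)) differentiable (at x)" for x
    using grad_compose[OF assms Ck_Suc_differentiable[OF Suc.prems]] by blast+
  moreover have "Ck k (\<lambda>x. H (Suc m) (f x))"
    using Suc.IH Suc.prems Ck_mono by blast
  ultimately show ?case using Suc.prems
    by (auto simp: differentiable_on_def intro!: Ck_mult)
qed

definition smooth :: "(real^'n \<Rightarrow> real) \<Rightarrow> bool"
  where "smooth f \<longleftrightarrow> (\<forall>k. Ck k f)"

lemma smooth_compose: "real_smooth F \<Longrightarrow> smooth f \<Longrightarrow> smooth (\<lambda>x. F (f x))"
  unfolding real_smooth_def smooth_def using Ck_compose_aux[of _ _ f 0] by metis

lemma smooth_const: "smooth (\<lambda>x. c)"
  and smooth_component: "smooth (\<lambda>x. x $ j)"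
  and smooth_add: "smooth f \<Longrightarrow> smooth g \<Longrightarrow> smooth (\<lambda>x. f x + g x)"
  and smooth_mult: "smooth f \<Longrightarrow> smooth g \<Longrightarrow> smooth (\<lambda>x. f x * g x)"
  and smooth_translate: "smooth f \<Longrightarrow> smooth (\<lambda>x. f (x + h))"
  by (simp_all add: smooth_def Ck_const Ck_component Ck_add Ck_mult Ck_translate)

lemma smooth_minus: "smooth f \<Longrightarrow> smooth (\<lambda>x. - f x)"
  using smooth_mult[OF smooth_const[of "-1"], of f] by simp

lemma smooth_diff: "smooth f \<Longrightarrow> smooth g \<Longrightarrow> smooth (\<lambda>x. f x - g x)"
  using smooth_add[of f "\<lambda>x. - g x"] smooth_minus[of g] by simp

lemma smooth_divide: "smooth f \<Longrightarrow> smooth (\<lambda>x. f x / c)"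
  using smooth_mult[OF _ smooth_const[of "inverse c"], of f] by (simp add: divide_inverse)

lemma smooth_sum: "(\<And>i. i \<in> I \<Longrightarrow> smooth (f i)) \<Longrightarrow> smooth (\<lambda>x. \<Sum>i\<in>I. f i x)"
  by (induction I rule: infinite_finite_induct) (auto intro: smooth_add smooth_const)

lemma smooth_norm_sq: "smooth (\<lambda>x::real^'n. (norm (x - a))\<^sup>2)"
proof -
  have "(norm (x - a))\<^sup>2 = (\<Sum>i\<in>UNIV. (x $ i - a $ i) * (x $ i - a $ i))" for x :: "real^'n"
    unfolding power2_norm_eq_inner inner_vec_def by simp
  then show ?thesis
    by (simp only:) (intro smooth_sum smooth_mult smooth_diff smooth_component smooth_const)
qed

lemma smooth_differentiable: "smooth f \<Longrightarrow> f differentiable (at x)"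
  unfolding smooth_def using Ck_Suc_differentiable by blast

lemma smooth_continuous: "smooth f \<Longrightarrow> continuous_on UNIV f"
  unfolding smooth_def by (metis Ck.simps(1))

lemma smooth_continuous_grad: "smooth f \<Longrightarrow> continuous_on UNIV (grad f)"
proof -
  assume "smooth f"
  then have "Ck (Suc 0) f" by (simp add: smooth_def)
  then have "continuous_on UNIV (\<lambda>x. \<chi> i. grad f x $ i)"
    by (intro continuous_on_vec_lambda) auto
  then show ?thesis by simp
qed

subsection \<open>A smooth convex substitute for the positive part\<close>

text \<open>The functions Q(1/t) exp(-1/t), extended by zero, form a family closed under
  differentiation. All derivatives of \<open>soft\<close> are found in it.\<close>

definition exp_poly :: "real poly \<Rightarrow> real \<Rightarrow> real"
  where "exp_poly Q t = (if 0 < t then poly Q (1 / t) * exp (- 1 / t) else 0)"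

lemma poly_times_exp_neg_tendsto: "((\<lambda>s. poly Q s * exp (- s)) \<longlongrightarrow> (0::real)) at_top"
proof -
  have "((\<lambda>s. \<Sum>i\<le>degree Q. coeff Q i * (s ^ i / exp s)) \<longlongrightarrow> (\<Sum>i\<le>degree Q. coeff Q i * 0)) at_top"
    by (intro tendsto_sum tendsto_mult tendsto_const tendsto_power_div_exp_0)
  moreover have "(\<lambda>s. poly Q s * exp (- s)) = (\<lambda>s. \<Sum>i\<le>degree Q. coeff Q i * (s ^ i / exp s))"
    by (simp add: poly_altdef sum_distrib_right exp_minus divide_inverse mult.assoc)
  ultimately show ?thesis by simp
qed

text \<open>This is the difference quotient at \<open>0\<close>. On the right, s = 1/t turns it into
  s Q(s) exp(-s), which explains the factor \<open>[:0, 1:]\<close>; on the left it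
  vanishes.\<close>

lemma exp_poly_divide_tendsto: "((\<lambda>t. exp_poly Q t / t) \<longlongrightarrow> 0) (at 0)"
proof -
  have "((\<lambda>t. poly ([:0, 1:] * Q) (inverse t) * exp (- inverse t)) \<longlongrightarrow> (0::real)) (at_right 0)"
    using filterlim_compose[OF poly_times_exp_neg_tendsto filterlim_inverse_at_top_right] .
  moreover have "\<forall>\<^sub>F t in at_right 0.
      poly ([:0, 1:] * Q) (inverse t) * exp (- inverse t) = exp_poly Q t / (t::real)"
    by (auto simp: eventually_at_filter exp_poly_def divide_inverse mult_ac)
  ultimately have R: "((\<lambda>t. exp_poly Q t / t) \<longlongrightarrow> 0) (at_right 0)"
    by (rule Lim_transform_eventually)
  have "\<forall>\<^sub>F t::real in at_left 0. 0 = exp_poly Q t / t"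
    by (auto simp: eventually_at_filter exp_poly_def)
  then have "((\<lambda>t. exp_poly Q t / t) \<longlongrightarrow> 0) (at_left 0)"
    by (rule Lim_transform_eventually[OF tendsto_const])
  with R show ?thesis by (rule filterlim_split_at[rotated])
qed

text \<open>Both 1/t and -1/t are differentiated: the derivative of Q(1/t) exp(-1/t) is (Q -
  Q')(1/t) / t^2 times the exponential, and \<open>[:0, 0, 1:]\<close> supplies the factor
  1/t^2.\<close>

lemma exp_poly_DERIV:
  "(exp_poly Q has_real_derivative exp_poly ([:0, 0, 1:] * (Q - pderiv Q)) t) (at t)"
proof -
  consider "t > 0" | "t < 0" | "t = 0" by linarith
  then show ?thesis
  proof cases
    case 1
    have "((\<lambda>t. poly Q (1 / t) * exp (- 1 / t)) has_real_derivative
        exp_poly ([:0, 0, 1:] * (Q - pderiv Q)) t) (at t)"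
      using 1 by (auto intro!: derivative_eq_intros simp: exp_poly_def field_simps power2_eq_square)
    then show ?thesis
      by (rule has_field_derivative_transform_within_open[of _ _ _ "{0<..}"])
        (use 1 in \<open>auto simp: exp_poly_def\<close>)
  next
    case 2
    have "((\<lambda>t. 0) has_real_derivative exp_poly ([:0, 0, 1:] * (Q - pderiv Q)) t) (at t)"
      using 2 by (auto simp: exp_poly_def)
    then show ?thesis
      by (rule has_field_derivative_transform_within_open[of _ _ _ "{..<0}"])
        (use 2 in \<open>auto simp: exp_poly_def\<close>)
  next
    case 3
    then show ?thesis
      using exp_poly_divide_tendsto[of Q]
      by (auto simp: has_field_derivative_iff exp_poly_def)
  qed
qed

text \<open>The function t exp(-1/t) is smooth, vanishes exactly for nonpositive arguments, lies
  between t - 1 and the positive part of t, and has slope between 0 and 1. Composed with test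
  functions and multiplied by a cut-off it therefore stays inside the class of test
  functions.\<close>

definition soft :: "real \<Rightarrow> real"
  where "soft t = (if 0 < t then t * exp (- 1 / t) else 0)"

definition soft' :: "real \<Rightarrow> real"
  where "soft' t = (if 0 < t then (1 + 1 / t) * exp (- 1 / t) else 0)"

lemma soft_eq: "soft t = t * exp_poly 1 t"
  by (simp add: soft_def exp_poly_def)

lemma soft'_eq: "soft' = exp_poly [:1, 1:]"
  by (auto simp: soft'_def exp_poly_def fun_eq_iff)

lemma soft_DERIV: "(soft has_real_derivative soft' t) (at t)"
proof -
  have "((\<lambda>t. t * exp_poly 1 t) has_real_derivative
      1 * exp_poly 1 t + exp_poly ([:0, 0, 1:] * (1 - pderiv 1)) t * t) (at t)"
    by (rule DERIV_mult[OF DERIV_ident exp_poly_DERIV])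
  also have "1 * exp_poly 1 t + exp_poly ([:0, 0, 1:] * (1 - pderiv 1)) t * t = soft' t"
    by (simp add: soft'_def exp_poly_def field_simps)
  finally show ?thesis by (simp add: soft_eq[abs_def])
qed

lemma real_smooth_soft: "real_smooth soft"
proof -
  \<comment> \<open>The recursion starts from 1 + s because \<open>soft'\<close> is (1 + 1/t)
    exp(-1/t); from there on the operator of \<open>exp_poly_DERIV\<close> is iterated.\<close>
  define Q where "Q = rec_nat [:1, 1::real:] (\<lambda>_ Q. [:0, 0, 1:] * (Q - pderiv Q))"
  define H where "H = (\<lambda>k. case k of 0 \<Rightarrow> soft | Suc m \<Rightarrow> exp_poly (Q m))"
  have "(H k has_real_derivative H (Suc k) t) (at t)" for k t
  proof (cases k)
    case 0
    then show ?thesis using soft_DERIV by (simp add: H_def soft'_eq Q_def)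
  next
    case (Suc m)
    then show ?thesis using exp_poly_DERIV[of "Q m"] by (simp add: H_def Q_def)
  qed
  moreover have "H 0 = soft" by (simp add: H_def)
  ultimately show ?thesis unfolding real_smooth_def by blast
qed

lemma soft_nonneg: "0 \<le> soft t"
  by (simp add: soft_def)

lemma soft_le: "soft t \<le> max 0 t"
  by (auto simp: soft_def mult_le_cancel_left2)

lemma soft_ge: "t - 1 \<le> soft t"
proof (cases "t > 0")
  case True
  have "1 + (- 1 / t) \<le> exp (- 1 / t)" by (rule exp_ge_add_one_self)
  then have "t * (1 - 1 / t) \<le> t * exp (- 1 / t)" using True by (intro mult_left_mono) auto
  moreover have "t * (1 - 1 / t) = t - 1" using True by (simp add: field_simps)
  ultimately show ?thesis using True by (simp add: soft_def)
qed (simp add: soft_def)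

lemma soft_pos: "0 < t \<Longrightarrow> 0 < soft t"
  by (simp add: soft_def)

lemma soft_eq_0_iff: "soft t = 0 \<longleftrightarrow> t \<le> 0"
  by (simp add: soft_def)

lemma soft'_nonneg: "0 \<le> soft' t"
  by (simp add: soft'_def)

lemma soft'_le_1: "soft' t \<le> 1"
proof (cases "t > 0")
  case True
  have "1 + 1 / t \<le> exp (1 / t)" by (rule exp_ge_add_one_self)
  then have "(1 + 1 / t) * exp (- 1 / t) \<le> exp (1 / t) * exp (- 1 / t)"
    by (intro mult_right_mono) auto
  also have "\<dots> = 1" by (simp add: exp_add[symmetric])
  finally show ?thesis using True by (simp add: soft'_def)
qed (simp add: soft'_def)

lemma soft_le_soft': "soft t \<le> max 0 t * soft' t"
  by (auto simp: soft_def soft'_def)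

lemma soft'_continuous: "continuous_on UNIV soft'"
  unfolding soft'_eq using exp_poly_DERIV by (meson DERIV_continuous_on has_field_derivative_at_within)

lemma soft_mono: "s \<le> t \<Longrightarrow> soft s \<le> soft t"
  by (rule DERIV_nonneg_imp_nondecreasing) (use soft_DERIV soft'_nonneg in blast)+

lemma soft_Lipschitz: "\<bar>soft s - soft t\<bar> \<le> \<bar>s - t\<bar>"
proof -
  have "norm (soft s - soft t) \<le> 1 * norm (s - t)"
    by (rule field_differentiable_bound[of UNIV soft soft'])
      (auto simp: soft'_nonneg soft'_le_1 intro: has_field_derivative_at_within soft_DERIV)
  then show ?thesis by simp
qed

lemma soft_continuous: "continuous_on UNIV soft"
  using soft_DERIV by (meson DERIV_continuous_on has_field_derivative_at_within)

text \<open>At scale \<open>\<tau>\<close> the substitute is within \<open>\<tau>\<close> of the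
  positive part, and its slope \<open>soft' (t / \<tau>)\<close> still lies between 0 and 1. The
  first estimate is the tangent inequality of a convex function that vanishes at 0; it makes the
  absorption in the Caccioppoli inequality possible.\<close>

lemma soft_scaled_le:
  assumes "0 < \<tau>"
  shows "\<tau> * soft (t / \<tau>) \<le> max 0 t * soft' (t / \<tau>)" "\<tau> * soft (t / \<tau>) \<le> max 0 t"
    "max 0 t - \<tau> \<le> \<tau> * soft (t / \<tau>)"
proof -
  have m: "\<tau> * max 0 (t / \<tau>) = max 0 t"
    using assms by (auto simp: max_def divide_simps)
  show "\<tau> * soft (t / \<tau>) \<le> max 0 t * soft' (t / \<tau>)"
    using mult_left_mono[OF soft_le_soft'[of "t / \<tau>"], of \<tau>] assms by (simp add: m mult.assoc[symmetric])
  show "\<tau> * soft (t / \<tau>) \<le> max 0 t"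
    using mult_left_mono[OF soft_le[of "t / \<tau>"], of \<tau>] assms by (simp add: m)
  have "\<tau> * (t / \<tau> - 1) \<le> \<tau> * soft (t / \<tau>)"
    using soft_ge[of "t / \<tau>"] assms by (intro mult_left_mono) auto
  moreover have "\<tau> * (t / \<tau> - 1) = t - \<tau>" using assms by (simp add: field_simps)
  moreover have "0 \<le> \<tau> * soft (t / \<tau>)" using assms soft_nonneg by simp
  ultimately show "max 0 t - \<tau> \<le> \<tau> * soft (t / \<tau>)" using assms by (auto simp: max_def)
qed

lemma soft_scaled_tendsto:
  "(\<lambda>n. inverse (real (Suc n)) * soft (t / inverse (real (Suc n)))) \<longlonglongrightarrow> max 0 t"
proof (rule tendsto_sandwich)
  have \<tau>: "0 < inverse (real (Suc n))" for n by simp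
  show "\<forall>\<^sub>F n in sequentially. max 0 t - inverse (real (Suc n))
      \<le> inverse (real (Suc n)) * soft (t / inverse (real (Suc n)))"
    "\<forall>\<^sub>F n in sequentially. inverse (real (Suc n)) * soft (t / inverse (real (Suc n))) \<le> max 0 t"
    by (intro always_eventually allI soft_scaled_le(2,3)[OF \<tau>])+
  show "(\<lambda>n. max 0 t - inverse (real (Suc n))) \<longlonglongrightarrow> max 0 t"
    using tendsto_diff[OF tendsto_const LIMSEQ_inverse_real_of_nat] by simp
qed simp

section \<open>Test functions\<close>

lemma test_functionsI:
  assumes "smooth f" "compact K" "K \<subseteq> \<Omega>" "\<And>x. x \<notin> K \<Longrightarrow> f x = 0"
  shows "f \<in> test_functions \<Omega>"
proof -
  have "closure {x. f x \<noteq> 0} \<subseteq> K"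
    using assms by (intro closure_minimal) (auto simp: compact_imp_closed)
  moreover from this have "compact (closure {x. f x \<noteq> 0})"
    by (metis assms(2) closed_closure compact_Int_closed inf.absorb2)
  ultimately show ?thesis
    using assms by (auto simp: test_functions_def smooth_def)
qed

lemma test_functions_smooth: "f \<in> test_functions \<Omega> \<Longrightarrow> smooth f"
  by (simp add: test_functions_def smooth_def)

lemma grad_zero_outside:
  assumes "closed K" "\<And>x. x \<notin> K \<Longrightarrow> f x = 0" "x \<notin> K"
  shows "grad f x = 0"
proof (rule grad_eqI)
  have "((\<lambda>x. 0) has_derivative (\<lambda>h. 0 \<bullet> h)) (at x)" by simp
  then show "(f has_derivative (\<lambda>h. 0 \<bullet> h)) (at x)"
    by (rule has_derivative_transform_within_open[of _ _ _ _ "- K"]) (use assms in auto)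
qed

lemma test_functionsE:
  assumes "f \<in> test_functions \<Omega>"
  obtains K where "compact K" "K \<subseteq> \<Omega>" "\<And>x. x \<notin> K \<Longrightarrow> f x = 0" "\<And>x. x \<notin> K \<Longrightarrow> grad f x = 0"
proof
  let ?K = "closure {x. f x \<noteq> 0}"
  show "compact ?K" "?K \<subseteq> \<Omega>" using assms by (auto simp: test_functions_def)
  show 1: "f x = 0" if "x \<notin> ?K" for x using that closure_subset[of "{x. f x \<noteq> 0}"] by blast
  then show "grad f x = 0" if "x \<notin> ?K" for x
    by (rule grad_zero_outside[OF closed_closure _ that])
qed

lemma test_functions_outside:
  assumes "f \<in> test_functions \<Omega>" "x \<notin> \<Omega>"
  shows "f x = 0" "grad f x = 0"
  using assms by (metis subsetD test_functionsE)+

lemma test_functions_mono: "\<Omega> \<subseteq> \<Omega>' \<Longrightarrow> f \<in> test_functions \<Omega> \<Longrightarrow> f \<in> test_functions \<Omega>'"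
  by (auto simp: test_functions_def)

lemma test_functions_add:
  assumes "f \<in> test_functions \<Omega>" "g \<in> test_functions \<Omega>"
  shows "(\<lambda>x. f x + g x) \<in> test_functions \<Omega>"
proof -
  obtain K L where "compact K" "K \<subseteq> \<Omega>" "\<And>x. x \<notin> K \<Longrightarrow> f x = 0"
    "compact L" "L \<subseteq> \<Omega>" "\<And>x. x \<notin> L \<Longrightarrow> g x = 0"
    by (meson assms test_functionsE)
  then show ?thesis
    by (intro test_functionsI[of _ "K \<union> L"] smooth_add)
      (use assms in \<open>auto intro: test_functions_smooth\<close>)
qed

lemma test_functions_mult:
  assumes "smooth g" "f \<in> test_functions \<Omega>"
  shows "(\<lambda>x. g x * f x) \<in> test_functions \<Omega>"
  by (rule test_functionsE[OF assms(2)], rule test_functionsI)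
    (use assms in \<open>auto intro: smooth_mult test_functions_smooth\<close>)

lemma test_functions_diff:
  assumes "f \<in> test_functions \<Omega>" "g \<in> test_functions \<Omega>"
  shows "(\<lambda>x. f x - g x) \<in> test_functions \<Omega>"
  using test_functions_add[OF assms(1) test_functions_mult[OF smooth_const[of "-1"] assms(2)]] by simp

lemma test_functions_grad_nth:
  assumes "\<phi> \<in> test_functions \<Omega>"
  shows "(\<lambda>x. grad \<phi> x $ i) \<in> test_functions \<Omega>"
proof -
  obtain K where K: "compact K" "K \<subseteq> \<Omega>" "\<And>x. x \<notin> K \<Longrightarrow> grad \<phi> x = 0"
    using assms test_functionsE by metis
  have "Ck k (\<lambda>x. grad \<phi> x $ i)" for k
    using test_functions_smooth[OF assms] unfolding smooth_def by (metis Ck.simps(2))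
  then show ?thesis using K by (intro test_functionsI[of _ K]) (auto simp: smooth_def)
qed

lemma test_functions_zero: "(\<lambda>x. 0) \<in> test_functions \<Omega>"
  by (rule test_functionsI[of _ "{}"]) (auto simp: smooth_const)

lemma test_functions_translate:
  fixes f :: "real^'n \<Rightarrow> real"
  assumes "f \<in> test_functions \<Omega>" "compact K" "\<And>x. x \<notin> K \<Longrightarrow> f x = 0" "(\<lambda>x. x - h) ` K \<subseteq> \<Omega>'"
  shows "(\<lambda>x. f (x + h)) \<in> test_functions \<Omega>'"
proof (rule test_functionsI[of _ "(\<lambda>x. x - h) ` K"])
  show "smooth (\<lambda>x. f (x + h))"
    using assms by (intro smooth_translate test_functions_smooth)
  show "compact ((\<lambda>x. x - h) ` K)"
    using assms by (intro compact_continuous_image continuous_intros)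
  show "f (x + h) = 0" if "x \<notin> (\<lambda>x. x - h) ` K" for x
    using that assms(3)[of "x + h"] by (metis add_diff_cancel image_eqI)
qed (use assms in auto)

subsection \<open>Integration of continuous functions with compact support\<close>

lemma compact_support_integrable:
  fixes F :: "'a::euclidean_space \<Rightarrow> 'b::euclidean_space"
  assumes "continuous_on UNIV F" "compact K" "\<And>x. x \<notin> K \<Longrightarrow> F x = 0"
  shows "integrable lborel F"
proof -
  have "integrable lborel (\<lambda>x. indicator K x *\<^sub>R F x)"
    using assms by (intro borel_integrable_compact) (auto intro: continuous_on_subset)
  also have "(\<lambda>x. indicator K x *\<^sub>R F x) = F"
    using assms by (auto simp: indicator_def)
  finally show ?thesis .
qed

lemma compact_support_bounded:
  fixes F :: "'a::euclidean_space \<Rightarrow> 'b::euclidean_space"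
  assumes "continuous_on UNIV F" "compact K" "\<And>x. x \<notin> K \<Longrightarrow> F x = 0"
  obtains M where "0 \<le> M" "\<And>x. norm (F x) \<le> M"
proof -
  have "bounded (F ` K)"
    using assms by (intro compact_imp_bounded compact_continuous_image) (auto intro: continuous_on_subset)
  then obtain M where M: "\<And>x. x \<in> K \<Longrightarrow> norm (F x) \<le> M"
    by (auto simp: bounded_iff)
  have "norm (F x) \<le> max 0 M" for x
    using M[of x] assms(3)[of x] by (cases "x \<in> K") auto
  then show ?thesis using that[of "max 0 M"] by simp
qed

lemma test_functions_continuous: "f \<in> test_functions \<Omega> \<Longrightarrow> continuous_on UNIV f"
  and test_functions_continuous_grad: "f \<in> test_functions \<Omega> \<Longrightarrow> continuous_on UNIV (grad f)"
  by (auto intro: smooth_continuous smooth_continuous_grad test_functions_smooth)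

lemma test_functions_borel: "f \<in> test_functions \<Omega> \<Longrightarrow> f \<in> borel_measurable borel"
  and test_functions_borel_grad: "f \<in> test_functions \<Omega> \<Longrightarrow> grad f \<in> borel_measurable borel"
  by (auto intro: borel_measurable_continuous_onI test_functions_continuous test_functions_continuous_grad)

lemma test_functions_integrable:
  assumes "f \<in> test_functions \<Omega>"
  shows "integrable lborel f" "integrable lborel (\<lambda>x. (f x)\<^sup>2)"
    "integrable lborel (grad f)" "integrable lborel (\<lambda>x. (norm (grad f x))\<^sup>2)"
proof -
  obtain K where "compact K" "\<And>x. x \<notin> K \<Longrightarrow> f x = 0" "\<And>x. x \<notin> K \<Longrightarrow> grad f x = 0"
    using assms test_functionsE by metis
  moreover note test_functions_continuous[OF assms] test_functions_continuous_grad[OF assms]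
  ultimately show "integrable lborel f" "integrable lborel (\<lambda>x. (f x)\<^sup>2)"
    "integrable lborel (grad f)" "integrable lborel (\<lambda>x. (norm (grad f x))\<^sup>2)"
    by (auto intro!: compact_support_integrable[of _ K] continuous_intros)
qed

lemma lborel_integral_translate:
  fixes F :: "'a::euclidean_space \<Rightarrow> 'b::euclidean_space"
  assumes "F \<in> borel_measurable borel"
  shows "integral\<^sup>L lborel (\<lambda>x. F (x + h)) = integral\<^sup>L lborel F"
proof -
  have "integral\<^sup>L lborel F = integral\<^sup>L (distr lborel borel ((+) h)) F"
    by (simp add: lborel_distr_plus)
  also have "\<dots> = integral\<^sup>L lborel (\<lambda>x. F (h + x))"
    using assms by (subst integral_distr) auto
  finally show ?thesis by (simp add: add.commute)
qed

lemma lborel_nn_integral_translate: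
  fixes F :: "'a::euclidean_space \<Rightarrow> ennreal"
  assumes "F \<in> borel_measurable borel"
  shows "(\<integral>\<^sup>+x. F (x + h) \<partial>lborel) = integral\<^sup>N lborel F"
proof -
  have "integral\<^sup>N lborel F = integral\<^sup>N (distr lborel borel ((+) h)) F"
    by (simp add: lborel_distr_plus)
  also have "\<dots> = (\<integral>\<^sup>+x. F (h + x) \<partial>lborel)"
    using assms by (subst nn_integral_distr) auto
  finally show ?thesis by (simp add: add.commute)
qed

lemma lborel_integrable_translate:
  fixes F :: "'a::euclidean_space \<Rightarrow> 'b::euclidean_space"
  assumes "integrable lborel F"
  shows "integrable lborel (\<lambda>x. F (x + h))"
proof -
  have "integrable (distr lborel borel ((+) h)) F"
    using assms by (simp add: lborel_distr_plus)
  then have "integrable lborel (\<lambda>x. F (h + x))"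
    by (rule integrable_distr[rotated]) simp
  then show ?thesis by (simp add: add.commute)
qed

lemma test_functions_Lipschitz:
  assumes "smooth f" "\<And>x. norm (grad f x) \<le> M"
  shows "\<bar>f y - f x\<bar> \<le> M * norm (y - x)"
proof -
  have "norm (f y - f x) \<le> M * norm (y - x)"
  proof (rule differentiable_bound[of UNIV f "\<lambda>x h. grad f x \<bullet> h"])
    show "(f has_derivative (\<lambda>h. grad f x \<bullet> h)) (at x within UNIV)" for x
      using has_derivative_grad[OF smooth_differentiable[OF assms(1)]] by simp
    show "onorm (\<lambda>h. grad f x \<bullet> h) \<le> M" for x
    proof (rule onorm_le)
      fix h
      have "norm (grad f x \<bullet> h) \<le> norm (grad f x) * norm h"
        using Cauchy_Schwarz_ineq2 by simp
      also have "\<dots> \<le> M * norm h" by (intro mult_right_mono assms norm_ge_zero)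
      finally show "norm (grad f x \<bullet> h) \<le> M * norm h" .
    qed
  qed auto
  then show ?thesis by simp
qed

lemma difference_quotient_tendsto:
  assumes "smooth f"
  shows "(\<lambda>n. real (Suc n) * (f (x + h /\<^sub>R real (Suc n)) - f x)) \<longlonglongrightarrow> grad f x \<bullet> h"
proof -
  have "((\<lambda>t. f (x + t *\<^sub>R h)) has_derivative (\<lambda>t. grad f x \<bullet> (t *\<^sub>R h))) (at 0)"
    by (rule has_derivative_compose[of "\<lambda>t. x + t *\<^sub>R h" "\<lambda>t. t *\<^sub>R h" 0 UNIV f])
      (auto intro!: derivative_eq_intros has_derivative_grad smooth_differentiable assms)
  then have "((\<lambda>t. f (x + t *\<^sub>R h)) has_real_derivative grad f x \<bullet> h) (at 0)"
    by (simp add: has_field_derivative_def mult_commute_abs)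
  then have "((\<lambda>t. (f (x + t *\<^sub>R h) - f x) / t) \<longlongrightarrow> grad f x \<bullet> h) (at 0)"
    by (simp add: has_field_derivative_iff)
  moreover have "filterlim (\<lambda>n. inverse (real (Suc n))) (at 0) sequentially"
    using LIMSEQ_inverse_real_of_nat by (auto simp: filterlim_at)
  ultimately have "(\<lambda>n. (f (x + inverse (real (Suc n)) *\<^sub>R h) - f x) / inverse (real (Suc n))) \<longlonglongrightarrow> grad f x \<bullet> h"
    by (rule filterlim_compose)
  then show ?thesis by (simp add: divide_inverse mult.commute)
qed

text \<open>All increments have length at most \<open>norm h\<close>, so the supports stay in one
  ball and the Lipschitz bound gives a single integrable majorant for dominated convergence.\<close>

lemma difference_quotient_bound:
  fixes f :: "real^'n \<Rightarrow> real"
  assumes "f \<in> test_functions \<Omega>"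
  obtains M R where "0 \<le> M"
    "\<And>n x. \<bar>real (Suc n) * (f (x + h /\<^sub>R real (Suc n)) - f x)\<bar> \<le> M * indicator (cball 0 R) x"
proof -
  obtain K where K: "compact K" "\<And>x. x \<notin> K \<Longrightarrow> f x = 0" "\<And>x. x \<notin> K \<Longrightarrow> grad f x = 0"
    using assms test_functionsE by metis
  obtain M where M: "0 \<le> M" "\<And>x. norm (grad f x) \<le> M"
    using compact_support_bounded[OF test_functions_continuous_grad[OF assms] K(1,3)] by metis
  obtain R where R: "\<And>x. x \<in> K \<Longrightarrow> norm x \<le> R"
    using K(1) compact_imp_bounded bounded_iff by metis
  have "\<bar>real (Suc n) * (f (x + h /\<^sub>R real (Suc n)) - f x)\<bar>
      \<le> (M * norm h) * indicator (cball 0 (R + norm h)) x" for n x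
  proof (cases "norm x \<le> R + norm h")
    case True
    have "\<bar>f (x + h /\<^sub>R real (Suc n)) - f x\<bar> \<le> M * norm (x + h /\<^sub>R real (Suc n) - x)"
      using M by (intro test_functions_Lipschitz test_functions_smooth[OF assms]) auto
    then have "real (Suc n) * \<bar>f (x + h /\<^sub>R real (Suc n)) - f x\<bar>
        \<le> real (Suc n) * (M * norm (x + h /\<^sub>R real (Suc n) - x))"
      by (intro mult_left_mono) auto
    then show ?thesis using True by (simp add: abs_mult divide_simps)
  next
    case False
    have "norm (h /\<^sub>R real (Suc n)) \<le> norm h"
      by (simp add: divide_simps mult_le_cancel_left1)
    moreover have "norm x \<le> norm (x + h /\<^sub>R real (Suc n)) + norm (h /\<^sub>R real (Suc n))"
      by (metis add_diff_cancel norm_triangle_ineq4)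
    ultimately have "\<not> norm (x + h /\<^sub>R real (Suc n)) \<le> R" "\<not> norm x \<le> R"
      using False norm_ge_zero[of h] by linarith+
    then have "x \<notin> K" "x + h /\<^sub>R real (Suc n) \<notin> K" using R by blast+
    then show ?thesis using K M by simp
  qed
  then show ?thesis using M by (intro that[of "M * norm h"]) auto
qed

lemma integrable_indicator_cball: "integrable lborel (\<lambda>x. M * indicator (cball a R) x :: real)"
  using emeasure_bounded_finite[OF bounded_cball, of a R] by auto

text \<open>Every difference quotient has integral zero by translation invariance of Lebesgue
  measure, and this survives the limit. The divergence theorem is thus not involved.\<close>

lemma test_functions_integral_grad:
  fixes f :: "real^'n \<Rightarrow> real"
  assumes "f \<in> test_functions \<Omega>"
  shows "(\<integral>x. grad f x \<bullet> h \<partial>lborel) = 0"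
proof -
  define q where "q = (\<lambda>n x. real (Suc n) * (f (x + h /\<^sub>R real (Suc n)) - f x))"
  obtain M R where MR: "\<And>n x. \<bar>q n x\<bar> \<le> M * indicator (cball 0 R) x"
    using difference_quotient_bound[OF assms, of h] unfolding q_def by metis
  note [measurable] = test_functions_borel[OF assms] test_functions_borel_grad[OF assms]
  have "(\<lambda>n. \<integral>x. q n x \<partial>lborel) \<longlonglongrightarrow> (\<integral>x. grad f x \<bullet> h \<partial>lborel)"
  proof (rule integral_dominated_convergence)
    show "integrable lborel (\<lambda>x::real^'n. M * indicator (cball 0 R) x)"
      by (rule integrable_indicator_cball)
    show "AE x in lborel. (\<lambda>n. q n x) \<longlonglongrightarrow> grad f x \<bullet> h"
      unfolding q_def using difference_quotient_tendsto[OF test_functions_smooth[OF assms]] by simp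
    show "AE x in lborel. norm (q n x) \<le> M * indicator (cball 0 R) x" for n
      using MR by simp
  qed (auto simp: q_def)
  moreover have "(\<integral>x. q n x \<partial>lborel) = 0" for n
    using test_functions_integrable(1)[OF assms]
      lborel_integrable_translate[OF test_functions_integrable(1)[OF assms]]
      lborel_integral_translate[OF test_functions_borel[OF assms]]
    by (simp add: q_def)
  ultimately show ?thesis by (simp add: LIMSEQ_const_iff)
qed

lemma test_functions_integration_by_parts:
  fixes f g :: "real^'n \<Rightarrow> real"
  assumes "f \<in> test_functions \<Omega>" "g \<in> test_functions \<Omega>"
  shows "(\<integral>x. f x * grad g x $ i \<partial>lborel) = - (\<integral>x. grad f x $ i * g x \<partial>lborel)"
proof -
  have fg: "(\<lambda>x. f x * g x) \<in> test_functions \<Omega>"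
    using assms by (intro test_functions_mult test_functions_smooth)
  have sm: "smooth f" "smooth g" using assms test_functions_smooth by blast+
  have eq: "grad (\<lambda>x. f x * g x) x \<bullet> axis i 1 = f x * grad g x $ i + grad f x $ i * g x" for x
    using sm by (subst grad_mult) (auto intro: smooth_differentiable simp: inner_axis inner_add_left)
  obtain K where K: "compact K" "\<And>x. x \<notin> K \<Longrightarrow> f x = 0" "\<And>x. x \<notin> K \<Longrightarrow> grad f x = 0"
    using assms test_functionsE by metis
  have c: "continuous_on UNIV f" "continuous_on UNIV g" "continuous_on UNIV (grad f)" "continuous_on UNIV (grad g)"
    using sm smooth_continuous smooth_continuous_grad by blast+
  have "integrable lborel (\<lambda>x. f x * grad g x $ i)" "integrable lborel (\<lambda>x. grad f x $ i * g x)"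
    by (rule compact_support_integrable[of _ K]; auto intro!: continuous_intros c K simp: K)+
  moreover have "(\<integral>x. f x * grad g x $ i + grad f x $ i * g x \<partial>lborel) = 0"
    using test_functions_integral_grad[OF fg, of "axis i 1"] by (simp only: eq)
  ultimately show ?thesis by simp
qed

text \<open>The shift by \<open>h\<close> is cut into equal small steps. The Cauchy-Schwarz
  inequality for the sum and translation invariance bound the integral by that of a squared
  difference quotient with a small step, which converges to the directional derivative.\<close>

lemma test_functions_translate_L2:
  fixes f :: "real^'n \<Rightarrow> real"
  assumes "f \<in> test_functions \<Omega>"
  shows "(\<integral>x. (f (x + h) - f x)\<^sup>2 \<partial>lborel) \<le> (norm h)\<^sup>2 * (\<integral>x. (norm (grad f x))\<^sup>2 \<partial>lborel)"
proof -
  define q where "q = (\<lambda>n x. real (Suc n) * (f (x + h /\<^sub>R real (Suc n)) - f x))"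
  obtain M R where MR: "0 \<le> M" "\<And>n x. \<bar>q n x\<bar> \<le> M * indicator (cball 0 R) x"
    using difference_quotient_bound[OF assms, of h] unfolding q_def by metis
  have [measurable]: "f \<in> borel_measurable borel" "grad f \<in> borel_measurable borel"
    by (rule test_functions_borel[OF assms] test_functions_borel_grad[OF assms])+
  have q_meas [measurable]: "q n \<in> borel_measurable borel" for n by (auto simp: q_def)
  have q2: "(q n x)\<^sup>2 \<le> M\<^sup>2 * indicator (cball 0 R) x" for n x
    using power_mono[OF MR(2)[of n x], of 2] by (auto simp: indicator_def split: if_splits)
  have iq: "integrable lborel (\<lambda>x. (q n x)\<^sup>2)" for n
    by (rule Bochner_Integration.integrable_bound[OF integrable_indicator_cball[of "M\<^sup>2" 0 R]])
      (use q2 in auto)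
  have lim: "(\<lambda>n. \<integral>x. (q n x)\<^sup>2 \<partial>lborel) \<longlonglongrightarrow> (\<integral>x. (grad f x \<bullet> h)\<^sup>2 \<partial>lborel)"
  proof (rule integral_dominated_convergence)
    show "integrable lborel (\<lambda>x::real^'n. M\<^sup>2 * indicator (cball 0 R) x)"
      by (rule integrable_indicator_cball)
    show "AE x in lborel. (\<lambda>n. (q n x)\<^sup>2) \<longlonglongrightarrow> (grad f x \<bullet> h)\<^sup>2"
      unfolding q_def using difference_quotient_tendsto[OF test_functions_smooth[OF assms]]
      by (auto intro!: tendsto_power)
    show "AE x in lborel. norm ((q n x)\<^sup>2) \<le> M\<^sup>2 * indicator (cball 0 R) x" for n
      using q2 by simp
  qed auto
  have "(\<integral>x. (f (x + h) - f x)\<^sup>2 \<partial>lborel) \<le> (\<integral>x. (q n x)\<^sup>2 \<partial>lborel)" for n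
  proof -
    let ?N = "real (Suc n)"
    define k where "k = h /\<^sub>R ?N"
    have Nk: "?N *\<^sub>R k = h" by (simp add: k_def)
    have stepk: "x + real (Suc i) *\<^sub>R k = x + real i *\<^sub>R k + k" for x i
      by (simp add: algebra_simps)
    have iqi: "integrable lborel (\<lambda>x. (q n (x + real i *\<^sub>R k))\<^sup>2)" for i
      using lborel_integrable_translate[OF iq] by simp
    \<comment> \<open>A telescoping sum of \<open>Suc n\<close> increments, each equal to a
      translate of \<open>q n\<close> divided by the number of steps. Squaring the sum costs a
      factor equal to that number.\<close>
    have pw: "(f (x + h) - f x)\<^sup>2 \<le> (\<Sum>i<Suc n. (q n (x + real i *\<^sub>R k))\<^sup>2) / ?N" for x
    proof -
      have "(\<Sum>i<Suc n. f (x + real (Suc i) *\<^sub>R k) - f (x + real i *\<^sub>R k)) = f (x + real (Suc n) *\<^sub>R k) - f x"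
        by (subst sum_lessThan_telescope) simp
      then have "f (x + h) - f x = (\<Sum>i<Suc n. f (x + real (Suc i) *\<^sub>R k) - f (x + real i *\<^sub>R k))"
        by (simp only: Nk)
      also have "\<dots> = (\<Sum>i<Suc n. q n (x + real i *\<^sub>R k) / ?N)"
        by (intro sum.cong) (simp_all add: q_def stepk k_def[symmetric] del: of_nat_Suc)
      finally have "(f (x + h) - f x)\<^sup>2 \<le> (\<Sum>i<Suc n. (q n (x + real i *\<^sub>R k) / ?N)\<^sup>2) * card {..<Suc n}"
        by (metis sum_squared_le_sum_of_squares finite_lessThan)
      also have "\<dots> = (\<Sum>i<Suc n. (q n (x + real i *\<^sub>R k))\<^sup>2) / ?N"
        by (simp add: power_divide sum_divide_distrib[symmetric] power2_eq_square divide_simps del: sum.lessThan_Suc of_nat_Suc)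
      finally show ?thesis .
    qed
    have "(\<integral>x. (f (x + h) - f x)\<^sup>2 \<partial>lborel) \<le> (\<integral>x. (\<Sum>i<Suc n. (q n (x + real i *\<^sub>R k))\<^sup>2) / ?N \<partial>lborel)"
    proof (rule integral_mono_AE')
      show "integrable lborel (\<lambda>x. (\<Sum>i<Suc n. (q n (x + real i *\<^sub>R k))\<^sup>2) / ?N)"
        using iqi by (intro integrable_divide Bochner_Integration.integrable_sum) auto
      show "AE x in lborel. (f (x + h) - f x)\<^sup>2 \<le> (\<Sum>i<Suc n. (q n (x + real i *\<^sub>R k))\<^sup>2) / ?N"
        using pw by (intro AE_I2)
      show "AE x in lborel. 0 \<le> (\<Sum>i<Suc n. (q n (x + real i *\<^sub>R k))\<^sup>2) / ?N"
        by (intro AE_I2 divide_nonneg_nonneg sum_nonneg) auto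
    qed
    also have "\<dots> = (\<Sum>i<Suc n. \<integral>x. (q n (x + real i *\<^sub>R k))\<^sup>2 \<partial>lborel) / ?N"
      using iqi by (simp add: Bochner_Integration.integral_sum del: sum.lessThan_Suc)
    also have "\<dots> = (\<Sum>i<Suc n. \<integral>x. (q n x)\<^sup>2 \<partial>lborel) / ?N"
      by (subst lborel_integral_translate[of "\<lambda>x. (q n x)\<^sup>2"]) auto
    also have "\<dots> = (\<integral>x. (q n x)\<^sup>2 \<partial>lborel)" by simp
    finally show ?thesis .
  qed
  then have "(\<integral>x. (f (x + h) - f x)\<^sup>2 \<partial>lborel) \<le> (\<integral>x. (grad f x \<bullet> h)\<^sup>2 \<partial>lborel)"
    using lim by (intro LIMSEQ_le_const) auto
  also have "\<dots> \<le> (\<integral>x. (norm h)\<^sup>2 * (norm (grad f x))\<^sup>2 \<partial>lborel)"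
  proof (rule integral_mono_AE')
    show "AE x in lborel. (grad f x \<bullet> h)\<^sup>2 \<le> (norm h)\<^sup>2 * (norm (grad f x))\<^sup>2"
      by (intro AE_I2) (metis Cauchy_Schwarz_ineq mult.commute power2_norm_eq_inner)
  qed (use test_functions_integrable[OF assms] in auto)
  finally show ?thesis by simp
qed

subsection \<open>A Nash inequality\<close>

text \<open>The function \<open>f\<^sup>2\<close> is compared with \<open>f(x) f(x + h)\<close>, whose integral over \<open>x\<close> and over
  \<open>h\<close> in a ball is at most the square of the \<open>L\<^sup>1\<close> norm of \<open>f\<close>.\<close>

lemma test_functions_Nash:
  fixes f :: "real^'n \<Rightarrow> real"
  assumes "f \<in> test_functions \<Omega>" "0 < s"
  shows "(\<integral>x. (f x)\<^sup>2 \<partial>lborel) \<le> s\<^sup>2 * (\<integral>x. (norm (grad f x))\<^sup>2 \<partial>lborel)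
    + 2 * (\<integral>x. \<bar>f x\<bar> \<partial>lborel)\<^sup>2 / measure lborel (ball (0::real^'n) s)"
proof -
  note int = test_functions_integrable[OF assms(1)]
  have [measurable]: "f \<in> borel_measurable borel" by (rule test_functions_borel[OF assms(1)])
  define X where "X = (\<integral>x. (f x)\<^sup>2 \<partial>lborel) - s\<^sup>2 * (\<integral>x. (norm (grad f x))\<^sup>2 \<partial>lborel)"
  let ?B = "ball (0::real^'n) s"
  have B: "emeasure lborel ?B = ennreal (measure lborel ?B)" "0 < measure lborel ?B"
    using emeasure_bounded_finite[OF bounded_ball, of "0::real^'n" s] content_ball_pos[of s "0::real^'n"] assms(2)
    by (auto simp: emeasure_eq_ennreal_measure measure_completion)
  \<comment> \<open>From a^2 \<le> (b - a)^2 + 2 |a| |b| with a = f(x) and b = f(x + h): the squared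
    difference costs at most \<open>s\<^sup>2\<close> times the energy since \<open>h\<close> has
    length below \<open>s\<close>, and \<open>X\<close> is what remains.\<close>
  have X_le: "ennreal X \<le> (\<integral>\<^sup>+x. ennreal (2 * (\<bar>f x\<bar> * \<bar>f (x + h)\<bar>)) \<partial>lborel)" if "h \<in> ?B" for h
  proof -
    have i2: "integrable lborel (\<lambda>x. (f (x + h))\<^sup>2)"
      using lborel_integrable_translate[OF int(2)] .
    have i3: "integrable lborel (\<lambda>x. \<bar>f x\<bar> * \<bar>f (x + h)\<bar>)"
    proof (rule Bochner_Integration.integrable_bound)
      show "integrable lborel (\<lambda>x. (f x)\<^sup>2 + (f (x + h))\<^sup>2)" using int i2 by simp
      show "AE x in lborel. norm (\<bar>f x\<bar> * \<bar>f (x + h)\<bar>) \<le> norm ((f x)\<^sup>2 + (f (x + h))\<^sup>2)"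
      proof (intro AE_I2)
        fix x
        have "2 * \<bar>f x\<bar> * \<bar>f (x + h)\<bar> \<le> (f x)\<^sup>2 + (f (x + h))\<^sup>2"
          using sum_squares_bound[of "\<bar>f x\<bar>" "\<bar>f (x + h)\<bar>"] by simp
        moreover have "0 \<le> \<bar>f x\<bar> * \<bar>f (x + h)\<bar>" by simp
        ultimately have "\<bar>f x\<bar> * \<bar>f (x + h)\<bar> \<le> (f x)\<^sup>2 + (f (x + h))\<^sup>2"
          by linarith
        then show "norm (\<bar>f x\<bar> * \<bar>f (x + h)\<bar>) \<le> norm ((f x)\<^sup>2 + (f (x + h))\<^sup>2)"
          by (simp add: abs_mult)
      qed
    qed auto
    have i4: "integrable lborel (\<lambda>x. (f (x + h) - f x)\<^sup>2)"
    proof (rule Bochner_Integration.integrable_bound)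
      show "integrable lborel (\<lambda>x. 2 * (f x)\<^sup>2 + 2 * (f (x + h))\<^sup>2)" using int i2 by simp
      have "(a - b)\<^sup>2 \<le> 2 * b\<^sup>2 + 2 * a\<^sup>2" for a b :: real
        using zero_le_power2[of "a + b"] by (simp add: power2_eq_square algebra_simps)
      then show "AE x in lborel. norm ((f (x + h) - f x)\<^sup>2) \<le> norm (2 * (f x)\<^sup>2 + 2 * (f (x + h))\<^sup>2)"
        by (intro AE_I2) (smt (verit) real_norm_def zero_le_power2)
    qed auto
    have "(\<integral>x. (f x)\<^sup>2 \<partial>lborel) \<le> (\<integral>x. (f (x + h) - f x)\<^sup>2 + 2 * (\<bar>f x\<bar> * \<bar>f (x + h)\<bar>) \<partial>lborel)"
    proof (rule integral_mono)
      have "a\<^sup>2 \<le> (b - a)\<^sup>2 + 2 * (\<bar>a\<bar> * \<bar>b\<bar>)" for a b :: real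
      proof -
        have "a * b \<le> \<bar>a\<bar> * \<bar>b\<bar>" by (metis abs_ge_self abs_mult)
        moreover have "(b - a)\<^sup>2 = b\<^sup>2 - 2 * (a * b) + a\<^sup>2" by (simp add: power2_eq_square algebra_simps)
        ultimately show ?thesis using zero_le_power2[of b] by linarith
      qed
      then show "(f x)\<^sup>2 \<le> (f (x + h) - f x)\<^sup>2 + 2 * (\<bar>f x\<bar> * \<bar>f (x + h)\<bar>)" for x .
    qed (use int i3 i4 in auto)
    also have "\<dots> = (\<integral>x. (f (x + h) - f x)\<^sup>2 \<partial>lborel) + 2 * (\<integral>x. \<bar>f x\<bar> * \<bar>f (x + h)\<bar> \<partial>lborel)"
      using i3 i4 by simp
    also have "(\<integral>x. (f (x + h) - f x)\<^sup>2 \<partial>lborel) \<le> s\<^sup>2 * (\<integral>x. (norm (grad f x))\<^sup>2 \<partial>lborel)"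
      using that by (intro order_trans[OF test_functions_translate_L2[OF assms(1), of h]]
          mult_right_mono power_mono) (auto simp: less_imp_le)
    finally have "X \<le> (\<integral>x. 2 * (\<bar>f x\<bar> * \<bar>f (x + h)\<bar>) \<partial>lborel)" by (simp add: X_def)
    then show ?thesis
      using i3 by (subst nn_integral_eq_integral) (auto intro: ennreal_leI)
  qed
  have I: "(\<integral>\<^sup>+x. ennreal \<bar>f x\<bar> \<partial>lborel) = ennreal (\<integral>x. \<bar>f x\<bar> \<partial>lborel)"
    using int by (intro nn_integral_eq_integral) auto
  \<comment> \<open>\<open>X\<close> may be negative. Then \<open>ennreal X\<close> is 0, which does
    no harm: the upper bound reached at the end is nonnegative, so the comparison of real numbers
    can be recovered.\<close>
  have "ennreal X * emeasure lborel ?B = (\<integral>\<^sup>+h. ennreal X * indicator ?B h \<partial>lborel)"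
    by (simp add: nn_integral_cmult_indicator)
  also have "\<dots> \<le> (\<integral>\<^sup>+h. \<integral>\<^sup>+x. ennreal (2 * (\<bar>f x\<bar> * \<bar>f (x + h)\<bar>)) \<partial>lborel \<partial>lborel)"
    using X_le by (intro nn_integral_mono) (auto simp: indicator_def)
  also have "\<dots> = (\<integral>\<^sup>+x. \<integral>\<^sup>+h. ennreal (2 * (\<bar>f x\<bar> * \<bar>f (x + h)\<bar>)) \<partial>lborel \<partial>lborel)"
    using lborel_pair.Fubini[of "\<lambda>(x, h). ennreal (2 * (\<bar>f x\<bar> * \<bar>f (x + h)\<bar>))"] by simp
  also have "\<dots> = (\<integral>\<^sup>+x. ennreal (2 * \<bar>f x\<bar>) * (\<integral>\<^sup>+h. ennreal \<bar>f (h + x)\<bar> \<partial>lborel) \<partial>lborel)"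
    by (subst nn_integral_cmult[symmetric]) (auto simp: ennreal_mult'[symmetric] mult.assoc add.commute)
  also have "\<dots> = (\<integral>\<^sup>+x. ennreal 2 * ennreal \<bar>f x\<bar> * (\<integral>\<^sup>+h. ennreal \<bar>f h\<bar> \<partial>lborel) \<partial>lborel)"
    by (subst lborel_nn_integral_translate[of "\<lambda>h. ennreal \<bar>f h\<bar>"]) (auto simp: ennreal_mult')
  also have "\<dots> = ennreal 2 * ennreal (\<integral>x. \<bar>f x\<bar> \<partial>lborel) * ennreal (\<integral>x. \<bar>f x\<bar> \<partial>lborel)"
    by (simp only: I) (simp add: nn_integral_multc nn_integral_cmult I mult.assoc)
  also have "\<dots> = ennreal (2 * (\<integral>x. \<bar>f x\<bar> \<partial>lborel)\<^sup>2)"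
    by (simp add: power2_eq_square mult.assoc ennreal_mult del: ennreal_numeral)
  finally have "ennreal (X * measure lborel ?B) \<le> ennreal (2 * (\<integral>x. \<bar>f x\<bar> \<partial>lborel)\<^sup>2)"
    using B by (simp add: ennreal_mult'')
  then have "X * measure lborel ?B \<le> 2 * (\<integral>x. \<bar>f x\<bar> \<partial>lborel)\<^sup>2"
    by (simp add: ennreal_le_iff)
  then show ?thesis
    using B(2) by (simp add: X_def field_simps)
qed

subsection \<open>Cut-off functions\<close>

text \<open>A quadratic profile \<open>\<psi>\<close> is negative or zero outside the large ball and
  at least 2 on the small one. There \<open>soft\<close> of it is at least 1, and the map 1 - soft(1
  - z) / soft(1) saturates at 1 for such z. In the constant, 12 = 3 * 4: 1 / soft(1) is e \<le> 3,
  and the gradient of \<open>\<psi>\<close> is at most 4 R / d with d \<ge> (R - r) R.\<close>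

lemma cutoff_exists:
  fixes a :: "real^'n"
  assumes "0 < r" "r < R"
  obtains \<eta> where "smooth \<eta>" "\<And>x. 0 \<le> \<eta> x" "\<And>x. \<eta> x \<le> 1" "\<And>x. x \<in> cball a r \<Longrightarrow> \<eta> x = 1"
    "\<And>x. x \<notin> ball a R \<Longrightarrow> \<eta> x = 0" "\<And>x. norm (grad \<eta> x) \<le> 12 / (R - r)"
    "\<And>x. x \<notin> ball a R \<Longrightarrow> grad \<eta> x = 0"
proof -
  define d where "d = R\<^sup>2 - r\<^sup>2"
  define \<psi> where "\<psi> = (\<lambda>x. 2 * (R\<^sup>2 - (norm (x - a))\<^sup>2) / d)"
  define \<zeta> where "\<zeta> = (\<lambda>x. soft (\<psi> x))"
  define \<eta> where "\<eta> = (\<lambda>x. 1 - soft (1 - \<zeta> x) / soft 1)"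
  have "d = (R - r) * (R + r)"
    by (simp add: d_def power2_eq_square algebra_simps)
  then have d: "0 < d" "(R - r) * R \<le> d"
    using assms by (auto intro!: mult_pos_pos mult_left_mono)
  have s1: "0 < soft 1" by (simp add: soft_pos)
  have s\<psi>: "smooth \<psi>" unfolding \<psi>_def
    by (intro smooth_divide smooth_mult smooth_diff smooth_const smooth_norm_sq)
  then have s\<zeta>: "smooth \<zeta>" unfolding \<zeta>_def by (rule smooth_compose[OF real_smooth_soft])
  then have s\<eta>: "smooth \<eta>" unfolding \<eta>_def
    by (intro smooth_diff smooth_const smooth_divide smooth_compose[OF real_smooth_soft])
  have g\<psi>: "grad \<psi> x = - (4 / d) *\<^sub>R (x - a)" for x
  proof (rule grad_eqI)
    show "(\<psi> has_derivative (\<lambda>h. (- (4 / d) *\<^sub>R (x - a)) \<bullet> h)) (at x)"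
      unfolding \<psi>_def power2_norm_eq_inner using d
      by (auto intro!: derivative_eq_intros simp: inner_commute inner_diff_left inner_diff_right fun_eq_iff field_simps)
  qed
  have g\<zeta>: "grad \<zeta> x = soft' (\<psi> x) *\<^sub>R grad \<psi> x" for x
    unfolding \<zeta>_def by (rule grad_compose(1)[OF soft_DERIV smooth_differentiable[OF s\<psi>]])
  have D: "((\<lambda>t. 1 - soft (1 - t) / soft 1) has_real_derivative soft' (1 - t) / soft 1) (at t)" for t
    using s1 by (auto intro!: derivative_eq_intros DERIV_chain2[OF soft_DERIV])
  have g\<eta>: "grad \<eta> x = (soft' (1 - \<zeta> x) / soft 1) *\<^sub>R grad \<zeta> x" for x
    unfolding \<eta>_def by (rule grad_compose(1)[OF D smooth_differentiable[OF s\<zeta>]])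
  have out: "\<psi> x \<le> 0" if "x \<notin> ball a R" for x
  proof -
    have "R\<^sup>2 \<le> (norm (x - a))\<^sup>2" using that assms by (intro power_mono) (auto simp: dist_norm norm_minus_commute)
    then show ?thesis using d by (simp add: \<psi>_def divide_le_0_iff)
  qed
  show ?thesis
  proof (rule that[of \<eta>])
    show "smooth \<eta>" by fact
    have c0: "0 \<le> \<zeta> x" for x by (simp add: \<zeta>_def soft_nonneg)
    then show "0 \<le> \<eta> x" for x
      using soft_mono[of "1 - \<zeta> x" 1] s1 by (simp add: \<eta>_def)
    show "\<eta> x \<le> 1" for x using s1 soft_nonneg by (simp add: \<eta>_def)
    show "\<eta> x = 1" if "x \<in> cball a r" for x
    proof -
      have "(norm (x - a))\<^sup>2 \<le> r\<^sup>2" using that assms by (intro power_mono) (auto simp: dist_norm norm_minus_commute)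
      then have "2 \<le> \<psi> x" using d by (simp add: \<psi>_def d_def le_divide_eq)
      then have "1 \<le> \<zeta> x" using soft_ge[of "\<psi> x"] by (simp add: \<zeta>_def)
      then show ?thesis by (simp add: \<eta>_def soft_eq_0_iff)
    qed
    show "\<eta> x = 0" if "x \<notin> ball a R" for x
      using out[OF that] s1 by (simp add: \<eta>_def \<zeta>_def soft_eq_0_iff[THEN iffD2])
    show go: "grad \<eta> x = 0" if "x \<notin> ball a R" for x
      using out[OF that] by (simp add: g\<eta> g\<zeta> soft'_def)
    show "norm (grad \<eta> x) \<le> 12 / (R - r)" for x
    proof (cases "x \<in> ball a R")
      case True
      have "exp (1::real) \<le> 3" by (rule exp_le)
      then have e: "1 / soft 1 \<le> 3" by (simp add: soft_def exp_minus divide_inverse)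
      have "norm (grad \<eta> x) = soft' (1 - \<zeta> x) * (1 / soft 1) * (soft' (\<psi> x) * ((4 / d) * norm (x - a)))"
        using s1 d soft'_nonneg by (simp add: g\<eta> g\<zeta> g\<psi> abs_mult)
      also have "\<dots> \<le> 1 * 3 * (1 * ((4 / d) * R))"
        using s1 d e True soft'_nonneg soft'_le_1
        by (intro mult_mono) (auto simp: dist_norm norm_minus_commute)
      also have "\<dots> = 12 * R / d" by simp
      also have "\<dots> \<le> 12 * R / ((R - r) * R)"
        using d assms by (intro divide_left_mono) auto
      also have "\<dots> = 12 / (R - r)" using assms by simp
      finally show ?thesis .
    qed (use assms in \<open>simp add: go\<close>)
  qed
qed

text \<open>Finitely many ball cut-offs cover \<open>K\<close> by compactness. Their sum is at least
  1 on \<open>K\<close> but may exceed 1, so it is passed through the saturating map of the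
  preceding construction.\<close>

lemma smooth_Urysohn:
  fixes K :: "(real^'n) set"
  assumes "compact K" "open W" "K \<subseteq> W"
  obtains \<phi> where "\<phi> \<in> test_functions W" "\<And>x. 0 \<le> \<phi> x" "\<And>x. \<phi> x \<le> 1" "\<And>x. x \<in> K \<Longrightarrow> \<phi> x = 1"
proof -
  have "\<exists>r>0. cball x (2 * r) \<subseteq> W" if "x \<in> K" for x
  proof -
    have "x \<in> W" using that assms(3) by auto
    then obtain e where "e > 0" "cball x e \<subseteq> W"
      using open_contains_cball_eq[OF assms(2)] by auto
    then show ?thesis by (intro exI[of _ "e / 2"]) auto
  qed
  then obtain r where r: "\<And>x. x \<in> K \<Longrightarrow> r x > 0" "\<And>x. x \<in> K \<Longrightarrow> cball x (2 * r x) \<subseteq> W" by metis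
  have "\<exists>\<eta>. \<eta> \<in> test_functions W \<and> (\<forall>y. 0 \<le> \<eta> y) \<and> (\<forall>y\<in>ball x (r x). \<eta> y = 1)" if x: "x \<in> K" for x
  proof -
    have "0 < r x" "r x < 2 * r x" using r(1)[OF x] by auto
    then obtain \<eta> where \<eta>: "smooth \<eta>" "\<And>y. 0 \<le> \<eta> y" "\<And>y. y \<in> cball x (r x) \<Longrightarrow> \<eta> y = 1"
      "\<And>y. y \<notin> ball x (2 * r x) \<Longrightarrow> \<eta> y = 0"
      by (rule cutoff_exists[of _ _ x]) blast
    moreover have "\<eta> \<in> test_functions W"
      using \<eta> r(2)[OF x] by (intro test_functionsI[of _ "cball x (2 * r x)"]) auto
    ultimately show ?thesis by (intro exI[of _ \<eta>]) auto
  qed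
  then have "\<forall>x\<in>K. \<exists>\<eta>. \<eta> \<in> test_functions W \<and> (\<forall>y. 0 \<le> \<eta> y) \<and> (\<forall>y\<in>ball x (r x). \<eta> y = 1)"
    by blast
  then obtain \<eta> where "\<forall>x\<in>K. \<eta> x \<in> test_functions W \<and> (\<forall>y. 0 \<le> \<eta> x y) \<and> (\<forall>y\<in>ball x (r x). \<eta> x y = 1)"
    by (rule bchoice[THEN exE])
  then have \<eta>: "\<And>x. x \<in> K \<Longrightarrow> \<eta> x \<in> test_functions W" "\<And>x y. x \<in> K \<Longrightarrow> 0 \<le> \<eta> x y"
      "\<And>x y. x \<in> K \<Longrightarrow> y \<in> ball x (r x) \<Longrightarrow> \<eta> x y = 1" by blast+
  have "K \<subseteq> (\<Union>x\<in>K. ball x (r x))" using r(1) by fastforce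
  then obtain C where C: "C \<subseteq> K" "finite C" "K \<subseteq> (\<Union>x\<in>C. ball x (r x))"
    by (rule compactE_image[OF assms(1) open_ball]) blast
  define S where "S = (\<lambda>y. \<Sum>x\<in>C. \<eta> x y)"
  have S: "S \<in> test_functions W"
    unfolding S_def using C(2,1)
    by (induction C rule: finite_induct) (auto intro: test_functions_zero test_functions_add \<eta>)
  have S0: "0 \<le> S y" for y unfolding S_def using C \<eta> by (auto intro!: sum_nonneg)
  have S1: "1 \<le> S y" if y: "y \<in> K" for y
  proof -
    obtain x where x: "x \<in> C" "y \<in> ball x (r x)" using C(3) y by blast
    then have "\<eta> x y \<le> S y" unfolding S_def using C \<eta> by (intro member_le_sum) auto
    then show ?thesis using \<eta>(3) x C by fastforce
  qed
  have s1: "0 < soft 1" by (simp add: soft_pos)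
  define \<phi> where "\<phi> = (\<lambda>x. 1 - soft (1 - S x) / soft 1)"
  show ?thesis
  proof (rule that[of \<phi>])
    obtain L where L: "compact L" "L \<subseteq> W" "\<And>x. x \<notin> L \<Longrightarrow> S x = 0" using S test_functionsE by metis
    have "smooth \<phi>" unfolding \<phi>_def
      by (intro smooth_diff smooth_const smooth_divide smooth_compose[OF real_smooth_soft] test_functions_smooth[OF S])
    then show "\<phi> \<in> test_functions W"
      using L s1 by (intro test_functionsI[of _ L]) (auto simp: \<phi>_def)
    show "0 \<le> \<phi> x" "\<phi> x \<le> 1" for x
      using s1 soft_nonneg soft_mono[of "1 - S x" 1] S0[of x] by (auto simp: \<phi>_def)
    show "\<phi> x = 1" if "x \<in> K" for x
      using S1[OF that] by (simp add: \<phi>_def soft_eq_0_iff)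
  qed
qed

section \<open>Square-integrable functions\<close>

lemma sq_norm_add_le: "(norm (a + b))\<^sup>2 \<le> 2 * (norm a)\<^sup>2 + 2 * (norm (b::'a::real_normed_vector))\<^sup>2"
proof -
  have "(norm (a + b))\<^sup>2 \<le> (norm a + norm b)\<^sup>2"
    by (intro power_mono norm_triangle_ineq) auto
  also have "\<dots> \<le> 2 * (norm a)\<^sup>2 + 2 * (norm b)\<^sup>2"
    using zero_le_power2[of "norm a - norm b"] by (simp add: power2_eq_square algebra_simps)
  finally show ?thesis .
qed

lemma sq_norm_diff_le: "(norm (a - b))\<^sup>2 \<le> 2 * (norm a)\<^sup>2 + 2 * (norm (b::'a::real_normed_vector))\<^sup>2"
  using sq_norm_add_le[of a "- b"] by simp

lemma sq_integrable_diff: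
  fixes f g :: "'a \<Rightarrow> 'b::euclidean_space"
  assumes [measurable]: "f \<in> borel_measurable M" "g \<in> borel_measurable M"
    and "integrable M (\<lambda>x. (norm (f x))\<^sup>2)" "integrable M (\<lambda>x. (norm (g x))\<^sup>2)"
  shows "integrable M (\<lambda>x. (norm (f x - g x))\<^sup>2)"
  by (rule Bochner_Integration.integrable_bound[of _ "\<lambda>x. 2 * (norm (f x))\<^sup>2 + 2 * (norm (g x))\<^sup>2"])
    (use assms sq_norm_diff_le in auto)

lemma sq_integrable_add:
  fixes f g :: "'a \<Rightarrow> 'b::euclidean_space"
  assumes [measurable]: "f \<in> borel_measurable M" "g \<in> borel_measurable M"
    and "integrable M (\<lambda>x. (norm (f x))\<^sup>2)" "integrable M (\<lambda>x. (norm (g x))\<^sup>2)"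
  shows "integrable M (\<lambda>x. (norm (f x + g x))\<^sup>2)"
  by (rule Bochner_Integration.integrable_bound[of _ "\<lambda>x. 2 * (norm (f x))\<^sup>2 + 2 * (norm (g x))\<^sup>2"])
    (use assms sq_norm_add_le in auto)

lemma norm_mult_norm_le: "norm a * norm b \<le> (norm a)\<^sup>2 + (norm b)\<^sup>2"
proof -
  have "2 * norm a * norm b \<le> (norm a)\<^sup>2 + (norm b)\<^sup>2" by (rule sum_squares_bound)
  moreover have "0 \<le> norm a * norm b" by simp
  ultimately show ?thesis by linarith
qed

lemma sq_integrable_inner:
  fixes f g :: "'a \<Rightarrow> 'b::euclidean_space"
  assumes [measurable]: "f \<in> borel_measurable M" "g \<in> borel_measurable M"
    and "integrable M (\<lambda>x. (norm (f x))\<^sup>2)" "integrable M (\<lambda>x. (norm (g x))\<^sup>2)"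
  shows "integrable M (\<lambda>x. f x \<bullet> g x)" "integrable M (\<lambda>x. norm (f x) * norm (g x))"
proof -
  have i: "integrable M (\<lambda>x. (norm (f x))\<^sup>2 + (norm (g x))\<^sup>2)" using assms by simp
  have b: "norm (f x \<bullet> g x) \<le> norm ((norm (f x))\<^sup>2 + (norm (g x))\<^sup>2)" for x
    using order_trans[OF Cauchy_Schwarz_ineq2[of "f x" "g x"] norm_mult_norm_le] by simp
  show "integrable M (\<lambda>x. f x \<bullet> g x)"
    by (rule Bochner_Integration.integrable_bound[OF i]) (use b in auto)
  show "integrable M (\<lambda>x. norm (f x) * norm (g x))"
    by (rule Bochner_Integration.integrable_bound[OF i]) (use norm_mult_norm_le in auto)
qed

lemma integral_Cauchy_Schwarz:
  fixes f g :: "'a \<Rightarrow> 'b::euclidean_space"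
  assumes [measurable]: "f \<in> borel_measurable M" "g \<in> borel_measurable M"
    and i: "integrable M (\<lambda>x. (norm (f x))\<^sup>2)" "integrable M (\<lambda>x. (norm (g x))\<^sup>2)"
  shows "\<bar>\<integral>x. f x \<bullet> g x \<partial>M\<bar> \<le> sqrt (\<integral>x. (norm (f x))\<^sup>2 \<partial>M) * sqrt (\<integral>x. (norm (g x))\<^sup>2 \<partial>M)"
proof -
  let ?a = "\<integral>x. (norm (f x))\<^sup>2 \<partial>M" and ?b = "\<integral>x. (norm (g x))\<^sup>2 \<partial>M"
  define I where "I = (\<integral>x. f x \<bullet> g x \<partial>M)"
  have ab: "0 \<le> ?a" "0 \<le> ?b" by auto
  note [simp] = sq_integrable_inner(1)[OF assms]
  have q: "0 \<le> t\<^sup>2 * ?a - 2 * t * I + ?b" for t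
  proof -
    have "0 \<le> (\<integral>x. (norm (t *\<^sub>R f x - g x))\<^sup>2 \<partial>M)" by simp
    also have "\<dots> = (\<integral>x. t\<^sup>2 * (norm (f x))\<^sup>2 - 2 * t * (f x \<bullet> g x) + (norm (g x))\<^sup>2 \<partial>M)"
      by (intro Bochner_Integration.integral_cong refl, unfold power2_norm_eq_inner)
        (simp add: inner_diff_left inner_diff_right inner_commute power2_eq_square algebra_simps)
    also have "\<dots> = t\<^sup>2 * ?a - 2 * t * I + ?b"
      using i by (simp add: I_def)
    finally show ?thesis .
  qed
  have "I\<^sup>2 \<le> ?a * ?b"
  proof (cases "?a = 0")
    case True
    have "I = 0"
    proof (rule ccontr)
      assume "I \<noteq> 0"
      then show False using q[of "(?b + 1) / (2 * I)"] True by simp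
    qed
    then show ?thesis using ab by simp
  next
    case False
    then have a: "0 < ?a" using ab(1) by linarith
    have "0 \<le> (I / ?a)\<^sup>2 * ?a - 2 * (I / ?a) * I + ?b" by (rule q)
    also have "\<dots> = ?b - I\<^sup>2 / ?a" using a by (simp add: field_simps power2_eq_square)
    finally show ?thesis using a by (simp add: field_simps)
  qed
  then have "sqrt (I\<^sup>2) \<le> sqrt (?a * ?b)" by (rule real_sqrt_le_mono)
  then show ?thesis by (simp add: I_def real_sqrt_mult)
qed

text \<open>The integral of the whole series is finite, hence so is the series almost everywhere.
  This is how fast convergence in norm becomes pointwise convergence, for Lebesgue measure and later
  for the measures of the equation.\<close>

lemma AE_summable_of_geometric_bound:
  fixes f :: "nat \<Rightarrow> 'a \<Rightarrow> real"
  assumes [measurable]: "\<And>n. f n \<in> borel_measurable M" and "\<And>n x. 0 \<le> f n x"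
    and "\<And>n. (\<integral>\<^sup>+x. ennreal (f n x) \<partial>M) \<le> ennreal (C * (1/2)^n)" and "0 \<le> C"
  shows "AE x in M. summable (\<lambda>n. f n x)"
proof -
  have "(\<integral>\<^sup>+x. (\<Sum>n. ennreal (f n x)) \<partial>M) = (\<Sum>n. \<integral>\<^sup>+x. ennreal (f n x) \<partial>M)"
    by (rule nn_integral_suminf) auto
  also have "\<dots> \<le> (\<Sum>n. ennreal (C * (1/2)^n))"
    using assms(3) by (intro suminf_le) auto
  also have "\<dots> = ennreal (\<Sum>n. C * (1/2)^n)"
    using assms(4) by (intro suminf_ennreal2 summable_mult summable_geometric) auto
  finally have "(\<integral>\<^sup>+x. (\<Sum>n. ennreal (f n x)) \<partial>M) \<noteq> \<infinity>"
    by (auto simp: top_unique)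
  then have "AE x in M. (\<Sum>n. ennreal (f n x)) \<noteq> \<infinity>"
    by (intro nn_integral_PInf_AE) auto
  then show ?thesis
    by eventually_elim (use assms(2) in \<open>auto intro: summable_suminf_not_top\<close>)
qed

section \<open>Weak gradients\<close>

lemma lebesgue_on_integral:
  fixes F :: "'a::euclidean_space \<Rightarrow> 'b::{banach, second_countable_topology}"
  assumes "\<Omega> \<in> sets borel" "F \<in> borel_measurable borel" "\<And>x. x \<notin> \<Omega> \<Longrightarrow> F x = 0"
  shows "integral\<^sup>L (lebesgue_on \<Omega>) F = integral\<^sup>L lborel F"
    and "integrable (lebesgue_on \<Omega>) F \<longleftrightarrow> integrable lborel F"
proof -
  have 1: "(\<lambda>x. indicator \<Omega> x *\<^sub>R F x) = F" using assms(3) by (auto simp: indicator_def)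
  have 2: "\<Omega> \<inter> space lebesgue \<in> sets lebesgue" using assms(1) by (simp add: sets_completionI_sets)
  show "integral\<^sup>L (lebesgue_on \<Omega>) F = integral\<^sup>L lborel F"
    using assms(2) by (simp add: integral_restrict_space[OF 2] 1 integral_completion)
  show "integrable (lebesgue_on \<Omega>) F \<longleftrightarrow> integrable lborel F"
    using assms(2) by (simp add: integrable_restrict_space[OF 2] 1 integrable_completion)
qed

lemma AE_lebesgue_on:
  assumes "\<Omega> \<in> sets borel"
  shows "(AE x in lebesgue_on \<Omega>. Q x) \<longleftrightarrow> (AE x in lborel. x \<in> \<Omega> \<longrightarrow> Q x)"
proof -
  have "\<Omega> \<inter> space lebesgue \<in> sets lebesgue" using assms by (simp add: sets_completionI_sets)
  then show ?thesis by (simp add: AE_restrict_space_iff AE_completion_iff)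
qed

text \<open>The positive and negative parts of \<open>f\<close> are densities of finite measures
  that agree on open sets, a generator stable under intersection. The measures coincide, so by
  uniqueness of densities the two parts agree almost everywhere, and they can only agree where both
  vanish.\<close>

lemma AE_zero_if_open_integrals_zero:
  fixes f :: "'a::euclidean_space \<Rightarrow> real"
  assumes int: "integrable lborel f"
    and zero: "\<And>W. open W \<Longrightarrow> (\<integral>x. indicator W x * f x \<partial>lborel) = 0"
  shows "AE x in lborel. f x = 0"
proof -
  have [measurable]: "f \<in> borel_measurable borel" using int by auto
  define M where "M = density lborel (\<lambda>x. ennreal (f x))"
  define N where "N = density lborel (\<lambda>x. ennreal (- f x))"
  have eq: "emeasure M W = emeasure N W" "emeasure M W \<noteq> \<infinity>" if "open W" for W
  proof -
    have [measurable]: "W \<in> sets borel" using that by simp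
    have e: "ennreal (g x) * indicator W x = ennreal (indicator W x * max 0 (g x))" for g :: "'a \<Rightarrow> real" and x
      by (auto simp: indicator_def max_def ennreal_neg)
    have i: "integrable lborel (\<lambda>x. indicator W x * max 0 (f x))" "integrable lborel (\<lambda>x. indicator W x * max 0 (- f x))"
      by (rule Bochner_Integration.integrable_bound[OF int]; auto simp: indicator_def)+
    have eM: "emeasure M W = ennreal (\<integral>x. indicator W x * max 0 (f x) \<partial>lborel)"
      unfolding M_def using i by (simp add: emeasure_density e nn_integral_eq_integral)
    have eN: "emeasure N W = ennreal (\<integral>x. indicator W x * max 0 (- f x) \<partial>lborel)"
      unfolding N_def using i by (simp add: emeasure_density e[of "\<lambda>x. - f x"] nn_integral_eq_integral)
    have p: "indicator W x * max 0 (f x) - indicator W x * max 0 (- f x) = indicator W x * f x" for x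
      by (auto simp: max_def indicator_def)
    have "(\<integral>x. indicator W x * max 0 (f x) \<partial>lborel) - (\<integral>x. indicator W x * max 0 (- f x) \<partial>lborel)
        = (\<integral>x. indicator W x * f x \<partial>lborel)"
      using i by (simp only: Bochner_Integration.integral_diff[symmetric] p)
    then show "emeasure M W = emeasure N W" "emeasure M W \<noteq> \<infinity>"
      using zero[OF that] eM eN by auto
  qed
  have "M = N"
  proof (rule measure_eqI_generator_eq[where E = "Collect open" and \<Omega> = UNIV and A = "\<lambda>_. UNIV"])
    show "Int_stable (Collect open :: 'a set set)" by (auto simp: Int_stable_def)
    show "sets M = sigma_sets UNIV (Collect open)" "sets N = sigma_sets UNIV (Collect open)"
      by (simp_all add: M_def N_def borel_def)
  qed (use eq in auto)
  then have "AE x in lborel. ennreal (f x) = ennreal (- f x)"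
    unfolding M_def N_def
    by (subst (asm) sigma_finite_measure.density_unique_iff[OF sigma_finite_lborel]) auto
  then show ?thesis
    by eventually_elim (metis ennreal_eq_0_iff ennreal_neg linorder_linear neg_le_0_iff_le order_antisym)
qed

text \<open>The fundamental lemma of the calculus of variations. On the interior of a compact set of
  an exhaustion \<open>f\<close> is integrable, and indicators of open subsets are limits of smooth
  Urysohn functions bounded by 1, so dominated convergence reduces the claim to the previous
  lemma.\<close>

lemma AE_zero_if_test_integrals_zero:
  fixes f :: "real^'n \<Rightarrow> real"
  assumes \<Omega>: "open \<Omega>" and f: "f \<in> L1_loc \<Omega>"
    and zero: "\<And>\<phi>. \<phi> \<in> test_functions \<Omega> \<Longrightarrow> (\<integral>x. f x * \<phi> x \<partial>(lebesgue_on \<Omega>)) = 0"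
  shows "AE x in lebesgue_on \<Omega>. f x = 0"
proof -
  obtain C where C: "\<And>n. compact (C n)" "\<And>n. C n \<subseteq> \<Omega>" "\<And>n. C n \<subseteq> interior (C (Suc n))" "\<Union>(range C) = \<Omega>"
    using open_Union_compact_subsets[OF \<Omega>] by metis
  have \<Omega>s: "\<Omega> \<inter> space lebesgue \<in> sets lebesgue" using \<Omega> by (simp add: borel_open sets_completionI_sets)
  have main: "AE x in lborel. x \<in> interior (C m) \<longrightarrow> f x = 0" for m
  proof -
    define V where "V = interior (C m)"
    have V: "open V" "V \<subseteq> C m" "V \<subseteq> \<Omega>" using C(2) interior_subset by (auto simp: V_def)
    have Cs: "C m \<inter> space lebesgue \<in> sets lebesgue"
      using C(1)[of m] by (simp add: borel_compact sets_completionI_sets)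
    have "integrable (lebesgue_on (C m)) f" using f C by (auto simp: L1_loc_def)
    then have "integrable lebesgue (\<lambda>x. indicator (C m) x *\<^sub>R f x)"
      by (simp add: integrable_restrict_space[OF Cs])
    then have iF: "integrable lebesgue (\<lambda>x. indicator V x *\<^sub>R (indicator (C m) x *\<^sub>R f x))"
      by (rule integrable_mult_indicator[rotated]) (use V(1) in \<open>simp add: sets_completionI_sets\<close>)
    define F where "F = (\<lambda>x. indicator V x * f x)"
    have "(\<lambda>x. indicator V x *\<^sub>R (indicator (C m) x *\<^sub>R f x)) = F"
      using V(2) by (auto simp: F_def indicator_def fun_eq_iff)
    with iF have iF: "integrable lebesgue F" by simp
    \<comment> \<open>\<open>f\<close> is only measurable for the completed measure, while the
      argument with densities runs over \<open>lborel\<close>; \<open>G\<close> is a Borel version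
      of the localized function.\<close>
    obtain G where G [measurable]: "G \<in> borel_measurable lborel" and FG: "AE x in lborel. F x = G x"
      using completion_ex_borel_measurable_real[of F lborel] iF by auto
    have FG': "AE x in lebesgue. F x = G x" using FG by (simp add: AE_completion)
    have Gl [measurable]: "G \<in> borel_measurable lebesgue" using G by (simp add: measurable_completion)
    have iG: "integrable lborel G"
    proof -
      have "integrable lebesgue G"
        using iF FG' Gl integrable_cong_AE_imp[OF iF Gl] by (auto simp: eq_commute)
      then show ?thesis using G by (simp add: integrable_completion)
    qed
    have G0: "AE x in lborel. x \<notin> V \<longrightarrow> G x = 0" using FG by eventually_elim (auto simp: F_def)
    have test0: "(\<integral>x. \<phi> x * G x \<partial>lborel) = 0" if \<phi>: "\<phi> \<in> test_functions V" for \<phi>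
    proof -
      have [measurable]: "\<phi> \<in> borel_measurable borel" using test_functions_borel[OF \<phi>] .
      have \<phi>l [measurable]: "\<phi> \<in> borel_measurable lebesgue" by (simp add: measurable_completion)
      have "0 = (\<integral>x. f x * \<phi> x \<partial>(lebesgue_on \<Omega>))"
        using zero[OF test_functions_mono[OF V(3) \<phi>]] by simp
      also have "\<dots> = (\<integral>x. indicator \<Omega> x *\<^sub>R (f x * \<phi> x) \<partial>lebesgue)"
        by (rule integral_restrict_space[OF \<Omega>s])
      also have "(\<lambda>x. indicator \<Omega> x *\<^sub>R (f x * \<phi> x)) = (\<lambda>x. \<phi> x * F x)"
        using test_functions_outside(1)[OF \<phi>] V(3) by (auto simp: F_def indicator_def fun_eq_iff)
      also have "(\<integral>x. \<phi> x * F x \<partial>lebesgue) = (\<integral>x. \<phi> x * G x \<partial>lebesgue)"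
        using FG' iF by (intro integral_cong_AE) auto
      also have "\<dots> = (\<integral>x. \<phi> x * G x \<partial>lborel)" by (simp add: integral_completion)
      finally show ?thesis by simp
    qed
    have "AE x in lborel. G x = 0"
    proof (rule AE_zero_if_open_integrals_zero[OF iG])
      fix W :: "(real^'n) set" assume W: "open W"
      have [measurable]: "W \<inter> V \<in> sets borel" "W \<in> sets borel" using W V(1) by auto
      obtain D where D: "\<And>n. compact (D n)" "\<And>n. D n \<subseteq> W \<inter> V" "\<Union>(range D) = W \<inter> V"
        "\<And>n. D n \<subseteq> interior (D (Suc n))"
        using open_Union_compact_subsets[of "W \<inter> V"] W V(1) by (metis open_Int)
      have "\<exists>\<phi>. \<phi> \<in> test_functions (W \<inter> V) \<and> (\<forall>x. 0 \<le> \<phi> x \<and> \<phi> x \<le> 1) \<and> (\<forall>x\<in>D n. \<phi> x = 1)" for n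
        by (rule smooth_Urysohn[OF D(1) _ D(2)]) (use W V in auto)
      then obtain \<phi> where \<phi>: "\<And>n. \<phi> n \<in> test_functions (W \<inter> V)" "\<And>n x. 0 \<le> \<phi> n x" "\<And>n x. \<phi> n x \<le> 1"
        "\<And>n x. x \<in> D n \<Longrightarrow> \<phi> n x = 1" by metis
      have [measurable]: "\<phi> n \<in> borel_measurable borel" for n using \<phi>(1) test_functions_borel by blast
      have mono: "D n \<subseteq> D k" if "n \<le> k" for n k
        using lift_Suc_mono_le[of D, OF _ that] D(4) interior_subset by (meson order_trans)
      have lim: "(\<lambda>n. \<phi> n x) \<longlonglongrightarrow> indicator (W \<inter> V) x" for x
      proof (cases "x \<in> W \<inter> V")
        case True
        then obtain k where "x \<in> D k" using D(3) by blast
        then have "\<forall>n\<ge>k. x \<in> D n" using mono by blast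
        then have "\<forall>\<^sub>F n in sequentially. \<phi> n x = indicator (W \<inter> V) x"
          using \<phi>(4) True by (auto simp: eventually_sequentially intro!: exI[of _ k])
        then show ?thesis by (rule tendsto_eventually)
      next
        case False
        then show ?thesis using test_functions_outside(1)[OF \<phi>(1)] by simp
      qed
      have "(\<lambda>n. \<integral>x. \<phi> n x * G x \<partial>lborel) \<longlonglongrightarrow> (\<integral>x. indicator (W \<inter> V) x * G x \<partial>lborel)"
      proof (rule integral_dominated_convergence)
        show "integrable lborel (\<lambda>x. norm (G x))" using iG by simp
        show "AE x in lborel. norm (\<phi> n x * G x) \<le> norm (G x)" for n
          using \<phi>(2,3) by (auto simp: abs_mult intro!: mult_left_le_one_le)
        show "AE x in lborel. (\<lambda>n. \<phi> n x * G x) \<longlonglongrightarrow> indicator (W \<inter> V) x * G x"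
          using lim by (auto intro!: tendsto_intros)
      qed (use W V in auto)
      moreover have "(\<integral>x. \<phi> n x * G x \<partial>lborel) = 0" for n
        using test0 test_functions_mono[OF _ \<phi>(1)] by blast
      ultimately have "(\<integral>x. indicator (W \<inter> V) x * G x \<partial>lborel) = 0"
        by (simp add: LIMSEQ_const_iff)
      also have "(\<integral>x. indicator (W \<inter> V) x * G x \<partial>lborel) = (\<integral>x. indicator W x * G x \<partial>lborel)"
      proof (rule integral_cong_AE)
        show "AE x in lborel. indicator (W \<inter> V) x * G x = indicator W x * G x"
          using G0 by eventually_elim (auto simp: indicator_def)
      qed auto
      finally show "(\<integral>x. indicator W x * G x \<partial>lborel) = 0" .
    qed
    with FG show ?thesis
      by eventually_elim (auto simp: F_def V_def)
  qed
  have "AE x in lborel. \<forall>m. x \<in> interior (C m) \<longrightarrow> f x = 0"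
    using main by (subst AE_all_countable) blast
  then have "AE x in lborel. x \<in> \<Omega> \<longrightarrow> f x = 0"
  proof eventually_elim
    case (elim x)
    then show ?case using C(3,4) by blast
  qed
  then show ?thesis using \<Omega> by (simp add: AE_lebesgue_on)
qed

lemma L1_loc_mult_test:
  fixes g :: "real^'n \<Rightarrow> real"
  assumes "open \<Omega>" "g \<in> L1_loc \<Omega>" "\<phi> \<in> test_functions \<Omega>"
  shows "integrable (lebesgue_on \<Omega>) (\<lambda>x. g x * \<phi> x)"
proof -
  obtain K where K: "compact K" "K \<subseteq> \<Omega>" "\<And>x. x \<notin> K \<Longrightarrow> \<phi> x = 0"
    using assms(3) test_functionsE by metis
  obtain M where M: "\<And>x. norm (\<phi> x) \<le> M"
    using compact_support_bounded[OF test_functions_continuous[OF assms(3)] K(1,3)] by metis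
  have Ks: "K \<inter> space lebesgue \<in> sets lebesgue" and \<Omega>s: "\<Omega> \<inter> space lebesgue \<in> sets lebesgue"
    using K(1) assms(1) by (simp_all add: borel_compact borel_open sets_completionI_sets)
  have i: "integrable (lebesgue_on K) g" using assms K by (auto simp: L1_loc_def)
  have \<phi>m: "\<phi> \<in> borel_measurable (lebesgue_on K)"
    using test_functions_borel[OF assms(3)]
    by (intro measurable_restrict_space1 measurable_completion) auto
  have "integrable (lebesgue_on K) (\<lambda>x. g x * \<phi> x)"
  proof (rule Bochner_Integration.integrable_bound)
    show "integrable (lebesgue_on K) (\<lambda>x. M * (g x))" using i by simp
    show "(\<lambda>x. g x * \<phi> x) \<in> borel_measurable (lebesgue_on K)"
      using i \<phi>m by (intro borel_measurable_times) auto
    show "AE x in lebesgue_on K. norm (g x * \<phi> x) \<le> norm (M * (g x))"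
    proof (rule AE_I2)
      fix x
      have "\<bar>\<phi> x\<bar> \<le> \<bar>M\<bar>" using M[of x] by simp
      then show "norm (g x * \<phi> x) \<le> norm (M * (g x))"
        by (simp add: abs_mult mult.commute mult_right_mono)
    qed
  qed
  moreover have "(\<lambda>x. indicator K x *\<^sub>R (g x * \<phi> x)) = (\<lambda>x. indicator \<Omega> x *\<^sub>R (g x * \<phi> x))"
    using K by (auto simp: indicator_def fun_eq_iff)
  ultimately show ?thesis
    by (simp add: integrable_restrict_space[OF Ks] integrable_restrict_space[OF \<Omega>s])
qed

lemma L1_loc_nth: "g \<in> L1_loc \<Omega> \<Longrightarrow> (\<lambda>x. g x $ i) \<in> L1_loc \<Omega>"
  by (auto simp: L1_loc_def intro!: integrable_bounded_linear[OF bounded_linear_vec_nth])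

lemma L1_loc_diff: "f \<in> L1_loc \<Omega> \<Longrightarrow> g \<in> L1_loc \<Omega> \<Longrightarrow> (\<lambda>x. f x - g x) \<in> L1_loc \<Omega>"
  by (auto simp: L1_loc_def)

lemma L1_loc_measurable:
  fixes f :: "real^'n \<Rightarrow> 'b::euclidean_space"
  assumes "open \<Omega>" "f \<in> L1_loc \<Omega>"
  shows "f \<in> borel_measurable (lebesgue_on \<Omega>)"
proof -
  obtain C where C: "\<And>n. compact (C n)" "\<And>n. C n \<subseteq> \<Omega>" "\<And>n. C n \<subseteq> interior (C (Suc n))" "\<Union>(range C) = \<Omega>"
    using open_Union_compact_subsets[OF assms(1)] by metis
  have mono: "C n \<subseteq> C k" if "n \<le> k" for n k
    using lift_Suc_mono_le[of C, OF _ that] C(3) interior_subset by (meson order_trans)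
  have \<Omega>s: "\<Omega> \<inter> space lebesgue \<in> sets lebesgue" using assms(1) by (simp add: borel_open sets_completionI_sets)
  have m: "(\<lambda>x. indicator (C n) x *\<^sub>R f x) \<in> borel_measurable lebesgue" for n
  proof -
    have Cs: "C n \<inter> space lebesgue \<in> sets lebesgue"
      using C(1)[of n] by (simp add: borel_compact sets_completionI_sets)
    have "integrable (lebesgue_on (C n)) f" using assms C by (auto simp: L1_loc_def)
    then show ?thesis
      by (simp add: integrable_restrict_space[OF Cs])
  qed
  have "(\<lambda>x. indicator \<Omega> x *\<^sub>R f x) \<in> borel_measurable lebesgue"
  proof (rule borel_measurable_LIMSEQ_metric[OF m])
    fix x
    show "(\<lambda>n. indicator (C n) x *\<^sub>R f x) \<longlonglongrightarrow> indicator \<Omega> x *\<^sub>R f x"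
    proof (cases "x \<in> \<Omega>")
      case True
      then obtain k where "x \<in> C k" using C(4) by blast
      then have "\<forall>\<^sub>F n in sequentially. indicator (C n) x *\<^sub>R f x = indicator \<Omega> x *\<^sub>R f x"
        using mono True by (auto simp: eventually_sequentially indicator_def intro!: exI[of _ k])
      then show ?thesis by (rule tendsto_eventually)
    next
      case False
      then have "x \<notin> C n" for n using C(2) by blast
      with False show ?thesis by simp
    qed
  qed
  then show ?thesis by (simp add: borel_measurable_restrict_space_iff[OF \<Omega>s])
qed

lemma is_weak_gradient_unique:
  fixes u :: "real^'n \<Rightarrow> real"
  assumes "open \<Omega>" "is_weak_gradient \<Omega> u g" "is_weak_gradient \<Omega> u g'"
  shows "AE x in lebesgue_on \<Omega>. g x = g' x"
proof -
  have L: "g \<in> L1_loc \<Omega>" "g' \<in> L1_loc \<Omega>" using assms by (auto simp: is_weak_gradient_def)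
  have "AE x in lebesgue_on \<Omega>. g x $ i - g' x $ i = 0" for i
  proof (rule AE_zero_if_test_integrals_zero[OF assms(1)])
    show "(\<lambda>x. g x $ i - g' x $ i) \<in> L1_loc \<Omega>"
      using L by (intro L1_loc_diff L1_loc_nth)
    show "(\<integral>x. (g x $ i - g' x $ i) * \<phi> x \<partial>(lebesgue_on \<Omega>)) = 0" if "\<phi> \<in> test_functions \<Omega>" for \<phi>
      using L1_loc_mult_test[OF assms(1) L1_loc_nth[OF L(1)] that] L1_loc_mult_test[OF assms(1) L1_loc_nth[OF L(2)] that] assms(2,3) that
      by (simp add: left_diff_distrib is_weak_gradient_def)
  qed
  then have "AE x in lebesgue_on \<Omega>. \<forall>i. g x $ i - g' x $ i = 0"
    by (simp add: AE_all_countable)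
  then show ?thesis by eventually_elim (auto simp: vec_eq_iff)
qed

lemma is_weak_gradient_diff:
  fixes u v :: "real^'n \<Rightarrow> real"
  assumes \<Omega>: "open \<Omega>" and u: "is_weak_gradient \<Omega> u g" and v: "is_weak_gradient \<Omega> v g'"
  shows "is_weak_gradient \<Omega> (\<lambda>x. u x - v x) (\<lambda>x. g x - g' x)"
  unfolding is_weak_gradient_def
proof (intro conjI ballI allI)
  have L: "u \<in> L1_loc \<Omega>" "v \<in> L1_loc \<Omega>" "g \<in> L1_loc \<Omega>" "g' \<in> L1_loc \<Omega>"
    using assms by (auto simp: is_weak_gradient_def)
  then show "(\<lambda>x. u x - v x) \<in> L1_loc \<Omega>" "(\<lambda>x. g x - g' x) \<in> L1_loc \<Omega>"
    by (auto intro: L1_loc_diff)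
  fix \<phi> and i :: 'n assume \<phi>: "\<phi> \<in> test_functions \<Omega>"
  note D = test_functions_grad_nth[OF \<phi>, of i]
  have iu: "integrable (lebesgue_on \<Omega>) (\<lambda>x. u x * grad \<phi> x $ i)" "integrable (lebesgue_on \<Omega>) (\<lambda>x. v x * grad \<phi> x $ i)"
    by (intro L1_loc_mult_test[OF \<Omega> _ D] L)+
  show "(\<integral>x. (u x - v x) * grad \<phi> x $ i \<partial>(lebesgue_on \<Omega>)) = - (\<integral>x. (g x - g' x) $ i * \<phi> x \<partial>(lebesgue_on \<Omega>))"
    using iu L1_loc_mult_test[OF \<Omega> L1_loc_nth[OF L(3)] \<phi>, of i] L1_loc_mult_test[OF \<Omega> L1_loc_nth[OF L(4)] \<phi>, of i] u v \<phi>
    by (simp add: left_diff_distrib is_weak_gradient_def)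
qed

lemma test_functions_borel_grad_nth:
  "\<phi> \<in> test_functions \<Omega> \<Longrightarrow> (\<lambda>x. grad \<phi> x $ i) \<in> borel_measurable borel"
  by (intro borel_measurable_continuous_onI continuous_on_component test_functions_continuous_grad)

lemma is_weak_gradient_test:
  fixes \<phi> :: "real^'n \<Rightarrow> real"
  assumes \<Omega>: "open \<Omega>" and \<phi>: "\<phi> \<in> test_functions \<Omega>"
  shows "is_weak_gradient \<Omega> \<phi> (grad \<phi>)"
  unfolding is_weak_gradient_def
proof (intro conjI ballI allI)
  have "F \<in> L1_loc \<Omega>" if "integrable lborel F" for F :: "real^'n \<Rightarrow> 'b::euclidean_space"
    unfolding L1_loc_def
  proof (intro CollectI allI impI)
    fix K :: "(real^'n) set" assume "compact K \<and> K \<subseteq> \<Omega>"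
    then have Ks: "K \<in> sets borel" by (simp add: borel_compact)
    then have "integrable lborel (\<lambda>x. indicator K x *\<^sub>R F x)"
      using that by (intro integrable_mult_indicator) auto
    then have "integrable lebesgue (\<lambda>x. indicator K x *\<^sub>R F x)"
      by (subst integrable_completion) auto
    then show "integrable (lebesgue_on K) F"
      using Ks by (subst integrable_restrict_space) (auto simp: sets_completionI_sets)
  qed
  then show "\<phi> \<in> L1_loc \<Omega>" "grad \<phi> \<in> L1_loc \<Omega>"
    using test_functions_integrable[OF \<phi>] by blast+
  fix \<psi> and i :: 'n assume \<psi>: "\<psi> \<in> test_functions \<Omega>"
  note [measurable] = test_functions_borel[OF \<phi>] test_functions_borel[OF \<psi>]
    test_functions_borel_grad_nth[OF \<phi>] test_functions_borel_grad_nth[OF \<psi>]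
  have "(\<integral>x. \<phi> x * grad \<psi> x $ i \<partial>(lebesgue_on \<Omega>)) = (\<integral>x. \<phi> x * grad \<psi> x $ i \<partial>lborel)"
    using \<Omega> test_functions_outside[OF \<phi>] by (intro lebesgue_on_integral) auto
  also have "\<dots> = - (\<integral>x. grad \<phi> x $ i * \<psi> x \<partial>lborel)"
    by (rule test_functions_integration_by_parts[OF \<phi> \<psi>])
  also have "(\<integral>x. grad \<phi> x $ i * \<psi> x \<partial>lborel) = (\<integral>x. grad \<phi> x $ i * \<psi> x \<partial>(lebesgue_on \<Omega>))"
    using \<Omega> test_functions_outside[OF \<phi>] by (intro lebesgue_on_integral(1)[symmetric]) auto
  finally show "(\<integral>x. \<phi> x * grad \<psi> x $ i \<partial>(lebesgue_on \<Omega>)) = - (\<integral>x. grad \<phi> x $ i * \<psi> x \<partial>(lebesgue_on \<Omega>))" .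
qed

lemma weak_gradient_AE_eq:
  assumes "open \<Omega>" "is_weak_gradient \<Omega> u g"
  shows "AE x in lebesgue_on \<Omega>. weak_gradient \<Omega> u x = g x"
    and "is_weak_gradient \<Omega> u (weak_gradient \<Omega> u)"
    and "weak_gradient \<Omega> u \<in> borel_measurable (lebesgue_on \<Omega>)"
proof -
  show w: "is_weak_gradient \<Omega> u (weak_gradient \<Omega> u)"
    unfolding weak_gradient_def by (rule someI[of "is_weak_gradient \<Omega> u", OF assms(2)])
  show "AE x in lebesgue_on \<Omega>. weak_gradient \<Omega> u x = g x"
    using is_weak_gradient_unique[OF assms(1) w assms(2)] .
  show "weak_gradient \<Omega> u \<in> borel_measurable (lebesgue_on \<Omega>)"
    using w assms(1) by (auto simp: is_weak_gradient_def intro: L1_loc_measurable)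
qed

lemma L2_norm_cong_AE:
  assumes "f \<in> borel_measurable (lebesgue_on \<Omega>)" "g \<in> borel_measurable (lebesgue_on \<Omega>)"
    "AE x in lebesgue_on \<Omega>. f x = g x"
  shows "L2_norm \<Omega> f = L2_norm \<Omega> g"
  unfolding L2_norm_def using assms by (intro arg_cong[where f = sqrt] integral_cong_AE) auto

lemma H1_weak_gradient:
  assumes "open \<Omega>" "u \<in> H1 \<Omega>"
  shows "is_weak_gradient \<Omega> u (weak_gradient \<Omega> u)" "weak_gradient \<Omega> u \<in> L2 \<Omega>"
proof -
  obtain g where g: "g \<in> L2 \<Omega>" "is_weak_gradient \<Omega> u g" using assms by (auto simp: H1_def)
  note w = weak_gradient_AE_eq[OF assms(1) g(2)]
  show "is_weak_gradient \<Omega> u (weak_gradient \<Omega> u)" by (rule w)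
  have "integrable (lebesgue_on \<Omega>) (\<lambda>x. (norm (weak_gradient \<Omega> u x))\<^sup>2)"
  proof (rule integrable_cong_AE_imp)
    show "integrable (lebesgue_on \<Omega>) (\<lambda>x. (norm (g x))\<^sup>2)" using g(1) by (simp add: L2_def)
    show "(\<lambda>x. (norm (weak_gradient \<Omega> u x))\<^sup>2) \<in> borel_measurable (lebesgue_on \<Omega>)" using w(3) by simp
    show "AE x in lebesgue_on \<Omega>. (norm (g x))\<^sup>2 = (norm (weak_gradient \<Omega> u x))\<^sup>2"
      using w(1) by eventually_elim simp
  qed
  with w(3) show "weak_gradient \<Omega> u \<in> L2 \<Omega>" by (simp add: L2_def)
qed

section \<open>Limits of test functions\<close>

text \<open>Square integrability of all terms and of the limit is part of the notion, because the
  Bochner integral of a function that is not integrable is 0 and convergence of the integrals alone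
  would say nothing.\<close>

definition L2_tendsto :: "'a measure \<Rightarrow> (nat \<Rightarrow> 'a \<Rightarrow> 'b::euclidean_space) \<Rightarrow> ('a \<Rightarrow> 'b) \<Rightarrow> bool"
  where "L2_tendsto M f F \<longleftrightarrow>
    (\<forall>n. f n \<in> borel_measurable M \<and> integrable M (\<lambda>x. (norm (f n x))\<^sup>2)) \<and>
    F \<in> borel_measurable M \<and> integrable M (\<lambda>x. (norm (F x))\<^sup>2) \<and>
    (\<lambda>n. \<integral>x. (norm (f n x - F x))\<^sup>2 \<partial>M) \<longlonglongrightarrow> 0"

lemma L2_tendstoD:
  assumes "L2_tendsto M f F"
  shows "f n \<in> borel_measurable M" "integrable M (\<lambda>x. (norm (f n x))\<^sup>2)"
    "F \<in> borel_measurable M" "integrable M (\<lambda>x. (norm (F x))\<^sup>2)"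
    "(\<lambda>n. \<integral>x. (norm (f n x - F x))\<^sup>2 \<partial>M) \<longlonglongrightarrow> 0"
    "integrable M (\<lambda>x. (norm (f n x - F x))\<^sup>2)"
  using assms by (auto simp: L2_tendsto_def intro!: sq_integrable_diff)

lemma L2_tendsto_const:
  "F \<in> borel_measurable M \<Longrightarrow> integrable M (\<lambda>x. (norm (F x))\<^sup>2) \<Longrightarrow> L2_tendsto M (\<lambda>n. F) F"
  by (auto simp: L2_tendsto_def)

lemma L2_tendsto_inner:
  fixes F G :: "'a \<Rightarrow> 'b::euclidean_space"
  assumes f: "L2_tendsto M f F" and g: "L2_tendsto M g G"
  shows "(\<lambda>n. \<integral>x. f n x \<bullet> g n x \<partial>M) \<longlonglongrightarrow> (\<integral>x. F x \<bullet> G x \<partial>M)"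
proof -
  note F = L2_tendstoD[OF f] and G = L2_tendstoD[OF g]
  let ?n = "\<lambda>h. sqrt (\<integral>x. (norm (h x))\<^sup>2 \<partial>M)"
  have mf: "(\<lambda>x. f n x - F x) \<in> borel_measurable M" "(\<lambda>x. g n x - G x) \<in> borel_measurable M" for n
    using F(1)[of n] F(3) G(1)[of n] G(3) by auto
  have lim0: "(\<lambda>n. ?n (\<lambda>x. f n x - F x)) \<longlonglongrightarrow> 0" "(\<lambda>n. ?n (\<lambda>x. g n x - G x)) \<longlonglongrightarrow> 0"
    using tendsto_real_sqrt[OF F(5)] tendsto_real_sqrt[OF G(5)] by simp_all
  have i1: "integrable M (\<lambda>x. (f n x - F x) \<bullet> (g n x - G x))" for n
    by (rule sq_integrable_inner) (use mf F G in auto)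
  have i2: "integrable M (\<lambda>x. (f n x - F x) \<bullet> G x)" for n
    by (rule sq_integrable_inner) (use mf F G in auto)
  have i3: "integrable M (\<lambda>x. F x \<bullet> (g n x - G x))" for n
    by (rule sq_integrable_inner) (use mf F G in auto)
  have i4: "integrable M (\<lambda>x. F x \<bullet> G x)"
    by (rule sq_integrable_inner) (use F G in auto)
  have eq: "(\<integral>x. f n x \<bullet> g n x \<partial>M) = (\<integral>x. (f n x - F x) \<bullet> (g n x - G x) \<partial>M)
      + (\<integral>x. (f n x - F x) \<bullet> G x \<partial>M) + (\<integral>x. F x \<bullet> (g n x - G x) \<partial>M) + (\<integral>x. F x \<bullet> G x \<partial>M)" for n
  proof -
    have "f n x \<bullet> g n x = (f n x - F x) \<bullet> (g n x - G x) + (f n x - F x) \<bullet> G x + F x \<bullet> (g n x - G x) + F x \<bullet> G x" for x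
      by (simp add: inner_diff_left inner_diff_right)
    then have "(\<integral>x. f n x \<bullet> g n x \<partial>M) =
        (\<integral>x. (f n x - F x) \<bullet> (g n x - G x) + (f n x - F x) \<bullet> G x + F x \<bullet> (g n x - G x) + F x \<bullet> G x \<partial>M)"
      by (intro Bochner_Integration.integral_cong) auto
    then show ?thesis using i1 i2 i3 i4 by (simp only: Bochner_Integration.integral_add Bochner_Integration.integrable_add)
  qed
  have "(\<lambda>n. \<integral>x. (f n x - F x) \<bullet> (g n x - G x) \<partial>M) \<longlonglongrightarrow> 0"
  proof (rule Lim_null_comparison)
    show "\<forall>\<^sub>F n in sequentially. norm (\<integral>x. (f n x - F x) \<bullet> (g n x - G x) \<partial>M)
        \<le> ?n (\<lambda>x. f n x - F x) * ?n (\<lambda>x. g n x - G x)"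
      unfolding real_norm_def by (intro always_eventually allI integral_Cauchy_Schwarz) (use mf F G in auto)
    show "(\<lambda>n. ?n (\<lambda>x. f n x - F x) * ?n (\<lambda>x. g n x - G x)) \<longlonglongrightarrow> 0"
      using tendsto_mult[OF lim0] by simp
  qed
  moreover have "(\<lambda>n. \<integral>x. (f n x - F x) \<bullet> G x \<partial>M) \<longlonglongrightarrow> 0"
  proof (rule Lim_null_comparison)
    show "\<forall>\<^sub>F n in sequentially. norm (\<integral>x. (f n x - F x) \<bullet> G x \<partial>M) \<le> ?n (\<lambda>x. f n x - F x) * ?n G"
      unfolding real_norm_def by (intro always_eventually allI integral_Cauchy_Schwarz) (use mf F G in auto)
    show "(\<lambda>n. ?n (\<lambda>x. f n x - F x) * ?n G) \<longlonglongrightarrow> 0"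
      using tendsto_mult[OF lim0(1) tendsto_const] by simp
  qed
  moreover have "(\<lambda>n. \<integral>x. F x \<bullet> (g n x - G x) \<partial>M) \<longlonglongrightarrow> 0"
  proof (rule Lim_null_comparison)
    show "\<forall>\<^sub>F n in sequentially. norm (\<integral>x. F x \<bullet> (g n x - G x) \<partial>M) \<le> ?n F * ?n (\<lambda>x. g n x - G x)"
      unfolding real_norm_def by (intro always_eventually allI integral_Cauchy_Schwarz) (use mf F G in auto)
    show "(\<lambda>n. ?n F * ?n (\<lambda>x. g n x - G x)) \<longlonglongrightarrow> 0"
      using tendsto_mult[OF tendsto_const lim0(2)] by simp
  qed
  ultimately have "(\<lambda>n. \<integral>x. f n x \<bullet> g n x \<partial>M) \<longlonglongrightarrow> 0 + 0 + 0 + (\<integral>x. F x \<bullet> G x \<partial>M)"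
    unfolding eq by (intro tendsto_add tendsto_const)
  then show ?thesis by simp
qed

lemma L2_tendsto_norm:
  assumes "L2_tendsto M f F"
  shows "(\<lambda>n. \<integral>x. (norm (f n x))\<^sup>2 \<partial>M) \<longlonglongrightarrow> (\<integral>x. (norm (F x))\<^sup>2 \<partial>M)"
  using L2_tendsto_inner[OF assms assms] by (simp add: power2_norm_eq_inner)

text \<open>Lipschitz images of a convergent sequence converge. Square integrability of the limit
  needs no separate argument: it is one term minus a square integrable difference.\<close>

lemma L2_tendsto_dominated:
  fixes f :: "nat \<Rightarrow> 'a \<Rightarrow> 'b::euclidean_space" and g :: "nat \<Rightarrow> 'a \<Rightarrow> 'c::euclidean_space"
  assumes g: "L2_tendsto M g G"
    and meas [measurable]: "\<And>n. f n \<in> borel_measurable M" "F \<in> borel_measurable M"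
    and int: "\<And>n. integrable M (\<lambda>x. (norm (f n x))\<^sup>2)"
    and le: "\<And>n x. norm (f n x - F x) \<le> C * norm (g n x - G x)"
  shows "L2_tendsto M f F"
proof -
  note g' = L2_tendstoD[OF g]
  have le2: "(norm (f n x - F x))\<^sup>2 \<le> C\<^sup>2 * (norm (g n x - G x))\<^sup>2" for n x
    using power_mono[OF le[of n x], of 2] by (simp add: power_mult_distrib)
  have id: "integrable M (\<lambda>x. (norm (f n x - F x))\<^sup>2)" for n
    by (rule Bochner_Integration.integrable_bound[of _ "\<lambda>x. C\<^sup>2 * (norm (g n x - G x))\<^sup>2"])
      (use g'(6)[of n] le2 in auto)
  have "integrable M (\<lambda>x. (norm (f 0 x - (f 0 x - F x)))\<^sup>2)"
    by (rule sq_integrable_diff[OF _ _ int[of 0] id[of 0]]) auto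
  then have "integrable M (\<lambda>x. (norm (F x))\<^sup>2)" by simp
  moreover have "(\<lambda>n. \<integral>x. (norm (f n x - F x))\<^sup>2 \<partial>M) \<longlonglongrightarrow> 0"
  proof (rule Lim_null_comparison)
    show "\<forall>\<^sub>F n in sequentially. norm (\<integral>x. (norm (f n x - F x))\<^sup>2 \<partial>M) \<le> C\<^sup>2 * (\<integral>x. (norm (g n x - G x))\<^sup>2 \<partial>M)"
    proof (intro always_eventually allI)
      fix n
      have "(\<integral>x. (norm (f n x - F x))\<^sup>2 \<partial>M) \<le> (\<integral>x. C\<^sup>2 * (norm (g n x - G x))\<^sup>2 \<partial>M)"
        using id[of n] g'(6)[of n] le2 by (intro integral_mono) auto
      then show "norm (\<integral>x. (norm (f n x - F x))\<^sup>2 \<partial>M) \<le> C\<^sup>2 * (\<integral>x. (norm (g n x - G x))\<^sup>2 \<partial>M)" by simp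
    qed
    show "(\<lambda>n. C\<^sup>2 * (\<integral>x. (norm (g n x - G x))\<^sup>2 \<partial>M)) \<longlonglongrightarrow> 0"
      using tendsto_mult[OF tendsto_const g'(5)] by simp
  qed
  ultimately show ?thesis using int by (simp add: L2_tendsto_def)
qed

lemma L2_tendsto_add:
  assumes f: "L2_tendsto M f F" and g: "L2_tendsto M g G"
  shows "L2_tendsto M (\<lambda>n x. f n x + g n x) (\<lambda>x. F x + G x)"
proof -
  note F = L2_tendstoD[OF f] and G = L2_tendstoD[OF g]
  have "(\<lambda>n. \<integral>x. (norm ((f n x + g n x) - (F x + G x)))\<^sup>2 \<partial>M) \<longlonglongrightarrow> 0"
  proof (rule Lim_null_comparison)
    show "\<forall>\<^sub>F n in sequentially. norm (\<integral>x. (norm ((f n x + g n x) - (F x + G x)))\<^sup>2 \<partial>M)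
        \<le> 2 * (\<integral>x. (norm (f n x - F x))\<^sup>2 \<partial>M) + 2 * (\<integral>x. (norm (g n x - G x))\<^sup>2 \<partial>M)"
    proof (intro always_eventually allI)
      fix n
      have "(\<integral>x. (norm ((f n x + g n x) - (F x + G x)))\<^sup>2 \<partial>M)
          \<le> (\<integral>x. 2 * (norm (f n x - F x))\<^sup>2 + 2 * (norm (g n x - G x))\<^sup>2 \<partial>M)"
      proof (rule integral_mono)
        show "integrable M (\<lambda>x. (norm ((f n x + g n x) - (F x + G x)))\<^sup>2)"
          using F(1)[of n] F(2)[of n] G(1)[of n] G(2)[of n] F(3,4) G(3,4)
          by (intro sq_integrable_diff sq_integrable_add) auto
        show "(norm ((f n x + g n x) - (F x + G x)))\<^sup>2 \<le> 2 * (norm (f n x - F x))\<^sup>2 + 2 * (norm (g n x - G x))\<^sup>2" for x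
          using sq_norm_add_le[of "f n x - F x" "g n x - G x"] by (simp add: algebra_simps)
      qed (use F(6)[of n] G(6)[of n] in auto)
      then show "norm (\<integral>x. (norm ((f n x + g n x) - (F x + G x)))\<^sup>2 \<partial>M)
        \<le> 2 * (\<integral>x. (norm (f n x - F x))\<^sup>2 \<partial>M) + 2 * (\<integral>x. (norm (g n x - G x))\<^sup>2 \<partial>M)"
        using F(6)[of n] G(6)[of n] by simp
    qed
    show "(\<lambda>n. 2 * (\<integral>x. (norm (f n x - F x))\<^sup>2 \<partial>M) + 2 * (\<integral>x. (norm (g n x - G x))\<^sup>2 \<partial>M)) \<longlonglongrightarrow> 0"
      using tendsto_add[OF tendsto_mult[OF tendsto_const F(5)] tendsto_mult[OF tendsto_const G(5)], of 2 2] by simp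
  qed
  then show ?thesis using F G by (auto simp: L2_tendsto_def intro: sq_integrable_add)
qed

text \<open>Meant for the chain rule, where the scalar factor converges only almost everywhere. One
  splits into \<open>c n\<close> times (g_n - G), small in norm since \<open>c n\<close> is bounded,
  and (c_n - c') times \<open>G\<close>, which tends to 0 by dominated convergence with the fixed
  majorant given by \<open>G\<close>.\<close>

lemma L2_tendsto_bounded_scale:
  fixes c :: "nat \<Rightarrow> 'a \<Rightarrow> real" and g :: "nat \<Rightarrow> 'a \<Rightarrow> 'b::euclidean_space"
  assumes g: "L2_tendsto M g G"
    and [measurable]: "\<And>n. c n \<in> borel_measurable M" "c' \<in> borel_measurable M"
    and bound: "\<And>n x. \<bar>c n x\<bar> \<le> C"
    and lim: "AE x in M. (\<lambda>n. c n x) \<longlonglongrightarrow> c' x" and bound': "\<And>x. \<bar>c' x\<bar> \<le> C"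
  shows "L2_tendsto M (\<lambda>n x. c n x *\<^sub>R g n x) (\<lambda>x. c' x *\<^sub>R G x)"
proof -
  note G = L2_tendstoD[OF g]
  note [measurable] = G(1,3)
  have C: "0 \<le> C" using bound'[of undefined] by linarith
  have sq: "(norm (t *\<^sub>R a))\<^sup>2 \<le> C\<^sup>2 * (norm a)\<^sup>2" if "\<bar>t\<bar> \<le> C" for t and a :: 'b
    using that power_mono[of "\<bar>t\<bar>" C 2] by (auto simp: power_mult_distrib intro!: mult_right_mono)
  have int: "integrable M (\<lambda>x. (norm (t x *\<^sub>R h x))\<^sup>2)"
    if "integrable M (\<lambda>x. (norm (h x))\<^sup>2)" "h \<in> borel_measurable M" "t \<in> borel_measurable M" "\<And>x. \<bar>t x\<bar> \<le> C"
    for t and h :: "'a \<Rightarrow> 'b"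
  proof (rule Bochner_Integration.integrable_bound[of _ "\<lambda>x. C\<^sup>2 * (norm (h x))\<^sup>2"])
    show "(\<lambda>x. (norm (t x *\<^sub>R h x))\<^sup>2) \<in> borel_measurable M" using that by auto
    show "AE x in M. norm ((norm (t x *\<^sub>R h x))\<^sup>2) \<le> norm (C\<^sup>2 * (norm (h x))\<^sup>2)"
      using sq[OF that(4)] by (intro AE_I2) auto
  qed (use that in auto)
  have A: "L2_tendsto M (\<lambda>n x. c n x *\<^sub>R G x) (\<lambda>x. c' x *\<^sub>R G x)"
    unfolding L2_tendsto_def
  proof (intro conjI allI)
    show "integrable M (\<lambda>x. (norm (c n x *\<^sub>R G x))\<^sup>2)" for n by (rule int) (use G bound in auto)
    show "integrable M (\<lambda>x. (norm (c' x *\<^sub>R G x))\<^sup>2)" by (rule int) (use G bound' in auto)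
    have "(\<lambda>n. \<integral>x. (norm (c n x *\<^sub>R G x - c' x *\<^sub>R G x))\<^sup>2 \<partial>M) \<longlonglongrightarrow> (\<integral>x. 0 \<partial>M)"
    proof (rule integral_dominated_convergence)
      show "integrable M (\<lambda>x. 4 * C\<^sup>2 * (norm (G x))\<^sup>2)" using G(4) by simp
      show "AE x in M. (\<lambda>n. (norm (c n x *\<^sub>R G x - c' x *\<^sub>R G x))\<^sup>2) \<longlonglongrightarrow> 0"
        using lim
      proof eventually_elim
        case (elim x)
        have "(\<lambda>n. (norm (c n x *\<^sub>R G x - c' x *\<^sub>R G x))\<^sup>2) \<longlonglongrightarrow> (norm (c' x *\<^sub>R G x - c' x *\<^sub>R G x))\<^sup>2"
          by (intro tendsto_intros elim)
        then show ?case by simp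
      qed
      show "AE x in M. norm ((norm (c n x *\<^sub>R G x - c' x *\<^sub>R G x))\<^sup>2) \<le> 4 * C\<^sup>2 * (norm (G x))\<^sup>2" for n
      proof (intro AE_I2)
        fix x
        have "(norm (c n x *\<^sub>R G x - c' x *\<^sub>R G x))\<^sup>2 \<le> 2 * (norm (c n x *\<^sub>R G x))\<^sup>2 + 2 * (norm (c' x *\<^sub>R G x))\<^sup>2"
          by (rule sq_norm_diff_le)
        also have "\<dots> \<le> 2 * (C\<^sup>2 * (norm (G x))\<^sup>2) + 2 * (C\<^sup>2 * (norm (G x))\<^sup>2)"
          using sq[OF bound[of n x]] sq[OF bound'[of x]] by (intro add_mono mult_left_mono) auto
        finally show "norm ((norm (c n x *\<^sub>R G x - c' x *\<^sub>R G x))\<^sup>2) \<le> 4 * C\<^sup>2 * (norm (G x))\<^sup>2" by simp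
      qed
    qed auto
    then show "(\<lambda>n. \<integral>x. (norm (c n x *\<^sub>R G x - c' x *\<^sub>R G x))\<^sup>2 \<partial>M) \<longlonglongrightarrow> 0" by simp
  qed auto
  have gd: "L2_tendsto M (\<lambda>n x. g n x - G x) (\<lambda>x. 0)"
    using G(5,6) by (simp add: L2_tendsto_def)
  have B: "L2_tendsto M (\<lambda>n x. c n x *\<^sub>R (g n x - G x)) (\<lambda>x. 0)"
  proof (rule L2_tendsto_dominated[OF gd])
    show "integrable M (\<lambda>x. (norm (c n x *\<^sub>R (g n x - G x)))\<^sup>2)" for n
      by (rule int) (use G(6)[of n] bound in auto)
    show "norm (c n x *\<^sub>R (g n x - G x) - 0) \<le> C * norm (g n x - G x - 0)" for n x
      using bound[of n x] by (auto intro!: mult_right_mono)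
  qed auto
  show ?thesis
    using L2_tendsto_add[OF A B] by (simp add: scaleR_diff_right)
qed

text \<open>A function with zero boundary values, given by its approximation. Everything is extended
  by zero and measured by \<open>lborel\<close>, so that translations are available, and
  \<open>G\<close> is the limit of the gradients rather than a weak gradient. Pointwise convergence
  is included because truncation composes \<open>p n\<close> with nonlinear functions.\<close>

locale H1_limit =
  fixes \<Omega> :: "(real^'n) set" and p :: "nat \<Rightarrow> real^'n \<Rightarrow> real"
    and P :: "real^'n \<Rightarrow> real" and G :: "real^'n \<Rightarrow> real^'n"
  assumes \<Omega>_open: "open \<Omega>" and \<Omega>_bounded: "bounded \<Omega>"
    and p_test: "p n \<in> test_functions \<Omega>"
    and P_outside: "x \<notin> \<Omega> \<Longrightarrow> P x = 0"
    and p_lim: "AE x in lborel. (\<lambda>n. p n x) \<longlonglongrightarrow> P x"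
    and p_L2: "L2_tendsto lborel p P"
    and grad_L2: "L2_tendsto lborel (\<lambda>n. grad (p n)) G"
begin

lemma P_borel [measurable]: "P \<in> borel_measurable borel"
  and G_borel [measurable]: "G \<in> borel_measurable borel"
  and p_borel [measurable]: "p n \<in> borel_measurable borel"
  and grad_p_borel [measurable]: "grad (p n) \<in> borel_measurable borel"
  using L2_tendstoD[OF p_L2] L2_tendstoD[OF grad_L2] by auto

lemma grad_difference_sq:
  "(\<integral>x. (norm (grad (p n) x - grad (p m) x))\<^sup>2 \<partial>lborel)
    \<le> 2 * (\<integral>x. (norm (grad (p n) x - G x))\<^sup>2 \<partial>lborel) + 2 * (\<integral>x. (norm (grad (p m) x - G x))\<^sup>2 \<partial>lborel)"
  "integrable lborel (\<lambda>x. (norm (grad (p n) x - grad (p m) x))\<^sup>2)"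
proof -
  note G = L2_tendstoD[OF grad_L2]
  show i: "integrable lborel (\<lambda>x. (norm (grad (p n) x - grad (p m) x))\<^sup>2)"
    by (intro sq_integrable_diff G(2)) auto
  have "(\<integral>x. (norm (grad (p n) x - grad (p m) x))\<^sup>2 \<partial>lborel)
      \<le> (\<integral>x. 2 * (norm (grad (p n) x - G x))\<^sup>2 + 2 * (norm (grad (p m) x - G x))\<^sup>2 \<partial>lborel)"
  proof (rule integral_mono[OF i])
    show "(norm (grad (p n) x - grad (p m) x))\<^sup>2 \<le> 2 * (norm (grad (p n) x - G x))\<^sup>2 + 2 * (norm (grad (p m) x - G x))\<^sup>2" for x
      using sq_norm_diff_le[of "grad (p n) x - G x" "grad (p m) x - G x"] by simp
  qed (use G(6) in simp)
  then show "(\<integral>x. (norm (grad (p n) x - grad (p m) x))\<^sup>2 \<partial>lborel)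
    \<le> 2 * (\<integral>x. (norm (grad (p n) x - G x))\<^sup>2 \<partial>lborel) + 2 * (\<integral>x. (norm (grad (p m) x - G x))\<^sup>2 \<partial>lborel)"
    using G(6) by simp
qed

lemma emeasure_\<Omega>: "emeasure lborel \<Omega> < \<infinity>"
  using emeasure_bounded_finite[OF \<Omega>_bounded] by simp

lemma integrable_indicator_\<Omega>: "integrable lborel (\<lambda>x. c * indicator \<Omega> x :: real)"
  using emeasure_\<Omega> \<Omega>_open by (auto simp: integrable_real_indicator)

lemma integrable_of_sq:
  fixes f :: "real^'n \<Rightarrow> real"
  assumes [measurable]: "f \<in> borel_measurable borel" and "integrable lborel (\<lambda>x. (norm (f x))\<^sup>2)" "\<And>x. x \<notin> \<Omega> \<Longrightarrow> f x = 0"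
  shows "integrable lborel f"
proof (rule Bochner_Integration.integrable_bound)
  show "integrable lborel (\<lambda>x. 1 * indicator \<Omega> x + (norm (f x))\<^sup>2)"
    using integrable_indicator_\<Omega>[of 1] assms by (intro Bochner_Integration.integrable_add) auto
  have "norm (f x) \<le> 1 + (norm (f x))\<^sup>2" for x
    using sum_squares_bound[of 1 "norm (f x)"] by (simp add: power2_eq_square)
  then show "AE x in lborel. norm (f x) \<le> norm (1 * indicator \<Omega> x + (norm (f x))\<^sup>2)"
    using assms(3) by (intro AE_I2) (auto simp: indicator_def)
qed auto

lemma P_integrable: "integrable lborel P"
  by (rule integrable_of_sq[OF P_borel L2_tendstoD(4)[OF p_L2] P_outside])

text \<open>Since \<open>\<Omega>\<close> has finite measure, its indicator is square integrable;
  pairing with it turns convergence in the square norm into convergence of the first moments that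
  occur in the Nash inequality.\<close>

lemma p_L1: "(\<lambda>n. \<integral>x. \<bar>p n x\<bar> \<partial>lborel) \<longlonglongrightarrow> (\<integral>x. \<bar>P x\<bar> \<partial>lborel)"
proof -
  have sq: "integrable lborel (\<lambda>x. (norm (indicator \<Omega> x :: real))\<^sup>2)"
  proof -
    have "(\<lambda>x. (norm (indicator \<Omega> x :: real))\<^sup>2) = (\<lambda>x. 1 * indicator \<Omega> x)"
      by (auto simp: indicator_def)
    then show ?thesis using integrable_indicator_\<Omega>[of 1] by simp
  qed
  have abs: "L2_tendsto lborel (\<lambda>n x. \<bar>p n x\<bar>) (\<lambda>x. \<bar>P x\<bar>)"
  proof (rule L2_tendsto_dominated[OF p_L2])
    show "norm (\<bar>p n x\<bar> - \<bar>P x\<bar>) \<le> 1 * norm (p n x - P x)" for n x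
      by (simp add: abs_triangle_ineq3)
    show "integrable lborel (\<lambda>x. (norm \<bar>p n x\<bar>)\<^sup>2)" for n
      using L2_tendstoD(2)[OF p_L2] by simp
  qed auto
  have ind: "L2_tendsto lborel (\<lambda>n x. indicator \<Omega> x) (\<lambda>x. indicator \<Omega> x :: real)"
    using sq \<Omega>_open by (intro L2_tendsto_const) auto
  have e: "\<bar>p n x\<bar> * indicator \<Omega> x = \<bar>p n x\<bar>" "\<bar>P x\<bar> * indicator \<Omega> x = \<bar>P x\<bar>" for n x
    using test_functions_outside(1)[OF p_test] P_outside by (auto simp: indicator_def)
  show ?thesis using L2_tendsto_inner[OF abs ind] by (simp only: inner_real_def e)
qed

lemma Nash:
  assumes "0 < s"
  shows "(\<integral>x. (P x)\<^sup>2 \<partial>lborel) \<le> s\<^sup>2 * (\<integral>x. (norm (G x))\<^sup>2 \<partial>lborel)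
    + 2 * (\<integral>x. \<bar>P x\<bar> \<partial>lborel)\<^sup>2 / measure lborel (ball (0::real^'n) s)"
proof (rule LIMSEQ_le)
  show "(\<lambda>n. \<integral>x. (p n x)\<^sup>2 \<partial>lborel) \<longlonglongrightarrow> (\<integral>x. (P x)\<^sup>2 \<partial>lborel)"
    using L2_tendsto_norm[OF p_L2] by simp
  show "(\<lambda>n. s\<^sup>2 * (\<integral>x. (norm (grad (p n) x))\<^sup>2 \<partial>lborel) + 2 * (\<integral>x. \<bar>p n x\<bar> \<partial>lborel)\<^sup>2 / measure lborel (ball (0::real^'n) s))
    \<longlonglongrightarrow> s\<^sup>2 * (\<integral>x. (norm (G x))\<^sup>2 \<partial>lborel) + 2 * (\<integral>x. \<bar>P x\<bar> \<partial>lborel)\<^sup>2 / measure lborel (ball (0::real^'n) s)"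
    using content_ball_pos[OF assms, of "0::real^'n"]
    by (intro tendsto_intros L2_tendsto_norm[OF grad_L2] p_L1) simp
qed (use test_functions_Nash[OF p_test assms] in auto)

text \<open>The class of limits is stable under localized truncation. The product and chain rules
  are applied to the smooth functions \<open>p n\<close>; the term with \<open>grad \<eta>\<close>
  converges because the truncation is 1-Lipschitz, the other one because \<open>soft'\<close> is
  bounded and continuous.\<close>

lemma cutoff_truncation:
  fixes \<eta> :: "real^'n \<Rightarrow> real" and \<kappa> \<tau> :: real
  assumes \<eta>: "\<eta> \<in> test_functions \<Omega>" and \<tau>: "0 < \<tau>"
  defines "f \<equiv> \<lambda>n x. \<eta> x * (\<tau> * soft ((\<kappa> - p n x) / \<tau>))"
    and "F \<equiv> \<lambda>x. \<eta> x * (\<tau> * soft ((\<kappa> - P x) / \<tau>))"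
    and "H \<equiv> \<lambda>x. (\<tau> * soft ((\<kappa> - P x) / \<tau>)) *\<^sub>R grad \<eta> x + (- \<eta> x * soft' ((\<kappa> - P x) / \<tau>)) *\<^sub>R G x"
  shows "H1_limit \<Omega> f F H"
proof
  obtain K where K: "compact K" "\<And>x. x \<notin> K \<Longrightarrow> \<eta> x = 0" "\<And>x. x \<notin> K \<Longrightarrow> grad \<eta> x = 0"
    using \<eta> test_functionsE by metis
  obtain M where M: "0 \<le> M" "\<And>x. norm (\<eta> x) \<le> M"
    using compact_support_bounded[OF test_functions_continuous[OF \<eta>] K(1,2)] by metis
  obtain M' where M': "0 \<le> M'" "\<And>x. norm (grad \<eta> x) \<le> M'"
    using compact_support_bounded[OF test_functions_continuous_grad[OF \<eta>] K(1,3)] by metis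
  have [measurable]: "\<eta> \<in> borel_measurable borel" "grad \<eta> \<in> borel_measurable borel"
    using test_functions_borel[OF \<eta>] test_functions_borel_grad[OF \<eta>] by auto
  have [measurable]: "soft \<in> borel_measurable borel" "soft' \<in> borel_measurable borel"
    by (auto intro: borel_measurable_continuous_onI soft_continuous soft'_continuous)
  define \<Phi> where "\<Phi> = (\<lambda>t. \<tau> * soft ((\<kappa> - t) / \<tau>))"
  have [measurable]: "\<Phi> \<in> borel_measurable borel" by (simp add: \<Phi>_def)
  have Lip: "\<bar>\<Phi> s - \<Phi> t\<bar> \<le> \<bar>s - t\<bar>" for s t
  proof -
    have "\<bar>\<Phi> s - \<Phi> t\<bar> = \<tau> * \<bar>soft ((\<kappa> - s) / \<tau>) - soft ((\<kappa> - t) / \<tau>)\<bar>"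
      using \<tau> by (simp add: \<Phi>_def abs_mult right_diff_distrib[symmetric])
    also have "\<dots> \<le> \<tau> * \<bar>(\<kappa> - s) / \<tau> - (\<kappa> - t) / \<tau>\<bar>"
      using \<tau> by (intro mult_left_mono soft_Lipschitz) auto
    also have "\<dots> = \<bar>s - t\<bar>"
      using \<tau> by (simp add: diff_divide_distrib[symmetric])
    finally show ?thesis .
  qed
  have D: "(\<Phi> has_real_derivative - soft' ((\<kappa> - t) / \<tau>)) (at t)" for t
    unfolding \<Phi>_def using \<tau> by (auto intro!: derivative_eq_intros DERIV_chain2[OF soft_DERIV])
  have s\<Phi>: "smooth (\<lambda>x. \<Phi> (p n x))" for n
    unfolding \<Phi>_def
    by (intro smooth_mult[OF smooth_const] smooth_compose[OF real_smooth_soft] smooth_divide smooth_diff smooth_const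
        test_functions_smooth[OF p_test])
  have g\<Phi>: "grad (\<lambda>x. \<Phi> (p n x)) x = - soft' ((\<kappa> - p n x) / \<tau>) *\<^sub>R grad (p n) x" for n x
    by (rule grad_compose(1)[OF D smooth_differentiable[OF test_functions_smooth[OF p_test]]])
  have gf: "grad (f n) x = \<Phi> (p n x) *\<^sub>R grad \<eta> x + (- \<eta> x * soft' ((\<kappa> - p n x) / \<tau>)) *\<^sub>R grad (p n) x" for n x
  proof -
    have "f n = (\<lambda>x. \<eta> x * \<Phi> (p n x))" by (simp add: f_def \<Phi>_def)
    then show ?thesis
      using grad_mult[OF smooth_differentiable[OF test_functions_smooth[OF \<eta>]] smooth_differentiable[OF s\<Phi>]]
      by (simp add: g\<Phi>)
  qed
  show "open \<Omega>" "bounded \<Omega>" by (rule \<Omega>_open \<Omega>_bounded)+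
  show f_test: "f n \<in> test_functions \<Omega>" for n
    using test_functions_mult[OF s\<Phi> \<eta>, of n] by (simp add: f_def \<Phi>_def mult.commute)
  show "F x = 0" if "x \<notin> \<Omega>" for x using test_functions_outside[OF \<eta> that] by (simp add: F_def)
  show "AE x in lborel. (\<lambda>n. f n x) \<longlonglongrightarrow> F x"
    using p_lim
  proof eventually_elim
    case (elim x)
    show ?case unfolding f_def F_def using \<tau>
      by (intro tendsto_intros continuous_on_tendsto_compose[OF soft_continuous] elim) auto
  qed
  show "L2_tendsto lborel f F"
  proof (rule L2_tendsto_dominated[OF p_L2])
    show "f n \<in> borel_measurable lborel" "F \<in> borel_measurable lborel" for n
      unfolding f_def F_def by simp_all
    show "integrable lborel (\<lambda>x. (norm (f n x))\<^sup>2)" for n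
      using test_functions_integrable(2)[OF f_test] by simp
    show "norm (f n x - F x) \<le> M * norm (p n x - P x)" for n x
    proof -
      have "f n x - F x = \<eta> x * (\<Phi> (p n x) - \<Phi> (P x))" by (simp add: f_def F_def \<Phi>_def algebra_simps)
      then have "norm (f n x - F x) = norm (\<eta> x) * \<bar>\<Phi> (p n x) - \<Phi> (P x)\<bar>" by (simp add: abs_mult)
      also have "\<dots> \<le> M * \<bar>p n x - P x\<bar>" using M Lip by (intro mult_mono) auto
      finally show ?thesis by simp
    qed
  qed
  have "L2_tendsto lborel (\<lambda>n x. \<Phi> (p n x) *\<^sub>R grad \<eta> x) (\<lambda>x. \<Phi> (P x) *\<^sub>R grad \<eta> x)"
  proof (rule L2_tendsto_dominated[OF p_L2])
    show "integrable lborel (\<lambda>x. (norm (\<Phi> (p n x) *\<^sub>R grad \<eta> x))\<^sup>2)" for n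
      using smooth_continuous[OF s\<Phi>] test_functions_continuous_grad[OF \<eta>] K
      by (intro compact_support_integrable[of _ K] continuous_intros) auto
    show "norm (\<Phi> (p n x) *\<^sub>R grad \<eta> x - \<Phi> (P x) *\<^sub>R grad \<eta> x) \<le> M' * norm (p n x - P x)" for n x
      using mult_mono[OF Lip[of "p n x" "P x"] M'(2)[of x]] 
      by (simp add: scaleR_diff_left[symmetric] mult.commute)
  qed auto
  moreover have "L2_tendsto lborel (\<lambda>n x. (- \<eta> x * soft' ((\<kappa> - p n x) / \<tau>)) *\<^sub>R grad (p n) x)
      (\<lambda>x. (- \<eta> x * soft' ((\<kappa> - P x) / \<tau>)) *\<^sub>R G x)"
  proof (rule L2_tendsto_bounded_scale[OF grad_L2])
    have b: "\<bar>- \<eta> x * soft' t\<bar> \<le> M" for x t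
      using mult_mono[OF M(2)[of x] soft'_le_1[of t]] M(1) soft'_nonneg[of t] by (simp add: abs_mult)
    show "\<bar>- \<eta> x * soft' ((\<kappa> - p n x) / \<tau>)\<bar> \<le> M" "\<bar>- \<eta> x * soft' ((\<kappa> - P x) / \<tau>)\<bar> \<le> M" for n x
      by (rule b)+
    show "AE x in lborel. (\<lambda>n. - \<eta> x * soft' ((\<kappa> - p n x) / \<tau>)) \<longlonglongrightarrow> - \<eta> x * soft' ((\<kappa> - P x) / \<tau>)"
      using p_lim
    proof eventually_elim
      case (elim x)
      show ?case using \<tau>
        by (intro tendsto_intros continuous_on_tendsto_compose[OF soft'_continuous] elim) auto
    qed
  qed auto
  ultimately show "L2_tendsto lborel (\<lambda>n. grad (f n)) H"
    unfolding H_def gf[abs_def] \<Phi>_def by (rule L2_tendsto_add)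
qed

end

section \<open>Lower bounds for supersolutions\<close>

lemma weighted_AM_GM:
  assumes "0 < (\<alpha>::real)"
  shows "2 * (x * y) \<le> \<alpha> / 2 * x\<^sup>2 + 2 / \<alpha> * y\<^sup>2"
proof -
  have "0 \<le> (\<alpha> * x - 2 * y)\<^sup>2 / (2 * \<alpha>)" using assms by simp
  also have "\<dots> = \<alpha> / 2 * x\<^sup>2 + 2 / \<alpha> * y\<^sup>2 - 2 * (x * y)"
    using assms by (simp add: field_simps power2_eq_square)
  finally show ?thesis by simp
qed

text \<open>\<open>B\<close> plays the role of the flux, the coefficient matrix applied to the
  gradient. Coercivity, a linear bound and the sign against nonnegative test functions are all that
  De Giorgi's method asks of it; symmetry or linearity in the gradient is not assumed.\<close>

locale supersolution = H1_limit \<Omega> p P G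
  for \<Omega> :: "(real^'n) set" and p P G +
  fixes B :: "real^'n \<Rightarrow> real^'n" and \<alpha> C :: real
  assumes \<alpha>_pos: "0 < \<alpha>"
    and B_borel [measurable]: "B \<in> borel_measurable borel"
    and B_sq: "integrable lborel (\<lambda>x. (norm (B x))\<^sup>2)"
    and coercive: "AE x in lborel. \<alpha> * (norm (G x))\<^sup>2 \<le> B x \<bullet> G x"
    and B_le: "AE x in lborel. norm (B x) \<le> C * norm (G x)"
    and super: "\<phi> \<in> test_functions \<Omega> \<Longrightarrow> (\<And>x. 0 \<le> \<phi> x) \<Longrightarrow> 0 \<le> (\<integral>x. B x \<bullet> grad \<phi> x \<partial>lborel)"
begin

text \<open>The constant in the energy bound for a truncation times a cut-off: the two parts of its
  gradient contribute 2 and, through the Caccioppoli inequality, twice 4 C^2 / \<alpha>^2.\<close>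

definition K where "K = 2 + 8 * C\<^sup>2 / \<alpha>\<^sup>2"

lemma K_ge_2: "2 \<le> K"
  by (simp add: K_def)

lemma integrable_truncation:
  assumes \<eta>: "continuous_on UNIV \<eta>" "compact L" "L \<subseteq> \<Omega>" "\<And>x. x \<notin> L \<Longrightarrow> \<eta> x = (0::real)"
  shows "integrable lborel (\<lambda>x. (max 0 (\<kappa> - P x))\<^sup>2 * (\<eta> x)\<^sup>2)"
    "integrable lborel (\<lambda>x. max 0 (\<kappa> - P x) * \<bar>\<eta> x\<bar>)"
proof -
  obtain M where M: "\<And>x. norm (\<eta> x) \<le> M"
    using compact_support_bounded[OF \<eta>(1,2,4)] by metis
  have [measurable]: "\<eta> \<in> borel_measurable borel" using \<eta>(1) by (rule borel_measurable_continuous_onI)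
  have \<eta>0: "\<eta> x = 0" if "x \<notin> \<Omega>" for x using that \<eta> by blast
  have iP: "integrable lborel (\<lambda>x. (P x)\<^sup>2)" using L2_tendstoD(4)[OF p_L2] by simp
  show sq: "integrable lborel (\<lambda>x. (max 0 (\<kappa> - P x))\<^sup>2 * (\<eta> x)\<^sup>2)"
  proof (rule Bochner_Integration.integrable_bound)
    show "integrable lborel (\<lambda>x. (2 * \<kappa>\<^sup>2 * M\<^sup>2) * indicator \<Omega> x + 2 * M\<^sup>2 * (P x)\<^sup>2)"
      by (intro Bochner_Integration.integrable_add integrable_indicator_\<Omega>) (use iP in simp)
    show "AE x in lborel. norm ((max 0 (\<kappa> - P x))\<^sup>2 * (\<eta> x)\<^sup>2) \<le> norm ((2 * \<kappa>\<^sup>2 * M\<^sup>2) * indicator \<Omega> x + 2 * M\<^sup>2 * (P x)\<^sup>2)"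
    proof (intro AE_I2)
      fix x
      show "norm ((max 0 (\<kappa> - P x))\<^sup>2 * (\<eta> x)\<^sup>2) \<le> norm ((2 * \<kappa>\<^sup>2 * M\<^sup>2) * indicator \<Omega> x + 2 * M\<^sup>2 * (P x)\<^sup>2)"
      proof (cases "x \<in> \<Omega>")
        case True
        have "(max 0 (\<kappa> - P x))\<^sup>2 \<le> (\<kappa> - P x)\<^sup>2" by (auto simp: max_def)
        also have "\<dots> \<le> 2 * \<kappa>\<^sup>2 + 2 * (P x)\<^sup>2" using sq_norm_diff_le[of \<kappa> "P x"] by simp
        finally have "(max 0 (\<kappa> - P x))\<^sup>2 * (\<eta> x)\<^sup>2 \<le> (2 * \<kappa>\<^sup>2 + 2 * (P x)\<^sup>2) * M\<^sup>2"
          using power_mono[OF M[of x], of 2] by (intro mult_mono) auto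
        then show ?thesis using True by (simp add: algebra_simps)
      qed (simp add: \<eta>0)
    qed
  qed auto
  show "integrable lborel (\<lambda>x. max 0 (\<kappa> - P x) * \<bar>\<eta> x\<bar>)"
    by (rule integrable_of_sq) (use sq \<eta>0 in \<open>auto simp: power_mult_distrib\<close>)
qed

lemma truncation_ball_integrable:
  assumes "ball a r \<subseteq> \<Omega>"
  shows "integrable lborel (\<lambda>x. indicator (ball a r) x * (max 0 (k - P x))\<^sup>2)"
proof (rule Bochner_Integration.integrable_bound)
  have [measurable]: "ball a r \<in> sets borel" by simp
  show "(\<lambda>x. indicator (ball a r) x * (max 0 (k - P x))\<^sup>2) \<in> borel_measurable lborel" by measurable
  show "integrable lborel (\<lambda>x. (2 * k\<^sup>2) * indicator \<Omega> x + 2 * (P x)\<^sup>2)"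
    using L2_tendstoD(4)[OF p_L2] by (intro Bochner_Integration.integrable_add integrable_indicator_\<Omega>) simp
  show "AE x in lborel. norm (indicator (ball a r) x * (max 0 (k - P x))\<^sup>2) \<le> norm ((2 * k\<^sup>2) * indicator \<Omega> x + 2 * (P x)\<^sup>2)"
  proof (intro AE_I2)
    fix x
    have "(max 0 (k - P x))\<^sup>2 \<le> (k - P x)\<^sup>2" by (auto simp: max_def)
    also have "\<dots> \<le> 2 * k\<^sup>2 + 2 * (P x)\<^sup>2" using sq_norm_diff_le[of k "P x"] by simp
    finally have "(max 0 (k - P x))\<^sup>2 \<le> 2 * k\<^sup>2 + 2 * (P x)\<^sup>2" .
    then show "norm (indicator (ball a r) x * (max 0 (k - P x))\<^sup>2) \<le> norm ((2 * k\<^sup>2) * indicator \<Omega> x + 2 * (P x)\<^sup>2)"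
      using assms by (auto simp: indicator_def)
  qed
qed

lemma truncation_times_gradient_integrable:
  assumes \<eta>: "\<eta> \<in> test_functions \<Omega>"
  shows "integrable lborel (\<lambda>x. (max 0 (\<kappa> - P x))\<^sup>2 * (norm (grad \<eta> x))\<^sup>2)"
proof -
  obtain L where L: "compact L" "L \<subseteq> \<Omega>" "\<And>x. x \<notin> L \<Longrightarrow> grad \<eta> x = 0"
    using \<eta> test_functionsE by metis
  show ?thesis
    by (rule integrable_truncation(1)[of _ L])
      (use L in \<open>auto intro!: continuous_intros test_functions_continuous_grad[OF \<eta>]\<close>)
qed

text \<open>The equation is tested with the square of the cut-off times the softened positive part
  of \<open>\<kappa> - P\<close>, as a limit of test functions. Coercivity produces the left-hand
  side; the cross term is split by the weighted arithmetic-geometric inequality so that half of the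
  coercive term absorbs one part.\<close>

lemma Caccioppoli:
  assumes \<eta>: "\<eta> \<in> test_functions \<Omega>" and \<tau>: "0 < \<tau>"
  shows "(\<integral>x. (\<eta> x)\<^sup>2 * soft' ((\<kappa> - P x) / \<tau>) * (norm (G x))\<^sup>2 \<partial>lborel)
      \<le> 4 * C\<^sup>2 / \<alpha>\<^sup>2 * (\<integral>x. (max 0 (\<kappa> - P x))\<^sup>2 * (norm (grad \<eta> x))\<^sup>2 \<partial>lborel)"
    and "integrable lborel (\<lambda>x. (\<eta> x)\<^sup>2 * soft' ((\<kappa> - P x) / \<tau>) * (norm (G x))\<^sup>2)"
proof -
  have [measurable]: "\<eta> \<in> borel_measurable borel" "grad \<eta> \<in> borel_measurable borel"
    using test_functions_borel[OF \<eta>] test_functions_borel_grad[OF \<eta>] by auto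
  have [measurable]: "soft \<in> borel_measurable borel" "soft' \<in> borel_measurable borel"
    by (auto intro: borel_measurable_continuous_onI soft_continuous soft'_continuous)
  obtain L where L: "compact L" "L \<subseteq> \<Omega>" "\<And>x. x \<notin> L \<Longrightarrow> \<eta> x = 0"
    using \<eta> test_functionsE by metis
  obtain M where M: "\<And>x. norm (\<eta> x) \<le> M"
    using compact_support_bounded[OF test_functions_continuous[OF \<eta>] L(1,3)] by metis
  define \<eta>2 where "\<eta>2 = (\<lambda>x. \<eta> x * \<eta> x)"
  have \<eta>2: "\<eta>2 \<in> test_functions \<Omega>"
    unfolding \<eta>2_def by (intro test_functions_mult \<eta> test_functions_smooth[OF \<eta>])
  have g\<eta>2: "grad \<eta>2 x = (2 * \<eta> x) *\<^sub>R grad \<eta> x" for x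
    unfolding \<eta>2_def
    by (subst grad_mult) (auto intro: smooth_differentiable test_functions_smooth[OF \<eta>] simp: scaleR_2[symmetric])
  define f where "f = (\<lambda>n x. \<eta>2 x * (\<tau> * soft ((\<kappa> - p n x) / \<tau>)))"
  define s where "s = (\<lambda>x. soft' ((\<kappa> - P x) / \<tau>))"
  define w where "w = (\<lambda>x. max 0 (\<kappa> - P x))"
  define H where "H = (\<lambda>x. (\<tau> * soft ((\<kappa> - P x) / \<tau>)) *\<^sub>R grad \<eta>2 x + (- \<eta>2 x * s x) *\<^sub>R G x)"
  interpret L: H1_limit \<Omega> f "\<lambda>x. \<eta>2 x * (\<tau> * soft ((\<kappa> - P x) / \<tau>))" H
    unfolding f_def H_def s_def by (rule cutoff_truncation[OF \<eta>2 \<tau>])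
  have s01: "0 \<le> s x" "s x \<le> 1" for x by (simp_all add: s_def soft'_nonneg soft'_le_1)
  have [measurable]: "s \<in> borel_measurable borel" by (simp add: s_def)
  have iG: "integrable lborel (\<lambda>x. (norm (G x))\<^sup>2)" using L2_tendstoD(4)[OF grad_L2] .
  show i1: "integrable lborel (\<lambda>x. (\<eta> x)\<^sup>2 * soft' ((\<kappa> - P x) / \<tau>) * (norm (G x))\<^sup>2)"
  proof (rule Bochner_Integration.integrable_bound)
    show "integrable lborel (\<lambda>x. M\<^sup>2 * (norm (G x))\<^sup>2)" using iG by simp
    show "AE x in lborel. norm ((\<eta> x)\<^sup>2 * soft' ((\<kappa> - P x) / \<tau>) * (norm (G x))\<^sup>2) \<le> norm (M\<^sup>2 * (norm (G x))\<^sup>2)"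
    proof (intro AE_I2)
      fix x
      have "(\<eta> x)\<^sup>2 * s x \<le> M\<^sup>2 * 1"
        using power_mono[OF M[of x], of 2] s01[of x] by (intro mult_mono) auto
      then have "(\<eta> x)\<^sup>2 * s x * (norm (G x))\<^sup>2 \<le> M\<^sup>2 * (norm (G x))\<^sup>2"
        by (intro mult_right_mono) auto
      then show "norm ((\<eta> x)\<^sup>2 * soft' ((\<kappa> - P x) / \<tau>) * (norm (G x))\<^sup>2) \<le> norm (M\<^sup>2 * (norm (G x))\<^sup>2)"
        using s01[of x] by (simp add: abs_mult s_def)
    qed
  qed auto
  note i2 = truncation_times_gradient_integrable[OF \<eta>, of \<kappa>]
  have "0 \<le> (\<integral>x. B x \<bullet> H x \<partial>lborel)"
  proof (rule LIMSEQ_le_const)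
    show "(\<lambda>n. \<integral>x. B x \<bullet> grad (f n) x \<partial>lborel) \<longlonglongrightarrow> (\<integral>x. B x \<bullet> H x \<partial>lborel)"
      using B_sq by (intro L2_tendsto_inner L2_tendsto_const L.grad_L2) auto
    have "0 \<le> f n x" for n x using \<tau> soft_nonneg by (simp add: f_def \<eta>2_def)
    then show "\<exists>N. \<forall>n\<ge>N. 0 \<le> (\<integral>x. B x \<bullet> grad (f n) x \<partial>lborel)"
      using super[OF L.p_test] by blast
  qed
  also have "\<dots> \<le> (\<integral>x. 2 / \<alpha> * C\<^sup>2 * ((w x)\<^sup>2 * (norm (grad \<eta> x))\<^sup>2) - \<alpha> / 2 * ((\<eta> x)\<^sup>2 * s x * (norm (G x))\<^sup>2) \<partial>lborel)"
  proof (rule integral_mono_AE)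
    show "integrable lborel (\<lambda>x. B x \<bullet> H x)"
      using B_sq L2_tendstoD(4)[OF L.grad_L2] by (intro sq_integrable_inner) auto
    show "integrable lborel (\<lambda>x. 2 / \<alpha> * C\<^sup>2 * ((w x)\<^sup>2 * (norm (grad \<eta> x))\<^sup>2) - \<alpha> / 2 * ((\<eta> x)\<^sup>2 * s x * (norm (G x))\<^sup>2))"
      using i1 i2 unfolding w_def s_def by (intro Bochner_Integration.integrable_diff integrable_mult_right) auto
    show "AE x in lborel. B x \<bullet> H x \<le> 2 / \<alpha> * C\<^sup>2 * ((w x)\<^sup>2 * (norm (grad \<eta> x))\<^sup>2) - \<alpha> / 2 * ((\<eta> x)\<^sup>2 * s x * (norm (G x))\<^sup>2)"
      using coercive B_le
    proof eventually_elim
      case (elim x)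
      let ?\<Phi> = "\<tau> * soft ((\<kappa> - P x) / \<tau>)"
      \<comment> \<open>The bound by \<open>w x * s x\<close> puts the factor \<open>s x\<close>
        into the cross term. The energy term to be kept carries the same factor, and only therefore
        can it absorb the cross term.\<close>
      have \<Phi>: "0 \<le> ?\<Phi>" "?\<Phi> \<le> w x * s x"
        using \<tau> soft_nonneg soft_scaled_le(1)[OF \<tau>, of "\<kappa> - P x"] by (auto simp: w_def s_def)
      have w0: "0 \<le> w x" by (simp add: w_def)
      have "2 * \<eta> x * (B x \<bullet> grad \<eta> x) \<le> 2 * (\<bar>\<eta> x\<bar> * (norm (B x) * norm (grad \<eta> x)))"
        using mult_mono[OF order_refl[of "\<bar>\<eta> x\<bar>"] Cauchy_Schwarz_ineq2[of "B x" "grad \<eta> x"]]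
          abs_ge_self[of "\<eta> x * (B x \<bullet> grad \<eta> x)"] by (simp add: abs_mult)
      also have "\<dots> \<le> 2 * (\<bar>\<eta> x\<bar> * ((C * norm (G x)) * norm (grad \<eta> x)))"
        using elim by (intro mult_left_mono mult_right_mono) auto
      finally have "?\<Phi> * (2 * \<eta> x * (B x \<bullet> grad \<eta> x)) \<le> ?\<Phi> * (2 * (\<bar>\<eta> x\<bar> * ((C * norm (G x)) * norm (grad \<eta> x))))"
        using \<Phi> by (intro mult_left_mono)
      also have "\<dots> \<le> (w x * s x) * (2 * (\<bar>\<eta> x\<bar> * ((C * norm (G x)) * norm (grad \<eta> x))))"
      proof (rule mult_right_mono[OF \<Phi>(2)])
        have "0 \<le> C * norm (G x)" using elim(2) norm_ge_zero order_trans by blast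
        then show "0 \<le> 2 * (\<bar>\<eta> x\<bar> * ((C * norm (G x)) * norm (grad \<eta> x)))" by simp
      qed
      also have "\<dots> = s x * (2 * ((\<bar>\<eta> x\<bar> * norm (G x)) * (C * w x * norm (grad \<eta> x))))"
        by (simp add: mult_ac)
      also have "\<dots> \<le> s x * (\<alpha> / 2 * (\<bar>\<eta> x\<bar> * norm (G x))\<^sup>2 + 2 / \<alpha> * (C * w x * norm (grad \<eta> x))\<^sup>2)"
        by (intro mult_left_mono weighted_AM_GM \<alpha>_pos s01)
      also have "\<dots> = \<alpha> / 2 * ((\<eta> x)\<^sup>2 * s x * (norm (G x))\<^sup>2) + s x * (2 / \<alpha> * (C * w x * norm (grad \<eta> x))\<^sup>2)"
        by (simp add: power_mult_distrib algebra_simps)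
      also have "s x * (2 / \<alpha> * (C * w x * norm (grad \<eta> x))\<^sup>2) \<le> 1 * (2 / \<alpha> * (C * w x * norm (grad \<eta> x))\<^sup>2)"
        using \<alpha>_pos by (intro mult_right_mono s01) auto
      also have "1 * (2 / \<alpha> * (C * w x * norm (grad \<eta> x))\<^sup>2) = 2 / \<alpha> * C\<^sup>2 * ((w x)\<^sup>2 * (norm (grad \<eta> x))\<^sup>2)"
        by (simp add: power_mult_distrib)
      finally have A: "?\<Phi> * (2 * \<eta> x * (B x \<bullet> grad \<eta> x))
          \<le> \<alpha> / 2 * ((\<eta> x)\<^sup>2 * s x * (norm (G x))\<^sup>2) + 2 / \<alpha> * C\<^sup>2 * ((w x)\<^sup>2 * (norm (grad \<eta> x))\<^sup>2)"
        by simp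
      have "(\<eta> x)\<^sup>2 * s x * (\<alpha> * (norm (G x))\<^sup>2) \<le> (\<eta> x)\<^sup>2 * s x * (B x \<bullet> G x)"
        using elim s01 by (intro mult_left_mono) auto
      moreover have "B x \<bullet> H x = ?\<Phi> * (2 * \<eta> x * (B x \<bullet> grad \<eta> x)) - (\<eta> x)\<^sup>2 * s x * (B x \<bullet> G x)"
        unfolding H_def g\<eta>2 by (simp add: \<eta>2_def inner_add_right inner_diff_right power2_eq_square)
      moreover have "(\<eta> x)\<^sup>2 * s x * (\<alpha> * (norm (G x))\<^sup>2) = 2 * (\<alpha> / 2 * ((\<eta> x)\<^sup>2 * s x * (norm (G x))\<^sup>2))"
        by simp
      ultimately show ?case using A by linarith
    qed
  qed
  also have "\<dots> = 2 / \<alpha> * C\<^sup>2 * (\<integral>x. (w x)\<^sup>2 * (norm (grad \<eta> x))\<^sup>2 \<partial>lborel) - \<alpha> / 2 * (\<integral>x. (\<eta> x)\<^sup>2 * s x * (norm (G x))\<^sup>2 \<partial>lborel)"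
    using i1 i2 by (simp add: w_def s_def)
  finally have "\<alpha> / 2 * (\<integral>x. (\<eta> x)\<^sup>2 * s x * (norm (G x))\<^sup>2 \<partial>lborel) \<le> 2 / \<alpha> * C\<^sup>2 * (\<integral>x. (w x)\<^sup>2 * (norm (grad \<eta> x))\<^sup>2 \<partial>lborel)"
    by simp
  then have "2 / \<alpha> * (\<alpha> / 2 * (\<integral>x. (\<eta> x)\<^sup>2 * s x * (norm (G x))\<^sup>2 \<partial>lborel))
      \<le> 2 / \<alpha> * (2 / \<alpha> * C\<^sup>2 * (\<integral>x. (w x)\<^sup>2 * (norm (grad \<eta> x))\<^sup>2 \<partial>lborel))"
    using \<alpha>_pos by (intro mult_left_mono) auto
  then show "(\<integral>x. (\<eta> x)\<^sup>2 * soft' ((\<kappa> - P x) / \<tau>) * (norm (G x))\<^sup>2 \<partial>lborel)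
      \<le> 4 * C\<^sup>2 / \<alpha>\<^sup>2 * (\<integral>x. (max 0 (\<kappa> - P x))\<^sup>2 * (norm (grad \<eta> x))\<^sup>2 \<partial>lborel)"
    using \<alpha>_pos by (simp add: w_def s_def power2_eq_square mult_ac)
qed

text \<open>The Nash inequality for the cut-off truncation, with its energy replaced by means of the
  Caccioppoli inequality. As \<open>soft'\<close> lies between 0 and 1, its square in the energy is
  at most itself, the power which that inequality controls.\<close>

lemma truncation_estimate_soft:
  assumes \<eta>: "\<eta> \<in> test_functions \<Omega>" and \<tau>: "0 < \<tau>" and s: "0 < s"
  shows "(\<integral>x. (\<eta> x * (\<tau> * soft ((\<kappa> - P x) / \<tau>)))\<^sup>2 \<partial>lborel)
    \<le> K * s\<^sup>2 * (\<integral>x. (max 0 (\<kappa> - P x))\<^sup>2 * (norm (grad \<eta> x))\<^sup>2 \<partial>lborel)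
      + 2 * (\<integral>x. max 0 (\<kappa> - P x) * \<bar>\<eta> x\<bar> \<partial>lborel)\<^sup>2 / measure lborel (ball (0::real^'n) s)"
proof -
  define F where "F = (\<lambda>x. \<eta> x * (\<tau> * soft ((\<kappa> - P x) / \<tau>)))"
  define H where "H = (\<lambda>x. (\<tau> * soft ((\<kappa> - P x) / \<tau>)) *\<^sub>R grad \<eta> x + (- \<eta> x * soft' ((\<kappa> - P x) / \<tau>)) *\<^sub>R G x)"
  interpret L: H1_limit \<Omega> "\<lambda>n x. \<eta> x * (\<tau> * soft ((\<kappa> - p n x) / \<tau>))" F H
    unfolding F_def H_def by (rule cutoff_truncation[OF \<eta> \<tau>])
  define D where "D = (\<integral>x. (max 0 (\<kappa> - P x))\<^sup>2 * (norm (grad \<eta> x))\<^sup>2 \<partial>lborel)"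
  define E where "E = (\<integral>x. (\<eta> x)\<^sup>2 * soft' ((\<kappa> - P x) / \<tau>) * (norm (G x))\<^sup>2 \<partial>lborel)"
  note i1 = Caccioppoli(2)[OF \<eta> \<tau>, of \<kappa>] and i2 = truncation_times_gradient_integrable[OF \<eta>, of \<kappa>]
  obtain L where L: "compact L" "L \<subseteq> \<Omega>" "\<And>x. x \<notin> L \<Longrightarrow> \<eta> x = 0"
    using \<eta> test_functionsE by metis
  note i3 = integrable_truncation(2)[OF test_functions_continuous[OF \<eta>] L]
  have \<Phi>: "0 \<le> \<tau> * soft (t / \<tau>)" "\<tau> * soft (t / \<tau>) \<le> max 0 t" for t
    using \<tau> soft_nonneg soft_scaled_le(2)[OF \<tau>] by auto
  have "(\<integral>x. (norm (H x))\<^sup>2 \<partial>lborel) \<le> (\<integral>x. 2 * ((max 0 (\<kappa> - P x))\<^sup>2 * (norm (grad \<eta> x))\<^sup>2)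
      + 2 * ((\<eta> x)\<^sup>2 * soft' ((\<kappa> - P x) / \<tau>) * (norm (G x))\<^sup>2) \<partial>lborel)"
  proof (rule integral_mono)
    show "integrable lborel (\<lambda>x. (norm (H x))\<^sup>2)" by (rule L2_tendstoD(4)[OF L.grad_L2])
    fix x
    have "(norm (H x))\<^sup>2 \<le> 2 * (norm ((\<tau> * soft ((\<kappa> - P x) / \<tau>)) *\<^sub>R grad \<eta> x))\<^sup>2
        + 2 * (norm ((- \<eta> x * soft' ((\<kappa> - P x) / \<tau>)) *\<^sub>R G x))\<^sup>2"
      unfolding H_def by (rule sq_norm_add_le)
    also have "\<dots> = 2 * ((\<tau> * soft ((\<kappa> - P x) / \<tau>))\<^sup>2 * (norm (grad \<eta> x))\<^sup>2)
        + 2 * ((\<eta> x)\<^sup>2 * (soft' ((\<kappa> - P x) / \<tau>))\<^sup>2 * (norm (G x))\<^sup>2)"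
      by (simp add: power_mult_distrib)
    also have "\<dots> \<le> 2 * ((max 0 (\<kappa> - P x))\<^sup>2 * (norm (grad \<eta> x))\<^sup>2)
        + 2 * ((\<eta> x)\<^sup>2 * soft' ((\<kappa> - P x) / \<tau>) * (norm (G x))\<^sup>2)"
    proof (intro add_mono mult_left_mono mult_right_mono power_mono \<Phi>)
      show "(soft' ((\<kappa> - P x) / \<tau>))\<^sup>2 \<le> soft' ((\<kappa> - P x) / \<tau>)"
        using mult_left_mono[OF soft'_le_1 soft'_nonneg] by (simp add: power2_eq_square)
    qed auto
    finally show "(norm (H x))\<^sup>2 \<le> 2 * ((max 0 (\<kappa> - P x))\<^sup>2 * (norm (grad \<eta> x))\<^sup>2)
        + 2 * ((\<eta> x)\<^sup>2 * soft' ((\<kappa> - P x) / \<tau>) * (norm (G x))\<^sup>2)" .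
  qed (use i1 i2 in simp)
  also have "\<dots> = 2 * D + 2 * E" using i1 i2 by (simp add: D_def E_def)
  also have "\<dots> \<le> 2 * D + 2 * (4 * C\<^sup>2 / \<alpha>\<^sup>2 * D)"
    using Caccioppoli(1)[OF \<eta> \<tau>, of \<kappa>] by (simp add: D_def E_def)
  also have "\<dots> = K * D" by (simp add: K_def algebra_simps)
  finally have H: "(\<integral>x. (norm (H x))\<^sup>2 \<partial>lborel) \<le> K * D" .
  have "(\<integral>x. \<bar>F x\<bar> \<partial>lborel) \<le> (\<integral>x. max 0 (\<kappa> - P x) * \<bar>\<eta> x\<bar> \<partial>lborel)"
  proof (rule integral_mono)
    show "integrable lborel (\<lambda>x. \<bar>F x\<bar>)" using L.P_integrable by simp
    show "\<bar>F x\<bar> \<le> max 0 (\<kappa> - P x) * \<bar>\<eta> x\<bar>" for x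
      using mult_right_mono[OF \<Phi>(2)[of "\<kappa> - P x"], of "\<bar>\<eta> x\<bar>"] \<tau>
      by (simp add: F_def abs_mult mult.commute soft_nonneg)
  qed (rule i3)
  then have F: "(\<integral>x. \<bar>F x\<bar> \<partial>lborel)\<^sup>2 \<le> (\<integral>x. max 0 (\<kappa> - P x) * \<bar>\<eta> x\<bar> \<partial>lborel)\<^sup>2"
    by (intro power_mono) auto
  have "(\<integral>x. (F x)\<^sup>2 \<partial>lborel) \<le> s\<^sup>2 * (\<integral>x. (norm (H x))\<^sup>2 \<partial>lborel)
      + 2 * (\<integral>x. \<bar>F x\<bar> \<partial>lborel)\<^sup>2 / measure lborel (ball (0::real^'n) s)"
    by (rule L.Nash[OF s])
  also have "\<dots> \<le> s\<^sup>2 * (K * D) + 2 * (\<integral>x. max 0 (\<kappa> - P x) * \<bar>\<eta> x\<bar> \<partial>lborel)\<^sup>2 / measure lborel (ball (0::real^'n) s)"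
    using H F by (intro add_mono mult_left_mono divide_right_mono) auto
  finally show ?thesis by (simp add: F_def D_def mult_ac)
qed

text \<open>The previous bound does not depend on \<open>\<tau>\<close> on its right-hand side, so
  \<open>\<tau>\<close> may tend to 0 on the left.\<close>

lemma truncation_estimate:
  assumes \<eta>: "\<eta> \<in> test_functions \<Omega>" and s: "0 < s"
  shows "(\<integral>x. (max 0 (\<kappa> - P x))\<^sup>2 * (\<eta> x)\<^sup>2 \<partial>lborel)
    \<le> K * s\<^sup>2 * (\<integral>x. (max 0 (\<kappa> - P x))\<^sup>2 * (norm (grad \<eta> x))\<^sup>2 \<partial>lborel)
      + 2 * (\<integral>x. max 0 (\<kappa> - P x) * \<bar>\<eta> x\<bar> \<partial>lborel)\<^sup>2 / measure lborel (ball (0::real^'n) s)"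
proof -
  define \<tau> where "\<tau> = (\<lambda>n. inverse (real (Suc n)))"
  have \<tau>: "0 < \<tau> n" for n by (simp add: \<tau>_def)
  obtain L where L: "compact L" "L \<subseteq> \<Omega>" "\<And>x. x \<notin> L \<Longrightarrow> \<eta> x = 0"
    using \<eta> test_functionsE by metis
  have [measurable]: "\<eta> \<in> borel_measurable borel" by (rule test_functions_borel[OF \<eta>])
  have [measurable]: "soft \<in> borel_measurable borel"
    by (auto intro: borel_measurable_continuous_onI soft_continuous)
  have lim: "(\<lambda>n. \<integral>x. (\<eta> x * (\<tau> n * soft ((\<kappa> - P x) / \<tau> n)))\<^sup>2 \<partial>lborel) \<longlonglongrightarrow> (\<integral>x. (max 0 (\<kappa> - P x))\<^sup>2 * (\<eta> x)\<^sup>2 \<partial>lborel)"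
  proof (rule integral_dominated_convergence)
    show "integrable lborel (\<lambda>x. (max 0 (\<kappa> - P x))\<^sup>2 * (\<eta> x)\<^sup>2)"
      by (rule integrable_truncation(1)[OF test_functions_continuous[OF \<eta>] L])
    have "(\<lambda>n. \<tau> n * soft (t / \<tau> n)) \<longlonglongrightarrow> max 0 t" for t
      unfolding \<tau>_def by (rule soft_scaled_tendsto)
    then have "(\<lambda>n. (\<eta> x * (\<tau> n * soft ((\<kappa> - P x) / \<tau> n)))\<^sup>2) \<longlonglongrightarrow> (\<eta> x * max 0 (\<kappa> - P x))\<^sup>2" for x
      by (intro tendsto_power tendsto_mult tendsto_const)
    then show "AE x in lborel. (\<lambda>n. (\<eta> x * (\<tau> n * soft ((\<kappa> - P x) / \<tau> n)))\<^sup>2) \<longlonglongrightarrow> (max 0 (\<kappa> - P x))\<^sup>2 * (\<eta> x)\<^sup>2"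
      by (simp add: power_mult_distrib mult.commute)
    show "AE x in lborel. norm ((\<eta> x * (\<tau> n * soft ((\<kappa> - P x) / \<tau> n)))\<^sup>2) \<le> (max 0 (\<kappa> - P x))\<^sup>2 * (\<eta> x)\<^sup>2" for n
    proof (intro AE_I2)
      fix x
      have "(\<tau> n * soft ((\<kappa> - P x) / \<tau> n))\<^sup>2 \<le> (max 0 (\<kappa> - P x))\<^sup>2"
        using \<tau>[of n] soft_nonneg by (intro power_mono soft_scaled_le(2)[OF \<tau>]) auto
      then have "(\<eta> x)\<^sup>2 * (\<tau> n * soft ((\<kappa> - P x) / \<tau> n))\<^sup>2 \<le> (\<eta> x)\<^sup>2 * (max 0 (\<kappa> - P x))\<^sup>2"
        by (intro mult_left_mono) auto
      then show "norm ((\<eta> x * (\<tau> n * soft ((\<kappa> - P x) / \<tau> n)))\<^sup>2) \<le> (max 0 (\<kappa> - P x))\<^sup>2 * (\<eta> x)\<^sup>2"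
        by (simp add: power_mult_distrib mult.commute)
    qed
  qed auto
  show ?thesis
    by (rule LIMSEQ_le_const2[OF lim]) (use truncation_estimate_soft[OF \<eta> \<tau> s] in blast)
qed

text \<open>Where \<open>P\<close> is below the lower level \<open>\<kappa>'\<close>, its distance
  to \<open>\<kappa>\<close> exceeds \<open>\<kappa> - \<kappa>'\<close>. Hence the first moment at
  the lower level is at most the second moment at the higher level divided by the gap, and the
  squared first moment of the Nash inequality becomes quadratic in the old quantity. This gain makes
  the iteration contract.\<close>

lemma De_Giorgi_step:
  assumes "0 < r'" "r' < r" "cball a r \<subseteq> \<Omega>" "\<kappa>' < \<kappa>" "0 < s"
  shows "(\<integral>x. indicator (ball a r') x * (max 0 (\<kappa>' - P x))\<^sup>2 \<partial>lborel)
    \<le> K * s\<^sup>2 * (12 / (r - r'))\<^sup>2 * (\<integral>x. indicator (ball a r) x * (max 0 (\<kappa> - P x))\<^sup>2 \<partial>lborel)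
      + 2 * ((\<integral>x. indicator (ball a r) x * (max 0 (\<kappa> - P x))\<^sup>2 \<partial>lborel) / (\<kappa> - \<kappa>'))\<^sup>2 / measure lborel (ball (0::real^'n) s)"
proof -
  obtain \<eta> where \<eta>: "smooth \<eta>" "\<And>x. 0 \<le> \<eta> x" "\<And>x. \<eta> x \<le> 1" "\<And>x. x \<in> cball a r' \<Longrightarrow> \<eta> x = 1"
    "\<And>x. x \<notin> ball a r \<Longrightarrow> \<eta> x = 0" "\<And>x. norm (grad \<eta> x) \<le> 12 / (r - r')"
    "\<And>x. x \<notin> ball a r \<Longrightarrow> grad \<eta> x = 0"
    using cutoff_exists[OF assms(1,2), of a] by blast
  have \<eta>t: "\<eta> \<in> test_functions \<Omega>"
    using \<eta>(1,5) assms(3) by (intro test_functionsI[of _ "cball a r"]) auto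
  define Y where "Y = (\<integral>x. indicator (ball a r) x * (max 0 (\<kappa> - P x))\<^sup>2 \<partial>lborel)"
  have [measurable]: "\<eta> \<in> borel_measurable borel" by (rule test_functions_borel[OF \<eta>t])
  have "ball a r \<subseteq> \<Omega>" using assms(3) ball_subset_cball by blast
  note iY = truncation_ball_integrable[OF this]
  have mono: "(max 0 (\<kappa>' - P x))\<^sup>2 \<le> (max 0 (\<kappa> - P x))\<^sup>2" for x
    using assms(4) by (intro power_mono) auto
  have iw: "integrable lborel (\<lambda>x. (max 0 (\<kappa>' - P x))\<^sup>2 * (\<eta> x)\<^sup>2)" "integrable lborel (\<lambda>x. max 0 (\<kappa>' - P x) * \<bar>\<eta> x\<bar>)"
    by (rule integrable_truncation[of _ "cball a r"]; use \<eta>(5) assms(3) smooth_continuous[OF \<eta>(1)] in auto)+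
  have A: "(\<integral>x. indicator (ball a r') x * (max 0 (\<kappa>' - P x))\<^sup>2 \<partial>lborel) \<le> (\<integral>x. (max 0 (\<kappa>' - P x))\<^sup>2 * (\<eta> x)\<^sup>2 \<partial>lborel)"
  proof (rule integral_mono_AE')
    show "AE x in lborel. indicator (ball a r') x * (max 0 (\<kappa>' - P x))\<^sup>2 \<le> (max 0 (\<kappa>' - P x))\<^sup>2 * (\<eta> x)\<^sup>2"
      using \<eta>(4) by (intro AE_I2) (auto simp: indicator_def)
  qed (use iw in auto)
  have D: "(\<integral>x. (max 0 (\<kappa>' - P x))\<^sup>2 * (norm (grad \<eta> x))\<^sup>2 \<partial>lborel) \<le> (12 / (r - r'))\<^sup>2 * Y"
  proof -
    have "(\<integral>x. (max 0 (\<kappa>' - P x))\<^sup>2 * (norm (grad \<eta> x))\<^sup>2 \<partial>lborel)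
        \<le> (\<integral>x. (12 / (r - r'))\<^sup>2 * (indicator (ball a r) x * (max 0 (\<kappa> - P x))\<^sup>2) \<partial>lborel)"
    proof (rule integral_mono)
      fix x
      show "(max 0 (\<kappa>' - P x))\<^sup>2 * (norm (grad \<eta> x))\<^sup>2 \<le> (12 / (r - r'))\<^sup>2 * (indicator (ball a r) x * (max 0 (\<kappa> - P x))\<^sup>2)"
      proof (cases "x \<in> ball a r")
        case True
        have "(max 0 (\<kappa>' - P x))\<^sup>2 * (norm (grad \<eta> x))\<^sup>2 \<le> (max 0 (\<kappa> - P x))\<^sup>2 * (12 / (r - r'))\<^sup>2"
          by (intro mult_mono mono power_mono \<eta>(6)) auto
        then show ?thesis using True by (simp add: mult.commute)
      qed (simp add: \<eta>(7))
    qed (use truncation_times_gradient_integrable[OF \<eta>t] iY in auto)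
    then show ?thesis by (simp add: Y_def)
  qed
  have E: "(\<integral>x. max 0 (\<kappa>' - P x) * \<bar>\<eta> x\<bar> \<partial>lborel) \<le> Y / (\<kappa> - \<kappa>')"
  proof -
    have "(\<integral>x. max 0 (\<kappa>' - P x) * \<bar>\<eta> x\<bar> \<partial>lborel)
        \<le> (\<integral>x. (indicator (ball a r) x * (max 0 (\<kappa> - P x))\<^sup>2) / (\<kappa> - \<kappa>') \<partial>lborel)"
    proof (rule integral_mono)
      fix x
      show "max 0 (\<kappa>' - P x) * \<bar>\<eta> x\<bar> \<le> (indicator (ball a r) x * (max 0 (\<kappa> - P x))\<^sup>2) / (\<kappa> - \<kappa>')"
      proof (cases "x \<in> ball a r \<and> P x < \<kappa>'")
        case True
        have "max 0 (\<kappa>' - P x) * \<bar>\<eta> x\<bar> \<le> (\<kappa>' - P x) * 1"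
          using True \<eta>(2,3)[of x] by (intro mult_mono) auto
        also have "\<dots> \<le> (\<kappa> - P x)\<^sup>2 / (\<kappa> - \<kappa>')"
        proof -
          have "(\<kappa>' - P x) * (\<kappa> - \<kappa>') \<le> (\<kappa> - P x) * (\<kappa> - P x)"
            using True assms(4) by (intro mult_mono) auto
          then show ?thesis using assms(4) by (simp add: pos_le_divide_eq power2_eq_square)
        qed
        finally show ?thesis using True assms(4) by simp
      next
        case False
        then have "max 0 (\<kappa>' - P x) * \<bar>\<eta> x\<bar> = 0" using \<eta>(5)[of x] by auto
        also have "0 \<le> (indicator (ball a r) x * (max 0 (\<kappa> - P x))\<^sup>2) / (\<kappa> - \<kappa>')"
          using assms(4) by simp
        finally show ?thesis .
      qed
    qed (use iw iY in auto)
    then show ?thesis by (simp add: Y_def)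
  qed
  have "(\<integral>x. (max 0 (\<kappa>' - P x))\<^sup>2 * (\<eta> x)\<^sup>2 \<partial>lborel) \<le> K * s\<^sup>2 * ((12 / (r - r'))\<^sup>2 * Y)
      + 2 * (Y / (\<kappa> - \<kappa>'))\<^sup>2 / measure lborel (ball (0::real^'n) s)"
  proof (rule order_trans[OF truncation_estimate[OF \<eta>t assms(5), of \<kappa>']])
    have "0 \<le> (\<integral>x. max 0 (\<kappa>' - P x) * \<bar>\<eta> x\<bar> \<partial>lborel)" by simp
    then show "K * s\<^sup>2 * (\<integral>x. (max 0 (\<kappa>' - P x))\<^sup>2 * (norm (grad \<eta> x))\<^sup>2 \<partial>lborel)
        + 2 * (\<integral>x. max 0 (\<kappa>' - P x) * \<bar>\<eta> x\<bar> \<partial>lborel)\<^sup>2 / measure lborel (ball (0::real^'n) s)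
      \<le> K * s\<^sup>2 * ((12 / (r - r'))\<^sup>2 * Y) + 2 * (Y / (\<kappa> - \<kappa>'))\<^sup>2 / measure lborel (ball (0::real^'n) s)"
      using D E K_ge_2 by (intro add_mono mult_left_mono divide_right_mono power_mono) auto
  qed
  with A show ?thesis by (simp add: Y_def mult.assoc)
qed

text \<open>The step is iterated over radii and levels whose gaps decay like \<open>(1/2)^j\<close>. Choosing \<open>s\<close>
  proportional to the gap of the radii, times a small constant \<open>e\<close>, makes the linear term of the step a
  contraction, so that the integrals decay geometrically as soon as the first one is small.\<close>

lemma De_Giorgi:
  obtains \<delta> where "0 < \<delta>"
    "\<And>a r \<kappa> \<theta>. 0 < r \<Longrightarrow> cball a r \<subseteq> \<Omega> \<Longrightarrow> 0 < \<theta> \<Longrightarrow>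
      (\<integral>x. indicator (ball a r) x * (max 0 (\<kappa> - P x))\<^sup>2 \<partial>lborel) \<le> \<delta> * \<theta>\<^sup>2 * r ^ CARD('n) \<Longrightarrow>
      AE x in lborel. x \<in> ball a (r / 2) \<longrightarrow> \<kappa> - \<theta> \<le> P x"
proof -
  define N where "N = CARD('n)"
  define V where "V = measure lborel (ball (0::real^'n) 1)"
  have V: "0 < V" using content_ball_pos[of 1 "0::real^'n"] by (simp add: V_def)
  have Vs: "measure lborel (ball (0::real^'n) s) = s ^ N * V" if "0 < s" for s
    using content_ball_conv_unit_ball[of s "0::real^'n"] that by (simp add: V_def N_def)
  \<comment> \<open>This ratio cancels the growth of the quadratic term: 4^j comes from the squared
    gap of the levels and 2^(N j) from the volume of a ball whose radius halves at each
    step.\<close>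
  define q where "q = 1 / (4 * 2 ^ N :: real)"
  have q: "0 < q" "q * (4 * 2 ^ N) = 1" by (auto simp: q_def)
  \<comment> \<open>The gap of the radii is r/4 times (1/2)^j and the cut-off constant is 12, whence
    48 = 12 * 4. Since 4608 = 2 * 48^2, the linear coefficient K 48^2 e^2 equals q / 2.\<close>
  define e where "e = sqrt (q / (4608 * K))"
  have e: "0 < e" "K * 48\<^sup>2 * e\<^sup>2 = q / 2" using K_ge_2 q by (auto simp: e_def)
  \<comment> \<open>Chosen so that the coefficient 8 \<open>\<delta>\<close> / (V e^N) of the
    quadratic term is also q / 2; the two halves add up to a contraction by
    \<open>q\<close>.\<close>
  define \<delta> where "\<delta> = q * V * e ^ N / 16"
  have \<delta>: "0 < \<delta>" using q V e by (simp add: \<delta>_def)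
  show ?thesis
  proof (rule that[OF \<delta>])
    fix a :: "real^'n" and r \<kappa> \<theta> :: real
    assume r: "0 < r" and sub: "cball a r \<subseteq> \<Omega>" and \<theta>: "0 < \<theta>"
      and Y0: "(\<integral>x. indicator (ball a r) x * (max 0 (\<kappa> - P x))\<^sup>2 \<partial>lborel) \<le> \<delta> * \<theta>\<^sup>2 * r ^ CARD('n)"
    \<comment> \<open>The radii fall from \<open>r\<close> to \<open>r / 2\<close> and the levels
      \<open>k\<close> from \<open>\<kappa>\<close> to \<open>\<kappa> - \<theta>\<close>, so every
      integral of the sequence dominates the one over the half ball at the final level.\<close>
    define R where "R = (\<lambda>j::nat. r / 2 * (1 + (1/2)^j))"
    define k where "k = (\<lambda>j::nat. \<kappa> - \<theta> * (1 - (1/2)^j))"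
    define Y where "Y = (\<lambda>j. \<integral>x. indicator (ball a (R j)) x * (max 0 (k j - P x))\<^sup>2 \<partial>lborel)"
    have R: "0 < R j" "R (Suc j) < R j" "R j \<le> r" "r / 2 \<le> R j" "R j - R (Suc j) = r / 4 * (1/2)^j" for j
    proof -
      define z where "z = r * (1/2)^j"
      have "0 < z" using r by (simp add: z_def)
      moreover have "z \<le> r"
        using mult_left_mono[OF power_le_one[of "1/2::real" j], of r] r by (simp add: z_def)
      moreover have "R j = r / 2 + z / 2" "R (Suc j) = r / 2 + z / 4" "r / 4 * (1/2)^j = z / 4"
        by (simp_all add: R_def z_def algebra_simps)
      ultimately show "0 < R j" "R (Suc j) < R j" "R j \<le> r" "r / 2 \<le> R j" "R j - R (Suc j) = r / 4 * (1/2)^j"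
        using r by linarith+
    qed
    have k: "k (Suc j) < k j" "k j - k (Suc j) = \<theta> / 2 * (1/2)^j" for j
      using \<theta> by (auto simp: k_def algebra_simps)
    have Ynn: "0 \<le> Y j" for j by (simp add: Y_def)
    have step: "Y (Suc j) \<le> q / 2 * Y j + 8 / (V * e ^ N) * (4 * 2 ^ N) ^ j / (\<theta>\<^sup>2 * r ^ N) * (Y j)\<^sup>2" for j
    proof -
      define s where "s = r * e * (1/2)^j"
      have s: "0 < s" using r e by (simp add: s_def)
      have "Y (Suc j) \<le> K * s\<^sup>2 * (12 / (R j - R (Suc j)))\<^sup>2 * Y j
          + 2 * (Y j / (k j - k (Suc j)))\<^sup>2 / measure lborel (ball (0::real^'n) s)"
        unfolding Y_def
      proof (rule De_Giorgi_step[OF R(1) R(2) _ k(1) s])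
        show "cball a (R j) \<subseteq> \<Omega>" using sub subset_cball[OF R(3), of a j] by blast
      qed
      also have "K * s\<^sup>2 * (12 / (R j - R (Suc j)))\<^sup>2 * Y j = (K * 48\<^sup>2 * e\<^sup>2) * Y j"
        unfolding R(5) s_def using r by (simp add: field_simps power2_eq_square)
      also have "K * 48\<^sup>2 * e\<^sup>2 = q / 2" by (rule e)
      also have "2 * (Y j / (k j - k (Suc j)))\<^sup>2 / measure lborel (ball (0::real^'n) s)
          = 8 / (V * e ^ N) * (4 * 2 ^ N) ^ j / (\<theta>\<^sup>2 * r ^ N) * (Y j)\<^sup>2"
      proof -
        have a: "((1/2::real)^j) ^ N = 1 / (2 ^ N) ^ j" by (simp add: power_one_over power_mult[symmetric] mult.commute)
        have b: "((1/2::real)^j)\<^sup>2 = 1 / 4 ^ j" by (simp add: power_one_over power2_eq_square power_mult_distrib[symmetric])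
        have "2 * (Y j / (k j - k (Suc j)))\<^sup>2 = 8 * 4 ^ j * (Y j)\<^sup>2 / \<theta>\<^sup>2"
          unfolding k(2) using b by (simp add: power_divide power_mult_distrib field_simps)
        moreover have "measure lborel (ball (0::real^'n) s) = r ^ N * e ^ N / (2 ^ N) ^ j * V"
          by (subst Vs[OF s]) (simp add: s_def power_mult_distrib a)
        ultimately show ?thesis using r e V by (simp add: power_mult_distrib) (simp add: mult_ac)
      qed
      finally show ?thesis .
    qed
    have bound: "Y j \<le> \<delta> * \<theta>\<^sup>2 * r ^ N * q ^ j" for j
    proof (induction j)
      case 0
      have "R 0 = r" "k 0 = \<kappa>" by (simp_all add: R_def k_def)
      then show ?case using Y0 by (simp add: Y_def N_def)
    next
      case (Suc j)
      define Z where "Z = \<delta> * \<theta>\<^sup>2 * r ^ N * q ^ j"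
      have Z0: "0 \<le> Z" using \<delta> r q by (simp add: Z_def)
      have "Y (Suc j) \<le> q / 2 * Y j + 8 / (V * e ^ N) * (4 * 2 ^ N) ^ j / (\<theta>\<^sup>2 * r ^ N) * (Y j)\<^sup>2" by (rule step)
      also have "\<dots> \<le> q / 2 * Z + 8 / (V * e ^ N) * (4 * 2 ^ N) ^ j / (\<theta>\<^sup>2 * r ^ N) * Z\<^sup>2"
        using Suc Ynn[of j] q V e r by (intro add_mono mult_left_mono power_mono) (auto simp: Z_def)
      also have "8 / (V * e ^ N) * (4 * 2 ^ N) ^ j / (\<theta>\<^sup>2 * r ^ N) * Z\<^sup>2
          = 8 / (V * e ^ N) * \<delta> * ((q * (4 * 2 ^ N)) ^ j) * Z"
        using r \<theta> V e by (simp add: Z_def power2_eq_square power_mult_distrib field_simps)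
      also have "\<dots> = q / 2 * Z"
        using V e unfolding q(2) by (simp add: \<delta>_def)
      also have "q / 2 * Z + q / 2 * Z = q * Z" by simp
      finally show ?case by (simp add: Z_def mult_ac)
    qed
    define Y' where "Y' = (\<integral>x. indicator (ball a (r / 2)) x * (max 0 (\<kappa> - \<theta> - P x))\<^sup>2 \<partial>lborel)"
    have iY: "integrable lborel (\<lambda>x. indicator (ball a \<rho>) x * (max 0 (c - P x))\<^sup>2)" if "\<rho> \<le> r" for \<rho> c
      by (rule truncation_ball_integrable) (use sub subset_ball[OF that, of a] ball_subset_cball in blast)
    have "Y' \<le> Y j" for j
      unfolding Y'_def Y_def
    proof (rule integral_mono)
      show "integrable lborel (\<lambda>x. indicator (ball a (r / 2)) x * (max 0 (\<kappa> - \<theta> - P x))\<^sup>2)"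
        "integrable lborel (\<lambda>x. indicator (ball a (R j)) x * (max 0 (k j - P x))\<^sup>2)"
        using r R(3) by (auto intro!: iY)
      fix x
      have "\<kappa> - \<theta> \<le> k j" using \<theta> by (simp add: k_def algebra_simps)
      moreover have "indicator (ball a (r / 2)) x \<le> (indicator (ball a (R j)) x :: real)"
        using subset_ball[OF R(4), of a j] by (auto simp: indicator_def)
      ultimately show "indicator (ball a (r / 2)) x * (max 0 (\<kappa> - \<theta> - P x))\<^sup>2 \<le> indicator (ball a (R j)) x * (max 0 (k j - P x))\<^sup>2"
        by (intro mult_mono power_mono) auto
    qed
    then have "Y' \<le> \<delta> * \<theta>\<^sup>2 * r ^ N * q ^ j" for j using bound order_trans by blast
    moreover have "(\<lambda>j. \<delta> * \<theta>\<^sup>2 * r ^ N * q ^ j) \<longlonglongrightarrow> \<delta> * \<theta>\<^sup>2 * r ^ N * 0"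
    proof (intro tendsto_mult tendsto_const LIMSEQ_realpow_zero)
      have "1 * 1 < 4 * (2::real) ^ N" by (intro mult_less_le_imp_less) auto
      then show "q < 1" by (simp add: q_def)
    qed (use q in simp)
    ultimately have "Y' \<le> \<delta> * \<theta>\<^sup>2 * r ^ N * 0" by (intro LIMSEQ_le_const) auto
    moreover have "0 \<le> Y'" by (simp add: Y'_def)
    ultimately have "Y' = 0" by simp
    then have "AE x in lborel. indicator (ball a (r / 2)) x * (max 0 (\<kappa> - \<theta> - P x))\<^sup>2 = 0"
      unfolding Y'_def using r by (subst (asm) integral_nonneg_eq_0_iff_AE) (auto intro!: iY)
    then show "AE x in lborel. x \<in> ball a (r / 2) \<longrightarrow> \<kappa> - \<theta> \<le> P x"
      by eventually_elim (auto simp: indicator_def max_def split: if_splits)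
  qed
qed

end

section \<open>Measures of finite energy\<close>

lemma AE_lborel_translate:
  fixes x :: "'a::euclidean_space"
  assumes "AE y in lborel. Q y"
  shows "AE h in lborel. Q (x + h)"
proof -
  obtain N where N: "{y. \<not> Q y} \<subseteq> N" "emeasure lborel N = 0" "N \<in> sets borel"
    using AE_E[OF assms] by auto
  have "emeasure lborel {h. x + h \<in> N} = emeasure (distr lborel borel ((+) x)) N"
    using N(3) by (subst emeasure_distr) (auto simp: vimage_def)
  also have "\<dots> = 0" using N by (simp add: lborel_distr_plus)
  finally have "{h. x + h \<in> N} \<in> null_sets lborel"
    using N(3) by (auto simp: null_sets_def)
  then show ?thesis
    by (rule AE_I') (use N(1) in auto)
qed

lemma sq_norm_add3_le: "(norm (a + b + c))\<^sup>2 \<le> 3 * ((norm a)\<^sup>2 + (norm b)\<^sup>2 + (norm (c::'a::real_normed_vector))\<^sup>2)"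
proof -
  have "(norm (a + b + c))\<^sup>2 \<le> (norm a + norm b + norm c)\<^sup>2"
    by (intro power_mono norm_triangle_le) (auto simp: norm_triangle_ineq intro: norm_triangle_mono)
  also have "\<dots> \<le> 3 * ((norm a)\<^sup>2 + (norm b)\<^sup>2 + (norm c)\<^sup>2)"
    using zero_le_power2[of "norm a - norm b"] zero_le_power2[of "norm a - norm c"] zero_le_power2[of "norm b - norm c"]
    by (simp add: power2_eq_square algebra_simps)
  finally show ?thesis .
qed

text \<open>The components of the gradient of a test function are test functions themselves, so the
  translation estimate applies to each. The constant depends on second derivatives, which is why
  this is used for one fixed member of the approximating sequence only.\<close>

lemma grad_translate_L2:
  fixes \<phi> :: "real^'n \<Rightarrow> real"
  assumes "\<phi> \<in> test_functions \<Omega>"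
  obtains M where "0 \<le> M" "\<And>h. (\<integral>x. (norm (grad \<phi> (x + h) - grad \<phi> x))\<^sup>2 \<partial>lborel) \<le> (norm h)\<^sup>2 * M"
proof -
  define M where "M = (\<Sum>i\<in>UNIV. \<integral>x. (norm (grad (\<lambda>x. grad \<phi> x $ i) x))\<^sup>2 \<partial>lborel)"
  have D: "(\<lambda>x. grad \<phi> x $ i) \<in> test_functions \<Omega>" for i by (rule test_functions_grad_nth[OF assms])
  have "(\<integral>x. (norm (grad \<phi> (x + h) - grad \<phi> x))\<^sup>2 \<partial>lborel) \<le> (norm h)\<^sup>2 * M" for h
  proof -
    have i: "integrable lborel (\<lambda>x. (grad \<phi> (x + h) $ i - grad \<phi> x $ i)\<^sup>2)" for i
    proof -
      have "integrable lborel (\<lambda>x. (norm (grad \<phi> (x + h) $ i - grad \<phi> x $ i))\<^sup>2)"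
        using test_functions_integrable(2)[OF D[of i]] lborel_integrable_translate[OF test_functions_integrable(2)[OF D[of i]], of h]
          test_functions_borel[OF D[of i]]
        by (intro sq_integrable_diff) auto
      then show ?thesis by simp
    qed
    have "(\<integral>x. (norm (grad \<phi> (x + h) - grad \<phi> x))\<^sup>2 \<partial>lborel) = (\<integral>x. (\<Sum>i\<in>UNIV. (grad \<phi> (x + h) $ i - grad \<phi> x $ i)\<^sup>2) \<partial>lborel)"
      by (intro Bochner_Integration.integral_cong refl, unfold power2_norm_eq_inner inner_vec_def)
        (simp add: power2_eq_square)
    also have "\<dots> = (\<Sum>i\<in>UNIV. \<integral>x. (grad \<phi> (x + h) $ i - grad \<phi> x $ i)\<^sup>2 \<partial>lborel)"
      using i by (rule Bochner_Integration.integral_sum)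
    also have "\<dots> \<le> (\<Sum>i\<in>UNIV. (norm h)\<^sup>2 * (\<integral>x. (norm (grad (\<lambda>x. grad \<phi> x $ i) x))\<^sup>2 \<partial>lborel))"
      by (intro sum_mono test_functions_translate_L2[OF D])
    finally show ?thesis by (simp add: M_def sum_distrib_left)
  qed
  moreover have "0 \<le> M" by (auto simp: M_def intro!: sum_nonneg)
  ultimately show ?thesis using that by blast
qed

text \<open>\<open>\<mu>\<close> acts boundedly on test functions in the gradient norm, with the
  absolute value inside the integral. Thus a sequence that is Cauchy in that norm is Cauchy in the
  first moment for \<open>\<mu>\<close>. The limit \<open>P\<close> is required to be the same
  function for \<open>\<mu>\<close> as for Lebesgue measure.\<close>

locale energy_measure = H1_limit \<Omega> p P G
  for \<Omega> :: "(real^'n) set" and p P G +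
  fixes \<mu> :: "(real^'n) measure" and c :: real
  assumes sets_\<mu> [measurable_cong]: "sets \<mu> = sets borel"
    and \<mu>_sigma_finite: "sigma_finite_measure \<mu>"
    and c_nonneg: "0 \<le> c"
    and energy: "g \<in> test_functions \<Omega> \<Longrightarrow>
      (\<integral>\<^sup>+x. ennreal \<bar>g x\<bar> \<partial>\<mu>) \<le> ennreal (c * sqrt (\<integral>x. (norm (grad g x))\<^sup>2 \<partial>lborel))"
    and p_lim_\<mu>: "AE x in \<mu>. (\<lambda>n. p n x) \<longlonglongrightarrow> P x"
begin

text \<open>Differences of translates of test functions are again test functions, so the energy bound controls
  the oscillation of the limit almost everywhere with respect to \<open>\<mu>\<close>, without a maximal function.\<close>

lemma translate_energy:
  assumes K: "compact K" "K \<subseteq> \<Omega>" "\<And>n x. x \<notin> K \<Longrightarrow> p n x = 0" and \<epsilon>: "0 < \<epsilon>"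
  obtains r0 m where "0 < r0"
    "\<And>n h. m \<le> n \<Longrightarrow> norm h < r0 \<Longrightarrow> (\<integral>\<^sup>+x. ennreal \<bar>p n (x + h) - p n x\<bar> \<partial>\<mu>) \<le> ennreal \<epsilon>"
proof -
  obtain d where d: "0 < d" "(\<Union>x\<in>K. ball x d) \<subseteq> \<Omega>"
    by (rule compact_subset_open_imp_ball_epsilon_subset[OF K(1) \<Omega>_open K(2)]) blast
  \<comment> \<open>The gradient of the translation difference splits into three parts with squared
    norms at most 4 e, e and 4 e; the square of a sum of three costs a factor 3, in all 27 e.
    Dividing by c + 1 rather than c allows c = 0.\<close>
  define e where "e = (\<epsilon> / (c + 1))\<^sup>2 / 27"
  have e: "0 < e" "c * sqrt (27 * e) \<le> \<epsilon>"
  proof -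
    show "0 < e" using \<epsilon> c_nonneg by (simp add: e_def)
    have "sqrt (27 * e) = \<epsilon> / (c + 1)" using \<epsilon> c_nonneg by (simp add: e_def)
    moreover have "c * \<epsilon> \<le> \<epsilon> * (c + 1)" using \<epsilon> by (simp add: algebra_simps)
    ultimately show "c * sqrt (27 * e) \<le> \<epsilon>" using c_nonneg by (simp add: pos_divide_le_eq)
  qed
  note G = L2_tendstoD[OF grad_L2]
  obtain m where m: "\<And>n. m \<le> n \<Longrightarrow> (\<integral>x. (norm (grad (p n) x - G x))\<^sup>2 \<partial>lborel) < e"
    using order_tendstoD(2)[OF G(5) e(1)] by (auto simp: eventually_sequentially)
  obtain M where M: "0 \<le> M" "\<And>h. (\<integral>x. (norm (grad (p m) (x + h) - grad (p m) x))\<^sup>2 \<partial>lborel) \<le> (norm h)\<^sup>2 * M"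
    by (rule grad_translate_L2[OF p_test[of m]]) blast
  \<comment> \<open>Below \<open>d\<close> the translated supports stay in \<open>\<Omega>\<close>;
    below the square root the fixed function \<open>p m\<close> changes its gradient by at most e in
    squared norm.\<close>
  define r0 where "r0 = min d (sqrt (e / (M + 1)))"
  have r0: "0 < r0" using d e M by (simp add: r0_def)
  show ?thesis
  proof (rule that[OF r0, of m])
    fix n and h :: "real^'n" assume n: "m \<le> n" and h: "norm h < r0"
    define q where "q = (\<lambda>x. p n (x + h) - p n x)"
    have sm: "smooth (p n)" by (rule test_functions_smooth[OF p_test])
    have q: "q \<in> test_functions \<Omega>"
      unfolding q_def
    proof (intro test_functions_diff p_test test_functions_translate[OF p_test K(1)])
      have "x - h \<in> ball x d" for x using h by (simp add: r0_def dist_norm)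
      then show "(\<lambda>x. x - h) ` K \<subseteq> \<Omega>" using d(2) by blast
    qed (rule K(3))
    have gq: "grad q x = grad (p n) (x + h) - grad (p n) x" for x
      unfolding q_def
      using grad_diff[OF grad_translate(2)[OF smooth_differentiable[OF sm]] smooth_differentiable[OF sm]]
        grad_translate(1)[OF smooth_differentiable[OF sm]] by metis
    define D where "D = (\<lambda>x. grad (p n) x - grad (p m) x)"
    have [measurable]: "D \<in> borel_measurable borel" unfolding D_def by simp
    have iD: "integrable lborel (\<lambda>x. (norm (D x))\<^sup>2)"
      unfolding D_def by (rule grad_difference_sq(2))
    have DA: "(\<integral>x. (norm (D x))\<^sup>2 \<partial>lborel) \<le> 4 * e"
      unfolding D_def using grad_difference_sq(1)[of n m] m[OF n] m[OF order_refl] by simp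
    have iDh: "integrable lborel (\<lambda>x. (norm (D (x + h)))\<^sup>2)"
      using lborel_integrable_translate[OF iD] .
    have DhA: "(\<integral>x. (norm (D (x + h)))\<^sup>2 \<partial>lborel) \<le> 4 * e"
      using lborel_integral_translate[of "\<lambda>x. (norm (D x))\<^sup>2" h] DA by simp
    have im: "integrable lborel (\<lambda>x. (norm (grad (p m) (x + h) - grad (p m) x))\<^sup>2)"
      using lborel_integrable_translate[OF G(2)[of m], of h] by (intro sq_integrable_diff G(2)) auto
    have "(norm h)\<^sup>2 * M \<le> e / (M + 1) * M"
    proof (rule mult_right_mono)
      have "(norm h)\<^sup>2 \<le> (sqrt (e / (M + 1)))\<^sup>2" using h by (intro power_mono) (auto simp: r0_def)
      then show "(norm h)\<^sup>2 \<le> e / (M + 1)" using e M by simp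
    qed (use M in simp)
    also have "\<dots> \<le> e" using e M by (simp add: pos_divide_le_eq algebra_simps)
    finally have mA: "(\<integral>x. (norm (grad (p m) (x + h) - grad (p m) x))\<^sup>2 \<partial>lborel) \<le> e"
      using M(2)[of h] by linarith
    have "(\<integral>x. (norm (grad q x))\<^sup>2 \<partial>lborel) \<le> (\<integral>x. 3 * ((norm (D (x + h)))\<^sup>2
        + (norm (grad (p m) (x + h) - grad (p m) x))\<^sup>2 + (norm (D x))\<^sup>2) \<partial>lborel)"
    proof (rule integral_mono)
      show "integrable lborel (\<lambda>x. (norm (grad q x))\<^sup>2)" by (rule test_functions_integrable(4)[OF q])
      show "(norm (grad q x))\<^sup>2 \<le> 3 * ((norm (D (x + h)))\<^sup>2
        + (norm (grad (p m) (x + h) - grad (p m) x))\<^sup>2 + (norm (D x))\<^sup>2)" for x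
        using sq_norm_add3_le[of "D (x + h)" "grad (p m) (x + h) - grad (p m) x" "- D x"]
        by (simp add: gq D_def norm_minus_commute[of "grad (p m) x" "grad (p n) x"])
    qed (use iD iDh im in simp)
    also have "\<dots> = 3 * ((\<integral>x. (norm (D (x + h)))\<^sup>2 \<partial>lborel)
        + (\<integral>x. (norm (grad (p m) (x + h) - grad (p m) x))\<^sup>2 \<partial>lborel) + (\<integral>x. (norm (D x))\<^sup>2 \<partial>lborel))"
      using iD iDh im by simp
    also have "\<dots> \<le> 27 * e" using DA DhA mA by simp
    finally have "sqrt (\<integral>x. (norm (grad q x))\<^sup>2 \<partial>lborel) \<le> sqrt (27 * e)" by (rule real_sqrt_le_mono)
    then have "c * sqrt (\<integral>x. (norm (grad q x))\<^sup>2 \<partial>lborel) \<le> \<epsilon>"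
      using e(2) c_nonneg mult_left_mono order_trans by blast
    then have "ennreal (c * sqrt (\<integral>x. (norm (grad q x))\<^sup>2 \<partial>lborel)) \<le> ennreal \<epsilon>" by (rule ennreal_leI)
    with energy[OF q] show "(\<integral>\<^sup>+x. ennreal \<bar>p n (x + h) - p n x\<bar> \<partial>\<mu>) \<le> ennreal \<epsilon>"
      unfolding q_def by (rule order_trans)
  qed
qed

text \<open>For \<open>p n\<close> the two integrals are exchanged and the uniform translation bound
  is used for each shift. Passing to \<open>P\<close> takes Fatou's lemma twice. The inner limit
  needs \<open>p n (x + h)\<close> to converge for almost every \<open>h\<close> at a given
  \<open>x\<close>, which holds because translates of null sets are null.\<close>

lemma mean_oscillation_integral:
  assumes K: "compact K" "K \<subseteq> \<Omega>" "\<And>n x. x \<notin> K \<Longrightarrow> p n x = 0" and \<epsilon>: "0 < \<epsilon>"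
  obtains r0 where "0 < r0"
    "\<And>r. r < r0 \<Longrightarrow> (\<integral>\<^sup>+x. (\<integral>\<^sup>+h. indicator (ball 0 r) h * ennreal \<bar>P (x + h) - P x\<bar> \<partial>lborel) \<partial>\<mu>)
      \<le> ennreal \<epsilon> * emeasure lborel (ball (0::real^'n) r)"
proof -
  obtain r0 m where r0: "0 < r0"
    and m: "\<And>n h. m \<le> n \<Longrightarrow> norm h < r0 \<Longrightarrow> (\<integral>\<^sup>+x. ennreal \<bar>p n (x + h) - p n x\<bar> \<partial>\<mu>) \<le> ennreal \<epsilon>"
    by (rule translate_energy[OF K \<epsilon>]) blast+
  interpret \<mu>: sigma_finite_measure \<mu> by (rule \<mu>_sigma_finite)
  interpret pair_sigma_finite \<mu> lborel ..
  show ?thesis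
  proof (rule that[OF r0])
    fix r assume r: "r < r0"
    have [measurable]: "ball (0::real^'n) r \<in> sets borel" by simp
    define I where "I = (\<lambda>n x. \<integral>\<^sup>+h. indicator (ball 0 r) h * ennreal \<bar>p n (x + h) - p n x\<bar> \<partial>lborel)"
    have [measurable]: "I n \<in> borel_measurable borel" for n unfolding I_def by measurable
    have I_le: "(\<integral>\<^sup>+x. I n x \<partial>\<mu>) \<le> ennreal \<epsilon> * emeasure lborel (ball (0::real^'n) r)" if "m \<le> n" for n
    proof -
      have "(\<integral>\<^sup>+x. I n x \<partial>\<mu>) = (\<integral>\<^sup>+h. \<integral>\<^sup>+x. indicator (ball 0 r) h * ennreal \<bar>p n (x + h) - p n x\<bar> \<partial>\<mu> \<partial>lborel)"
        unfolding I_def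
        using Fubini[of "\<lambda>(x, h). indicator (ball 0 r) h * ennreal \<bar>p n (x + h) - p n x\<bar>"] by simp
      also have "\<dots> \<le> (\<integral>\<^sup>+h. ennreal \<epsilon> * indicator (ball (0::real^'n) r) h \<partial>lborel)"
      proof (rule nn_integral_mono)
        fix h
        show "(\<integral>\<^sup>+x. indicator (ball 0 r) h * ennreal \<bar>p n (x + h) - p n x\<bar> \<partial>\<mu>) \<le> ennreal \<epsilon> * indicator (ball 0 r) h"
          using m[OF that, of h] r by (auto simp: indicator_def)
      qed
      also have "\<dots> = ennreal \<epsilon> * emeasure lborel (ball (0::real^'n) r)"
        by (simp add: nn_integral_cmult_indicator)
      finally show ?thesis .
    qed
    have "(\<integral>\<^sup>+x. (\<integral>\<^sup>+h. indicator (ball 0 r) h * ennreal \<bar>P (x + h) - P x\<bar> \<partial>lborel) \<partial>\<mu>)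
        \<le> (\<integral>\<^sup>+x. liminf (\<lambda>n. I n x) \<partial>\<mu>)"
    proof (rule nn_integral_mono_AE)
      show "AE x in \<mu>. (\<integral>\<^sup>+h. indicator (ball 0 r) h * ennreal \<bar>P (x + h) - P x\<bar> \<partial>lborel) \<le> liminf (\<lambda>n. I n x)"
        using p_lim_\<mu>
      proof eventually_elim
        case (elim x)
        have "(\<integral>\<^sup>+h. indicator (ball 0 r) h * ennreal \<bar>P (x + h) - P x\<bar> \<partial>lborel)
          = (\<integral>\<^sup>+h. liminf (\<lambda>n. indicator (ball 0 r) h * ennreal \<bar>p n (x + h) - p n x\<bar>) \<partial>lborel)"
        proof (rule nn_integral_cong_AE)
          show "AE h in lborel. indicator (ball 0 r) h * ennreal \<bar>P (x + h) - P x\<bar>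
            = liminf (\<lambda>n. indicator (ball 0 r) h * ennreal \<bar>p n (x + h) - p n x\<bar>)"
            using AE_lborel_translate[OF p_lim, of x]
          proof eventually_elim
            fix h assume h: "(\<lambda>n. p n (x + h)) \<longlonglongrightarrow> P (x + h)"
            have "(\<lambda>n. indicator (ball 0 r) h * ennreal \<bar>p n (x + h) - p n x\<bar>)
                \<longlonglongrightarrow> indicator (ball 0 r) h * ennreal \<bar>P (x + h) - P x\<bar>"
              by (cases "h \<in> ball 0 r") (auto intro!: tendsto_intros h elim)
            then show "indicator (ball 0 r) h * ennreal \<bar>P (x + h) - P x\<bar>
              = liminf (\<lambda>n. indicator (ball 0 r) h * ennreal \<bar>p n (x + h) - p n x\<bar>)"
              by (intro lim_imp_Liminf[symmetric]) auto
          qed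
        qed
        also have "\<dots> \<le> liminf (\<lambda>n. I n x)"
          unfolding I_def by (intro nn_integral_liminf) measurable
        finally show ?case .
      qed
    qed
    also have "\<dots> \<le> liminf (\<lambda>n. \<integral>\<^sup>+x. I n x \<partial>\<mu>)"
      by (intro nn_integral_liminf) measurable
    also have "\<dots> \<le> ennreal \<epsilon> * emeasure lborel (ball (0::real^'n) r)"
    proof -
      have "liminf (\<lambda>n. \<integral>\<^sup>+x. I n x \<partial>\<mu>) \<le> limsup (\<lambda>n. \<integral>\<^sup>+x. I n x \<partial>\<mu>)"
        by (rule Liminf_le_Limsup) simp
      also have "\<dots> \<le> ennreal \<epsilon> * emeasure lborel (ball (0::real^'n) r)"
        using I_le by (intro Limsup_bounded) (auto simp: eventually_sequentially)
      finally show ?thesis .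
    qed
    finally show "(\<integral>\<^sup>+x. (\<integral>\<^sup>+h. indicator (ball 0 r) h * ennreal \<bar>P (x + h) - P x\<bar> \<partial>lborel) \<partial>\<mu>)
      \<le> ennreal \<epsilon> * emeasure lborel (ball (0::real^'n) r)" .
  qed
qed

text \<open>By Fatou's lemma along the radii 1/(j + 1), the lower limit of the mean oscillations has
  integral zero. This yields arbitrarily small good radii rather than all small radii; such a weak
  form of a Lebesgue point is enough for what follows.\<close>

lemma mean_oscillation_AE:
  assumes K: "compact K" "K \<subseteq> \<Omega>" "\<And>n x. x \<notin> K \<Longrightarrow> p n x = 0"
  shows "AE x in \<mu>. \<forall>\<epsilon>>0. \<forall>\<rho>>0. \<exists>r>0. r < \<rho> \<and>
    (\<integral>\<^sup>+h. indicator (ball 0 r) h * ennreal \<bar>P (x + h) - P x\<bar> \<partial>lborel) < ennreal (\<epsilon> * measure lborel (ball (0::real^'n) r))"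
proof -
  define r where "r = (\<lambda>j. inverse (real (Suc j)))"
  define V where "V = (\<lambda>j. emeasure lborel (ball (0::real^'n) (r j)))"
  have V: "0 < measure lborel (ball (0::real^'n) (r j))" "V j = ennreal (measure lborel (ball (0::real^'n) (r j)))" for j
    using content_ball_pos[of "r j" "0::real^'n"] emeasure_bounded_finite[OF bounded_ball, of "0::real^'n" "r j"]
    by (auto simp: r_def V_def emeasure_eq_ennreal_measure)
  have V0: "V j \<noteq> 0" "V j \<noteq> \<infinity>" for j using V[of j] by auto
  define A where "A = (\<lambda>j x. (\<integral>\<^sup>+h. indicator (ball 0 (r j)) h * ennreal \<bar>P (x + h) - P x\<bar> \<partial>lborel))"
  have [measurable]: "A j \<in> borel_measurable borel" for j
  proof -
    have [measurable]: "ball (0::real^'n) (r j) \<in> sets borel" by simp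
    show ?thesis unfolding A_def by measurable
  qed
  have r_lim: "r \<longlonglongrightarrow> 0" unfolding r_def by (rule LIMSEQ_inverse_real_of_nat)
  have "(\<integral>\<^sup>+x. liminf (\<lambda>j. A j x / V j) \<partial>\<mu>) \<le> liminf (\<lambda>j. \<integral>\<^sup>+x. A j x / V j \<partial>\<mu>)"
    by (intro nn_integral_liminf) measurable
  also have "\<dots> \<le> 0"
  proof (rule ennreal_le_epsilon)
    fix \<epsilon> :: real assume \<epsilon>: "0 < \<epsilon>"
    obtain r0 where r0: "0 < r0" "\<And>r. r < r0 \<Longrightarrow>
        (\<integral>\<^sup>+x. (\<integral>\<^sup>+h. indicator (ball 0 r) h * ennreal \<bar>P (x + h) - P x\<bar> \<partial>lborel) \<partial>\<mu>)
        \<le> ennreal \<epsilon> * emeasure lborel (ball (0::real^'n) r)"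
      by (rule mean_oscillation_integral[OF K \<epsilon>]) blast+
    have "liminf (\<lambda>j. \<integral>\<^sup>+x. A j x / V j \<partial>\<mu>) \<le> limsup (\<lambda>j. \<integral>\<^sup>+x. A j x / V j \<partial>\<mu>)"
      by (rule Liminf_le_Limsup) simp
    also have "\<dots> \<le> ennreal \<epsilon>"
    proof (rule Limsup_bounded)
      show "\<forall>\<^sub>F j in sequentially. (\<integral>\<^sup>+x. A j x / V j \<partial>\<mu>) \<le> ennreal \<epsilon>"
        using order_tendstoD(2)[OF r_lim r0(1)]
      proof eventually_elim
        case (elim j)
        have "(\<integral>\<^sup>+x. A j x / V j \<partial>\<mu>) = (\<integral>\<^sup>+x. A j x \<partial>\<mu>) / V j"
          by (rule nn_integral_divide) measurable
        also have "\<dots> \<le> ennreal \<epsilon> * V j / V j"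
          using r0(2)[OF elim] unfolding A_def V_def by (rule divide_right_mono_ennreal)
        also have "\<dots> = ennreal \<epsilon>" using V0[of j] by (simp add: ennreal_mult_divide_eq)
        finally show ?case .
      qed
    qed
    finally show "liminf (\<lambda>j. \<integral>\<^sup>+x. A j x / V j \<partial>\<mu>) \<le> 0 + ennreal \<epsilon>" by simp
  qed
  finally have "(\<integral>\<^sup>+x. liminf (\<lambda>j. A j x / V j) \<partial>\<mu>) = 0" by simp
  then have "AE x in \<mu>. liminf (\<lambda>j. A j x / V j) = 0"
    by (subst (asm) nn_integral_0_iff_AE) measurable
  then show ?thesis
  proof eventually_elim
    case (elim x)
    show ?case
    proof (intro allI impI)
      fix \<epsilon> \<rho> :: real assume \<epsilon>: "0 < \<epsilon>" and \<rho>: "0 < \<rho>"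
      have "\<not> (\<forall>\<^sub>F j in sequentially. ennreal \<epsilon> \<le> A j x / V j)"
      proof
        assume "\<forall>\<^sub>F j in sequentially. ennreal \<epsilon> \<le> A j x / V j"
        then have "ennreal \<epsilon> \<le> liminf (\<lambda>j. A j x / V j)" by (rule Liminf_bounded)
        with elim \<epsilon> show False by simp
      qed
      then have "\<exists>\<^sub>F j in sequentially. A j x / V j < ennreal \<epsilon>"
        by (simp add: frequently_def not_less)
      then have "\<exists>\<^sub>F j in sequentially. A j x / V j < ennreal \<epsilon> \<and> r j < \<rho>"
        using order_tendstoD(2)[OF r_lim \<rho>] by (rule frequently_eventually_frequently)
      then obtain j where j: "A j x / V j < ennreal \<epsilon>" "r j < \<rho>"
        using frequently_ex by blast
      have "A j x < ennreal \<epsilon> * V j"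
      proof (rule ccontr)
        assume "\<not> A j x < ennreal \<epsilon> * V j"
        then have "ennreal \<epsilon> * V j / V j \<le> A j x / V j" by (intro divide_right_mono_ennreal) simp
        then show False using j(1) V0[of j] by (simp add: ennreal_mult_divide_eq)
      qed
      also have "ennreal \<epsilon> * V j = ennreal (\<epsilon> * measure lborel (ball (0::real^'n) (r j)))"
        using V[of j] \<epsilon> by (simp add: ennreal_mult'')
      finally show "\<exists>r>0. r < \<rho> \<and> (\<integral>\<^sup>+h. indicator (ball 0 r) h * ennreal \<bar>P (x + h) - P x\<bar> \<partial>lborel)
          < ennreal (\<epsilon> * measure lborel (ball (0::real^'n) r))"
        using j(2) unfolding A_def by (intro exI[of _ "r j"]) (auto simp: r_def)
    qed
  qed
qed

text \<open>The functions \<open>p n\<close> need not have a common compact support, as the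
  oscillation lemma demands. Multiplied by a fixed cut-off they do, and by
  \<open>cutoff_truncation\<close> the softened truncation times the cut-off is again such a limit,
  with the same \<open>\<mu>\<close> and \<open>c\<close>.\<close>

lemma truncation_mean_oscillation_AE:
  assumes \<eta>: "\<eta> \<in> test_functions \<Omega>"
  shows "AE x in \<mu>. \<forall>\<epsilon>>0. \<forall>\<rho>>0. \<exists>r>0. r < \<rho> \<and>
    (\<integral>\<^sup>+h. indicator (ball 0 r) h * ennreal \<bar>\<eta> (x + h) * soft (\<kappa> - P (x + h)) - \<eta> x * soft (\<kappa> - P x)\<bar> \<partial>lborel)
      < ennreal (\<epsilon> * measure lborel (ball (0::real^'n) r))"
proof -
  obtain K where K: "compact K" "K \<subseteq> \<Omega>" "\<And>x. x \<notin> K \<Longrightarrow> \<eta> x = 0"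
    using \<eta> test_functionsE by metis
  \<comment> \<open>The instance \<open>\<tau> = 1\<close>; the factors and divisors 1 are kept so
    that the terms match the general form.\<close>
  define H where "H = (\<lambda>x. (1 * soft ((\<kappa> - P x) / 1)) *\<^sub>R grad \<eta> x + (- \<eta> x * soft' ((\<kappa> - P x) / 1)) *\<^sub>R G x)"
  interpret L: H1_limit \<Omega> "\<lambda>n x. \<eta> x * (1 * soft ((\<kappa> - p n x) / 1))" "\<lambda>x. \<eta> x * (1 * soft ((\<kappa> - P x) / 1))" H
    unfolding H_def by (rule cutoff_truncation[OF \<eta>]) simp
  interpret L: energy_measure \<Omega> "\<lambda>n x. \<eta> x * (1 * soft ((\<kappa> - p n x) / 1))" "\<lambda>x. \<eta> x * (1 * soft ((\<kappa> - P x) / 1))" H \<mu> c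
  proof
    show "AE x in \<mu>. (\<lambda>n. \<eta> x * (1 * soft ((\<kappa> - p n x) / 1))) \<longlonglongrightarrow> \<eta> x * (1 * soft ((\<kappa> - P x) / 1))"
      using p_lim_\<mu>
    proof eventually_elim
      case (elim x)
      show ?case
        by (intro tendsto_intros continuous_on_tendsto_compose[OF soft_continuous] elim) auto
    qed
  qed (use sets_\<mu> \<mu>_sigma_finite c_nonneg energy in \<open>simp_all add: sigma_finite_measure_def\<close>)
  show ?thesis using L.mean_oscillation_AE[OF K(1,2)] K(3) by simp
qed

end

context energy_measure
begin

text \<open>Countably many cut-offs and rational levels leave a single exceptional null set. The
  cut-off disappears because the radius may be taken so small that the whole ball lies where it
  equals 1.\<close>

lemma oscillation_AE:
  "AE x in \<mu>. x \<in> \<Omega> \<longrightarrow> (\<forall>q::rat. \<forall>\<epsilon>>0. \<forall>\<rho>>0. \<exists>r>0. r < \<rho> \<and>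
    (\<integral>\<^sup>+h. indicator (ball 0 r) h * ennreal \<bar>soft (of_rat q - P (x + h)) - soft (of_rat q - P x)\<bar> \<partial>lborel)
      < ennreal (\<epsilon> * measure lborel (ball (0::real^'n) r)))"
proof -
  obtain C where C: "\<And>n. compact (C n)" "\<And>n. C n \<subseteq> \<Omega>" "\<And>n. C n \<subseteq> interior (C (Suc n))" "\<Union>(range C) = \<Omega>"
    by (rule open_Union_compact_subsets[OF \<Omega>_open]) blast
  have "\<exists>\<eta>. \<eta> \<in> test_functions \<Omega> \<and> (\<forall>x\<in>C k. \<eta> x = 1)" for k
    by (rule smooth_Urysohn[OF C(1) \<Omega>_open C(2)]) blast
  then obtain \<eta> where \<eta>: "\<And>k. \<eta> k \<in> test_functions \<Omega>" "\<And>k x. x \<in> C k \<Longrightarrow> \<eta> k x = 1" by metis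
  have "AE x in \<mu>. \<forall>k. \<forall>q::rat. \<forall>\<epsilon>>0. \<forall>\<rho>>0. \<exists>r>0. r < \<rho> \<and>
    (\<integral>\<^sup>+h. indicator (ball 0 r) h * ennreal \<bar>\<eta> k (x + h) * soft (of_rat q - P (x + h)) - \<eta> k x * soft (of_rat q - P x)\<bar> \<partial>lborel)
      < ennreal (\<epsilon> * measure lborel (ball (0::real^'n) r))"
    unfolding AE_all_countable by (intro allI truncation_mean_oscillation_AE \<eta>)
  then show ?thesis
  proof eventually_elim
    case (elim x)
    show ?case
    proof (intro impI allI)
      fix q :: rat and \<epsilon> \<rho> :: real assume x: "x \<in> \<Omega>" and \<epsilon>: "0 < \<epsilon>" and \<rho>: "0 < \<rho>"
      obtain k where k: "x \<in> C k" using x C(4) by blast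
      then have "x \<in> interior (C (Suc k))" using C(3) by blast
      then obtain e where e: "0 < e" "ball x e \<subseteq> C (Suc k)"
        by (meson mem_interior)
      then have x1: "x \<in> C (Suc k)" by (meson centre_in_ball subsetD)
      obtain r where r: "0 < r" "r < min \<rho> e"
        "(\<integral>\<^sup>+h. indicator (ball 0 r) h * ennreal \<bar>\<eta> (Suc k) (x + h) * soft (of_rat q - P (x + h)) - \<eta> (Suc k) x * soft (of_rat q - P x)\<bar> \<partial>lborel)
          < ennreal (\<epsilon> * measure lborel (ball (0::real^'n) r))"
        using elim[rule_format, of \<epsilon> "min \<rho> e" "Suc k" q] \<epsilon> \<rho> e(1) by auto
      have "indicator (ball 0 r) h * ennreal \<bar>\<eta> (Suc k) (x + h) * soft (of_rat q - P (x + h)) - \<eta> (Suc k) x * soft (of_rat q - P x)\<bar>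
          = indicator (ball 0 r) h * ennreal \<bar>soft (of_rat q - P (x + h)) - soft (of_rat q - P x)\<bar>" for h
      proof (cases "h \<in> ball 0 r")
        case True
        then have "x + h \<in> ball x e" using r(2) by (simp add: dist_norm)
        then have "x + h \<in> C (Suc k)" using e(2) by blast
        then show ?thesis by (simp add: \<eta>(2) x1)
      qed simp
      with r show "\<exists>r>0. r < \<rho> \<and> (\<integral>\<^sup>+h. indicator (ball 0 r) h * ennreal \<bar>soft (of_rat q - P (x + h)) - soft (of_rat q - P x)\<bar> \<partial>lborel)
        < ennreal (\<epsilon> * measure lborel (ball (0::real^'n) r))"
        by (intro exI[of _ r]) simp
    qed
  qed
qed

text \<open>Suppose \<open>P x < q < \<kappa>\<close> although \<open>P\<close> is at least
  \<open>\<kappa>\<close> nearby. Then soft(q - P) vanishes almost everywhere around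
  \<open>x\<close> but is positive at \<open>x\<close>, so its mean oscillation equals that positive
  value on every small ball, against the choice of the radius.\<close>

lemma local_lower_bound_AE:
  "AE x in \<mu>. x \<in> \<Omega> \<longrightarrow> (\<forall>\<kappa> \<rho>. 0 < \<rho> \<longrightarrow> (AE y in lborel. y \<in> ball x \<rho> \<longrightarrow> \<kappa> \<le> P y) \<longrightarrow> \<kappa> \<le> P x)"
  using oscillation_AE
proof eventually_elim
  case (elim x)
  show ?case
  proof (intro impI allI)
    fix \<kappa> \<rho> :: real assume x: "x \<in> \<Omega>" and \<rho>: "0 < \<rho>" and lb: "AE y in lborel. y \<in> ball x \<rho> \<longrightarrow> \<kappa> \<le> P y"
    show "\<kappa> \<le> P x"
    proof (rule ccontr)
      assume "\<not> \<kappa> \<le> P x"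
      then obtain q :: rat where q: "P x < of_rat q" "of_rat q < \<kappa>" using of_rat_dense[of "P x" \<kappa>] by auto
      define \<epsilon> where "\<epsilon> = soft (of_rat q - P x)"
      have \<epsilon>: "0 < \<epsilon>" using q by (simp add: \<epsilon>_def soft_pos)
      obtain r where r: "0 < r" "r < \<rho>"
        "(\<integral>\<^sup>+h. indicator (ball 0 r) h * ennreal \<bar>soft (of_rat q - P (x + h)) - soft (of_rat q - P x)\<bar> \<partial>lborel)
          < ennreal (\<epsilon> * measure lborel (ball (0::real^'n) r))"
        using elim x \<epsilon> \<rho> by blast
      have "(\<integral>\<^sup>+h. indicator (ball 0 r) h * ennreal \<bar>soft (of_rat q - P (x + h)) - soft (of_rat q - P x)\<bar> \<partial>lborel)
          = (\<integral>\<^sup>+h. ennreal \<epsilon> * indicator (ball (0::real^'n) r) h \<partial>lborel)"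
      proof (rule nn_integral_cong_AE)
        show "AE h in lborel. indicator (ball 0 r) h * ennreal \<bar>soft (of_rat q - P (x + h)) - soft (of_rat q - P x)\<bar>
          = ennreal \<epsilon> * indicator (ball (0::real^'n) r) h"
          using AE_lborel_translate[OF lb, of x]
        proof eventually_elim
          case (elim h)
          show ?case
          proof (cases "h \<in> ball 0 r")
            case True
            then have "\<kappa> \<le> P (x + h)" using elim r(2) by (simp add: dist_norm)
            then have "soft (of_rat q - P (x + h)) = 0" using q by (simp add: soft_eq_0_iff)
            then show ?thesis using True \<epsilon> by (simp add: \<epsilon>_def)
          qed simp
        qed
      qed
      also have "\<dots> = ennreal \<epsilon> * emeasure lborel (ball (0::real^'n) r)"
        by (simp add: nn_integral_cmult_indicator)
      also have "\<dots> = ennreal (\<epsilon> * measure lborel (ball (0::real^'n) r))"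
        using emeasure_bounded_finite[OF bounded_ball, of "0::real^'n" r] \<epsilon>
        by (simp add: emeasure_eq_ennreal_measure ennreal_mult'')
      finally show False using r(3) by simp
    qed
  qed
qed

end

locale supersolution_energy = supersolution \<Omega> p P G B \<alpha> C + energy_measure \<Omega> p P G \<mu> c
  for \<Omega> :: "(real^'n) set" and p P G B \<alpha> C \<mu> c
begin

text \<open>For a rational \<open>q\<close> below \<open>P x\<close> the value soft(q - P x) is 0,
  so a small oscillation means that soft(q - P) has small mean on a ball. With \<open>P\<close>
  nonnegative this controls the squared truncation at a lower level \<open>k\<close>, and De
  Giorgi's estimate turns it into a pointwise bound near \<open>x\<close>.\<close>

lemma upper_bound_AE:
  assumes nonneg: "AE x in lborel. 0 \<le> P x"
  shows "AE x in \<mu>. x \<in> \<Omega> \<longrightarrow> (\<forall>\<kappa><P x. \<exists>\<rho>>0. AE y in lborel. y \<in> ball x \<rho> \<longrightarrow> \<kappa> \<le> P y)"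
proof -
  obtain \<delta> where \<delta>: "0 < \<delta>"
    "\<And>a r \<kappa> \<theta>. 0 < r \<Longrightarrow> cball a r \<subseteq> \<Omega> \<Longrightarrow> 0 < \<theta> \<Longrightarrow>
      (\<integral>x. indicator (ball a r) x * (max 0 (\<kappa> - P x))\<^sup>2 \<partial>lborel) \<le> \<delta> * \<theta>\<^sup>2 * r ^ CARD('n) \<Longrightarrow>
      AE x in lborel. x \<in> ball a (r / 2) \<longrightarrow> \<kappa> - \<theta> \<le> P x"
    by (rule De_Giorgi) blast
  define V where "V = measure lborel (ball (0::real^'n) 1)"
  have V: "0 < V" using content_ball_pos[of 1 "0::real^'n"] by (simp add: V_def)
  have Vr: "measure lborel (ball (0::real^'n) r) = r ^ CARD('n) * V" if "0 < r" for r
    using content_ball_conv_unit_ball[of r "0::real^'n"] that by (simp add: V_def)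
  show ?thesis
    using oscillation_AE
  proof eventually_elim
    case (elim x)
    show ?case
    proof (intro impI allI)
      fix \<kappa> assume x: "x \<in> \<Omega>" and \<kappa>: "\<kappa> < P x"
      obtain q :: rat where q: "\<kappa> < of_rat q" "of_rat q < P x" using of_rat_dense[OF \<kappa>] by auto
      \<comment> \<open>The midpoint leaves room on both sides: \<open>\<theta>\<close> is the loss
        in De Giorgi's estimate down to \<open>\<kappa>\<close>, and the gap up to \<open>q\<close>
        keeps \<open>m\<close> positive.\<close>
      define k where "k = (\<kappa> + of_rat q) / 2"
      define \<theta> where "\<theta> = k - \<kappa>"
      have k: "\<kappa> < k" "k < of_rat q" "0 < \<theta>" using q by (auto simp: k_def \<theta>_def field_simps)
      define m where "m = soft (of_rat q - k)"
      have m: "0 < m" using k by (simp add: m_def soft_pos)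
      \<comment> \<open>Where 0 \<le> P < k, the squared truncation is at most k^2 = L m, and
        \<open>m\<close> is at most soft(q - P) by monotonicity.\<close>
      define L where "L = k\<^sup>2 / m"
      have L: "0 \<le> L" using m by (simp add: L_def)
      \<comment> \<open>Solves (L + 1) \<epsilon> V r^N = \<delta> \<theta>^2 r^N, the threshold of
        De Giorgi's estimate. Using L + 1 avoids a division by zero when \<open>k\<close> is
        0.\<close>
      define \<epsilon> where "\<epsilon> = \<delta> * \<theta>\<^sup>2 / (V * (L + 1))"
      have \<epsilon>: "0 < \<epsilon>" using \<delta>(1) k V L by (simp add: \<epsilon>_def)
      obtain e where e: "0 < e" "cball x e \<subseteq> \<Omega>"
        using open_contains_cball_eq[OF \<Omega>_open] x by auto
      obtain r where r: "0 < r" "r < e"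
        "(\<integral>\<^sup>+h. indicator (ball 0 r) h * ennreal \<bar>soft (of_rat q - P (x + h)) - soft (of_rat q - P x)\<bar> \<partial>lborel)
          < ennreal (\<epsilon> * measure lborel (ball (0::real^'n) r))"
        using elim x \<epsilon> e(1) by blast
      have sub: "cball x r \<subseteq> \<Omega>" using e(2) subset_cball[of r e x] r(2) by auto
      have P0: "soft (of_rat q - P x) = 0" using q by (simp add: soft_eq_0_iff)
      have sub': "ball x r \<subseteq> \<Omega>" using sub ball_subset_cball by blast
      note i = truncation_ball_integrable[OF sub', of k]
      have [measurable]: "ball x r \<in> sets borel" by simp
      have "ennreal (\<integral>y. indicator (ball x r) y * (max 0 (k - P y))\<^sup>2 \<partial>lborel)
          = (\<integral>\<^sup>+y. ennreal (indicator (ball x r) y * (max 0 (k - P y))\<^sup>2) \<partial>lborel)"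
        using i by (intro nn_integral_eq_integral[symmetric]) auto
      also have "\<dots> = (\<integral>\<^sup>+h. ennreal (indicator (ball x r) (h + x) * (max 0 (k - P (h + x)))\<^sup>2) \<partial>lborel)"
        by (rule lborel_nn_integral_translate[symmetric]) measurable
      also have "\<dots> \<le> (\<integral>\<^sup>+h. ennreal L * (indicator (ball 0 r) h * ennreal \<bar>soft (of_rat q - P (x + h)) - soft (of_rat q - P x)\<bar>) \<partial>lborel)"
      proof (rule nn_integral_mono_AE)
        show "AE h in lborel. ennreal (indicator (ball x r) (h + x) * (max 0 (k - P (h + x)))\<^sup>2)
          \<le> ennreal L * (indicator (ball 0 r) h * ennreal \<bar>soft (of_rat q - P (x + h)) - soft (of_rat q - P x)\<bar>)"
          using AE_lborel_translate[OF nonneg, of x]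
        proof eventually_elim
          case (elim h)
          show ?case
          proof (cases "h \<in> ball 0 r \<and> P (x + h) < k")
            case True
            have "(k - P (x + h))\<^sup>2 \<le> k\<^sup>2" using True elim by (intro power_mono) auto
            also have "k\<^sup>2 = L * m" using m by (simp add: L_def)
            also have "\<dots> \<le> L * soft (of_rat q - P (x + h))"
              using True L by (intro mult_left_mono) (auto simp: m_def intro!: soft_mono)
            finally have "(k - P (x + h))\<^sup>2 \<le> L * soft (of_rat q - P (x + h))" .
            then show ?thesis using True L P0 soft_nonneg
              by (auto simp: indicator_def dist_norm add.commute ennreal_mult'[symmetric] intro!: ennreal_leI)
          next
            case False
            then have e: "indicator (ball x r) (h + x) * (max 0 (k - P (h + x)))\<^sup>2 = 0"
              by (auto simp: indicator_def dist_norm add.commute max_def)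
            show ?thesis unfolding e by simp
          qed
        qed
      qed
      also have "\<dots> = ennreal L * (\<integral>\<^sup>+h. indicator (ball 0 r) h * ennreal \<bar>soft (of_rat q - P (x + h)) - soft (of_rat q - P x)\<bar> \<partial>lborel)"
      proof (rule nn_integral_cmult)
        have [measurable]: "soft \<in> borel_measurable borel" "ball (0::real^'n) r \<in> sets borel"
          by (auto intro: borel_measurable_continuous_onI soft_continuous)
        show "(\<lambda>h. indicator (ball 0 r) h * ennreal \<bar>soft (of_rat q - P (x + h)) - soft (of_rat q - P x)\<bar>) \<in> borel_measurable lborel"
          by measurable
      qed
      also have "\<dots> \<le> ennreal L * ennreal (\<epsilon> * measure lborel (ball (0::real^'n) r))"
        using r(3) by (intro mult_left_mono) auto
      also have "\<dots> = ennreal (L * (\<epsilon> * measure lborel (ball (0::real^'n) r)))"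
        using L by (simp add: ennreal_mult')
      finally have "(\<integral>y. indicator (ball x r) y * (max 0 (k - P y))\<^sup>2 \<partial>lborel) \<le> L * (\<epsilon> * measure lborel (ball (0::real^'n) r))"
        using L \<epsilon> by (subst (asm) ennreal_le_iff) auto
      also have "\<dots> \<le> (L + 1) * (\<epsilon> * measure lborel (ball (0::real^'n) r))"
        using \<epsilon> by (intro mult_right_mono) auto
      also have "\<dots> = (L + 1) * (\<epsilon> * (r ^ CARD('n) * V))" by (simp only: Vr[OF r(1)])
      also have "\<dots> = \<delta> * \<theta>\<^sup>2 * r ^ CARD('n)"
        using V L by (simp add: \<epsilon>_def)
      finally have "AE y in lborel. y \<in> ball x (r / 2) \<longrightarrow> k - \<theta> \<le> P y"
        by (rule \<delta>(2)[OF r(1) sub k(3)])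
      then show "\<exists>\<rho>>0. AE y in lborel. y \<in> ball x \<rho> \<longrightarrow> \<kappa> \<le> P y"
        using r(1) by (intro exI[of _ "r / 2"]) (simp add: \<theta>_def)
    qed
  qed
qed

end

section \<open>The lower semicontinuous regularization\<close>

lemma essinf_on_AE: "AE y in lebesgue_on S. essinf_on S u \<le> ereal (u y)"
proof -
  have "AE y in lebesgue_on S. - ereal (u y) \<le> esssup (lebesgue_on S) (\<lambda>y. - ereal (u y))"
    by (rule esssup_AE)
  then show ?thesis
    unfolding essinf_on_def by eventually_elim (metis ereal_uminus_le_reorder)
qed

lemma essinf_on_ge:
  assumes "u \<in> borel_measurable (lebesgue_on S)" "AE y in lebesgue_on S. c \<le> ereal (u y)"
  shows "c \<le> essinf_on S u"
proof -
  note [measurable] = assms(1)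
  have "(\<lambda>y. - ereal (u y)) \<in> borel_measurable (lebesgue_on S)" by measurable
  moreover have "AE y in lebesgue_on S. - ereal (u y) \<le> - c"
    using assms(2) by eventually_elim (simp only: ereal_minus_le_minus)
  ultimately have "esssup (lebesgue_on S) (\<lambda>y. - ereal (u y)) \<le> - c"
    by (rule esssup_I)
  then have "- (- c) \<le> essinf_on S u" unfolding essinf_on_def by (simp only: ereal_minus_le_minus)
  then show ?thesis by simp
qed

lemma measurable_lebesgue_on_Int:
  assumes "open \<Omega>" "open U" "u \<in> borel_measurable (lebesgue_on \<Omega>)"
  shows "u \<in> borel_measurable (lebesgue_on (\<Omega> \<inter> U))"
proof -
  have "restrict_space (lebesgue_on \<Omega>) U = lebesgue_on (\<Omega> \<inter> U)"
    using assms(1,2) by (intro restrict_restrict_space) (auto simp: sets_completionI_sets)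
  then show ?thesis using measurable_restrict_space1[OF assms(3), of U] by simp
qed

text \<open>\<open>Lim\<close> is a definite description, so existence of the limit has to be shown
  before anything is known about it. The essential infimum grows as the ball shrinks, hence
  converges to its supremum.\<close>

lemma lsc_reg_tendsto:
  assumes \<Omega>: "open \<Omega>" and u: "u \<in> borel_measurable (lebesgue_on \<Omega>)"
  shows "lsc_reg \<Omega> u x = (SUP r\<in>{0<..}. essinf_on (\<Omega> \<inter> ball x r) u)"
proof -
  let ?E = "\<lambda>r. essinf_on (\<Omega> \<inter> ball x r) u"
  have mono: "?E r \<le> ?E r'" if "r' \<le> r" for r r'
  proof (rule essinf_on_ge)
    have s: "\<Omega> \<inter> ball x r' \<in> sets borel" "\<Omega> \<inter> ball x r \<in> sets borel" using \<Omega> by auto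
    show "u \<in> borel_measurable (lebesgue_on (\<Omega> \<inter> ball x r'))"
      by (rule measurable_lebesgue_on_Int[OF \<Omega> open_ball u])
    have "AE y in lborel. y \<in> \<Omega> \<inter> ball x r \<longrightarrow> ?E r \<le> ereal (u y)"
      by (rule iffD1[OF AE_lebesgue_on[OF s(2)] essinf_on_AE])
    then have "AE y in lborel. y \<in> \<Omega> \<inter> ball x r' \<longrightarrow> ?E r \<le> ereal (u y)"
      by eventually_elim (use that in auto)
    then show "AE y in lebesgue_on (\<Omega> \<inter> ball x r'). ?E r \<le> ereal (u y)"
      using AE_lebesgue_on[OF s(1)] by blast
  qed
  have "(?E \<longlongrightarrow> (SUP r\<in>{0<..}. ?E r)) (at_right 0)"
  proof (rule order_tendstoI)
    fix a assume "a < (SUP r\<in>{0<..}. ?E r)"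
    then obtain r where r: "0 < r" "a < ?E r" by (auto simp: less_SUP_iff)
    have "a < ?E r'" if "r' < r" for r' using mono[of r' r] that r(2) by auto
    then show "\<forall>\<^sub>F r in at_right 0. a < ?E r"
      using r(1) by (auto simp: eventually_at_right_field)
  next
    fix a assume a: "(SUP r\<in>{0<..}. ?E r) < a"
    have "?E r < a" if "0 < r" for r using a SUP_upper[of r "{0<..}" ?E] that by auto
    then show "\<forall>\<^sub>F r in at_right 0. ?E r < a"
      by (auto simp: eventually_at_filter)
  qed
  then show ?thesis unfolding lsc_reg_def by (intro tendsto_Lim) auto
qed

lemma lsc_reg_ge:
  assumes \<Omega>: "open \<Omega>" and u: "u \<in> borel_measurable (lebesgue_on \<Omega>)"
    and \<rho>: "0 < \<rho>" and "AE y in lborel. y \<in> \<Omega> \<inter> ball x \<rho> \<longrightarrow> \<kappa> \<le> u y"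
  shows "ereal \<kappa> \<le> lsc_reg \<Omega> u x"
proof -
  have s: "\<Omega> \<inter> ball x \<rho> \<in> sets borel" using \<Omega> by auto
  have "ereal \<kappa> \<le> essinf_on (\<Omega> \<inter> ball x \<rho>) u"
  proof (rule essinf_on_ge)
    show "u \<in> borel_measurable (lebesgue_on (\<Omega> \<inter> ball x \<rho>))"
      by (rule measurable_lebesgue_on_Int[OF \<Omega> open_ball u])
    show "AE y in lebesgue_on (\<Omega> \<inter> ball x \<rho>). ereal \<kappa> \<le> ereal (u y)"
      using assms(4) by (simp add: AE_lebesgue_on[OF s])
  qed
  also have "\<dots> \<le> lsc_reg \<Omega> u x"
    unfolding lsc_reg_tendsto[OF \<Omega> u] using \<rho> by (intro SUP_upper) auto
  finally show ?thesis .
qed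

lemma less_lsc_reg:
  assumes \<Omega>: "open \<Omega>" and u: "u \<in> borel_measurable (lebesgue_on \<Omega>)"
    and "ereal \<kappa> < lsc_reg \<Omega> u x"
  obtains \<rho> \<kappa>' where "0 < \<rho>" "\<kappa> < \<kappa>'" "AE y in lborel. y \<in> \<Omega> \<inter> ball x \<rho> \<longrightarrow> \<kappa>' \<le> u y"
proof -
  obtain \<rho> where \<rho>: "0 < \<rho>" "ereal \<kappa> < essinf_on (\<Omega> \<inter> ball x \<rho>) u"
    using assms(3) unfolding lsc_reg_tendsto[OF \<Omega> u] by (auto simp: less_SUP_iff)
  obtain \<kappa>' where \<kappa>': "ereal \<kappa> < ereal \<kappa>'" "ereal \<kappa>' < essinf_on (\<Omega> \<inter> ball x \<rho>) u"
    using ereal_dense2[OF \<rho>(2)] by blast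
  have s: "\<Omega> \<inter> ball x \<rho> \<in> sets borel" using \<Omega> by auto
  have "AE y in lborel. y \<in> \<Omega> \<inter> ball x \<rho> \<longrightarrow> essinf_on (\<Omega> \<inter> ball x \<rho>) u \<le> ereal (u y)"
    by (rule iffD1[OF AE_lebesgue_on[OF s] essinf_on_AE])
  then have "AE y in lborel. y \<in> \<Omega> \<inter> ball x \<rho> \<longrightarrow> \<kappa>' \<le> u y"
    by eventually_elim (use \<kappa>'(2) in \<open>meson ereal_less_eq(3) less_imp_le order_trans\<close>)
  then show ?thesis using that \<rho> \<kappa>' by auto
qed

text \<open>Superlevel sets inside \<open>\<Omega>\<close> are open: a lower bound on a ball around
  \<open>x\<close> holds on smaller balls around nearby points. Outside \<open>\<Omega>\<close> the
  regularization is replaced by a constant, since the indicator discards its values there.\<close>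

lemma lsc_reg_borel:
  assumes \<Omega>: "open \<Omega>" and u: "u \<in> borel_measurable (lebesgue_on \<Omega>)"
  shows "(\<lambda>x. indicator \<Omega> x / real_of_ereal (lsc_reg \<Omega> u x) powr lam) \<in> borel_measurable borel"
proof -
  have op: "open {x \<in> \<Omega>. b < lsc_reg \<Omega> u x}" for b
  proof (subst open_subopen, intro ballI)
    fix x assume "x \<in> {x \<in> \<Omega>. b < lsc_reg \<Omega> u x}"
    then have x: "x \<in> \<Omega>" "b < lsc_reg \<Omega> u x" by auto
    obtain \<kappa> where \<kappa>: "b < ereal \<kappa>" "ereal \<kappa> < lsc_reg \<Omega> u x"
      using ereal_dense2[OF x(2)] by blast
    obtain \<rho> \<kappa>' where r: "0 < \<rho>" "\<kappa> < \<kappa>'" "AE y in lborel. y \<in> \<Omega> \<inter> ball x \<rho> \<longrightarrow> \<kappa>' \<le> u y"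
      by (rule less_lsc_reg[OF \<Omega> u \<kappa>(2)]) blast
    obtain e where e: "0 < e" "ball x e \<subseteq> \<Omega>" using \<Omega> x(1) open_contains_ball by blast
    have "b < lsc_reg \<Omega> u z" if z: "z \<in> ball x (min e \<rho>)" for z
    proof -
      have d: "0 < \<rho> - dist x z" using z by simp
      have "ball z (\<rho> - dist x z) \<subseteq> ball x \<rho>"
      proof
        fix y assume "y \<in> ball z (\<rho> - dist x z)"
        then show "y \<in> ball x \<rho>" using dist_triangle[of x y z] by simp
      qed
      then have "AE y in lborel. y \<in> \<Omega> \<inter> ball z (\<rho> - dist x z) \<longrightarrow> \<kappa>' \<le> u y"
        using r(3) by (auto elim!: eventually_mono)
      then have "ereal \<kappa>' \<le> lsc_reg \<Omega> u z" by (rule lsc_reg_ge[OF \<Omega> u d])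
      moreover have "ereal \<kappa> < ereal \<kappa>'" using r(2) by simp
      ultimately show ?thesis using \<kappa>(1) by (meson less_le_trans less_trans)
    qed
    then have "ball x (min e \<rho>) \<subseteq> {x \<in> \<Omega>. b < lsc_reg \<Omega> u x}" using e(2) by auto
    then show "\<exists>T. open T \<and> x \<in> T \<and> T \<subseteq> {x \<in> \<Omega>. b < lsc_reg \<Omega> u x}"
      using e(1) r(1) by (intro exI[of _ "ball x (min e \<rho>)"]) auto
  qed
  define L where "L = (\<lambda>x. if x \<in> \<Omega> then lsc_reg \<Omega> u x else -\<infinity>)"
  have "{x \<in> space borel. b < L x} = {x \<in> \<Omega>. b < lsc_reg \<Omega> u x}" for b
    by (auto simp: L_def)
  then have [measurable]: "L \<in> borel_measurable borel"
    using op by (intro borel_measurableI_greater) auto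
  have [measurable]: "\<Omega> \<in> sets borel" using \<Omega> by simp
  have "(\<lambda>x. indicator \<Omega> x / real_of_ereal (L x) powr lam) \<in> borel_measurable borel" by measurable
  moreover have "(\<lambda>x. indicator \<Omega> x / real_of_ereal (L x) powr lam) = (\<lambda>x. indicator \<Omega> x / real_of_ereal (lsc_reg \<Omega> u x) powr lam)"
    by (auto simp: L_def indicator_def)
  ultimately show ?thesis by simp
qed

section \<open>Approximation of functions in the Sobolev space\<close>

text \<open>At a geometric rate the squared errors are summable almost everywhere, which gives
  pointwise convergence. Taking \<open>lim\<close> makes the limit a Borel function defined at every
  point by the sequence alone.\<close>

lemma L2_limit_of_test_functions:
  fixes h :: "nat \<Rightarrow> real^'n \<Rightarrow> 'b::euclidean_space" and w :: "real^'n \<Rightarrow> 'b"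
  assumes \<Omega>: "open \<Omega>"
    and h [measurable]: "\<And>n. h n \<in> borel_measurable borel" and h0: "\<And>n x. x \<notin> \<Omega> \<Longrightarrow> h n x = 0"
    and ih: "\<And>n. integrable lborel (\<lambda>x. (norm (h n x))\<^sup>2)"
    and w: "w \<in> L2 \<Omega>"
    and fast: "\<And>n. (\<integral>x. (norm (w x - h n x))\<^sup>2 \<partial>(lebesgue_on \<Omega>)) \<le> (1/16)^n"
  defines "W \<equiv> \<lambda>x. lim (\<lambda>n. h n x)"
  shows "\<And>x. x \<notin> \<Omega> \<Longrightarrow> W x = 0" "AE x in lborel. x \<in> \<Omega> \<longrightarrow> W x = w x"
    "AE x in lborel. (\<lambda>n. h n x) \<longlonglongrightarrow> W x" "L2_tendsto lborel h W"
    "\<And>n. (\<integral>x. (norm (h n x - W x))\<^sup>2 \<partial>lborel) \<le> (1/16)^n"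
proof -
  have \<Omega>s: "\<Omega> \<in> sets borel" using \<Omega> by simp
  have [measurable]: "W \<in> borel_measurable borel" unfolding W_def by measurable
  have hm [measurable]: "h n \<in> borel_measurable (lebesgue_on \<Omega>)" "W \<in> borel_measurable (lebesgue_on \<Omega>)" for n
    by (auto intro!: measurable_restrict_space1 measurable_completion)
  have wm [measurable]: "w \<in> borel_measurable (lebesgue_on \<Omega>)" and iw: "integrable (lebesgue_on \<Omega>) (\<lambda>x. (norm (w x))\<^sup>2)"
    using w by (auto simp: L2_def)
  have ihl: "integrable (lebesgue_on \<Omega>) (\<lambda>x. (norm (h n x))\<^sup>2)" for n
    using ih[of n] h0 by (subst lebesgue_on_integral(2)[OF \<Omega>s]) auto
  have id: "integrable (lebesgue_on \<Omega>) (\<lambda>x. (norm (w x - h n x))\<^sup>2)" for n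
    by (rule sq_integrable_diff[OF wm hm(1) iw ihl])
  have "AE x in lebesgue_on \<Omega>. summable (\<lambda>n. (norm (w x - h n x))\<^sup>2)"
  proof (rule AE_summable_of_geometric_bound[where C = 1])
    show "(\<integral>\<^sup>+x. ennreal ((norm (w x - h n x))\<^sup>2) \<partial>(lebesgue_on \<Omega>)) \<le> ennreal (1 * (1/2)^n)" for n
    proof -
      have "(1/16::real)^n \<le> (1/2)^n" by (intro power_mono) auto
      then show ?thesis using id[of n] fast[of n]
        by (subst nn_integral_eq_integral) (auto intro!: ennreal_leI)
    qed
  qed auto
  then have lim: "AE x in lebesgue_on \<Omega>. (\<lambda>n. h n x) \<longlonglongrightarrow> w x"
  proof eventually_elim
    case (elim x)
    then have "(\<lambda>n. (norm (w x - h n x))\<^sup>2) \<longlonglongrightarrow> 0" by (rule summable_LIMSEQ_zero)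
    then have "(\<lambda>n. sqrt ((norm (w x - h n x))\<^sup>2)) \<longlonglongrightarrow> sqrt 0" by (rule tendsto_real_sqrt)
    then have "(\<lambda>n. norm (h n x - w x)) \<longlonglongrightarrow> 0" by (simp add: norm_minus_commute)
    then show ?case using LIM_zero_iff tendsto_norm_zero_iff by blast
  qed
  show W0: "W x = 0" if "x \<notin> \<Omega>" for x using h0[OF that] by (simp add: W_def)
  have Ww: "AE x in lebesgue_on \<Omega>. W x = w x"
    using lim by eventually_elim (auto simp: W_def limI)
  then show "AE x in lborel. x \<in> \<Omega> \<longrightarrow> W x = w x" by (simp add: AE_lebesgue_on[OF \<Omega>s])
  have "AE x in lborel. x \<in> \<Omega> \<longrightarrow> (\<lambda>n. h n x) \<longlonglongrightarrow> w x"
    using lim by (simp add: AE_lebesgue_on[OF \<Omega>s])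
  then show "AE x in lborel. (\<lambda>n. h n x) \<longlonglongrightarrow> W x"
  proof eventually_elim
    case (elim x)
    then show ?case by (cases "x \<in> \<Omega>") (auto simp: W_def limI h0)
  qed
  have eq: "(\<integral>x. (norm (h n x - W x))\<^sup>2 \<partial>lborel) = (\<integral>x. (norm (w x - h n x))\<^sup>2 \<partial>(lebesgue_on \<Omega>))" for n
  proof -
    have "(\<integral>x. (norm (h n x - W x))\<^sup>2 \<partial>lborel) = (\<integral>x. (norm (h n x - W x))\<^sup>2 \<partial>(lebesgue_on \<Omega>))"
      using h0 W0 by (intro lebesgue_on_integral(1)[OF \<Omega>s, symmetric]) auto
    also have "\<dots> = (\<integral>x. (norm (w x - h n x))\<^sup>2 \<partial>(lebesgue_on \<Omega>))"
    proof (rule integral_cong_AE)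
      show "AE x in lebesgue_on \<Omega>. (norm (h n x - W x))\<^sup>2 = (norm (w x - h n x))\<^sup>2"
        using Ww by eventually_elim (simp add: norm_minus_commute)
    qed auto
    finally show ?thesis .
  qed
  then show fast': "(\<integral>x. (norm (h n x - W x))\<^sup>2 \<partial>lborel) \<le> (1/16)^n" for n using fast by simp
  have "integrable (lebesgue_on \<Omega>) (\<lambda>x. (norm (W x))\<^sup>2)"
  proof (rule integrable_cong_AE_imp[OF iw])
    show "AE x in lebesgue_on \<Omega>. (norm (w x))\<^sup>2 = (norm (W x))\<^sup>2" using Ww by eventually_elim simp
  qed auto
  then have "integrable lborel (\<lambda>x. (norm (W x))\<^sup>2)"
    using W0 by (subst (asm) lebesgue_on_integral(2)[OF \<Omega>s]) auto
  moreover have "(\<lambda>n. \<integral>x. (norm (h n x - W x))\<^sup>2 \<partial>lborel) \<longlonglongrightarrow> 0"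
  proof (rule Lim_null_comparison)
    show "\<forall>\<^sub>F n in sequentially. norm (\<integral>x. (norm (h n x - W x))\<^sup>2 \<partial>lborel) \<le> (1/16)^n"
      using fast' by simp
    show "(\<lambda>n. (1/16::real)^n) \<longlonglongrightarrow> 0" by (rule LIMSEQ_realpow_zero) auto
  qed
  ultimately show "L2_tendsto lborel h W" using ih by (simp add: L2_tendsto_def)
qed

lemma L2_norm_sq: "(L2_norm \<Omega> f)\<^sup>2 = (\<integral>x. (norm (f x))\<^sup>2 \<partial>(lebesgue_on \<Omega>))"
  by (simp add: L2_norm_def)

text \<open>The identity \<open>P x = lim (\<lambda>n. p n x)\<close> is exported because it refers
  to no measure: once the sequence converges almost everywhere for another measure, its limit there
  is this same \<open>P\<close>.\<close>

lemma H01_approximation: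
  fixes u :: "real^'n \<Rightarrow> real"
  assumes \<Omega>: "open \<Omega>" "bounded \<Omega>" and u: "u \<in> H01 \<Omega>"
  obtains p P G where "H1_limit \<Omega> p P G"
    "\<And>n. (\<integral>x. (norm (grad (p n) x - G x))\<^sup>2 \<partial>lborel) \<le> (1/16)^n"
    "\<And>x. P x = lim (\<lambda>n. p n x)"
    "AE x in lborel. x \<in> \<Omega> \<longrightarrow> P x = u x" "AE x in lborel. x \<in> \<Omega> \<longrightarrow> G x = weak_gradient \<Omega> u x"
    "\<And>x. x \<notin> \<Omega> \<Longrightarrow> G x = 0"
proof -
  define g where "g = weak_gradient \<Omega> u"
  have u1: "u \<in> H1 \<Omega>" using u by (simp add: H01_def)
  note g = H1_weak_gradient[OF \<Omega>(1) u1, folded g_def]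
  have uL: "u \<in> L2 \<Omega>" using u1 by (simp add: H1_def)
  \<comment> \<open>Norms below (1/4)^n give squares below (1/16)^n, fast enough for summability
    both of the squared errors and of the increments under a measure of finite energy.\<close>
  have "\<exists>\<phi>\<in>test_functions \<Omega>. H1_norm \<Omega> (\<lambda>x. u x - \<phi> x) < (1/4)^n" for n :: nat
    using u by (simp add: H01_def)
  then obtain p where p: "\<And>n. p n \<in> test_functions \<Omega>" "\<And>n. H1_norm \<Omega> (\<lambda>x. u x - p n x) < (1/4)^n"
    by metis
  have small: "(L2_norm \<Omega> (\<lambda>x. u x - p n x))\<^sup>2 \<le> (1/16)^n"
    "(L2_norm \<Omega> (\<lambda>x. g x - grad (p n) x))\<^sup>2 \<le> (1/16)^n" for n
  proof -
    have wg: "is_weak_gradient \<Omega> (\<lambda>x. u x - p n x) (\<lambda>x. g x - grad (p n) x)"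
      by (rule is_weak_gradient_diff[OF \<Omega>(1) g(1) is_weak_gradient_test[OF \<Omega>(1) p(1)]])
    have gm: "(\<lambda>x. g x - grad (p n) x) \<in> borel_measurable (lebesgue_on \<Omega>)"
    proof (rule borel_measurable_diff)
      show "g \<in> borel_measurable (lebesgue_on \<Omega>)" using g(2) by (simp add: L2_def)
      show "grad (p n) \<in> borel_measurable (lebesgue_on \<Omega>)"
        using test_functions_borel_grad[OF p(1)[of n]]
        by (auto intro!: measurable_restrict_space1 measurable_completion)
    qed
    have eq: "L2_norm \<Omega> (weak_gradient \<Omega> (\<lambda>x. u x - p n x)) = L2_norm \<Omega> (\<lambda>x. g x - grad (p n) x)"
      using weak_gradient_AE_eq[OF \<Omega>(1) wg] gm by (intro L2_norm_cong_AE)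
    have "0 \<le> H1_norm \<Omega> (\<lambda>x. u x - p n x)" by (simp add: H1_norm_def)
    then have "(H1_norm \<Omega> (\<lambda>x. u x - p n x))\<^sup>2 \<le> ((1/4)^n)\<^sup>2"
      using p(2)[of n] by (intro power_mono) auto
    also have "((1/4::real)^n)\<^sup>2 = (1/16)^n" by (simp add: power2_eq_square power_mult_distrib[symmetric])
    finally have "(L2_norm \<Omega> (\<lambda>x. u x - p n x))\<^sup>2 + (L2_norm \<Omega> (\<lambda>x. g x - grad (p n) x))\<^sup>2 \<le> (1/16)^n"
      by (simp add: H1_norm_def eq)
    then show "(L2_norm \<Omega> (\<lambda>x. u x - p n x))\<^sup>2 \<le> (1/16)^n"
      "(L2_norm \<Omega> (\<lambda>x. g x - grad (p n) x))\<^sup>2 \<le> (1/16)^n"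
      using zero_le_power2[of "L2_norm \<Omega> (\<lambda>x. u x - p n x)"] zero_le_power2[of "L2_norm \<Omega> (\<lambda>x. g x - grad (p n) x)"]
      by linarith+
  qed
  define P where "P = (\<lambda>x. lim (\<lambda>n. p n x))"
  define G where "G = (\<lambda>x. lim (\<lambda>n. grad (p n) x))"
  have ip: "integrable lborel (\<lambda>x. (norm (p n x))\<^sup>2)" for n
    using test_functions_integrable(2)[OF p(1)] by simp
  note LP = L2_limit_of_test_functions[OF \<Omega>(1) test_functions_borel[OF p(1)] test_functions_outside(1)[OF p(1)]
      ip uL small(1)[unfolded L2_norm_sq]]
  note LG = L2_limit_of_test_functions[OF \<Omega>(1) test_functions_borel_grad[OF p(1)] test_functions_outside(2)[OF p(1)]
      test_functions_integrable(4)[OF p(1)] g(2) small(2)[unfolded L2_norm_sq]]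
  have H: "H1_limit \<Omega> p P G"
    unfolding P_def G_def
  proof (rule H1_limit.intro)
    show "AE x in lborel. (\<lambda>n. p n x) \<longlonglongrightarrow> lim (\<lambda>n. p n x)" by (rule LP(3))
    show "L2_tendsto lborel p (\<lambda>x. lim (\<lambda>n. p n x))" by (rule LP(4))
    show "L2_tendsto lborel (\<lambda>n. grad (p n)) (\<lambda>x. lim (\<lambda>n. grad (p n) x))" by (rule LG(4))
  qed (use \<Omega> p(1) LP(1) in auto)
  show ?thesis
    by (rule that[OF H]) (use LP(2) LG(1,2,5) in \<open>simp_all add: P_def G_def g_def\<close>)
qed

text \<open>The energy bound makes the first moments of consecutive differences geometrically small,
  so \<open>p n\<close> converges absolutely \<open>\<mu>\<close>-almost everywhere, and the limit
  is \<open>P\<close> by its definition as \<open>lim\<close>.\<close>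

lemma (in H1_limit) energy_measureI:
  assumes "sets \<mu> = sets borel" "sigma_finite_measure \<mu>" "0 \<le> c"
    and energy: "\<And>g. g \<in> test_functions \<Omega> \<Longrightarrow>
      (\<integral>\<^sup>+x. ennreal \<bar>g x\<bar> \<partial>\<mu>) \<le> ennreal (c * sqrt (\<integral>x. (norm (grad g x))\<^sup>2 \<partial>lborel))"
    and fast: "\<And>n. (\<integral>x. (norm (grad (p n) x - G x))\<^sup>2 \<partial>lborel) \<le> (1/16)^n"
    and P: "\<And>x. P x = lim (\<lambda>n. p n x)"
  shows "energy_measure \<Omega> p P G \<mu> c"
proof (rule energy_measure.intro[OF H1_limit_axioms], rule energy_measure_axioms.intro)
  note [measurable_cong] = assms(1)
  note G' = L2_tendstoD[OF grad_L2]
  have "AE x in \<mu>. summable (\<lambda>n. \<bar>p (Suc n) x - p n x\<bar>)"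
  proof (rule AE_summable_of_geometric_bound[where C = "2 * c"])
    show "(\<integral>\<^sup>+x. ennreal \<bar>p (Suc n) x - p n x\<bar> \<partial>\<mu>) \<le> ennreal (2 * c * (1/2)^n)" for n
    proof -
      define q where "q = (\<lambda>x. p (Suc n) x - p n x)"
      have q: "q \<in> test_functions \<Omega>" unfolding q_def by (intro test_functions_diff p_test)
      have gq: "grad q x = grad (p (Suc n)) x - grad (p n) x" for x
        unfolding q_def by (intro grad_diff smooth_differentiable test_functions_smooth[OF p_test])
      have "(\<integral>x. (norm (grad q x))\<^sup>2 \<partial>lborel)
          \<le> 2 * (\<integral>x. (norm (grad (p (Suc n)) x - G x))\<^sup>2 \<partial>lborel) + 2 * (\<integral>x. (norm (grad (p n) x - G x))\<^sup>2 \<partial>lborel)"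
        unfolding gq by (rule grad_difference_sq(1))
      also have "\<dots> \<le> 2 * (1/16)^Suc n + 2 * (1/16)^n"
        by (intro add_mono mult_left_mono fast) auto
      also have "\<dots> \<le> 4 * (1/16)^n" by simp
      also have "\<dots> \<le> 4 * (1/4)^n" by (intro mult_left_mono power_mono) auto
      also have "\<dots> = (2 * (1/2)^n)\<^sup>2" by (simp add: power_mult_distrib power2_eq_square power_mult_distrib[symmetric])
      finally have L: "(\<integral>x. (norm (grad q x))\<^sup>2 \<partial>lborel) \<le> (2 * (1/2)^n)\<^sup>2" .
      have "sqrt (\<integral>x. (norm (grad q x))\<^sup>2 \<partial>lborel) \<le> 2 * (1/2)^n"
        by (rule real_le_lsqrt) (use L in auto)
      then have "c * sqrt (\<integral>x. (norm (grad q x))\<^sup>2 \<partial>lborel) \<le> c * (2 * (1/2)^n)"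
        using assms(3) by (rule mult_left_mono)
      then have "ennreal (c * sqrt (\<integral>x. (norm (grad q x))\<^sup>2 \<partial>lborel)) \<le> ennreal (2 * c * (1/2)^n)"
        by (intro ennreal_leI) (simp add: mult_ac)
      with energy[OF q] show ?thesis unfolding q_def by (rule order_trans)
    qed
  qed (use assms(3) in auto)
  then show "AE x in \<mu>. (\<lambda>n. p n x) \<longlonglongrightarrow> P x"
  proof eventually_elim
    case (elim x)
    then have "summable (\<lambda>n. p (Suc n) x - p n x)" by (rule summable_rabs_cancel)
    then have "convergent (\<lambda>n. p n x)" 
      by (simp add: summable_iff_convergent sum_lessThan_telescope[of "\<lambda>i. p i x"] convergent_diff_const_right_iff)
    then show ?case by (simp add: P convergent_LIMSEQ_iff)
  qed
qed (fact assms)+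

text \<open>The energy bound makes \<open>p n\<close> Cauchy in the first moment; Fatou's lemma in
  the second index identifies the limit as \<open>P\<close>. This lets the weak equations be tested
  with the limits, although these are not test functions.\<close>

lemma (in energy_measure) p_integral_tendsto:
  "integrable \<mu> P" "(\<lambda>n. \<integral>x. p n x \<partial>\<mu>) \<longlonglongrightarrow> (\<integral>x. P x \<partial>\<mu>)"
proof -
  note G' = L2_tendstoD[OF grad_L2]
  define a where "a = (\<lambda>n. \<integral>x. (norm (grad (p n) x - G x))\<^sup>2 \<partial>lborel)"
  have a0: "0 \<le> a n" for n by (simp add: a_def)
  have alim: "a \<longlonglongrightarrow> 0" unfolding a_def by (rule G'(5))
  have pm: "(\<integral>\<^sup>+x. ennreal \<bar>p n x - p m x\<bar> \<partial>\<mu>) \<le> ennreal (c * sqrt (2 * a n + 2 * a m))" for n m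
  proof -
    define q where "q = (\<lambda>x. p n x - p m x)"
    have q: "q \<in> test_functions \<Omega>" unfolding q_def by (intro test_functions_diff p_test)
    have gq: "grad q x = grad (p n) x - grad (p m) x" for x
      unfolding q_def by (intro grad_diff smooth_differentiable test_functions_smooth[OF p_test])
    have "(\<integral>x. (norm (grad q x))\<^sup>2 \<partial>lborel) \<le> 2 * a n + 2 * a m"
      unfolding gq a_def by (rule grad_difference_sq(1))
    then have "c * sqrt (\<integral>x. (norm (grad q x))\<^sup>2 \<partial>lborel) \<le> c * sqrt (2 * a n + 2 * a m)"
      using c_nonneg by (intro mult_left_mono real_sqrt_le_mono)
    with energy[OF q] show ?thesis unfolding q_def by (meson ennreal_leI order_trans)
  qed
  have Pm: "(\<integral>\<^sup>+x. ennreal \<bar>p n x - P x\<bar> \<partial>\<mu>) \<le> ennreal (c * sqrt (2 * a n))" for n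
  proof -
    have "(\<integral>\<^sup>+x. ennreal \<bar>p n x - P x\<bar> \<partial>\<mu>) = (\<integral>\<^sup>+x. liminf (\<lambda>m. ennreal \<bar>p n x - p m x\<bar>) \<partial>\<mu>)"
    proof (rule nn_integral_cong_AE)
      show "AE x in \<mu>. ennreal \<bar>p n x - P x\<bar> = liminf (\<lambda>m. ennreal \<bar>p n x - p m x\<bar>)"
        using p_lim_\<mu>
      proof eventually_elim
        case (elim x)
        have "(\<lambda>m. ennreal \<bar>p n x - p m x\<bar>) \<longlonglongrightarrow> ennreal \<bar>p n x - P x\<bar>"
          by (intro tendsto_intros elim)
        then show ?case by (intro lim_imp_Liminf[symmetric]) auto
      qed
    qed
    also have "\<dots> \<le> liminf (\<lambda>m. \<integral>\<^sup>+x. ennreal \<bar>p n x - p m x\<bar> \<partial>\<mu>)"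
      by (rule nn_integral_liminf) measurable
    also have "\<dots> \<le> liminf (\<lambda>m. ennreal (c * sqrt (2 * a n + 2 * a m)))"
      using pm by (intro Liminf_mono) auto
    also have "\<dots> = ennreal (c * sqrt (2 * a n + 2 * 0))"
      by (intro lim_imp_Liminf tendsto_intros alim) auto
    finally show ?thesis by simp
  qed
  have ip: "integrable \<mu> (p n)" for n
  proof (rule integrableI_bounded)
    show "(\<integral>\<^sup>+x. ennreal (norm (p n x)) \<partial>\<mu>) < \<infinity>"
      using energy[OF p_test[of n]] by (simp add: le_less_trans[OF _ ennreal_less_top])
  qed measurable
  have id: "integrable \<mu> (\<lambda>x. p n x - P x)" for n
  proof (rule integrableI_bounded)
    show "(\<integral>\<^sup>+x. ennreal (norm (p n x - P x)) \<partial>\<mu>) < \<infinity>"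
      using Pm[of n] by (simp add: le_less_trans[OF _ ennreal_less_top])
  qed measurable
  show iP: "integrable \<mu> P"
    using Bochner_Integration.integrable_diff[OF ip[of 0] id[of 0]] by simp
  have "(\<lambda>n. (\<integral>x. p n x \<partial>\<mu>) - (\<integral>x. P x \<partial>\<mu>)) \<longlonglongrightarrow> 0"
  proof (rule Lim_null_comparison)
    show "\<forall>\<^sub>F n in sequentially. norm ((\<integral>x. p n x \<partial>\<mu>) - (\<integral>x. P x \<partial>\<mu>)) \<le> c * sqrt (2 * a n)"
    proof (intro always_eventually allI)
      fix n
      have "norm ((\<integral>x. p n x \<partial>\<mu>) - (\<integral>x. P x \<partial>\<mu>)) = norm (\<integral>x. p n x - P x \<partial>\<mu>)"
        using ip iP by simp
      also have "\<dots> \<le> (\<integral>x. norm (p n x - P x) \<partial>\<mu>)" by (rule integral_norm_bound)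
      also have "\<dots> \<le> c * sqrt (2 * a n)"
      proof -
        have "ennreal (\<integral>x. norm (p n x - P x) \<partial>\<mu>) = (\<integral>\<^sup>+x. ennreal \<bar>p n x - P x\<bar> \<partial>\<mu>)"
          using id[of n] by (subst nn_integral_eq_integral) auto
        also have "\<dots> \<le> ennreal (c * sqrt (2 * a n))" by (rule Pm)
        finally show ?thesis using c_nonneg a0[of n] by (subst (asm) ennreal_le_iff) auto
      qed
      finally show "norm ((\<integral>x. p n x \<partial>\<mu>) - (\<integral>x. P x \<partial>\<mu>)) \<le> c * sqrt (2 * a n)" .
    qed
    have "(\<lambda>n. c * sqrt (2 * a n)) \<longlonglongrightarrow> c * sqrt (2 * 0)" by (intro tendsto_intros alim)
    then show "(\<lambda>n. c * sqrt (2 * a n)) \<longlonglongrightarrow> 0" by simp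
  qed
  then show "(\<lambda>n. \<integral>x. p n x \<partial>\<mu>) \<longlonglongrightarrow> (\<integral>x. P x \<partial>\<mu>)" by (simp add: LIM_zero_iff)
qed

section \<open>Coefficients\<close>

lemma borel_measurable_vec:
  fixes b :: "'a \<Rightarrow> real^'n"
  assumes "\<And>i. (\<lambda>x. b x $ i) \<in> borel_measurable M"
  shows "b \<in> borel_measurable M"
proof -
  have "b x = (\<Sum>i\<in>UNIV. (b x $ i) *\<^sub>R axis i 1)" for x
    using basis_expansion[of "b x"] by (simp add: scalar_mult_eq_scaleR)
  then have "b = (\<lambda>x. \<Sum>i\<in>UNIV. (b x $ i) *\<^sub>R axis i 1)" by auto
  also have "\<dots> \<in> borel_measurable M"
    using assms by (intro borel_measurable_sum borel_measurable_scaleR) auto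
  finally show ?thesis .
qed

lemma borel_measurable_nth:
  fixes b :: "'a \<Rightarrow> ('b::euclidean_space)^'n"
  assumes "b \<in> borel_measurable M"
  shows "(\<lambda>x. b x $ i) \<in> borel_measurable M"
proof -
  have "(\<lambda>y::'b^'n. y $ i) \<in> borel_measurable borel"
    by (intro borel_measurable_continuous_onI continuous_intros)
  from measurable_compose[OF assms this] show ?thesis .
qed

lemma borel_measurable_matrix_vector_mult:
  fixes A :: "'a \<Rightarrow> real^'n^'m" and g :: "'a \<Rightarrow> real^'n"
  assumes A: "\<And>i j. (\<lambda>x. A x $ i $ j) \<in> borel_measurable M" and g: "g \<in> borel_measurable M"
  shows "(\<lambda>x. A x *v g x) \<in> borel_measurable M"
  using A borel_measurable_nth[OF g]
  by (intro borel_measurable_vec) (simp add: matrix_vector_mult_def)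

lemma norm_matrix_vector_mult_le:
  fixes A :: "real^'n^'m"
  assumes "\<And>i j. \<bar>A $ i $ j\<bar> \<le> C"
  shows "norm (A *v \<xi>) \<le> (real CARD('m) * real CARD('n) * C) * norm \<xi>"
proof -
  have "norm (A *v \<xi>) \<le> (\<Sum>i\<in>UNIV. \<bar>(A *v \<xi>) $ i\<bar>)" by (rule norm_le_l1_cart)
  also have "\<dots> \<le> (\<Sum>i\<in>(UNIV::'m set). real CARD('n) * (C * norm \<xi>))"
  proof (rule sum_mono)
    fix i
    have "\<bar>(A *v \<xi>) $ i\<bar> \<le> (\<Sum>j\<in>UNIV. \<bar>A $ i $ j * \<xi> $ j\<bar>)"
      by (simp add: matrix_vector_mult_def sum_abs)
    also have "\<dots> \<le> (\<Sum>j\<in>(UNIV::'n set). C * norm \<xi>)"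
    proof (rule sum_mono)
      fix j
      show "\<bar>A $ i $ j * \<xi> $ j\<bar> \<le> C * norm \<xi>"
        unfolding abs_mult
        by (intro mult_mono assms component_le_norm_cart order_trans[OF abs_ge_zero assms[of i j]]) simp
    qed
    finally show "\<bar>(A *v \<xi>) $ i\<bar> \<le> real CARD('n) * (C * norm \<xi>)" by simp
  qed
  finally show ?thesis by (simp add: mult_ac)
qed

text \<open>A Borel version of the coefficients is needed for fluxes that are Borel on the whole
  space. The constant \<open>C\<close> is the entrywise bound times the number of entries.\<close>

lemma M_coeff_borel:
  fixes A :: "real^'n \<Rightarrow> real^'n^'n"
  assumes \<Omega>: "open \<Omega>" and A: "A \<in> M_coeff \<alpha> \<beta> \<Omega>"
  obtains A' C where "\<And>i j. (\<lambda>x. A' x $ i $ j) \<in> borel_measurable borel"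
    "AE x in lborel. x \<in> \<Omega> \<longrightarrow> A' x = A x"
    "AE x in lborel. x \<in> \<Omega> \<longrightarrow> (\<forall>\<xi>. \<alpha> * (norm \<xi>)\<^sup>2 \<le> (A' x *v \<xi>) \<bullet> \<xi>)"
    "AE x in lborel. x \<in> \<Omega> \<longrightarrow> (\<forall>\<xi>. norm (A' x *v \<xi>) \<le> C * norm \<xi>)"
proof -
  have \<Omega>s: "\<Omega> \<in> sets borel" using \<Omega> by simp
  have \<Omega>l: "\<Omega> \<inter> space lebesgue \<in> sets lebesgue" using \<Omega> by (simp add: sets_completionI_sets)
  have Am: "A \<in> borel_measurable (lebesgue_on \<Omega>)" using A by (simp add: M_coeff_def)
  have "\<exists>C. AE x in lebesgue_on \<Omega>. \<forall>i j. \<bar>A x $ i $ j\<bar> \<le> C" using A by (simp add: M_coeff_def)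
  then obtain C where C: "AE x in lebesgue_on \<Omega>. \<forall>i j. \<bar>A x $ i $ j\<bar> \<le> C" by blast
  have coe: "AE x in lebesgue_on \<Omega>. \<forall>\<xi>. \<alpha> * (norm \<xi>)\<^sup>2 \<le> (A x *v \<xi>) \<bullet> \<xi>"
  proof -
    have "AE x in lebesgue_on \<Omega>. \<forall>\<xi>. (A x *v \<xi>) \<bullet> \<xi> \<ge> \<alpha> * (norm \<xi>)\<^sup>2 \<and>
       (matrix_inv (A x) *v \<xi>) \<bullet> \<xi> \<ge> inverse \<beta> * (norm \<xi>)\<^sup>2"
      using A by (simp add: M_coeff_def)
    then show ?thesis by eventually_elim blast
  qed
  have "\<exists>a\<in>borel_measurable lborel. AE x in lborel. indicator \<Omega> x * A x $ i $ j = a x" for i j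
  proof (rule completion_ex_borel_measurable_real)
    have "(\<lambda>x. A x $ i $ j) \<in> borel_measurable (lebesgue_on \<Omega>)"
      by (intro borel_measurable_nth Am)
    then show "(\<lambda>x. indicator \<Omega> x * A x $ i $ j) \<in> borel_measurable lebesgue"
      by (simp add: borel_measurable_restrict_space_iff[OF \<Omega>l])
  qed
  then have "\<forall>i j. \<exists>a. a \<in> borel_measurable lborel \<and> (AE x in lborel. indicator \<Omega> x * A x $ i $ j = a x)"
    by blast
  then obtain a where "\<forall>i j. a i j \<in> borel_measurable lborel \<and> (AE x in lborel. indicator \<Omega> x * A x $ i $ j = a i j x)"
    unfolding choice_iff by blast
  then have a: "\<And>i j. a i j \<in> borel_measurable lborel" "\<And>i j. AE x in lborel. indicator \<Omega> x * A x $ i $ j = a i j x"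
    by blast+
  define A' where "A' = (\<lambda>x. \<chi> i j. a i j x)"
  have "AE x in lborel. \<forall>i. \<forall>j. indicator \<Omega> x * A x $ i $ j = a i j x"
    unfolding AE_all_countable using a(2) by blast
  then have AA: "AE x in lborel. x \<in> \<Omega> \<longrightarrow> A' x = A x"
    by eventually_elim (auto simp: A'_def vec_eq_iff)
  show ?thesis
  proof (rule that[of A' "real CARD('n) * real CARD('n) * C"])
    show "(\<lambda>x. A' x $ i $ j) \<in> borel_measurable borel" for i j using a(1) by (simp add: A'_def)
    show "AE x in lborel. x \<in> \<Omega> \<longrightarrow> A' x = A x" by (rule AA)
    show "AE x in lborel. x \<in> \<Omega> \<longrightarrow> (\<forall>\<xi>. \<alpha> * (norm \<xi>)\<^sup>2 \<le> (A' x *v \<xi>) \<bullet> \<xi>)"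
      using AA iffD1[OF AE_lebesgue_on[OF \<Omega>s] coe] by eventually_elim simp
    show "AE x in lborel. x \<in> \<Omega> \<longrightarrow> (\<forall>\<xi>. norm (A' x *v \<xi>) \<le> (real CARD('n) * real CARD('n) * C) * norm \<xi>)"
      using AA iffD1[OF AE_lebesgue_on[OF \<Omega>s] C] by eventually_elim (auto intro!: norm_matrix_vector_mult_le)
  qed
qed

section \<open>The measures of the equation\<close>

text \<open>Testing with the absolute value of \<open>g\<close> is not possible, so it is replaced
  by the sum of the softened positive and negative parts. The gradient of this sum is that of
  \<open>g\<close> times a difference of two slopes in [0, 1], hence not longer. The Cauchy-Schwarz
  inequality bounds its integral, and Fatou's lemma restores |g|.\<close>

lemma energy_bound:
  fixes B :: "real^'n \<Rightarrow> real^'n"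
  assumes [measurable_cong]: "sets \<mu> = sets borel"
    and B [measurable]: "B \<in> borel_measurable borel" "integrable lborel (\<lambda>x. (norm (B x))\<^sup>2)"
    and eq: "\<And>\<phi>. \<phi> \<in> test_functions \<Omega> \<Longrightarrow> integrable \<mu> \<phi>"
      "\<And>\<phi>. \<phi> \<in> test_functions \<Omega> \<Longrightarrow> (\<integral>x. B x \<bullet> grad \<phi> x \<partial>lborel) = (\<integral>x. \<phi> x \<partial>\<mu>)"
    and g: "g \<in> test_functions \<Omega>"
  shows "(\<integral>\<^sup>+x. ennreal \<bar>g x\<bar> \<partial>\<mu>)
    \<le> ennreal (sqrt (\<integral>x. (norm (B x))\<^sup>2 \<partial>lborel) * sqrt (\<integral>x. (norm (grad g x))\<^sup>2 \<partial>lborel))"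
proof -
  let ?c = "sqrt (\<integral>x. (norm (B x))\<^sup>2 \<partial>lborel) * sqrt (\<integral>x. (norm (grad g x))\<^sup>2 \<partial>lborel)"
  define \<tau> where "\<tau> = (\<lambda>n. inverse (real (Suc n)))"
  have \<tau>: "0 < \<tau> n" for n by (simp add: \<tau>_def)
  define j where "j = (\<lambda>n x. \<tau> n * soft (g x / \<tau> n) + \<tau> n * soft (- g x / \<tau> n))"
  have gs: "smooth g" by (rule test_functions_smooth[OF g])
  have half: "(\<lambda>x. \<tau> n * soft (f x / \<tau> n)) \<in> test_functions \<Omega>"
    "grad (\<lambda>x. \<tau> n * soft (f x / \<tau> n)) x = soft' (f x / \<tau> n) *\<^sub>R grad f x" if f: "f \<in> test_functions \<Omega>" for f n x
  proof -
    obtain K where K: "compact K" "K \<subseteq> \<Omega>" "\<And>x. x \<notin> K \<Longrightarrow> f x = 0"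
      using f test_functionsE by metis
    have "smooth (\<lambda>x. \<tau> n * soft (f x / \<tau> n))"
      by (intro smooth_mult[OF smooth_const] smooth_compose[OF real_smooth_soft] smooth_divide test_functions_smooth[OF f])
    then show "(\<lambda>x. \<tau> n * soft (f x / \<tau> n)) \<in> test_functions \<Omega>"
      using K by (intro test_functionsI[of _ K]) (auto simp: soft_def)
    have "((\<lambda>t. \<tau> n * soft (t / \<tau> n)) has_real_derivative soft' (t / \<tau> n)) (at t)" for t
      using \<tau>[of n] by (auto intro!: derivative_eq_intros DERIV_chain2[OF soft_DERIV])
    from grad_compose(1)[OF this smooth_differentiable[OF test_functions_smooth[OF f]]]
    show "grad (\<lambda>x. \<tau> n * soft (f x / \<tau> n)) x = soft' (f x / \<tau> n) *\<^sub>R grad f x" .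
  qed
  have mg: "(\<lambda>x. - g x) \<in> test_functions \<Omega>" and gmg: "grad (\<lambda>x. - g x) x = - grad g x" for x
    using test_functions_mult[OF smooth_const[of "-1"] g]
      grad_diff[of "\<lambda>x. 0" x g] smooth_differentiable[OF gs] grad_eqI[of "\<lambda>x. 0" 0 x] by auto
  have jt: "j n \<in> test_functions \<Omega>" for n
    unfolding j_def by (intro test_functions_add half(1)[OF g] half(1)[OF mg])
  have j0: "0 \<le> j n x" for n x using \<tau>[of n] soft_nonneg by (simp add: j_def)
  have gj: "norm (grad (j n) x) \<le> norm (grad g x)" for n x
  proof -
    have "grad (j n) x = soft' (g x / \<tau> n) *\<^sub>R grad g x + soft' (- g x / \<tau> n) *\<^sub>R (- grad g x)"
      unfolding j_def
      using grad_add[OF smooth_differentiable[OF test_functions_smooth[OF half(1)[OF g]]]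
          smooth_differentiable[OF test_functions_smooth[OF half(1)[OF mg]]]]
      by (simp only: half(2)[OF g] half(2)[OF mg] gmg)
    also have "\<dots> = (soft' (g x / \<tau> n) - soft' (- g x / \<tau> n)) *\<^sub>R grad g x" by (simp add: scaleR_diff_left)
    finally have "norm (grad (j n) x) = \<bar>soft' (g x / \<tau> n) - soft' (- g x / \<tau> n)\<bar> * norm (grad g x)" by simp
    also have "\<dots> \<le> 1 * norm (grad g x)"
      using soft'_nonneg[of "g x / \<tau> n"] soft'_le_1[of "g x / \<tau> n"] soft'_nonneg[of "- g x / \<tau> n"] soft'_le_1[of "- g x / \<tau> n"]
      by (intro mult_right_mono) auto
    finally show ?thesis by simp
  qed
  have jbound: "(\<integral>\<^sup>+x. ennreal (j n x) \<partial>\<mu>) \<le> ennreal ?c" for n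
  proof -
    have "(\<integral>\<^sup>+x. ennreal (j n x) \<partial>\<mu>) = ennreal (\<integral>x. j n x \<partial>\<mu>)"
      using eq(1)[OF jt] j0 by (intro nn_integral_eq_integral) auto
    also have "(\<integral>x. j n x \<partial>\<mu>) = (\<integral>x. B x \<bullet> grad (j n) x \<partial>lborel)" using eq(2)[OF jt] by simp
    also have "\<dots> \<le> \<bar>\<integral>x. B x \<bullet> grad (j n) x \<partial>lborel\<bar>" by simp
    also have "\<dots> \<le> sqrt (\<integral>x. (norm (B x))\<^sup>2 \<partial>lborel) * sqrt (\<integral>x. (norm (grad (j n) x))\<^sup>2 \<partial>lborel)"
      using B test_functions_integrable(4)[OF jt] test_functions_borel_grad[OF jt]
      by (intro integral_Cauchy_Schwarz) auto
    also have "\<dots> \<le> ?c"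
      using gj test_functions_integrable(4)[OF jt] test_functions_integrable(4)[OF g]
      by (intro mult_left_mono real_sqrt_le_mono integral_mono power_mono) auto
    finally show ?thesis by (simp add: ennreal_leI)
  qed
  have [measurable]: "j n \<in> borel_measurable borel" for n by (rule test_functions_borel[OF jt])
  have jl: "(\<lambda>n. j n x) \<longlonglongrightarrow> \<bar>g x\<bar>" for x
  proof -
    have l: "(\<lambda>n. \<tau> n * soft (t / \<tau> n)) \<longlonglongrightarrow> max 0 t" for t
      unfolding \<tau>_def by (rule soft_scaled_tendsto)
    have "(\<lambda>n. j n x) \<longlonglongrightarrow> max 0 (g x) + max 0 (- g x)"
      unfolding j_def by (intro tendsto_add l)
    then show ?thesis by (simp add: max_def abs_real_def split: if_splits)
  qed
  have "(\<integral>\<^sup>+x. ennreal \<bar>g x\<bar> \<partial>\<mu>) = (\<integral>\<^sup>+x. liminf (\<lambda>n. ennreal (j n x)) \<partial>\<mu>)"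
    by (intro nn_integral_cong lim_imp_Liminf[symmetric] tendsto_ennrealI jl) auto
  also have "\<dots> \<le> liminf (\<lambda>n. \<integral>\<^sup>+x. ennreal (j n x) \<partial>\<mu>)"
    by (rule nn_integral_liminf) measurable
  also have "\<dots> \<le> liminf (\<lambda>n. ennreal ?c)" using jbound by (intro Liminf_mono) auto
  also have "\<dots> = ennreal ?c" by (simp add: Liminf_const)
  finally show ?thesis .
qed

text \<open>Measures of the problem live on the trace sigma-algebra of \<open>\<Omega>\<close>.
  Pushed forward to all Borel sets they can be combined with translations and with
  \<open>lborel\<close>.\<close>

definition ext :: "(real^'n) measure \<Rightarrow> (real^'n) measure"
  where "ext \<sigma> = distr \<sigma> borel (\<lambda>x. x)"

lemma sets_ext [measurable_cong, simp]: "sets (ext \<sigma>) = sets borel"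
  by (simp add: ext_def)

lemma M0_plus_space:
  assumes "\<sigma> \<in> M0_plus \<Omega>"
  shows "space \<sigma> = \<Omega>" "(\<lambda>x. x) \<in> measurable \<sigma> borel"
proof -
  have s: "sets \<sigma> = sets (restrict_space borel \<Omega>)" using assms by (simp add: M0_plus_def)
  show "space \<sigma> = \<Omega>" using sets_eq_imp_space_eq[OF s] by (simp add: space_restrict_space)
  show "(\<lambda>x. x) \<in> measurable \<sigma> borel"
    unfolding measurable_cong_sets[OF s refl] by (intro measurable_restrict_space1) simp
qed

lemma emeasure_ext:
  assumes "\<sigma> \<in> M0_plus \<Omega>" "E \<in> sets borel"
  shows "emeasure (ext \<sigma>) E = emeasure \<sigma> (E \<inter> \<Omega>)"
  using assms M0_plus_space[OF assms(1)] by (simp add: ext_def emeasure_distr)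

lemma sigma_finite_ext:
  fixes \<sigma> :: "(real^'n) measure"
  assumes \<sigma>: "\<sigma> \<in> M0_plus \<Omega>" and \<Omega>: "open \<Omega>"
  shows "sigma_finite_measure (ext \<sigma>)"
proof
  obtain C where C: "\<And>n. compact (C n)" "\<And>n. C n \<subseteq> \<Omega>" "\<Union>(range C) = \<Omega>"
    "\<And>n. C n \<subseteq> interior (C (Suc n))"
    by (rule open_Union_compact_subsets[OF \<Omega>]) blast
  have Cs: "C n \<in> sets borel" for n using C(1) by (simp add: borel_compact)
  have "emeasure (ext \<sigma>) (C n) \<noteq> \<infinity>" for n
  proof -
    have "emeasure (ext \<sigma>) (C n) = emeasure \<sigma> (C n)" using C(2)[of n] by (simp add: emeasure_ext[OF \<sigma> Cs] Int_absorb2)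
    then show ?thesis using \<sigma> C(1,2) by (auto simp: M0_plus_def less_top)
  qed
  moreover have "emeasure (ext \<sigma>) (- \<Omega>) \<noteq> \<infinity>" using \<Omega> by (simp add: emeasure_ext[OF \<sigma>])
  ultimately have fin: "\<forall>E\<in>insert (- \<Omega>) (range C). emeasure (ext \<sigma>) E \<noteq> \<infinity>" by simp
  have "\<Union>(insert (- \<Omega>) (range C)) = UNIV"
    by (simp only: Union_insert C(3) Compl_partition2)
  then have "\<Union>(insert (- \<Omega>) (range C)) = space (ext \<sigma>)" by (simp only: ext_def space_distr space_borel)
  moreover have "insert (- \<Omega>) (range C) \<subseteq> sets (ext \<sigma>)" using \<Omega> Cs by auto
  moreover have "countable (insert (- \<Omega>) (range C))" by simp
  ultimately show "\<exists>A. countable A \<and> A \<subseteq> sets (ext \<sigma>) \<and> \<Union>A = space (ext \<sigma>) \<and> (\<forall>a\<in>A. emeasure (ext \<sigma>) a \<noteq> \<infinity>)"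
    using fin by (intro exI conjI)
qed

text \<open>Like the integrand in the definition of a weak solution, the weight is \<open>0\<close> where the
  regularization is infinite.\<close>

definition inverse_power_weight :: "(real^'n) set \<Rightarrow> real \<Rightarrow> (real^'n \<Rightarrow> real) \<Rightarrow> real^'n \<Rightarrow> real"
  where "inverse_power_weight \<Omega> lam u x = indicator \<Omega> x / real_of_ereal (lsc_reg \<Omega> u x) powr lam"

definition solution_measure :: "(real^'n) set \<Rightarrow> real \<Rightarrow> (real^'n) measure \<Rightarrow> (real^'n \<Rightarrow> real) \<Rightarrow> (real^'n) measure"
  where "solution_measure \<Omega> lam \<sigma> u = density (ext \<sigma>) (\<lambda>x. ennreal (inverse_power_weight \<Omega> lam u x))"

lemma inverse_power_weight_nonneg: "0 \<le> inverse_power_weight \<Omega> lam u x"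
  by (simp add: inverse_power_weight_def)

lemma weak_solution_measurable:
  "weak_solution \<Omega> A lam \<sigma> u \<Longrightarrow> u \<in> borel_measurable (lebesgue_on \<Omega>)"
  by (simp add: weak_solution_def H01_def H1_def L2_def)

lemma inverse_power_weight_borel:
  assumes "open \<Omega>" "u \<in> borel_measurable (lebesgue_on \<Omega>)"
  shows "inverse_power_weight \<Omega> lam u \<in> borel_measurable borel"
  using lsc_reg_borel[OF assms] unfolding inverse_power_weight_def[abs_def] .

lemma sets_solution_measure: "sets (solution_measure \<Omega> lam \<sigma> u) = sets borel"
  by (simp add: solution_measure_def)

lemma sigma_finite_solution_measure:
  assumes "open \<Omega>" "\<sigma> \<in> M0_plus \<Omega>" "u \<in> borel_measurable (lebesgue_on \<Omega>)"
  shows "sigma_finite_measure (solution_measure \<Omega> lam \<sigma> u)"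
proof -
  interpret sigma_finite_measure "ext \<sigma>" by (rule sigma_finite_ext[OF assms(2,1)])
  show ?thesis unfolding solution_measure_def
    using inverse_power_weight_borel[OF assms(1,3)]
    by (subst sigma_finite_iff_density_finite) auto
qed

lemma weak_solution_equation:
  fixes u :: "real^'n \<Rightarrow> real"
  assumes \<Omega>: "open \<Omega>" and \<sigma>: "\<sigma> \<in> M0_plus \<Omega>" and u: "weak_solution \<Omega> A lam \<sigma> u" and A: "A \<in> M_coeff \<alpha> \<beta> \<Omega>"
    and B: "B \<in> borel_measurable borel" "\<And>x. x \<notin> \<Omega> \<Longrightarrow> B x = 0"
      "AE x in lborel. x \<in> \<Omega> \<longrightarrow> B x = A x *v weak_gradient \<Omega> u x"
    and \<phi>: "\<phi> \<in> test_functions \<Omega>"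
  shows "integrable (solution_measure \<Omega> lam \<sigma> u) \<phi>"
    "(\<integral>x. B x \<bullet> grad \<phi> x \<partial>lborel) = (\<integral>x. \<phi> x \<partial>(solution_measure \<Omega> lam \<sigma> u))"
proof -
  let ?s = "inverse_power_weight \<Omega> lam u"
  note um = weak_solution_measurable[OF u]
  have [measurable]: "?s \<in> borel_measurable borel" by (rule inverse_power_weight_borel[OF \<Omega> um])
  have [measurable]: "\<phi> \<in> borel_measurable borel" by (rule test_functions_borel[OF \<phi>])
  have w: "integrable \<sigma> (\<lambda>x. \<phi> x / real_of_ereal (lsc_reg \<Omega> u x) powr lam)"
    "(\<integral>x. (A x *v weak_gradient \<Omega> u x) \<bullet> grad \<phi> x \<partial>(lebesgue_on \<Omega>)) =
       (\<integral>x. \<phi> x / real_of_ereal (lsc_reg \<Omega> u x) powr lam \<partial>\<sigma>)"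
    using u \<phi> by (auto simp: weak_solution_def)
  have cong: "?s x *\<^sub>R \<phi> x = \<phi> x / real_of_ereal (lsc_reg \<Omega> u x) powr lam" if "x \<in> space \<sigma>" for x
    using that M0_plus_space(1)[OF \<sigma>] by (simp add: inverse_power_weight_def)
  have nn: "AE x in ext \<sigma>. 0 \<le> ?s x" by (simp add: inverse_power_weight_nonneg)
  have "integrable \<sigma> (\<lambda>x. ?s x *\<^sub>R \<phi> x)"
    using w(1) by (subst Bochner_Integration.integrable_cong[OF refl cong]) auto
  then have "integrable (ext \<sigma>) (\<lambda>x. ?s x *\<^sub>R \<phi> x)"
    unfolding ext_def by (subst integrable_distr_eq[OF M0_plus_space(2)[OF \<sigma>]]) auto
  then show "integrable (solution_measure \<Omega> lam \<sigma> u) \<phi>"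
    unfolding solution_measure_def by (subst integrable_density[OF _ _ nn]) auto
  have "(\<integral>x. \<phi> x \<partial>(solution_measure \<Omega> lam \<sigma> u)) = (\<integral>x. ?s x *\<^sub>R \<phi> x \<partial>(ext \<sigma>))"
    unfolding solution_measure_def by (rule integral_density[OF _ _ nn]) auto
  also have "\<dots> = (\<integral>x. ?s x *\<^sub>R \<phi> x \<partial>\<sigma>)"
    unfolding ext_def by (rule integral_distr[OF M0_plus_space(2)[OF \<sigma>]]) auto
  also have "\<dots> = (\<integral>x. \<phi> x / real_of_ereal (lsc_reg \<Omega> u x) powr lam \<partial>\<sigma>)"
    by (rule Bochner_Integration.integral_cong[OF refl cong])
  also have "\<dots> = (\<integral>x. (A x *v weak_gradient \<Omega> u x) \<bullet> grad \<phi> x \<partial>(lebesgue_on \<Omega>))" using w(2) by simp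
  also have "\<dots> = (\<integral>x. B x \<bullet> grad \<phi> x \<partial>(lebesgue_on \<Omega>))"
  proof (rule integral_cong_AE)
    have Am: "A \<in> borel_measurable (lebesgue_on \<Omega>)" using A by (simp add: M_coeff_def)
    have u1: "u \<in> H1 \<Omega>" using u by (simp add: weak_solution_def H01_def)
    have gm: "weak_gradient \<Omega> u \<in> borel_measurable (lebesgue_on \<Omega>)"
      using H1_weak_gradient(2)[OF \<Omega> u1] by (simp add: L2_def)
    have [measurable]: "grad \<phi> \<in> borel_measurable (lebesgue_on \<Omega>)" "B \<in> borel_measurable (lebesgue_on \<Omega>)"
      using test_functions_borel_grad[OF \<phi>] B(1) by (auto intro!: measurable_restrict_space1 measurable_completion)
    have [measurable]: "(\<lambda>x. A x *v weak_gradient \<Omega> u x) \<in> borel_measurable (lebesgue_on \<Omega>)"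
      by (intro borel_measurable_matrix_vector_mult borel_measurable_nth Am gm)
    show "(\<lambda>x. (A x *v weak_gradient \<Omega> u x) \<bullet> grad \<phi> x) \<in> borel_measurable (lebesgue_on \<Omega>)" by measurable
    show "(\<lambda>x. B x \<bullet> grad \<phi> x) \<in> borel_measurable (lebesgue_on \<Omega>)" by measurable
    have "AE x in lebesgue_on \<Omega>. B x = A x *v weak_gradient \<Omega> u x"
      using B(3) \<Omega> by (simp add: AE_lebesgue_on)
    then show "AE x in lebesgue_on \<Omega>. (A x *v weak_gradient \<Omega> u x) \<bullet> grad \<phi> x = B x \<bullet> grad \<phi> x"
      by eventually_elim simp
  qed
  also have "\<dots> = (\<integral>x. B x \<bullet> grad \<phi> x \<partial>lborel)"
    using \<Omega> B(1,2) test_functions_borel_grad[OF \<phi>] by (intro lebesgue_on_integral(1)) auto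
  finally show "(\<integral>x. B x \<bullet> grad \<phi> x \<partial>lborel) = (\<integral>x. \<phi> x \<partial>(solution_measure \<Omega> lam \<sigma> u))" by simp
qed

section \<open>The total variation of a difference\<close>

text \<open>Both measures are absolutely continuous with respect to their sum. Sigma-finiteness
  makes the densities finite almost everywhere, so they can be taken real-valued, and their
  difference makes sense even where both measures are infinite.\<close>

lemma common_density:
  fixes M N :: "'a measure"
  assumes N: "sets N = sets M" and sM: "sigma_finite_measure M" and sN: "sigma_finite_measure N"
  obtains \<rho> and a b :: "'a \<Rightarrow> real" where "sets \<rho> = sets M" "sigma_finite_measure \<rho>"
    "a \<in> borel_measurable \<rho>" "b \<in> borel_measurable \<rho>" "\<And>x. 0 \<le> a x" "\<And>x. 0 \<le> b x"
    "M = density \<rho> (\<lambda>x. ennreal (a x))" "N = density \<rho> (\<lambda>x. ennreal (b x))"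
proof -
  define \<rho> where "\<rho> = measure_of (space M) (sets M) (\<lambda>E. emeasure M E + emeasure N E)"
  have s: "sets \<rho> = sets M" by (simp add: \<rho>_def sets.space_closed)
  have sp: "space \<rho> = space M" by (rule sets_eq_imp_space_eq[OF s])
  have spN: "space N = space M" by (rule sets_eq_imp_space_eq[OF N])
  have em: "emeasure \<rho> E = emeasure M E + emeasure N E" if "E \<in> sets M" for E
    unfolding \<rho>_def
  proof (rule emeasure_measure_of_sigma[OF sets.sigma_algebra_axioms _ _ that])
    show "positive (sets M) (\<lambda>E. emeasure M E + emeasure N E)" by (simp add: positive_def)
    show "countably_additive (sets M) (\<lambda>E. emeasure M E + emeasure N E)"
    proof (rule countably_additiveI)
      fix A :: "nat \<Rightarrow> 'a set" assume A: "range A \<subseteq> sets M" "disjoint_family A"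
      have "(\<Sum>i. emeasure M (A i) + emeasure N (A i)) = (\<Sum>i. emeasure M (A i)) + (\<Sum>i. emeasure N (A i))"
        by (rule suminf_add[symmetric]) auto
      also have "\<dots> = emeasure M (\<Union>i. A i) + emeasure N (\<Union>i. A i)"
        using A N by (simp add: suminf_emeasure)
      finally show "(\<Sum>i. emeasure M (A i) + emeasure N (A i)) = emeasure M (\<Union>i. A i) + emeasure N (\<Union>i. A i)" .
    qed
  qed
  have sf: "sigma_finite_measure \<rho>"
  proof
    obtain A where A: "countable A" "A \<subseteq> sets M" "\<Union>A = space M" "\<forall>a\<in>A. emeasure M a \<noteq> \<infinity>"
      using sigma_finite_measure.sigma_finite_countable[OF sM] by blast
    obtain B where B: "countable B" "B \<subseteq> sets N" "\<Union>B = space N" "\<forall>a\<in>B. emeasure N a \<noteq> \<infinity>"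
      using sigma_finite_measure.sigma_finite_countable[OF sN] by blast
    let ?C = "(\<lambda>(a, b). a \<inter> b) ` (A \<times> B)"
    have "emeasure \<rho> (a \<inter> b) \<noteq> \<infinity>" if "a \<in> A" "b \<in> B" for a b
    proof -
      have m: "a \<in> sets M" "b \<in> sets M" using that A B N by auto
      have "emeasure \<rho> (a \<inter> b) \<le> emeasure M a + emeasure N b"
        using m N by (subst em) (auto intro!: add_mono emeasure_mono)
      also have "\<dots> < \<infinity>" using A(4) B(4) that by (simp add: less_top)
      finally show ?thesis by simp
    qed
    moreover have "countable ?C" using A(1) B(1) by (intro countable_image countable_SIGMA)
    moreover have "?C \<subseteq> sets \<rho>" using A(2) B(2) N s by auto
    moreover have "\<Union>?C = space \<rho>"
    proof -
      have "\<Union>?C = \<Union>A \<inter> \<Union>B" by auto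
      then show ?thesis using A(3) B(3) sp spN by simp
    qed
    ultimately show "\<exists>C. countable C \<and> C \<subseteq> sets \<rho> \<and> \<Union>C = space \<rho> \<and> (\<forall>a\<in>C. emeasure \<rho> a \<noteq> \<infinity>)"
      by (intro exI[of _ ?C]) auto
  qed
  interpret \<rho>: sigma_finite_measure \<rho> by (rule sf)
  have dens: "\<exists>f. f \<in> borel_measurable \<rho> \<and> (\<forall>x. 0 \<le> f x) \<and> L = density \<rho> (\<lambda>x. ennreal (f x))"
    if L: "sets L = sets M" "sigma_finite_measure L" "\<And>E. E \<in> sets M \<Longrightarrow> emeasure L E \<le> emeasure \<rho> E" for L
  proof -
    have "absolutely_continuous \<rho> L"
    proof -
      have "emeasure L E = 0" if "E \<in> sets M" "emeasure \<rho> E = 0" for E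
        using L(3)[OF that(1)] that(2) by simp
      then show ?thesis using L(1) s by (auto simp: absolutely_continuous_def null_sets_def)
    qed
    then obtain f where f: "f \<in> borel_measurable \<rho>" "density \<rho> f = L"
      using \<rho>.Radon_Nikodym[of L] L(1) s by auto
    have "AE x in \<rho>. f x \<noteq> \<infinity>"
      using \<rho>.sigma_finite_iff_density_finite[OF f(1)] f(2) L(2) by simp
    then have "AE x in \<rho>. f x = ennreal (enn2real (f x))"
      by eventually_elim (simp add: less_top)
    then have "L = density \<rho> (\<lambda>x. ennreal (enn2real (f x)))"
      using f by (subst f(2)[symmetric], intro density_cong) auto
    then show ?thesis using f(1) by (intro exI[of _ "\<lambda>x. enn2real (f x)"]) auto
  qed
  obtain a where a: "a \<in> borel_measurable \<rho>" "\<forall>x. 0 \<le> a x" "M = density \<rho> (\<lambda>x. ennreal (a x))"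
    using dens[OF refl sM] em by auto
  obtain b where b: "b \<in> borel_measurable \<rho>" "\<forall>x. 0 \<le> b x" "N = density \<rho> (\<lambda>x. ennreal (b x))"
    using dens[OF N sN] em by auto
  show ?thesis using that[OF s sf a(1) b(1)] a b by auto
qed

text \<open>The upper bound is the triangle inequality for integrals over disjoint sets. For the
  lower bound, the Hahn decomposition is read off the densities: \<open>E\<close>, cut by a compact
  set of an exhaustion, splits into the parts where a \<ge> b and a < b, and on each of them the
  absolute value can be pulled out of the integral.\<close>

lemma abs_diff_measure_eq:
  fixes \<sigma> \<nu> :: "(real^'n) measure"
  assumes \<Omega>: "open \<Omega>" and \<sigma>: "\<sigma> \<in> M0_plus \<Omega>" and \<nu>: "\<nu> \<in> M0_plus \<Omega>"
    and \<rho> [measurable_cong]: "sets \<rho> = sets borel"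
    and [measurable]: "a \<in> borel_measurable borel" "b \<in> borel_measurable borel"
    and nn: "\<And>x. 0 \<le> a x" "\<And>x. 0 \<le> (b x :: real)"
    and dens: "ext \<sigma> = density \<rho> (\<lambda>x. ennreal (a x))" "ext \<nu> = density \<rho> (\<lambda>x. ennreal (b x))"
  shows "abs_diff_measure \<Omega> \<sigma> \<nu> = restrict_space (density \<rho> (\<lambda>x. ennreal \<bar>a x - b x\<bar>)) \<Omega>"
proof -
  define \<tau> where "\<tau> = density \<rho> (\<lambda>x. ennreal \<bar>a x - b x\<bar>)"
  have s\<tau>: "sets \<tau> = sets borel" by (simp add: \<tau>_def \<rho>)
  have \<Omega>s: "\<Omega> \<in> sets borel" using \<Omega> by simp
  define \<A> where "\<A> = sets (restrict_space borel \<Omega>)"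
  have A_iff: "E \<in> \<A> \<longleftrightarrow> E \<in> sets borel \<and> E \<subseteq> \<Omega>" for E
    using \<Omega>s by (auto simp: \<A>_def sets_restrict_space_iff)
  define adm where "adm = (\<lambda>F. F \<in> \<A> \<and> (\<exists>K. compact K \<and> F \<subseteq> K \<and> K \<subseteq> \<Omega>))"
  have diff: "measure \<sigma> F - measure \<nu> F = (\<integral>x. indicator F x * (a x - b x) \<partial>\<rho>)"
    and int: "integrable \<rho> (\<lambda>x. indicator F x * (a x - b x))" if F: "adm F" for F
  proof -
    have Fb [measurable]: "F \<in> sets borel" and F\<Omega>: "F \<subseteq> \<Omega>" using F by (auto simp: adm_def A_iff)
    obtain K where K: "compact K" "F \<subseteq> K" "K \<subseteq> \<Omega>" using F by (auto simp: adm_def)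
    have one: "integrable \<rho> (\<lambda>x. indicator F x * c x) \<and> measure \<theta> F = (\<integral>x. indicator F x * c x \<partial>\<rho>)"
      if \<theta>: "\<theta> \<in> M0_plus \<Omega>" and c: "c \<in> borel_measurable borel" "\<And>x. 0 \<le> c x" "ext \<theta> = density \<rho> (\<lambda>x. ennreal (c x))"
      for \<theta> and c :: "real^'n \<Rightarrow> real"
    proof -
      have [measurable]: "c \<in> borel_measurable borel" by (rule c)
      have "emeasure \<theta> F = emeasure (ext \<theta>) F" using F\<Omega> by (simp add: emeasure_ext[OF \<theta> Fb] Int_absorb2)
      also have "\<dots> = (\<integral>\<^sup>+x. ennreal (indicator F x * c x) \<partial>\<rho>)"
        unfolding c(3) by (subst emeasure_density) (auto intro!: nn_integral_cong simp: indicator_def)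
      finally have e: "emeasure \<theta> F = (\<integral>\<^sup>+x. ennreal (indicator F x * c x) \<partial>\<rho>)" .
      have "emeasure \<theta> F \<le> emeasure \<theta> K"
        using \<theta> K \<Omega>s by (intro emeasure_mono) (auto simp: M0_plus_def sets_restrict_space_iff borel_compact)
      also have "\<dots> < \<infinity>" using \<theta> K by (auto simp: M0_plus_def)
      finally have fin: "emeasure \<theta> F < \<infinity>" .
      have i: "integrable \<rho> (\<lambda>x. indicator F x * c x)"
        by (rule integrableI_nonneg) (use fin e c(2) in auto)
      moreover have "emeasure \<theta> F = ennreal (\<integral>x. indicator F x * c x \<partial>\<rho>)"
        unfolding e using i c(2) by (intro nn_integral_eq_integral) auto
      ultimately show ?thesis using c(2) by (simp add: measure_def)
    qed
    have A: "integrable \<rho> (\<lambda>x. indicator F x * a x) \<and> measure \<sigma> F = (\<integral>x. indicator F x * a x \<partial>\<rho>)"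
      by (rule one[OF \<sigma> _ nn(1) dens(1)]) simp
    have B: "integrable \<rho> (\<lambda>x. indicator F x * b x) \<and> measure \<nu> F = (\<integral>x. indicator F x * b x \<partial>\<rho>)"
      by (rule one[OF \<nu> _ nn(2) dens(2)]) simp
    show "measure \<sigma> F - measure \<nu> F = (\<integral>x. indicator F x * (a x - b x) \<partial>\<rho>)"
      "integrable \<rho> (\<lambda>x. indicator F x * (a x - b x))"
      using A B by (simp_all add: right_diff_distrib)
  qed
  have em\<tau>: "emeasure \<tau> F = ennreal (\<integral>x. indicator F x * \<bar>a x - b x\<bar> \<partial>\<rho>)" if F: "adm F" for F
  proof -
    have [measurable]: "F \<in> sets borel" using F by (auto simp: adm_def A_iff)
    have "integrable \<rho> (\<lambda>x. \<bar>indicator F x * (a x - b x)\<bar>)" using int[OF F] by (rule integrable_abs)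
    then have i: "integrable \<rho> (\<lambda>x. indicator F x * \<bar>a x - b x\<bar>)" by (simp add: abs_mult)
    have "emeasure \<tau> F = (\<integral>\<^sup>+x. ennreal (indicator F x * \<bar>a x - b x\<bar>) \<partial>\<rho>)"
      unfolding \<tau>_def by (subst emeasure_density) (auto intro!: nn_integral_cong simp: indicator_def)
    also have "\<dots> = ennreal (\<integral>x. indicator F x * \<bar>a x - b x\<bar> \<partial>\<rho>)"
      using i by (intro nn_integral_eq_integral) auto
    finally show ?thesis .
  qed
  have le: "ennreal \<bar>measure \<sigma> F - measure \<nu> F\<bar> \<le> emeasure \<tau> F" if F: "adm F" for F
  proof -
    have "\<bar>measure \<sigma> F - measure \<nu> F\<bar> \<le> (\<integral>x. \<bar>indicator F x * (a x - b x)\<bar> \<partial>\<rho>)"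
      unfolding diff[OF F] using integral_norm_bound[of \<rho> "\<lambda>x. indicator F x * (a x - b x)"] by simp
    then show ?thesis by (simp add: em\<tau>[OF F] abs_mult ennreal_leI)
  qed
  have eq: "ennreal \<bar>measure \<sigma> F - measure \<nu> F\<bar> = emeasure \<tau> F"
    if F: "adm F" and sgn: "(\<forall>x\<in>F. b x \<le> a x) \<or> (\<forall>x\<in>F. a x < b x)" for F
  proof -
    from sgn have "\<bar>\<integral>x. indicator F x * (a x - b x) \<partial>\<rho>\<bar> = (\<integral>x. indicator F x * \<bar>a x - b x\<bar> \<partial>\<rho>)"
    proof
      assume "\<forall>x\<in>F. b x \<le> a x"
      then have e: "indicator F x * (a x - b x) = indicator F x * \<bar>a x - b x\<bar>" for x by (auto simp: indicator_def)
      show ?thesis unfolding e by (intro abs_of_nonneg integral_nonneg_AE) auto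
    next
      assume "\<forall>x\<in>F. a x < b x"
      then have e: "indicator F x * (a x - b x) = - (indicator F x * \<bar>a x - b x\<bar>)" for x
        by (auto simp: indicator_def dest: bspec)
      show ?thesis unfolding e integral_minus abs_minus_cancel by (intro abs_of_nonneg integral_nonneg_AE) auto
    qed
    then show ?thesis by (simp add: em\<tau>[OF F] diff[OF F])
  qed
  obtain C where C: "\<And>n. compact (C n)" "\<And>n. C n \<subseteq> \<Omega>" "\<And>n. C n \<subseteq> interior (C (Suc n))" "\<Union>(range C) = \<Omega>"
    by (rule open_Union_compact_subsets[OF \<Omega>]) blast
  have main: "(SUP P \<in> {P. finite P \<and> disjoint P \<and> (\<forall>F\<in>P. F \<in> sets (restrict_space borel \<Omega>) \<and> F \<subseteq> E \<and>
       (\<exists>K. compact K \<and> F \<subseteq> K \<and> K \<subseteq> \<Omega>))}. \<Sum>F\<in>P. ennreal \<bar>measure \<sigma> F - measure \<nu> F\<bar>) = emeasure \<tau> E"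
    (is "(SUP P \<in> ?P. ?S P) = _") if E: "E \<in> \<A>" for E
  proof (rule antisym)
    have Eb: "E \<in> sets borel" "E \<subseteq> \<Omega>" using E by (auto simp: A_iff)
    show "(SUP P \<in> ?P. ?S P) \<le> emeasure \<tau> E"
    proof (rule SUP_least)
      fix P assume P: "P \<in> ?P"
      have adm: "adm F" if "F \<in> P" for F using P that by (auto simp: adm_def \<A>_def)
      have "?S P \<le> (\<Sum>F\<in>P. emeasure \<tau> F)" by (intro sum_mono le adm)
      also have "\<dots> = emeasure \<tau> (\<Union>F\<in>P. F)"
      proof (rule sum_emeasure)
        show "(\<lambda>F. F) ` P \<subseteq> sets \<tau>" using adm s\<tau> by (auto simp: adm_def A_iff)
        show "disjoint_family_on (\<lambda>F. F) P" using P by (auto simp: disjoint_family_on_def disjoint_def)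
      qed (use P in auto)
      also have "\<dots> \<le> emeasure \<tau> E" using P Eb s\<tau> by (intro emeasure_mono) auto
      finally show "?S P \<le> emeasure \<tau> E" .
    qed
    have Cb: "C n \<in> sets borel" for n using C(1) by (simp add: borel_compact)
    have "emeasure \<tau> E = emeasure \<tau> (\<Union>n. E \<inter> C n)" using C(4) Eb by (intro arg_cong[where f = "emeasure \<tau>"]) auto
    also have "\<dots> = (SUP n. emeasure \<tau> (E \<inter> C n))"
    proof (rule SUP_emeasure_incseq[symmetric])
      show "range (\<lambda>n. E \<inter> C n) \<subseteq> sets \<tau>" using Eb Cb s\<tau> by auto
      show "incseq (\<lambda>n. E \<inter> C n)"
        by (rule incseq_SucI) (use C(3) interior_subset in blast)
    qed
    also have "\<dots> \<le> (SUP P \<in> ?P. ?S P)"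
    proof (rule SUP_least)
      fix n
      define X where "X = E \<inter> C n \<inter> {x. b x \<le> a x}"
      define Y where "Y = E \<inter> C n \<inter> {x. a x < b x}"
      have ms: "{x. b x \<le> a x} \<in> sets borel" "{x. a x < b x} \<in> sets borel" by measurable
      have XY: "adm X" "adm Y"
        using Eb Cb[of n] ms C(1,2)[of n] by (auto simp: adm_def A_iff X_def Y_def intro!: exI[of _ "C n"])
      have disj: "X \<inter> Y = {}" by (auto simp: X_def Y_def)
      have in_P: "{X, Y} \<in> ?P"
        using XY disj by (auto simp: adm_def \<A>_def disjoint_def X_def Y_def)
      have "emeasure \<tau> (E \<inter> C n) = emeasure \<tau> (X \<union> Y)"
        by (intro arg_cong[where f = "emeasure \<tau>"]) (auto simp: X_def Y_def)
      also have "\<dots> = emeasure \<tau> X + emeasure \<tau> Y"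
        using XY disj s\<tau> by (intro plus_emeasure[symmetric]) (auto simp: adm_def A_iff)
      also have "\<dots> = ?S {X, Y}"
      \<comment> \<open>As a set, \<open>{X, Y}\<close> has only one element when the two parts
        coincide. Being disjoint they are then empty, and both sides are 0.\<close>
      proof (cases "X = Y")
        case True
        then have "X = {}" using disj by auto
        with True show ?thesis by simp
      next
        case False
        then show ?thesis using eq[OF XY(1)] eq[OF XY(2)] by (simp add: X_def Y_def)
      qed
      also have "\<dots> \<le> (SUP P \<in> ?P. ?S P)" by (rule SUP_upper[OF in_P])
      finally show "emeasure \<tau> (E \<inter> C n) \<le> (SUP P \<in> ?P. ?S P)" .
    qed
    finally show "emeasure \<tau> E \<le> (SUP P \<in> ?P. ?S P)" .
  qed
  let ?R = "restrict_space \<tau> \<Omega>"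
  have sR: "sets ?R = \<A>" unfolding \<A>_def by (intro sets_restrict_space_cong s\<tau>)
  have spR: "space ?R = \<Omega>" using sets_eq_imp_space_eq[OF s\<tau>] by (simp add: space_restrict_space)
  have "abs_diff_measure \<Omega> \<sigma> \<nu> = measure_of \<Omega> \<A> (emeasure ?R)"
    unfolding abs_diff_measure_def \<A>_def[symmetric]
  proof (rule measure_of_eq)
    show "\<A> \<subseteq> Pow \<Omega>" by (auto simp: A_iff)
    have "sigma_sets \<Omega> \<A> = \<A>" using sets.sigma_sets_eq[of ?R] by (simp add: sR spR)
    then show "(SUP P \<in> {P. finite P \<and> disjoint P \<and> (\<forall>F\<in>P. F \<in> \<A> \<and> F \<subseteq> E \<and>
       (\<exists>K. compact K \<and> F \<subseteq> K \<and> K \<subseteq> \<Omega>))}. \<Sum>F\<in>P. ennreal \<bar>measure \<sigma> F - measure \<nu> F\<bar>) = emeasure ?R E"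
      if "E \<in> sigma_sets \<Omega> \<A>" for E
    proof -
      have E: "E \<in> \<A>" using that \<open>sigma_sets \<Omega> \<A> = \<A>\<close> by simp
      then have "emeasure ?R E = emeasure \<tau> E"
        using s\<tau> \<Omega>s by (intro emeasure_restrict_space) (auto simp: A_iff)
      then show ?thesis using main[OF E] unfolding \<A>_def by (rule trans[OF _ sym, rotated])
    qed
  qed
  also have "\<dots> = ?R" using measure_of_of_measure[of ?R] by (simp add: sR spR)
  finally show ?thesis by (simp add: \<tau>_def)
qed

section \<open>Test functions as competitors in the norm\<close>

lemma test_functions_L2:
  assumes \<Omega>: "open \<Omega>" and \<phi>: "\<phi> \<in> test_functions \<Omega>"
  shows "\<phi> \<in> L2 \<Omega>" "grad \<phi> \<in> L2 \<Omega>"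
proof -
  have s: "\<Omega> \<in> sets borel" using \<Omega> by simp
  note [measurable] = test_functions_borel[OF \<phi>] test_functions_borel_grad[OF \<phi>]
  have "\<phi> \<in> borel_measurable (lebesgue_on \<Omega>)" "grad \<phi> \<in> borel_measurable (lebesgue_on \<Omega>)"
    by (auto intro!: measurable_restrict_space1 measurable_completion)
  moreover have "integrable (lebesgue_on \<Omega>) (\<lambda>x. (norm (\<phi> x))\<^sup>2)"
    using test_functions_integrable(2)[OF \<phi>] test_functions_outside[OF \<phi>]
    by (subst lebesgue_on_integral(2)[OF s]) auto
  moreover have "integrable (lebesgue_on \<Omega>) (\<lambda>x. (norm (grad \<phi> x))\<^sup>2)"
    using test_functions_integrable(4)[OF \<phi>] test_functions_outside[OF \<phi>]
    by (subst lebesgue_on_integral(2)[OF s]) auto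
  ultimately show "\<phi> \<in> L2 \<Omega>" "grad \<phi> \<in> L2 \<Omega>" by (auto simp: L2_def)
qed

lemma L2_norm_weak_gradient_test:
  assumes \<Omega>: "open \<Omega>" and \<phi>: "\<phi> \<in> test_functions \<Omega>"
  shows "L2_norm \<Omega> (weak_gradient \<Omega> \<phi>) = sqrt (\<integral>x. (norm (grad \<phi> x))\<^sup>2 \<partial>lborel)"
proof -
  have s: "\<Omega> \<in> sets borel" using \<Omega> by simp
  note w = weak_gradient_AE_eq[OF \<Omega> is_weak_gradient_test[OF \<Omega> \<phi>]]
  have "grad \<phi> \<in> borel_measurable (lebesgue_on \<Omega>)" using test_functions_L2(2)[OF assms] by (simp add: L2_def)
  then have "L2_norm \<Omega> (weak_gradient \<Omega> \<phi>) = L2_norm \<Omega> (grad \<phi>)" using w by (intro L2_norm_cong_AE)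
  also have "\<dots> = sqrt (\<integral>x. (norm (grad \<phi> x))\<^sup>2 \<partial>lborel)"
    unfolding L2_norm_def using test_functions_borel_grad[OF \<phi>] test_functions_outside[OF \<phi>]
    by (subst lebesgue_on_integral(1)[OF s]) auto
  finally show ?thesis .
qed

lemma test_functions_H01:
  assumes \<Omega>: "open \<Omega>" and \<phi>: "\<phi> \<in> test_functions \<Omega>"
  shows "\<phi> \<in> H01 \<Omega>"
proof -
  have "\<phi> \<in> H1 \<Omega>"
    using test_functions_L2[OF assms] is_weak_gradient_test[OF assms] by (auto simp: H1_def)
  moreover have "H1_norm \<Omega> (\<lambda>x. \<phi> x - \<phi> x) = 0"
  proof -
    have "grad (\<lambda>x. 0 :: real) x = 0" for x :: "real^'a" by (rule grad_eqI) simp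
    then have "L2_norm \<Omega> (weak_gradient \<Omega> (\<lambda>x. 0)) = 0"
      using L2_norm_weak_gradient_test[OF \<Omega> test_functions_zero] by simp
    then show ?thesis by (simp add: H1_norm_def L2_norm_def)
  qed
  ultimately show ?thesis using \<phi> by (auto simp: H01_def intro!: bexI[of _ \<phi>])
qed

text \<open>Makes the empty set an admissible exceptional set, so that continuous functions are
  quasicontinuous.\<close>

lemma capacity_empty: "capacity {} \<Omega> = 0"
proof -
  have "grad (\<lambda>x. 0 :: real) x = 0" for x :: "real^'a" by (rule grad_eqI) simp
  then have g: "L2_norm \<Omega> (grad (\<lambda>x::real^'a. 0)) = 0" by (simp add: L2_norm_def)
  have "cap_compact {} \<Omega> \<le> ennreal ((L2_norm \<Omega> (grad (\<lambda>x::real^'a. 0)))\<^sup>2)"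
    unfolding cap_compact_def by (rule INF_lower) (simp add: test_functions_zero)
  then have c: "cap_compact {} \<Omega> = 0" using g by simp
  have "capacity {} \<Omega> \<le> (SUP K \<in> {K. compact K \<and> K \<subseteq> {}}. cap_compact K \<Omega>)"
    unfolding capacity_def by (rule INF_lower) auto
  also have "\<dots> \<le> 0" by (rule SUP_least) (auto simp: c)
  finally show ?thesis by simp
qed

lemma test_functions_quasicontinuous:
  "\<phi> \<in> test_functions \<Omega> \<Longrightarrow> quasicontinuous \<Omega> \<phi>"
  unfolding quasicontinuous_def
  by (intro allI impI exI[of _ "{}"])
    (auto simp: capacity_empty intro: continuous_on_subset[OF test_functions_continuous])

text \<open>Homogeneity: \<open>\<phi>\<close> divided by its gradient norm competes in the
  supremum. Adding \<epsilon> keeps the divisor positive when the gradient vanishes.\<close>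

lemma tri_norm_test:
  assumes \<Omega>: "open \<Omega>" and \<phi>: "\<phi> \<in> test_functions \<Omega>" and lam: "lam < 1" and \<epsilon>: "0 < \<epsilon>"
    and M: "sets M = sets (restrict_space borel \<Omega>)"
  shows "(\<integral>\<^sup>+x. ennreal (\<bar>\<phi> x\<bar> powr (1 - lam)) \<partial>M)
    \<le> tri_norm lam \<Omega> M * ennreal ((sqrt (\<integral>x. (norm (grad \<phi> x))\<^sup>2 \<partial>lborel) + \<epsilon>) powr (1 - lam))"
proof -
  define c where "c = sqrt (\<integral>x. (norm (grad \<phi> x))\<^sup>2 \<partial>lborel) + \<epsilon>"
  have c: "0 < c" "sqrt (\<integral>x. (norm (grad \<phi> x))\<^sup>2 \<partial>lborel) \<le> c" using \<epsilon> by (auto simp: c_def add_nonneg_pos)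
  define f where "f = (\<lambda>x. inverse c * \<phi> x)"
  have f: "f \<in> test_functions \<Omega>" unfolding f_def by (intro test_functions_mult smooth_const \<phi>)
  have gf: "grad f x = inverse c *\<^sub>R grad \<phi> x" for x
    unfolding f_def
    by (rule grad_compose(1)[OF _ smooth_differentiable[OF test_functions_smooth[OF \<phi>]]])
      (auto intro!: derivative_eq_intros)
  have "(\<integral>x. (norm (grad f x))\<^sup>2 \<partial>lborel) = (inverse c)\<^sup>2 * (\<integral>x. (norm (grad \<phi> x))\<^sup>2 \<partial>lborel)"
    by (simp add: gf power_mult_distrib abs_of_pos[OF c(1)])
  then have "L2_norm \<Omega> (weak_gradient \<Omega> f) = inverse c * sqrt (\<integral>x. (norm (grad \<phi> x))\<^sup>2 \<partial>lborel)"
    using c(1) by (simp add: L2_norm_weak_gradient_test[OF \<Omega> f] real_sqrt_mult)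
  also have "\<dots> \<le> inverse c * c" using c by (intro mult_left_mono) auto
  finally have "L2_norm \<Omega> (weak_gradient \<Omega> f) \<le> 1" using c by simp
  then have le: "(\<integral>\<^sup>+x. ennreal (\<bar>f x\<bar> powr (1 - lam)) \<partial>M) \<le> tri_norm lam \<Omega> M"
    using lam test_functions_H01[OF \<Omega> f] test_functions_quasicontinuous[OF f]
    unfolding tri_norm_def by (simp, intro SUP_upper) auto
  have fm: "f \<in> borel_measurable M"
    unfolding measurable_cong_sets[OF M refl] using test_functions_borel[OF f] by (rule measurable_restrict_space1)
  have "ennreal (\<bar>\<phi> x\<bar> powr (1 - lam)) = ennreal (\<bar>f x\<bar> powr (1 - lam)) * ennreal (c powr (1 - lam))" for x
  proof -
    have "\<bar>\<phi> x\<bar> = \<bar>f x\<bar> * c" using c by (simp add: f_def abs_mult)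
    then show ?thesis using c by (simp add: powr_mult ennreal_mult)
  qed
  then have "(\<integral>\<^sup>+x. ennreal (\<bar>\<phi> x\<bar> powr (1 - lam)) \<partial>M) = (\<integral>\<^sup>+x. ennreal (\<bar>f x\<bar> powr (1 - lam)) \<partial>M) * ennreal (c powr (1 - lam))"
    using fm by (simp add: nn_integral_multc)
  also have "\<dots> \<le> tri_norm lam \<Omega> M * ennreal (c powr (1 - lam))"
    using le by (intro mult_right_mono) auto
  finally show ?thesis by (simp add: c_def)
qed

text \<open>The competitors in the norm need not be measurable, so this is argued on simple functions.\<close>

lemma nn_integral_le_add:
  assumes L: "sets L = sets M" and N: "sets N = sets M"
    and le: "\<And>E. E \<in> sets M \<Longrightarrow> emeasure L E \<le> emeasure M E + emeasure N E"
  shows "integral\<^sup>N L f \<le> integral\<^sup>N M f + integral\<^sup>N N f"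
  unfolding nn_integral_def[of L]
proof (rule SUP_least)
  fix g assume "g \<in> {g. simple_function L g \<and> g \<le> f}"
  then have g: "simple_function L g" "g \<le> f" by auto
  have sp: "space L = space M" "space N = space M" using L N sets_eq_imp_space_eq by blast+
  have sM: "simple_function M g" and sN: "simple_function N g"
    using g(1) L N sp by (auto simp: simple_function_def)
  have "integral\<^sup>S L g = (\<Sum>y\<in>g ` space M. y * emeasure L (g -` {y} \<inter> space M))"
    by (simp add: simple_integral_def sp)
  also have "\<dots> \<le> (\<Sum>y\<in>g ` space M. y * emeasure M (g -` {y} \<inter> space M) + y * emeasure N (g -` {y} \<inter> space M))"
  proof (rule sum_mono)
    fix y assume "y \<in> g ` space M"
    then have "g -` {y} \<inter> space M \<in> sets M" using sM by (auto simp: simple_function_def)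
    then show "y * emeasure L (g -` {y} \<inter> space M) \<le> y * emeasure M (g -` {y} \<inter> space M) + y * emeasure N (g -` {y} \<inter> space M)"
      using le by (simp add: distrib_left[symmetric] mult_left_mono)
  qed
  also have "\<dots> = integral\<^sup>S M g + integral\<^sup>S N g"
    by (simp add: simple_integral_def sp sum.distrib)
  also have "\<dots> \<le> integral\<^sup>N M f + integral\<^sup>N N f"
    unfolding nn_integral_def using sM sN g(2) by (intro add_mono SUP_upper) auto
  finally show "integral\<^sup>S L g \<le> integral\<^sup>N M f + integral\<^sup>N N f" .
qed

text \<open>Serves to show that the distance of \<open>\<sigma>\<close> and \<open>\<nu>\<close> is
  finite. This matters because the final estimate reads the distance through
  \<open>enn2real\<close>, which sends infinity to 0.\<close>

lemma tri_norm_le_add: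
  assumes "sets L = sets M" "sets N = sets M" "\<Omega> \<in> sets M"
    and "\<And>E. E \<in> sets M \<Longrightarrow> emeasure L E \<le> emeasure M E + emeasure N E"
  shows "tri_norm lam \<Omega> L \<le> tri_norm lam \<Omega> M + tri_norm lam \<Omega> N"
proof (cases "lam = 1")
  case True
  then show ?thesis using assms by (simp add: tri_norm_def)
next
  case False
  then show ?thesis
    unfolding tri_norm_def
    by (simp, intro SUP_least order_trans[OF nn_integral_le_add[OF assms(1,2,4)]] add_mono SUP_upper) auto
qed

section \<open>Comparison of the singular terms\<close>

text \<open>If a s = 0, the left-hand side is not positive. Otherwise s \<le> t whenever b > 0, as
  the inverse power is decreasing, so a s - b t \<le> (a - b) s, and s \<le> (P - Q)^(-\<lambda>)
  because 0 < P - Q \<le> P. The hypotheses are conditional since each identity for a weight is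
  known only where its own measure has positive density.\<close>

lemma weight_difference_bound_aux:
  fixes P Q a b s t lam :: real
  assumes "0 \<le> a" "0 \<le> b" "0 \<le> s" "0 \<le> t" "0 < lam" "Q < P"
    and 1: "0 < a \<Longrightarrow> 0 < s \<Longrightarrow> s = 1 / P powr lam \<and> 0 < Q \<and> 0 < t"
    and 2: "0 < b \<Longrightarrow> 0 < t \<Longrightarrow> t = 1 / Q powr lam"
  shows "(P - Q) * (a * s - b * t) \<le> \<bar>a - b\<bar> * \<bar>P - Q\<bar> powr (1 - lam)"
proof (cases "0 < a \<and> 0 < s")
  case False
  then have "a * s = 0" using assms(1,3) by auto
  moreover have "0 \<le> b * t" using assms by simp
  ultimately have "(P - Q) * (a * s - b * t) \<le> 0" using assms by (intro mult_nonneg_nonpos) auto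
  also have "0 \<le> \<bar>a - b\<bar> * \<bar>P - Q\<bar> powr (1 - lam)" by simp
  finally show ?thesis .
next
  case True
  then have s: "s = 1 / P powr lam" and Q: "0 < Q" and t: "0 < t" using 1 by auto
  have bt: "b * s \<le> b * t"
  proof (cases "0 < b")
    case True
    have "Q powr lam \<le> P powr lam" using Q assms by (intro powr_mono2) auto
    then have "s \<le> t" unfolding s 2[OF True t] using Q assms(6) by (intro divide_left_mono) auto
    then show ?thesis using True by (intro mult_left_mono) auto
  qed (use assms in simp)
  have "(P - Q) powr lam \<le> P powr lam" using Q assms by (intro powr_mono2) auto
  then have sl: "s \<le> 1 / (P - Q) powr lam" unfolding s using Q assms by (intro divide_left_mono) auto
  have "a * s - b * t \<le> (a - b) * s" using bt by (simp add: left_diff_distrib)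
  also have "\<dots> \<le> \<bar>a - b\<bar> * s" using assms by (intro mult_right_mono) auto
  also have "\<dots> \<le> \<bar>a - b\<bar> * (1 / (P - Q) powr lam)" using sl by (intro mult_left_mono) auto
  finally have "(P - Q) * (a * s - b * t) \<le> (P - Q) * (\<bar>a - b\<bar> * (1 / (P - Q) powr lam))"
    using assms by (intro mult_left_mono) auto
  also have "\<dots> = \<bar>a - b\<bar> * \<bar>P - Q\<bar> powr (1 - lam)"
    using assms by (simp add: powr_diff)
  finally show ?thesis .
qed

lemma weight_difference_bound:
  fixes P Q a b s t lam :: real
  assumes "0 \<le> a" "0 \<le> b" "0 \<le> s" "0 \<le> t" "0 < lam"
    and 1: "0 < a \<Longrightarrow> 0 < s \<Longrightarrow> s = 1 / P powr lam \<and> 0 < Q \<and> 0 < t"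
    and 2: "0 < b \<Longrightarrow> 0 < t \<Longrightarrow> t = 1 / Q powr lam \<and> 0 < P \<and> 0 < s"
  shows "(P - Q) * (a * s - b * t) \<le> \<bar>a - b\<bar> * \<bar>P - Q\<bar> powr (1 - lam)"
proof -
  consider "Q < P" | "P < Q" | "P = Q" by linarith
  then show ?thesis
  proof cases
    case 1
    show ?thesis by (rule weight_difference_bound_aux) (use assms 1 in auto)
  next
    case 2
    have "(Q - P) * (b * t - a * s) \<le> \<bar>b - a\<bar> * \<bar>Q - P\<bar> powr (1 - lam)"
      by (rule weight_difference_bound_aux) (use assms 2 in auto)
    moreover have "(Q - P) * (b * t - a * s) = (P - Q) * (a * s - b * t)" by (simp add: algebra_simps)
    ultimately show ?thesis by (simp add: abs_minus_commute)
  qed simp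
qed

text \<open>Positivity is assumed for the regularization at every point. It gives a ball around each
  point on which \<open>u\<close> is nonnegative almost everywhere, and by Lindelof's theorem
  countably many open sets suffice.\<close>

lemma weak_solution_nonneg:
  assumes \<Omega>: "open \<Omega>" and u: "weak_solution \<Omega> A lam \<sigma> u"
  shows "AE x in lborel. x \<in> \<Omega> \<longrightarrow> 0 \<le> u x"
proof -
  note um = weak_solution_measurable[OF u]
  define \<F> where "\<F> = {U. open U \<and> (AE y in lborel. y \<in> \<Omega> \<inter> U \<longrightarrow> 0 \<le> u y)}"
  obtain \<F>' where F: "\<F>' \<subseteq> \<F>" "countable \<F>'" "\<Union>\<F>' = \<Union>\<F>"
    using Lindelof[of \<F>] by (auto simp: \<F>_def)
  have "\<Omega> \<subseteq> \<Union>\<F>"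
  proof
    fix x assume x: "x \<in> \<Omega>"
    then have "ereal 0 < lsc_reg \<Omega> u x" using u by (simp add: weak_solution_def zero_ereal_def[symmetric])
    then obtain \<rho> \<kappa> where r: "0 < \<rho>" "0 < \<kappa>" "AE y in lborel. y \<in> \<Omega> \<inter> ball x \<rho> \<longrightarrow> \<kappa> \<le> u y"
      by (rule less_lsc_reg[OF \<Omega> um]) blast
    have "AE y in lborel. y \<in> \<Omega> \<inter> ball x \<rho> \<longrightarrow> 0 \<le> u y"
      using r(3) by eventually_elim (use r(2) in auto)
    then have "ball x \<rho> \<in> \<F>" by (simp add: \<F>_def)
    then show "x \<in> \<Union>\<F>" using r(1) by (meson UnionI centre_in_ball)
  qed
  then have sub: "\<Omega> \<subseteq> \<Union>\<F>'" using F(3) by simp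
  have "\<forall>U\<in>\<F>'. AE y in lborel. y \<in> \<Omega> \<inter> U \<longrightarrow> 0 \<le> u y" using F(1) by (auto simp: \<F>_def)
  then have "AE y in lborel. \<forall>U\<in>\<F>'. y \<in> \<Omega> \<inter> U \<longrightarrow> 0 \<le> u y" by (simp only: AE_ball_countable[OF F(2)])
  then show ?thesis by eventually_elim (use sub in blast)
qed

text \<open>A number strictly between \<open>P x\<close> and the regularization would be a lower
  bound of \<open>P\<close> near \<open>x\<close>, which finite energy excludes. Nothing links
  \<open>\<mu>\<close> to the equation solved by \<open>u\<close>, so this also serves for the
  measure of the other equation.\<close>

lemma (in energy_measure) lsc_reg_le_AE:
  assumes um: "u \<in> borel_measurable (lebesgue_on \<Omega>)" and Pu: "AE x in lborel. x \<in> \<Omega> \<longrightarrow> P x = u x"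
  shows "AE x in \<mu>. x \<in> \<Omega> \<longrightarrow> lsc_reg \<Omega> u x \<le> ereal (P x)"
  using local_lower_bound_AE
proof eventually_elim
  case (elim x)
  show ?case
  proof (intro impI leI notI)
    assume x: "x \<in> \<Omega>" and less: "ereal (P x) < lsc_reg \<Omega> u x"
    obtain \<rho> \<kappa> where r: "0 < \<rho>" "P x < \<kappa>" "AE y in lborel. y \<in> \<Omega> \<inter> ball x \<rho> \<longrightarrow> \<kappa> \<le> u y"
      by (rule less_lsc_reg[OF \<Omega>_open um less]) blast
    obtain e where e: "0 < e" "ball x e \<subseteq> \<Omega>" using \<Omega>_open x openE by blast
    have "AE y in lborel. y \<in> ball x (min e \<rho>) \<longrightarrow> \<kappa> \<le> P y"
      using r(3) Pu
    proof eventually_elim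
      case (elim y)
      show ?case
      proof
        assume "y \<in> ball x (min e \<rho>)"
        then have "y \<in> \<Omega>" "y \<in> ball x \<rho>" using e(2) by auto
        then show "\<kappa> \<le> P y" using elim by simp
      qed
    qed
    moreover have "0 < min e \<rho>" using e r by simp
    ultimately have "\<kappa> \<le> P x" using elim x by blast
    with r(2) show False by simp
  qed
qed

text \<open>Any level below \<open>P x\<close> is a lower bound of \<open>P\<close> on some ball by
  De Giorgi's estimate, and so bounds the regularization from below. In particular the
  regularization coincides with \<open>P\<close> almost everywhere for \<open>\<mu>\<close>.\<close>

lemma (in supersolution_energy) lsc_reg_ge_AE:
  assumes um: "u \<in> borel_measurable (lebesgue_on \<Omega>)" and Pu: "AE x in lborel. x \<in> \<Omega> \<longrightarrow> P x = u x"
    and nonneg: "AE x in lborel. 0 \<le> P x"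
  shows "AE x in \<mu>. x \<in> \<Omega> \<longrightarrow> ereal (P x) \<le> lsc_reg \<Omega> u x"
  using upper_bound_AE[OF nonneg]
proof eventually_elim
  case (elim x)
  show ?case
  proof (intro impI leI notI)
    assume x: "x \<in> \<Omega>" and less: "lsc_reg \<Omega> u x < ereal (P x)"
    obtain \<kappa> where k: "lsc_reg \<Omega> u x < ereal \<kappa>" "ereal \<kappa> < ereal (P x)" using ereal_dense2[OF less] by blast
    then obtain \<rho> where r: "0 < \<rho>" "AE y in lborel. y \<in> ball x \<rho> \<longrightarrow> \<kappa> \<le> P y"
      using elim x by auto
    have "AE y in lborel. y \<in> \<Omega> \<inter> ball x \<rho> \<longrightarrow> \<kappa> \<le> u y"
      using r(2) Pu by eventually_elim auto
    then have "ereal \<kappa> \<le> lsc_reg \<Omega> u x" by (rule lsc_reg_ge[OF \<Omega>_open um r(1)])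
    with k(1) show False by simp
  qed
qed

text \<open>The Borel coefficients \<open>A'\<close> are an input, so that both solutions share them
  and their fluxes can be subtracted as \<open>A'\<close> applied to the difference of the
  gradients.\<close>

lemma solution_data:
  fixes u :: "real^'n \<Rightarrow> real"
  assumes \<Omega>: "open \<Omega>" "bounded \<Omega>" and \<sigma>: "\<sigma> \<in> M0_plus \<Omega>" and u: "weak_solution \<Omega> A lam \<sigma> u"
    and A: "A \<in> M_coeff \<alpha> \<beta> \<Omega>" and \<alpha>: "0 < \<alpha>"
    and A': "\<And>i j. (\<lambda>x. A' x $ i $ j) \<in> borel_measurable borel"
      "AE x in lborel. x \<in> \<Omega> \<longrightarrow> A' x = A x"
      "AE x in lborel. x \<in> \<Omega> \<longrightarrow> (\<forall>\<xi>. \<alpha> * (norm \<xi>)\<^sup>2 \<le> (A' x *v \<xi>) \<bullet> \<xi>)"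
      "AE x in lborel. x \<in> \<Omega> \<longrightarrow> (\<forall>\<xi>. norm (A' x *v \<xi>) \<le> C * norm \<xi>)"
  obtains p P G where "supersolution \<Omega> p P G (\<lambda>x. A' x *v G x) \<alpha> C"
    "\<And>n. (\<integral>x. (norm (grad (p n) x - G x))\<^sup>2 \<partial>lborel) \<le> (1/16)^n"
    "\<And>x. P x = lim (\<lambda>n. p n x)"
    "AE x in lborel. x \<in> \<Omega> \<longrightarrow> P x = u x" "AE x in lborel. x \<in> \<Omega> \<longrightarrow> G x = weak_gradient \<Omega> u x"
    "\<And>x. x \<notin> \<Omega> \<Longrightarrow> G x = 0" "AE x in lborel. 0 \<le> P x"
    "\<And>\<phi>. \<phi> \<in> test_functions \<Omega> \<Longrightarrow> integrable (solution_measure \<Omega> lam \<sigma> u) \<phi>"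
    "\<And>\<phi>. \<phi> \<in> test_functions \<Omega> \<Longrightarrow>
      (\<integral>x. (A' x *v G x) \<bullet> grad \<phi> x \<partial>lborel) = (\<integral>x. \<phi> x \<partial>(solution_measure \<Omega> lam \<sigma> u))"
proof -
  have "u \<in> H01 \<Omega>" using u by (simp add: weak_solution_def)
  then obtain p P G where L: "H1_limit \<Omega> p P G"
    and fast: "\<And>n. (\<integral>x. (norm (grad (p n) x - G x))\<^sup>2 \<partial>lborel) \<le> (1/16)^n"
    and Pl: "\<And>x. P x = lim (\<lambda>n. p n x)"
    and Pu: "AE x in lborel. x \<in> \<Omega> \<longrightarrow> P x = u x" and Gu: "AE x in lborel. x \<in> \<Omega> \<longrightarrow> G x = weak_gradient \<Omega> u x"
    and G0: "\<And>x. x \<notin> \<Omega> \<Longrightarrow> G x = 0"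
    by (rule H01_approximation[OF \<Omega>]) blast
  interpret L: H1_limit \<Omega> p P G by (rule L)
  define B where "B = (\<lambda>x. A' x *v G x)"
  have Bm [measurable]: "B \<in> borel_measurable borel"
    unfolding B_def by (intro borel_measurable_matrix_vector_mult A') simp
  have B0: "B x = 0" if "x \<notin> \<Omega>" for x using G0[OF that] by (simp add: B_def)
  have Ble: "AE x in lborel. norm (B x) \<le> C * norm (G x)"
    using A'(4)
  proof eventually_elim
    case (elim x)
    then show ?case by (cases "x \<in> \<Omega>") (auto simp: B_def G0)
  qed
  have BG: "AE x in lborel. \<alpha> * (norm (G x))\<^sup>2 \<le> B x \<bullet> G x"
    using A'(3)
  proof eventually_elim
    case (elim x)
    then show ?case by (cases "x \<in> \<Omega>") (auto simp: B_def G0)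
  qed
  have iB: "integrable lborel (\<lambda>x. (norm (B x))\<^sup>2)"
  proof (rule Bochner_Integration.integrable_bound)
    show "integrable lborel (\<lambda>x. C\<^sup>2 * (norm (G x))\<^sup>2)" using L2_tendstoD(4)[OF L.grad_L2] by simp
    show "AE x in lborel. norm ((norm (B x))\<^sup>2) \<le> norm (C\<^sup>2 * (norm (G x))\<^sup>2)"
      using Ble
    proof eventually_elim
      case (elim x)
      then have "(norm (B x))\<^sup>2 \<le> (C * norm (G x))\<^sup>2" by (intro power_mono) auto
      then show ?case by (simp add: power_mult_distrib)
    qed
  qed auto
  have Bu: "AE x in lborel. x \<in> \<Omega> \<longrightarrow> B x = A x *v weak_gradient \<Omega> u x"
    using A'(2) Gu by eventually_elim (simp add: B_def)
  have eq: "integrable (solution_measure \<Omega> lam \<sigma> u) \<phi>"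
    "(\<integral>x. B x \<bullet> grad \<phi> x \<partial>lborel) = (\<integral>x. \<phi> x \<partial>(solution_measure \<Omega> lam \<sigma> u))"
    if \<phi>: "\<phi> \<in> test_functions \<Omega>" for \<phi>
    by (rule weak_solution_equation[OF \<Omega>(1) \<sigma> u A Bm B0 Bu \<phi>], assumption)+
  have nn: "AE x in lborel. 0 \<le> P x"
    using weak_solution_nonneg[OF \<Omega>(1) u] Pu
  proof eventually_elim
    case (elim x)
    then show ?case by (cases "x \<in> \<Omega>") (auto simp: L.P_outside)
  qed
  have "supersolution \<Omega> p P G B \<alpha> C"
  proof (rule supersolution.intro[OF L], rule supersolution_axioms.intro)
    show "0 \<le> (\<integral>x. B x \<bullet> grad \<phi> x \<partial>lborel)" if "\<phi> \<in> test_functions \<Omega>" "\<And>x. 0 \<le> \<phi> x" for \<phi>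
      unfolding eq(2)[OF that(1)] using that(2) by simp
  qed (fact \<alpha> Bm iB BG Ble)+
  then show ?thesis
    using that[of p P G] fast Pl Pu Gu G0 nn eq unfolding B_def by blast
qed

theorem theorem4p6:
  fixes \<Omega> :: "(real^'n) set"
    and A :: "real^'n \<Rightarrow> real^'n^'n"
    and \<alpha> \<beta> lam :: real
    and \<sigma> \<nu> :: "(real^'n) measure"
    and u v :: "real^'n \<Rightarrow> real"
  assumes "open \<Omega>" and "connected \<Omega>" and "bounded \<Omega>" and "\<Omega> \<noteq> {}"
    and "0 < \<alpha>" and "\<alpha> \<le> \<beta>"
    and "A \<in> M_coeff \<alpha> \<beta> \<Omega>"
    and "0 < lam" and "lam \<le> 1"
    and "\<sigma> \<in> E_space lam \<Omega>" and "\<sigma> \<noteq> null_measure (restrict_space borel \<Omega>)"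
    and "\<nu> \<in> E_space lam \<Omega>" and "\<nu> \<noteq> null_measure (restrict_space borel \<Omega>)"
    and "weak_solution \<Omega> A lam \<sigma> u"
    and "weak_solution \<Omega> A lam \<nu> v"
  shows "L2_norm \<Omega> (weak_gradient \<Omega> (\<lambda>x. u x - v x))
           \<le> 1 / \<alpha> powr (1 / (1 + lam)) * enn2real (d_dist lam \<Omega> \<sigma> \<nu>) powr (1 / (1 + lam))"
proof -
  note \<Omega> = assms(1,3) and \<alpha> = assms(5) and lam = assms(8,9) and u = assms(14) and v = assms(15)
  have \<sigma>: "\<sigma> \<in> M0_plus \<Omega>" "tri_norm lam \<Omega> \<sigma> < \<infinity>" and \<nu>: "\<nu> \<in> M0_plus \<Omega>" "tri_norm lam \<Omega> \<nu> < \<infinity>"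
    using assms(10,12) by (auto simp: E_space_def)
  have \<Omega>s [measurable]: "\<Omega> \<in> sets borel" using \<Omega> by simp
  note um = weak_solution_measurable[OF u] and vm = weak_solution_measurable[OF v]

  \<comment> \<open>Approximation of both solutions and energy of both right-hand sides\<close>
  obtain A' C where A': "\<And>i j. (\<lambda>x. A' x $ i $ j) \<in> borel_measurable borel"
    "AE x in lborel. x \<in> \<Omega> \<longrightarrow> A' x = A x"
    "AE x in lborel. x \<in> \<Omega> \<longrightarrow> (\<forall>\<xi>. \<alpha> * (norm \<xi>)\<^sup>2 \<le> (A' x *v \<xi>) \<bullet> \<xi>)"
    "AE x in lborel. x \<in> \<Omega> \<longrightarrow> (\<forall>\<xi>. norm (A' x *v \<xi>) \<le> C * norm \<xi>)"
    by (rule M_coeff_borel[OF \<Omega>(1) assms(7)]) blast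
  define \<mu> where "\<mu> = solution_measure \<Omega> lam \<sigma> u"
  define \<theta> where "\<theta> = solution_measure \<Omega> lam \<nu> v"
  obtain p P G where Lp: "supersolution \<Omega> p P G (\<lambda>x. A' x *v G x) \<alpha> C"
    and p_fast: "\<And>n. (\<integral>x. (norm (grad (p n) x - G x))\<^sup>2 \<partial>lborel) \<le> (1/16)^n"
    and P_lim: "\<And>x. P x = lim (\<lambda>n. p n x)"
    and P_u: "AE x in lborel. x \<in> \<Omega> \<longrightarrow> P x = u x" and G_u: "AE x in lborel. x \<in> \<Omega> \<longrightarrow> G x = weak_gradient \<Omega> u x"
    and G0: "\<And>x. x \<notin> \<Omega> \<Longrightarrow> G x = 0" and P_nn: "AE x in lborel. 0 \<le> P x"
    and u_int: "\<And>\<phi>. \<phi> \<in> test_functions \<Omega> \<Longrightarrow> integrable \<mu> \<phi>"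
    and u_eq: "\<And>\<phi>. \<phi> \<in> test_functions \<Omega> \<Longrightarrow> (\<integral>x. (A' x *v G x) \<bullet> grad \<phi> x \<partial>lborel) = (\<integral>x. \<phi> x \<partial>\<mu>)"
    unfolding \<mu>_def by (rule solution_data[OF \<Omega> \<sigma>(1) u assms(7) \<alpha> A']) blast
  obtain q Q H where Lq: "supersolution \<Omega> q Q H (\<lambda>x. A' x *v H x) \<alpha> C"
    and q_fast: "\<And>n. (\<integral>x. (norm (grad (q n) x - H x))\<^sup>2 \<partial>lborel) \<le> (1/16)^n"
    and Q_lim: "\<And>x. Q x = lim (\<lambda>n. q n x)"
    and Q_v: "AE x in lborel. x \<in> \<Omega> \<longrightarrow> Q x = v x" and H_v: "AE x in lborel. x \<in> \<Omega> \<longrightarrow> H x = weak_gradient \<Omega> v x"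
    and H0: "\<And>x. x \<notin> \<Omega> \<Longrightarrow> H x = 0" and Q_nn: "AE x in lborel. 0 \<le> Q x"
    and v_int: "\<And>\<phi>. \<phi> \<in> test_functions \<Omega> \<Longrightarrow> integrable \<theta> \<phi>"
    and v_eq: "\<And>\<phi>. \<phi> \<in> test_functions \<Omega> \<Longrightarrow> (\<integral>x. (A' x *v H x) \<bullet> grad \<phi> x \<partial>lborel) = (\<integral>x. \<phi> x \<partial>\<theta>)"
    unfolding \<theta>_def by (rule solution_data[OF \<Omega> \<nu>(1) v assms(7) \<alpha> A']) blast
  interpret Lp: supersolution \<Omega> p P G "\<lambda>x. A' x *v G x" \<alpha> C by (rule Lp)
  interpret Lq: supersolution \<Omega> q Q H "\<lambda>x. A' x *v H x" \<alpha> C by (rule Lq)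
  have s\<mu> [measurable_cong]: "sets \<mu> = sets borel" and s\<theta> [measurable_cong]: "sets \<theta> = sets borel"
    by (simp_all add: \<mu>_def \<theta>_def sets_solution_measure)
  have f\<mu>: "sigma_finite_measure \<mu>" and f\<theta>: "sigma_finite_measure \<theta>"
    unfolding \<mu>_def \<theta>_def by (rule sigma_finite_solution_measure[OF \<Omega>(1)] \<sigma> \<nu> um vm)+
  let ?c = "sqrt (\<integral>x. (norm (A' x *v G x))\<^sup>2 \<partial>lborel)" and ?d = "sqrt (\<integral>x. (norm (A' x *v H x))\<^sup>2 \<partial>lborel)"
  note e\<mu> = energy_bound[OF s\<mu> Lp.B_borel Lp.B_sq u_int u_eq]
  note e\<theta> = energy_bound[OF s\<theta> Lq.B_borel Lq.B_sq v_int v_eq]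
  \<comment> \<open>Four instances, since the integral of \<open>P - Q\<close> against the
    difference of the two measures pairs each limit with each measure.\<close>
  have E1: "energy_measure \<Omega> p P G \<mu> ?c"
    by (rule Lp.energy_measureI[OF s\<mu> f\<mu> _ _ p_fast P_lim]) (simp, rule e\<mu>)
  have E2: "energy_measure \<Omega> p P G \<theta> ?d"
    by (rule Lp.energy_measureI[OF s\<theta> f\<theta> _ _ p_fast P_lim]) (simp, rule e\<theta>)
  have E3: "energy_measure \<Omega> q Q H \<mu> ?c"
    by (rule Lq.energy_measureI[OF s\<mu> f\<mu> _ _ q_fast Q_lim]) (simp, rule e\<mu>)
  have E4: "energy_measure \<Omega> q Q H \<theta> ?d"
    by (rule Lq.energy_measureI[OF s\<theta> f\<theta> _ _ q_fast Q_lim]) (simp, rule e\<theta>)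
  note S1 = supersolution_energy.intro[OF Lp E1] and S4 = supersolution_energy.intro[OF Lq E4]

  \<comment> \<open>Densities with respect to a common dominating measure\<close>
  define s where "s = inverse_power_weight \<Omega> lam u"
  define t where "t = inverse_power_weight \<Omega> lam v"
  have [measurable]: "s \<in> borel_measurable borel" "t \<in> borel_measurable borel"
    unfolding s_def t_def by (rule inverse_power_weight_borel[OF \<Omega>(1)] um vm)+
  have s0: "0 \<le> s x" and t0: "0 \<le> t x" for x by (simp_all add: s_def t_def inverse_power_weight_nonneg)
  obtain \<rho> and a b :: "real^'n \<Rightarrow> real" where \<rho>: "sets \<rho> = sets (ext \<sigma>)"
    and ab: "a \<in> borel_measurable \<rho>" "b \<in> borel_measurable \<rho>" and a0: "\<And>x. 0 \<le> a x" and b0: "\<And>x. 0 \<le> b x"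
    and dens: "ext \<sigma> = density \<rho> (\<lambda>x. ennreal (a x))" "ext \<nu> = density \<rho> (\<lambda>x. ennreal (b x))"
    using common_density[of "ext \<nu>" "ext \<sigma>"] sigma_finite_ext[OF \<sigma>(1) \<Omega>(1)] sigma_finite_ext[OF \<nu>(1) \<Omega>(1)]
    by (metis sets_ext)
  have s\<rho> [measurable_cong]: "sets \<rho> = sets borel" using \<rho> by simp
  have [measurable]: "a \<in> borel_measurable borel" "b \<in> borel_measurable borel"
    using ab by (simp_all add: measurable_cong_sets[OF s\<rho> refl])
  have \<mu>_dens: "\<mu> = density \<rho> (\<lambda>x. ennreal (a x * s x))"
    unfolding \<mu>_def solution_measure_def s_def[symmetric] dens
    by (subst density_density_eq) (auto simp: ennreal_mult a0 s0)
  have \<theta>_dens: "\<theta> = density \<rho> (\<lambda>x. ennreal (b x * t x))"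
    unfolding \<theta>_def solution_measure_def t_def[symmetric] dens
    by (subst density_density_eq) (auto simp: ennreal_mult b0 t0)
  \<comment> \<open>What holds \<open>\<mu>\<close>-almost everywhere is known
    \<open>\<rho>\<close>-almost everywhere only where the density a s is positive; this is the
    source of the conditional hypotheses in \<open>weight_difference_bound\<close>.\<close>
  have AE\<mu>: "AE x in \<rho>. 0 < a x \<longrightarrow> 0 < s x \<longrightarrow> R x" if "AE x in \<mu>. R x" for R
    using that unfolding \<mu>_dens by (subst (asm) AE_density) (auto elim!: eventually_mono)
  have AE\<theta>: "AE x in \<rho>. 0 < b x \<longrightarrow> 0 < t x \<longrightarrow> R x" if "AE x in \<theta>. R x" for R
    using that unfolding \<theta>_dens by (subst (asm) AE_density) (auto elim!: eventually_mono)

  \<comment> \<open>The distance as a finite number\<close>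
  define \<tau> where "\<tau> = abs_diff_measure \<Omega> \<sigma> \<nu>"
  have \<tau>: "\<tau> = restrict_space (density \<rho> (\<lambda>x. ennreal \<bar>a x - b x\<bar>)) \<Omega>"
    unfolding \<tau>_def by (rule abs_diff_measure_eq[OF \<Omega>(1) \<sigma>(1) \<nu>(1) s\<rho> _ _ a0 b0 dens]) simp_all
  have s\<tau>: "sets \<tau> = sets (restrict_space borel \<Omega>)"
    unfolding \<tau> by (intro sets_restrict_space_cong) (simp add: s\<rho>)
  have s\<sigma>: "sets \<sigma> = sets (restrict_space borel \<Omega>)" and s\<nu>: "sets \<nu> = sets (restrict_space borel \<Omega>)"
    using \<sigma> \<nu> by (auto simp: M0_plus_def)
  have nn_\<tau>: "integral\<^sup>N \<tau> f = (\<integral>\<^sup>+x. ennreal \<bar>a x - b x\<bar> * (f x * indicator \<Omega> x) \<partial>\<rho>)"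
    if [measurable]: "f \<in> borel_measurable borel" for f
    unfolding \<tau> using \<Omega>s by (simp add: nn_integral_restrict_space nn_integral_density s\<rho>)
  have tri_fin: "tri_norm lam \<Omega> \<tau> < \<infinity>"
  proof -
    have "tri_norm lam \<Omega> \<tau> \<le> tri_norm lam \<Omega> \<sigma> + tri_norm lam \<Omega> \<nu>"
    proof (rule tri_norm_le_add)
      show "sets \<tau> = sets \<sigma>" "sets \<nu> = sets \<sigma>" using s\<tau> s\<sigma> s\<nu> by simp_all
      show "\<Omega> \<in> sets \<sigma>" unfolding s\<sigma> using \<Omega>s by (simp add: sets_restrict_space_iff)
      fix E assume "E \<in> sets \<sigma>"
      then have E [measurable]: "E \<in> sets borel" and E\<Omega>: "E \<subseteq> \<Omega>" unfolding s\<sigma> using \<Omega>s by (simp_all add: sets_restrict_space_iff)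
      have "emeasure \<tau> E = (\<integral>\<^sup>+x. ennreal \<bar>a x - b x\<bar> * indicator E x \<partial>\<rho>)"
        unfolding \<tau> using \<Omega>s E\<Omega> by (subst emeasure_restrict_space) (auto simp: s\<rho> emeasure_density)
      also have "\<dots> \<le> (\<integral>\<^sup>+x. ennreal (a x) * indicator E x + ennreal (b x) * indicator E x \<partial>\<rho>)"
      proof (rule nn_integral_mono)
        fix x
        have "\<bar>a x - b x\<bar> \<le> a x + b x" using a0[of x] b0[of x] by simp
        then have "ennreal \<bar>a x - b x\<bar> \<le> ennreal (a x) + ennreal (b x)"
          using a0[of x] b0[of x] by (simp add: ennreal_plus[symmetric] ennreal_leI del: ennreal_plus)
        then show "ennreal \<bar>a x - b x\<bar> * indicator E x \<le> ennreal (a x) * indicator E x + ennreal (b x) * indicator E x"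
          by (simp add: indicator_def)
      qed
      also have "\<dots> = (\<integral>\<^sup>+x. ennreal (a x) * indicator E x \<partial>\<rho>) + (\<integral>\<^sup>+x. ennreal (b x) * indicator E x \<partial>\<rho>)"
        by (rule nn_integral_add) measurable
      also have "\<dots> = emeasure (ext \<sigma>) E + emeasure (ext \<nu>) E"
        unfolding dens by (simp add: emeasure_density s\<rho>)
      also have "\<dots> = emeasure \<sigma> E + emeasure \<nu> E"
        using E\<Omega> by (simp add: emeasure_ext[OF \<sigma>(1) E] emeasure_ext[OF \<nu>(1) E] Int_absorb2)
      finally show "emeasure \<tau> E \<le> emeasure \<sigma> E + emeasure \<nu> E" .
    qed
    also have "\<dots> < \<infinity>" using \<sigma>(2) \<nu>(2) by simp
    finally show ?thesis .
  qed
  define D where "D = enn2real (d_dist lam \<Omega> \<sigma> \<nu>)"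
  have D: "tri_norm lam \<Omega> \<tau> = ennreal D" "0 \<le> D"
    using tri_fin by (simp_all add: D_def d_dist_def \<tau>_def[symmetric])

  \<comment> \<open>Testing the difference of the two equations\<close>
  define \<phi> where "\<phi> = (\<lambda>n x. p n x - q n x)"
  have \<phi>t: "\<phi> n \<in> test_functions \<Omega>" for n unfolding \<phi>_def by (intro test_functions_diff Lp.p_test Lq.p_test)
  have [measurable]: "\<phi> n \<in> borel_measurable borel" for n by (rule test_functions_borel[OF \<phi>t])
  have g\<phi>: "grad (\<phi> n) x = grad (p n) x - grad (q n) x" for n x
    unfolding \<phi>_def by (intro grad_diff smooth_differentiable test_functions_smooth[OF Lp.p_test] test_functions_smooth[OF Lq.p_test])
  define S where "S = (\<integral>x. (norm (G x - H x))\<^sup>2 \<partial>lborel)"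
  have S0: "0 \<le> S" by (simp add: S_def)
  have g_lim: "L2_tendsto lborel (\<lambda>n. grad (\<phi> n)) (\<lambda>x. G x - H x)"
  proof -
    have "L2_tendsto lborel (\<lambda>n x. (- 1) *\<^sub>R grad (q n) x) (\<lambda>x. (- 1) *\<^sub>R H x)"
      by (rule L2_tendsto_bounded_scale[OF Lq.grad_L2, where C = 1]) auto
    from L2_tendsto_add[OF Lp.grad_L2 this] show ?thesis by (simp add: g\<phi>[abs_def])
  qed
  define W where "W = (\<lambda>x. A' x *v G x - A' x *v H x)"
  have W_eq: "W x = A' x *v (G x - H x)" for x by (simp add: W_def matrix_vector_mult_diff_distrib)
  have [measurable]: "W \<in> borel_measurable borel" unfolding W_def by measurable
  have W_sq: "integrable lborel (\<lambda>x. (norm (W x))\<^sup>2)"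
    unfolding W_def by (rule sq_integrable_diff) (use Lp.B_sq Lq.B_sq in simp_all)
  have lhs: "(\<lambda>n. \<integral>x. W x \<bullet> grad (\<phi> n) x \<partial>lborel) \<longlonglongrightarrow> (\<integral>x. W x \<bullet> (G x - H x) \<partial>lborel)"
    using W_sq by (intro L2_tendsto_inner L2_tendsto_const g_lim) simp_all
  have coercive: "\<alpha> * S \<le> (\<integral>x. W x \<bullet> (G x - H x) \<partial>lborel)"
  proof -
    have "\<alpha> * S = (\<integral>x. \<alpha> * (norm (G x - H x))\<^sup>2 \<partial>lborel)" by (simp add: S_def)
    also have "\<dots> \<le> (\<integral>x. W x \<bullet> (G x - H x) \<partial>lborel)"
    proof (rule integral_mono_AE)
      show "integrable lborel (\<lambda>x. \<alpha> * (norm (G x - H x))\<^sup>2)" using L2_tendstoD(4)[OF g_lim] by simp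
      show "integrable lborel (\<lambda>x. W x \<bullet> (G x - H x))"
        by (rule sq_integrable_inner(1)) (use W_sq L2_tendstoD(4)[OF g_lim] in simp_all)
      show "AE x in lborel. \<alpha> * (norm (G x - H x))\<^sup>2 \<le> W x \<bullet> (G x - H x)"
        using A'(3)
      proof eventually_elim
        case (elim x)
        then show ?case by (cases "x \<in> \<Omega>") (auto simp: W_eq G0 H0)
      qed
    qed
    finally show ?thesis .
  qed
  \<comment> \<open>The density with respect to \<open>\<rho>\<close> of the difference of the
    measures, multiplied by \<open>P - Q\<close>; its integral is the limit of the tested
    equations.\<close>
  define F where "F = (\<lambda>x. (P x - Q x) * (a x * s x - b x * t x))"
  have [measurable]: "F \<in> borel_measurable borel" unfolding F_def by measurable
  note i1 = energy_measure.p_integral_tendsto[OF E1] and i2 = energy_measure.p_integral_tendsto[OF E2]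
    and i3 = energy_measure.p_integral_tendsto[OF E3] and i4 = energy_measure.p_integral_tendsto[OF E4]
  have iF1: "integrable \<rho> (\<lambda>x. (a x * s x) *\<^sub>R (P x - Q x))" and F1: "(\<integral>x. P x - Q x \<partial>\<mu>) = (\<integral>x. (a x * s x) *\<^sub>R (P x - Q x) \<partial>\<rho>)"
    using Bochner_Integration.integrable_diff[OF i1(1) i3(1)] a0 s0 unfolding \<mu>_dens
    by (simp_all add: integrable_density integral_density)
  have iF2: "integrable \<rho> (\<lambda>x. (b x * t x) *\<^sub>R (P x - Q x))" and F2: "(\<integral>x. P x - Q x \<partial>\<theta>) = (\<integral>x. (b x * t x) *\<^sub>R (P x - Q x) \<partial>\<rho>)"
    using Bochner_Integration.integrable_diff[OF i2(1) i4(1)] b0 t0 unfolding \<theta>_dens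
    by (simp_all add: integrable_density integral_density)
  have F_eq: "F x = (a x * s x) *\<^sub>R (P x - Q x) - (b x * t x) *\<^sub>R (P x - Q x)" for x
    by (simp add: F_def algebra_simps)
  have iF: "integrable \<rho> F" unfolding F_eq[abs_def] using iF1 iF2 by (rule Bochner_Integration.integrable_diff)
  have rhs: "(\<lambda>n. \<integral>x. W x \<bullet> grad (\<phi> n) x \<partial>lborel) \<longlonglongrightarrow> (\<integral>x. F x \<partial>\<rho>)"
  proof -
    have "(\<integral>x. W x \<bullet> grad (\<phi> n) x \<partial>lborel) = ((\<integral>x. p n x \<partial>\<mu>) - (\<integral>x. q n x \<partial>\<mu>)) - ((\<integral>x. p n x \<partial>\<theta>) - (\<integral>x. q n x \<partial>\<theta>))" for n
    proof -
      have "integrable lborel (\<lambda>x. (A' x *v G x) \<bullet> grad (\<phi> n) x)" "integrable lborel (\<lambda>x. (A' x *v H x) \<bullet> grad (\<phi> n) x)"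
        by (rule sq_integrable_inner(1); use Lp.B_sq Lq.B_sq test_functions_integrable(4)[OF \<phi>t] test_functions_borel_grad[OF \<phi>t] in simp)+
      then have "(\<integral>x. W x \<bullet> grad (\<phi> n) x \<partial>lborel) = (\<integral>x. \<phi> n x \<partial>\<mu>) - (\<integral>x. \<phi> n x \<partial>\<theta>)"
        by (simp add: W_def inner_diff_left u_eq[OF \<phi>t] v_eq[OF \<phi>t])
      then show ?thesis
        using u_int[OF Lp.p_test] u_int[OF Lq.p_test] v_int[OF Lp.p_test] v_int[OF Lq.p_test]
        by (simp add: \<phi>_def)
    qed
    moreover have "(\<lambda>n. ((\<integral>x. p n x \<partial>\<mu>) - (\<integral>x. q n x \<partial>\<mu>)) - ((\<integral>x. p n x \<partial>\<theta>) - (\<integral>x. q n x \<partial>\<theta>)))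
        \<longlonglongrightarrow> ((\<integral>x. P x \<partial>\<mu>) - (\<integral>x. Q x \<partial>\<mu>)) - ((\<integral>x. P x \<partial>\<theta>) - (\<integral>x. Q x \<partial>\<theta>))"
      by (intro tendsto_diff i1 i2 i3 i4)
    moreover have "((\<integral>x. P x \<partial>\<mu>) - (\<integral>x. Q x \<partial>\<mu>)) - ((\<integral>x. P x \<partial>\<theta>) - (\<integral>x. Q x \<partial>\<theta>)) = (\<integral>x. F x \<partial>\<rho>)"
      unfolding F_eq Bochner_Integration.integral_diff[OF iF1 iF2] F1[symmetric] F2[symmetric]
      using i1(1) i2(1) i3(1) i4(1) by simp
    ultimately show ?thesis by simp
  qed
  \<comment> \<open>\<open>F\<close> may be negative somewhere. Only its positive part, which is
    what \<open>ennreal\<close> keeps, has to be bounded from above.\<close>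
  have S_le: "ennreal (\<alpha> * S) \<le> (\<integral>\<^sup>+x. ennreal (F x) \<partial>\<rho>)"
  proof -
    have "\<alpha> * S \<le> (\<integral>x. F x \<partial>\<rho>)" using coercive LIMSEQ_unique[OF lhs rhs] by simp
    also have "\<dots> \<le> (\<integral>x. max 0 (F x) \<partial>\<rho>)" using iF by (intro integral_mono) auto
    finally have "ennreal (\<alpha> * S) \<le> ennreal (\<integral>x. max 0 (F x) \<partial>\<rho>)" by (rule ennreal_leI)
    also have "\<dots> = (\<integral>\<^sup>+x. ennreal (max 0 (F x)) \<partial>\<rho>)"
      using iF by (intro nn_integral_eq_integral[symmetric]) auto
    also have "\<dots> = (\<integral>\<^sup>+x. ennreal (F x) \<partial>\<rho>)"
      by (intro nn_integral_cong) (auto simp: max_def ennreal_neg)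
    finally show ?thesis .
  qed

  \<comment> \<open>The singular weights at almost every point\<close>
  have u_pos: "0 < lsc_reg \<Omega> u x" and v_pos: "0 < lsc_reg \<Omega> v x" if "x \<in> \<Omega>" for x
    using u v that by (auto simp: weak_solution_def)
  \<comment> \<open>The real bound \<open>Z\<close> rules out an infinite regularization, for which
    \<open>real_of_ereal\<close> would give 0 and the weight would degenerate to 0.\<close>
  have weight: "0 < Z \<and> 0 < 1 / real_of_ereal l powr lam" if "0 < l" "l \<le> ereal Z" for l Z
    using that by (cases l) auto
  have in_\<Omega>: "x \<in> \<Omega>" if "0 < s x \<or> 0 < t x" for x
    using that by (cases "x \<in> \<Omega>") (auto simp: s_def t_def inverse_power_weight_def)
  \<comment> \<open>For \<open>u\<close>, both halves of the comparison hold under its own measure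
    and fix the weight \<open>s\<close>. For \<open>v\<close>, the upper half suffices under this
    measure: it makes the regularization finite, hence \<open>Q\<close> and the weight
    \<open>t\<close> positive.\<close>
  have at_\<mu>: "AE x in \<rho>. 0 < a x \<longrightarrow> 0 < s x \<longrightarrow> x \<in> \<Omega> \<and> (s x = 1 / P x powr lam \<and> 0 < Q x \<and> 0 < t x)
      \<and> (\<lambda>n. p n x) \<longlonglongrightarrow> P x \<and> (\<lambda>n. q n x) \<longlonglongrightarrow> Q x"
    using AE\<mu>[OF energy_measure.lsc_reg_le_AE[OF E1 um P_u]] AE\<mu>[OF supersolution_energy.lsc_reg_ge_AE[OF S1 um P_u P_nn]]
      AE\<mu>[OF energy_measure.lsc_reg_le_AE[OF E3 vm Q_v]]
      AE\<mu>[OF energy_measure.p_lim_\<mu>[OF E1]] AE\<mu>[OF energy_measure.p_lim_\<mu>[OF E3]]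
  proof eventually_elim
    case (elim x)
    show ?case
    proof (intro impI)
      assume as: "0 < a x" "0 < s x"
      then have x: "x \<in> \<Omega>" using in_\<Omega> by blast
      have "lsc_reg \<Omega> u x = ereal (P x)" using elim as x by (intro antisym) auto
      then have "s x = 1 / P x powr lam" using x by (simp add: s_def inverse_power_weight_def)
      moreover have "0 < Q x \<and> 0 < t x"
        using weight[OF v_pos[OF x], of "Q x"] elim as x by (simp add: t_def inverse_power_weight_def)
      ultimately show "x \<in> \<Omega> \<and> (s x = 1 / P x powr lam \<and> 0 < Q x \<and> 0 < t x) \<and> (\<lambda>n. p n x) \<longlonglongrightarrow> P x \<and> (\<lambda>n. q n x) \<longlonglongrightarrow> Q x"
        using elim as x by blast
    qed
  qed
  have at_\<theta>: "AE x in \<rho>. 0 < b x \<longrightarrow> 0 < t x \<longrightarrow> x \<in> \<Omega> \<and> (t x = 1 / Q x powr lam \<and> 0 < P x \<and> 0 < s x)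
      \<and> (\<lambda>n. p n x) \<longlonglongrightarrow> P x \<and> (\<lambda>n. q n x) \<longlonglongrightarrow> Q x"
    using AE\<theta>[OF energy_measure.lsc_reg_le_AE[OF E4 vm Q_v]] AE\<theta>[OF supersolution_energy.lsc_reg_ge_AE[OF S4 vm Q_v Q_nn]]
      AE\<theta>[OF energy_measure.lsc_reg_le_AE[OF E2 um P_u]]
      AE\<theta>[OF energy_measure.p_lim_\<mu>[OF E2]] AE\<theta>[OF energy_measure.p_lim_\<mu>[OF E4]]
  proof eventually_elim
    case (elim x)
    show ?case
    proof (intro impI)
      assume bt: "0 < b x" "0 < t x"
      then have x: "x \<in> \<Omega>" using in_\<Omega> by blast
      have "lsc_reg \<Omega> v x = ereal (Q x)" using elim bt x by (intro antisym) auto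
      then have "t x = 1 / Q x powr lam" using x by (simp add: t_def inverse_power_weight_def)
      moreover have "0 < P x \<and> 0 < s x"
        using weight[OF u_pos[OF x], of "P x"] elim bt x by (simp add: s_def inverse_power_weight_def)
      ultimately show "x \<in> \<Omega> \<and> (t x = 1 / Q x powr lam \<and> 0 < P x \<and> 0 < s x) \<and> (\<lambda>n. p n x) \<longlonglongrightarrow> P x \<and> (\<lambda>n. q n x) \<longlonglongrightarrow> Q x"
        using elim bt x by blast
    qed
  qed
  \<comment> \<open>Where neither measure has positive density \<open>F\<close> vanishes, and the
    sequences need not converge there; the first alternative takes care of such points.\<close>
  have pointwise: "AE x in \<rho>. F x \<le> 0 \<or> (x \<in> \<Omega> \<and> F x \<le> \<bar>a x - b x\<bar> * \<bar>P x - Q x\<bar> powr (1 - lam)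
      \<and> (\<lambda>n. \<phi> n x) \<longlonglongrightarrow> P x - Q x)"
    using at_\<mu> at_\<theta>
  proof eventually_elim
    case (elim x)
    show ?case
    proof (cases "(0 < a x \<and> 0 < s x) \<or> (0 < b x \<and> 0 < t x)")
      case True
      then have "x \<in> \<Omega>" "(\<lambda>n. p n x) \<longlonglongrightarrow> P x" "(\<lambda>n. q n x) \<longlonglongrightarrow> Q x" using elim by blast+
      moreover from this have "(\<lambda>n. \<phi> n x) \<longlonglongrightarrow> P x - Q x" unfolding \<phi>_def by (intro tendsto_diff)
      moreover have "F x \<le> \<bar>a x - b x\<bar> * \<bar>P x - Q x\<bar> powr (1 - lam)"
        unfolding F_def by (rule weight_difference_bound[OF a0 b0 s0 t0 lam(1)]) (use elim in blast)+
      ultimately show ?thesis by blast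
    next
      case False
      then have e: "a x * s x = 0" "b x * t x = 0" using a0[of x] b0[of x] s0[of x] t0[of x] by auto
      have "F x = 0" unfolding F_def e by simp
      then show ?thesis by simp
    qed
  qed

  \<comment> \<open>Bounding the energy by the distance\<close>
  have key: "\<alpha> * S \<le> D * sqrt S powr (1 - lam)" if "0 < S"
  proof (cases "lam = 1")
    case True
    have "(\<integral>\<^sup>+x. ennreal (F x) \<partial>\<rho>) \<le> (\<integral>\<^sup>+x. ennreal \<bar>a x - b x\<bar> * (1 * indicator \<Omega> x) \<partial>\<rho>)"
    proof (rule nn_integral_mono_AE)
      show "AE x in \<rho>. ennreal (F x) \<le> ennreal \<bar>a x - b x\<bar> * (1 * indicator \<Omega> x)"
        using pointwise
      proof eventually_elim
        case (elim x)
        then show ?case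
        proof
          assume "F x \<le> 0"
          then show ?thesis by (simp add: ennreal_neg)
        next
          assume F: "x \<in> \<Omega> \<and> F x \<le> \<bar>a x - b x\<bar> * \<bar>P x - Q x\<bar> powr (1 - lam) \<and> (\<lambda>n. \<phi> n x) \<longlonglongrightarrow> P x - Q x"
          \<comment> \<open>The exponent is 0 here, and \<open>0 powr 0\<close> is 0, so this is an
            inequality and not an equality where \<open>P x = Q x\<close>.\<close>
          have "\<bar>a x - b x\<bar> * \<bar>P x - Q x\<bar> powr (1 - lam) \<le> \<bar>a x - b x\<bar> * 1"
            using True by (intro mult_left_mono) auto
          then show ?thesis using F by (auto intro!: ennreal_leI)
        qed
      qed
    qed
    also have "\<dots> = integral\<^sup>N \<tau> (\<lambda>x. 1)" by (subst nn_\<tau>) auto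
    also have "\<dots> = emeasure \<tau> \<Omega>" using sets_eq_imp_space_eq[OF s\<tau>] by (simp add: space_restrict_space)
    also have "\<dots> = ennreal D" using D(1) True by (simp add: tri_norm_def)
    finally have "ennreal (\<alpha> * S) \<le> ennreal D" using S_le order_trans by blast
    then have "\<alpha> * S \<le> D" using D(2) by (simp add: ennreal_le_iff)
    then show ?thesis using True that by simp
  next
    case False
    then have l1: "0 < 1 - lam" using lam by simp
    \<comment> \<open>The normalization of \<open>tri_norm_test\<close> with \<epsilon> = 1/(n + 1):
      it stays positive even if the gradient of \<open>\<phi> n\<close> vanishes, and it tends to
      \<open>sqrt S\<close>.\<close>
    define c where "c = (\<lambda>n. sqrt (\<integral>x. (norm (grad (\<phi> n) x))\<^sup>2 \<partial>lborel) + inverse (real (Suc n)))"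
    have c_lim: "c \<longlonglongrightarrow> sqrt S + 0"
      unfolding c_def S_def by (intro tendsto_add tendsto_real_sqrt L2_tendsto_norm[OF g_lim] LIMSEQ_inverse_real_of_nat)
    have c0: "0 \<le> c n" for n by (simp add: c_def)
    have "(\<integral>\<^sup>+x. ennreal (F x) \<partial>\<rho>) \<le> (\<integral>\<^sup>+x. liminf (\<lambda>n. ennreal \<bar>a x - b x\<bar> * (ennreal (\<bar>\<phi> n x\<bar> powr (1 - lam)) * indicator \<Omega> x)) \<partial>\<rho>)"
    proof (rule nn_integral_mono_AE)
      show "AE x in \<rho>. ennreal (F x) \<le> liminf (\<lambda>n. ennreal \<bar>a x - b x\<bar> * (ennreal (\<bar>\<phi> n x\<bar> powr (1 - lam)) * indicator \<Omega> x))"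
        using pointwise
      proof eventually_elim
        case (elim x)
        then show ?case
        proof
          assume "F x \<le> 0"
          then show ?thesis by (simp add: ennreal_neg)
        next
          assume F: "x \<in> \<Omega> \<and> F x \<le> \<bar>a x - b x\<bar> * \<bar>P x - Q x\<bar> powr (1 - lam) \<and> (\<lambda>n. \<phi> n x) \<longlonglongrightarrow> P x - Q x"
          then have "(\<lambda>n. \<bar>\<phi> n x\<bar> powr (1 - lam)) \<longlonglongrightarrow> \<bar>P x - Q x\<bar> powr (1 - lam)"
            using l1 by (intro tendsto_powr' tendsto_intros) auto
          then have "(\<lambda>n. ennreal (\<bar>a x - b x\<bar> * \<bar>\<phi> n x\<bar> powr (1 - lam))) \<longlonglongrightarrow> ennreal (\<bar>a x - b x\<bar> * \<bar>P x - Q x\<bar> powr (1 - lam))"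
            by (rule tendsto_ennrealI[OF tendsto_mult[OF tendsto_const]])
          then have "liminf (\<lambda>n. ennreal (\<bar>a x - b x\<bar> * \<bar>\<phi> n x\<bar> powr (1 - lam))) = ennreal (\<bar>a x - b x\<bar> * \<bar>P x - Q x\<bar> powr (1 - lam))"
            by (intro lim_imp_Liminf) auto
          then show ?thesis using F by (simp add: ennreal_mult[symmetric] ennreal_leI)
        qed
      qed
    qed
    also have "\<dots> \<le> liminf (\<lambda>n. \<integral>\<^sup>+x. ennreal \<bar>a x - b x\<bar> * (ennreal (\<bar>\<phi> n x\<bar> powr (1 - lam)) * indicator \<Omega> x) \<partial>\<rho>)"
      by (rule nn_integral_liminf) measurable
    also have "\<dots> \<le> liminf (\<lambda>n. ennreal (D * c n powr (1 - lam)))"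
    proof (rule Liminf_mono, intro always_eventually allI)
      fix n
      have "(\<integral>\<^sup>+x. ennreal \<bar>a x - b x\<bar> * (ennreal (\<bar>\<phi> n x\<bar> powr (1 - lam)) * indicator \<Omega> x) \<partial>\<rho>)
          = (\<integral>\<^sup>+x. ennreal (\<bar>\<phi> n x\<bar> powr (1 - lam)) \<partial>\<tau>)"
        by (subst nn_\<tau>) auto
      also have "\<dots> \<le> ennreal D * ennreal (c n powr (1 - lam))"
        unfolding c_def D(1)[symmetric] using l1 by (intro tri_norm_test[OF \<Omega>(1) \<phi>t _ _ s\<tau>]) auto
      finally show "(\<integral>\<^sup>+x. ennreal \<bar>a x - b x\<bar> * (ennreal (\<bar>\<phi> n x\<bar> powr (1 - lam)) * indicator \<Omega> x) \<partial>\<rho>)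
          \<le> ennreal (D * c n powr (1 - lam))"
        using D(2) by (simp add: ennreal_mult)
    qed
    also have "\<dots> = ennreal (D * (sqrt S + 0) powr (1 - lam))"
      using l1 c0 by (intro lim_imp_Liminf tendsto_ennrealI tendsto_mult tendsto_const tendsto_powr' c_lim) auto
    finally have "ennreal (\<alpha> * S) \<le> ennreal (D * sqrt S powr (1 - lam))" using S_le order_trans by simp
    then show ?thesis using D(2) by (subst (asm) ennreal_le_iff) auto
  qed

  \<comment> \<open>Return to the weak gradient of the difference and the final exponent\<close>
  have "L2_norm \<Omega> (weak_gradient \<Omega> (\<lambda>x. u x - v x)) = sqrt S"
  proof -
    have uH: "u \<in> H1 \<Omega>" and vH: "v \<in> H1 \<Omega>" using u v by (auto simp: weak_solution_def H01_def)
    note gu = H1_weak_gradient[OF \<Omega>(1) uH] and gv = H1_weak_gradient[OF \<Omega>(1) vH]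
    note w = weak_gradient_AE_eq[OF \<Omega>(1) is_weak_gradient_diff[OF \<Omega>(1) gu(1) gv(1)]]
    have [measurable]: "G \<in> borel_measurable (lebesgue_on \<Omega>)" "H \<in> borel_measurable (lebesgue_on \<Omega>)"
      by (auto intro!: measurable_restrict_space1 measurable_completion)
    have "AE x in lebesgue_on \<Omega>. G x = weak_gradient \<Omega> u x" "AE x in lebesgue_on \<Omega>. H x = weak_gradient \<Omega> v x"
      using G_u H_v by (simp_all add: AE_lebesgue_on[OF \<Omega>s])
    with w(1) have AEw: "AE x in lebesgue_on \<Omega>. weak_gradient \<Omega> (\<lambda>x. u x - v x) x = G x - H x"
      by eventually_elim simp
    have "L2_norm \<Omega> (weak_gradient \<Omega> (\<lambda>x. u x - v x)) = L2_norm \<Omega> (\<lambda>x. G x - H x)"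
      by (rule L2_norm_cong_AE[OF w(3) _ AEw]) measurable
    also have "\<dots> = sqrt S"
      unfolding L2_norm_def S_def by (subst lebesgue_on_integral(1)[OF \<Omega>s]) (auto simp: G0 H0)
    finally show ?thesis .
  qed
  moreover have "sqrt S \<le> 1 / \<alpha> powr (1 / (1 + lam)) * D powr (1 / (1 + lam))"
  proof (cases "S = 0")
    case True
    then show ?thesis by simp
  next
    case False
    then have X: "0 < sqrt S" "0 < S" using S0 by auto
    \<comment> \<open>\<open>S\<close> is written as a product of the powers 1 + \<open>lam\<close>
      and 1 - \<open>lam\<close> of its root, so that the second factor cancels against the
      right-hand side of \<open>key\<close>.\<close>
    have "(\<alpha> * sqrt S powr (1 + lam)) * sqrt S powr (1 - lam) = \<alpha> * S"
      using X by (simp add: mult.assoc powr_add[symmetric])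
    also have "\<dots> \<le> D * sqrt S powr (1 - lam)" by (rule key[OF X(2)])
    finally have "(\<alpha> * sqrt S powr (1 + lam)) * sqrt S powr (1 - lam) \<le> D * sqrt S powr (1 - lam)" .
    then have "\<alpha> * sqrt S powr (1 + lam) \<le> D" using X by (simp add: mult_le_cancel_right)
    then have "sqrt S powr (1 + lam) \<le> D / \<alpha>" using \<alpha> by (simp add: field_simps)
    then have "(sqrt S powr (1 + lam)) powr (1 / (1 + lam)) \<le> (D / \<alpha>) powr (1 / (1 + lam))"
      using lam by (intro powr_mono2) auto
    also have "(sqrt S powr (1 + lam)) powr (1 / (1 + lam)) = sqrt S"
      using X lam by (simp add: powr_powr)
    also have "(D / \<alpha>) powr (1 / (1 + lam)) = 1 / \<alpha> powr (1 / (1 + lam)) * D powr (1 / (1 + lam))"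
      using D(2) \<alpha> by (simp add: powr_divide)
    finally show ?thesis .
  qed
  ultimately show ?thesis by (simp add: D_def)
qed

end
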